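(* Let $\mathbf n=(n_1,\dots,n_r)\in(\frac12\mathbb N)^r$ with total weight $n=\sum_in_i\in\mathbb N$, and $\mathbf p\in\mathbb C^r$ with the $[p_i]\in E_\tau$ pairwise distinct. The natural morphism $\pi$ from the generalized Lamé curve to the log-free variety maps open neighborhoods of the Type-I boundary points onto the branches of $V_{\mathbf n,\mathbf p}(\tau)$ near the infinity divisor $B=\infty$, inducing a 1-1 correspondence up to equivalence. Specifically: (1) If the boundary point $\mathbf a_{\mathbf k}$ is non-symmetric, i.e. $\mathbf a_{\mathbf k}\ne\mathbf a_{2\mathbf n-\mathbf k}$, then $\pi$ maps its neighborhood onto the branch intersecting the infinity divisor at $[2(n_1-k_1):\dots:2(n_r-k_r):1]$. (2) If the boundary point is symmetric, then $\pi$ maps the neighborhood of the self-equivalent point onto the unique branch intersecting the infinity divisor at the orbifold point $[0:\dots:0:1]$.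
   Context: $\mathbb N=\{1,2,\dots\}$. $\Im\tau>0$, $\Lambda_\tau=\mathbb Z+\mathbb Z\tau$, $E_\tau=\mathbb C/\Lambda_\tau$, $[z]$ the class of $z$; $\wp,\zeta$ Weierstrass functions; $\omega_1=1,\omega_2=\tau$, $\eta_i=2\zeta(\omega_i/2)$, $\eta(m_1\omega_1+m_2\omega_2)=m_1\eta_1+m_2\eta_2$. GLC: $\mathcal P_n=(\mathrm{Sym}^n\mathbb C\times\mathbb P^1)/\sim$, $\sim$ generated by $(a_1,\dots,a_i,\dots,a_n,h)\sim(a_1,\dots,a_i+\omega,\dots,a_n,h+\eta(\omega))$, $\omega\in\Lambda_\tau$ ($h=\infty$ preserved). $\mathcal Y_{\mathbf n,\mathbf p}(\tau)\subset\mathcal P_n$ is the locus of $[(\mathbf a,h)]$ with $h\in\mathbb C$, $[a_\mu]$ pairwise distinct and $\ne[p_i]$, $h=\frac1n\sum_\mu\sum_in_i\zeta(a_\mu-p_i)$, and $\sum_i\sum_{\nu\ne\mu}n_i(\zeta(a_\mu-a_\nu)-\zeta(a_\mu-p_i)+\zeta(a_\nu-p_i))=0$ for all $\mu$; $\overline{\mathcal Y}_{\mathbf n,\mathbf p}(\tau)$ is its closure. Type-I boundary points are the points of $\overline{\mathcal Y}_{\mathbf n,\mathbf p}(\tau)\setminus\mathcal Y_{\mathbf n,\mathbf p}(\tau)$ with $h=\infty$; they are $\mathbf a_{\mathbf k}=\{[p_1]^{k_1},\dots,[p_r]^{k_r}\}$ (with $h=\infty$), for integers $0\le k_i\le2n_i$,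 $\sum k_i=n$. Two of them are equivalent, $\mathbf a\sim\mathbf a'$, if they are equal or $\mathbf a+\mathbf a'=\sum_i2n_ip_i$ as divisors, i.e. $\mathbf a_{\mathbf k}\sim\mathbf a_{2\mathbf n-\mathbf k}$. If $\mathbf n\in\mathbb N^r$ there is a unique self-equivalent (symmetric) one, $\mathbf k=\mathbf n$. Log-free variety: consider $w''=Qw$, $Q(z)=\sum_in_i(n_i+1)\wp(z-p_i)+\sum_iA_i\zeta(z-p_i)+B$. For each $i$ put $\ell_i=2n_i$, expand $Q=\sum_{s\ge-2}q_s(z-p_i)^s$ at $p_i$, set $c_0=1$, $c_k=\frac1{k(k-1-\ell_i)}\sum_{s=-1}^{k-2}q_sc_{k-2-s}$ for $1\le k\le\ell_i$, and $F_{\ell_i}(\mathbf A,B)=\sum_{s=-1}^{\ell_i-1}q_sc_{\ell_i-1-s}$ (whose vanishing means no logarithms at $p_i$). $V_{\mathbf n,\mathbf p}(\tau)=\{(\mathbf A,B)\in\mathbb C^{r+1}:F_{\ell_i}=0\ \forall i,\ \sum A_i=0\}$, compactified in the weighted projective space $\mathbb P(1^{r+1},2)\ni[A_0:A_1:\dots:A_r:B]$ with $\deg A_i=1,\deg B=2$; the infinity divisor is $A_0=0$, and its points are written $[A_1:\dots:A_r:B]$. The leading terms of $F_{\ell_i}$ are proportional to $\prod_{j=0}^{2n_i}(A_i-(2n_i-2j)B^{1/2})$, so branches at infinity have $A_i\sim(2n_i-2k_i)B^{1/2}$ with $0\le k_i\le2n_i$, $\sum k_i=n$; they are indexed by such $\mathbf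 k$ modulo $\mathbf k\sim2\mathbf n-\mathbf k$. The morphism $\pi:\mathcal Y_{\mathbf n,\mathbf p}(\tau)\to V_{\mathbf n,\mathbf p}(\tau)$ (extended to closures) sends $[(\mathbf a,h)]$ to $(\mathbf A,B)$ with $A_i=2n_i\big(-\sum_\mu\zeta(p_i-a_\mu)+\sum_{j\ne i}n_j\zeta(p_i-p_j)-h\big)$ and, for any $i$, $B=\frac{A_i^2}{4n_i^2}-\sum_{j\ne i}n_j(n_j+2n_i)\wp(p_i-p_j)-\sum_{j\ne i}A_j\zeta(p_i-p_j)+(2n_i-1)\sum_\mu\wp(p_i-a_\mu)$. *)

theory Defs
  imports "HOL-Complex_Analysis.Complex_Analysis" "HOL-Library.Multiset"
begin

unbundle no fps_syntax

section \<open>Weierstrass functions of the lattice spanned by 1 and tau\<close>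

definition lattice :: "complex \<Rightarrow> complex set" where
  "lattice \<tau> = {of_int m1 + of_int m2 * \<tau> |m1 m2 :: int. True}"

definition wp :: "complex \<Rightarrow> complex \<Rightarrow> complex" where
  "wp \<tau> z = 1 / z\<^sup>2 + (\<Sum>\<^sub>\<infinity>\<omega>\<in>lattice \<tau> - {0}. 1 / (z - \<omega>)\<^sup>2 - 1 / \<omega>\<^sup>2)"

definition wzeta :: "complex \<Rightarrow> complex \<Rightarrow> complex" where
  "wzeta \<tau> z = 1 / z + (\<Sum>\<^sub>\<infinity>\<omega>\<in>lattice \<tau> - {0}. 1 / (z - \<omega>) + 1 / \<omega> + z / \<omega>\<^sup>2)"

text \<open>\<open>quasi_period \<tau> m1 m2\<close> is the value of the quasi-period map at \<open>m1 + m2 \<tau>\<close>.\<close>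

definition quasi_period :: "complex \<Rightarrow> int \<Rightarrow> int \<Rightarrow> complex" where
  "quasi_period \<tau> m1 m2 =
     of_int m1 * (2 * wzeta \<tau> (1 / 2)) + of_int m2 * (2 * wzeta \<tau> (\<tau> / 2))"

definition torus_class :: "complex \<Rightarrow> complex \<Rightarrow> complex set" where
  "torus_class \<tau> z = {w. w - z \<in> lattice \<tau>}"


section \<open>Quotient spaces\<close>

definition quotient_topology :: "'a topology \<Rightarrow> ('a \<Rightarrow> 'b) \<Rightarrow> 'b topology" where
  "quotient_topology X f =
     topology (\<lambda>U. U \<subseteq> f ` topspace X \<and> openin X {x \<in> topspace X. f x \<in> U})"

lemma openin_quotient_topology:
  "openin (quotient_topology X f) U \<longleftrightarrow>
     U \<subseteq> f ` topspace X \<and> openin X {x \<in> topspace X. f x \<in> U}"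
proof -
  have "istopology (\<lambda>U. U \<subseteq> f ` topspace X \<and> openin X {x \<in> topspace X. f x \<in> U})"
    unfolding istopology_def
  proof (intro conjI allI impI)
    fix S T
    assume S: "S \<subseteq> f ` topspace X \<and> openin X {x \<in> topspace X. f x \<in> S}"
      and T: "T \<subseteq> f ` topspace X \<and> openin X {x \<in> topspace X. f x \<in> T}"
    have "{x \<in> topspace X. f x \<in> S \<inter> T} =
        {x \<in> topspace X. f x \<in> S} \<inter> {x \<in> topspace X. f x \<in> T}"
      by blast
    then show "openin X {x \<in> topspace X. f x \<in> S \<inter> T}"
      using S T by auto
    show "S \<inter> T \<subseteq> f ` topspace X"
      using S by blast
  next
    fix \<K>
    assume K: "\<forall>S\<in>\<K>. S \<subseteq> f ` topspace X \<and> openin X {x \<in> topspace X. f x \<in> S}"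
    have "{x \<in> topspace X. f x \<in> \<Union>\<K>} = (\<Union>S\<in>\<K>. {x \<in> topspace X. f x \<in> S})"
      by blast
    then show "openin X {x \<in> topspace X. f x \<in> \<Union>\<K>}"
      using K by auto
    show "\<Union>\<K> \<subseteq> f ` topspace X"
      using K by blast
  qed
  then show ?thesis
    by (simp add: quotient_topology_def)
qed

lemma quotient_map_quotient_topology: "quotient_map X (quotient_topology X f) f"
proof -
  have "{x \<in> topspace X. f x \<in> f ` topspace X} = topspace X"
    by blast
  then have "openin (quotient_topology X f) (f ` topspace X)"
    by (simp add: openin_quotient_topology)
  then have "topspace (quotient_topology X f) = f ` topspace X"
    by (metis openin_quotient_topology openin_subset openin_topspace subset_antisym)
  then show ?thesis
    by (simp add: quotient_map_def openin_quotient_topology)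
qed


section \<open>The generalized Lame curve\<close>

definition ell :: "('r \<Rightarrow> real) \<Rightarrow> 'r \<Rightarrow> nat" where
  "ell n i = nat \<lfloor>2 * n i\<rfloor>"

definition total_weight :: "('r::finite \<Rightarrow> real) \<Rightarrow> nat" where
  "total_weight n = nat \<lfloor>\<Sum>i\<in>UNIV. n i\<rfloor>"

text \<open>The \<open>N\<close>-th symmetric power of the complex plane consists of the multisets of size \<open>N\<close>.\<close>

definition Sym_topology :: "nat \<Rightarrow> complex multiset topology" where
  "Sym_topology N =
     quotient_topology (product_topology (\<lambda>_. euclidean) {..<N})
       (\<lambda>a. image_mset a (mset_set {..<N}))"

text \<open>The projective line is the one-point compactification of the plane, \<open>None\<close> being infinity.\<close>

definition P1_topology :: "complex option topology" where
  "P1_topology = Alexandroff_compactification euclidean"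

type_synonym pre_point = "complex multiset \<times> complex option"

inductive shift_step :: "complex \<Rightarrow> pre_point \<Rightarrow> pre_point \<Rightarrow> bool" for \<tau> where
  "shift_step \<tau> (add_mset x a, h)
     (add_mset (x + (of_int m1 + of_int m2 * \<tau>)) a,
      map_option (\<lambda>h. h + quasi_period \<tau> m1 m2) h)"

definition glc_class :: "complex \<Rightarrow> pre_point \<Rightarrow> pre_point set" where
  "glc_class \<tau> x = {y. equivclp (shift_step \<tau>) x y}"

definition P_topology :: "complex \<Rightarrow> nat \<Rightarrow> pre_point set topology" where
  "P_topology \<tau> N =
     quotient_topology (prod_topology (Sym_topology N) P1_topology) (glc_class \<tau>)"

text \<open>The distinctness condition also excludes repeated points of \<open>a\<close>, as \<open>0\<close> is in the lattice.\<close>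

definition GLC :: "complex \<Rightarrow> ('r::finite \<Rightarrow> real) \<Rightarrow> ('r \<Rightarrow> complex) \<Rightarrow> pre_point set set" where
  "GLC \<tau> n p = {glc_class \<tau> (a, Some h) |a h.
     size a = total_weight n \<and>
     (\<forall>x\<in>#a. \<forall>y\<in>#a - {#x#}. x - y \<notin> lattice \<tau>) \<and>
     (\<forall>x\<in>#a. \<forall>i. x - p i \<notin> lattice \<tau>) \<and>
     h = 1 / of_nat (total_weight n) *
           (\<Sum>x\<in>#a. \<Sum>i\<in>UNIV. of_real (n i) * wzeta \<tau> (x - p i)) \<and>
     (\<forall>x\<in>#a. (\<Sum>i\<in>UNIV. \<Sum>y\<in>#a - {#x#}. of_real (n i) *
        (wzeta \<tau> (x - y) - wzeta \<tau> (x - p i) + wzeta \<tau> (y - p i))) = 0)}"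

definition GLC_closure ::
  "complex \<Rightarrow> ('r::finite \<Rightarrow> real) \<Rightarrow> ('r \<Rightarrow> complex) \<Rightarrow> pre_point set set" where
  "GLC_closure \<tau> n p = P_topology \<tau> (total_weight n) closure_of GLC \<tau> n p"

definition type_I :: "complex \<Rightarrow> ('r::finite \<Rightarrow> real) \<Rightarrow> ('r \<Rightarrow> complex) \<Rightarrow> pre_point set set" where
  "type_I \<tau> n p = {x \<in> GLC_closure \<tau> n p - GLC \<tau> n p. \<exists>a. x = glc_class \<tau> (a, None)}"

definition boundary_indices :: "('r::finite \<Rightarrow> real) \<Rightarrow> ('r \<Rightarrow> nat) set" where
  "boundary_indices n =
     {k. (\<forall>i. k i \<le> ell n i) \<and> (\<Sum>i\<in>UNIV. k i) = total_weight n}"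

definition boundary_pt ::
  "complex \<Rightarrow> ('r::finite \<Rightarrow> complex) \<Rightarrow> ('r \<Rightarrow> nat) \<Rightarrow> pre_point set" where
  "boundary_pt \<tau> p k = glc_class \<tau> (\<Sum>i\<in>UNIV. replicate_mset (k i) (p i), None)"

text \<open>The divisors in the definition below are divisors on the elliptic curve.\<close>

definition type_I_equiv ::
  "complex \<Rightarrow> ('r::finite \<Rightarrow> real) \<Rightarrow> ('r \<Rightarrow> complex) \<Rightarrow> (pre_point set \<times> pre_point set) set" where
  "type_I_equiv \<tau> n p = {(x, y). x \<in> type_I \<tau> n p \<and> y \<in> type_I \<tau> n p \<and>
     (x = y \<or>
      (\<exists>a b. x = glc_class \<tau> (a, None) \<and> y = glc_class \<tau> (b, None) \<and>
         image_mset (torus_class \<tau>) (a + b) =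
         (\<Sum>i\<in>UNIV. replicate_mset (ell n i) (torus_class \<tau> (p i)))))}"


section \<open>The log-free variety\<close>

definition Qpot ::
  "complex \<Rightarrow> ('r::finite \<Rightarrow> real) \<Rightarrow> ('r \<Rightarrow> complex) \<Rightarrow> complex ^ 'r \<Rightarrow> complex \<Rightarrow> complex \<Rightarrow> complex"
  where
  "Qpot \<tau> n p A B z =
     (\<Sum>i\<in>UNIV. of_real (n i * (n i + 1)) * wp \<tau> (z - p i)) +
     (\<Sum>i\<in>UNIV. A $ i * wzeta \<tau> (z - p i)) + B"

text \<open>
  \<open>frob l q k\<close> is the Frobenius coefficient \<open>c_k\<close>; the sum over \<open>s\<close> from \<open>-1\<close> to \<open>k - 2\<close> of
  \<open>q_s c_(k-2-s)\<close> is indexed by \<open>j = k - 2 - s\<close>. Only the values with \<open>k \<le> l\<close> are meaningful.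
\<close>

fun frob :: "nat \<Rightarrow> (int \<Rightarrow> complex) \<Rightarrow> nat \<Rightarrow> complex" where
  "frob l q k =
     (if k = 0 then 1
      else 1 / (of_nat k * (of_nat k - 1 - of_nat l)) *
             (\<Sum>j<k. q (int k - 2 - int j) * frob l q j))"

declare frob.simps [simp del]

definition log_obstruction ::
  "complex \<Rightarrow> ('r::finite \<Rightarrow> real) \<Rightarrow> ('r \<Rightarrow> complex) \<Rightarrow> 'r \<Rightarrow> complex ^ 'r \<Rightarrow> complex \<Rightarrow> complex"
  where
  "log_obstruction \<tau> n p i A B =
     (let q = fls_nth (laurent_expansion (Qpot \<tau> n p A B) (p i)); l = ell n i
      in \<Sum>j\<le>l. q (int l - 1 - int j) * frob l q j)"

definition log_free_variety ::
  "complex \<Rightarrow> ('r::finite \<Rightarrow> real) \<Rightarrow> ('r \<Rightarrow> complex) \<Rightarrow> ((complex ^ 'r) \<times> complex) set" where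
  "log_free_variety \<tau> n p =
     {(A, B). (\<forall>i. log_obstruction \<tau> n p i A B = 0) \<and> (\<Sum>i\<in>UNIV. A $ i) = 0}"


section \<open>The weighted projective space with weights (1, ..., 1, 2)\<close>

text \<open>
  A triple \<open>(A0, A, B)\<close> collects the homogeneous coordinates; a point of the weighted projective
  space is the orbit \<open>wproj x\<close> of a nonzero \<open>x\<close>.
\<close>

type_synonym 'r hcoords = "complex \<times> (complex ^ 'r) \<times> complex"

definition wproj :: "'r::finite hcoords \<Rightarrow> 'r hcoords set" where
  "wproj = (\<lambda>(A0, A, B). {(c * A0, c *s A, c\<^sup>2 * B) |c. c \<noteq> 0})"

definition wproj_topology :: "'r::finite hcoords set topology" where
  "wproj_topology = quotient_topology (top_of_set (- {0})) wproj"

definition infinity_divisor :: "'r::finite hcoords set set" where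
  "infinity_divisor = {wproj (0, A, B) |A B. (A, B) \<noteq> 0}"

definition log_free_closure ::
  "complex \<Rightarrow> ('r::finite \<Rightarrow> real) \<Rightarrow> ('r \<Rightarrow> complex) \<Rightarrow> 'r hcoords set set" where
  "log_free_closure \<tau> n p =
     wproj_topology closure_of ((\<lambda>(A, B). wproj (1, A, B)) ` log_free_variety \<tau> n p)"


section \<open>Germs of analytic sets and branches\<close>

definition cscale :: "complex \<Rightarrow> 'r::finite hcoords \<Rightarrow> 'r hcoords" where
  "cscale c = (\<lambda>(A0, A, B). (c * A0, c *s A, c * B))"

text \<open>Holomorphic functions of several variables: the real derivative is complex linear.\<close>

definition holomorphic_several :: "('r::finite hcoords \<Rightarrow> complex) \<Rightarrow> 'r hcoords set \<Rightarrow> bool" where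
  "holomorphic_several f U \<longleftrightarrow>
     (\<forall>x\<in>U. \<exists>D. (f has_derivative D) (at x) \<and> (\<forall>c v. D (cscale c v) = c * D v))"

definition germ_le :: "'r::finite hcoords set \<Rightarrow> 'r hcoords set set \<Rightarrow> 'r hcoords set set \<Rightarrow> bool" where
  "germ_le q S T \<longleftrightarrow> (\<exists>W. openin wproj_topology W \<and> q \<in> W \<and> S \<inter> W \<subseteq> T)"

definition germ :: "'r::finite hcoords set \<Rightarrow> 'r hcoords set set \<Rightarrow> 'r hcoords set set set" where
  "germ q S = {T. \<exists>W. openin wproj_topology W \<and> q \<in> W \<and> S \<inter> W = T \<inter> W}"

text \<open>
  The weighted projective space is the quotient of the punctured affine space by the proper action
  of the multiplicative group, so a subset is analytic iff its preimage, the cone over it, is.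
\<close>

definition analytic_germ :: "'r::finite hcoords set \<Rightarrow> 'r hcoords set set \<Rightarrow> bool" where
  "analytic_germ q S \<longleftrightarrow>
     (\<exists>W. openin wproj_topology W \<and> q \<in> W \<and>
        (\<forall>x. wproj x \<in> W \<longrightarrow>
           (\<exists>U F. open U \<and> x \<in> U \<and> finite F \<and> (\<forall>f\<in>F. holomorphic_several f U) \<and>
              {y \<in> U. wproj y \<in> S} = {y \<in> U. \<forall>f\<in>F. f y = 0})))"

definition irreducible_germ :: "'r::finite hcoords set \<Rightarrow> 'r hcoords set set \<Rightarrow> bool" where
  "irreducible_germ q S \<longleftrightarrow>
     analytic_germ q S \<and> q \<in> S \<and>
     (\<forall>S1 S2. analytic_germ q S1 \<and> analytic_germ q S2 \<and> germ q S = germ q (S1 \<union> S2) \<longrightarrow>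
        germ q S = germ q S1 \<or> germ q S = germ q S2)"

text \<open>The branches of \<open>X\<close> at \<open>q\<close> are the irreducible components of its germ at \<open>q\<close>.\<close>

definition branches_at ::
  "'r::finite hcoords set set \<Rightarrow> 'r hcoords set \<Rightarrow> 'r hcoords set set set set" where
  "branches_at X q = {germ q S |S.
     irreducible_germ q S \<and> germ_le q S X \<and>
     (\<forall>T. irreducible_germ q T \<and> germ_le q T X \<and> germ_le q S T \<longrightarrow> germ q T = germ q S)}"

definition branches_at_infinity ::
  "complex \<Rightarrow> ('r::finite \<Rightarrow> real) \<Rightarrow> ('r \<Rightarrow> complex) \<Rightarrow>
     ('r hcoords set \<times> 'r hcoords set set set) set" where
  "branches_at_infinity \<tau> n p =
     (SIGMA q : log_free_closure \<tau> n p \<inter> infinity_divisor. branches_at (log_free_closure \<tau> n p) q)"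


section \<open>The morphism from the curve to the log-free variety\<close>

definition A_formula ::
  "complex \<Rightarrow> ('r::finite \<Rightarrow> real) \<Rightarrow> ('r \<Rightarrow> complex) \<Rightarrow> complex multiset \<Rightarrow> complex \<Rightarrow> complex ^ 'r"
  where
  "A_formula \<tau> n p a h =
     (\<chi> i. 2 * of_real (n i) *
        (- (\<Sum>x\<in>#a. wzeta \<tau> (p i - x)) +
         (\<Sum>j\<in>UNIV - {i}. of_real (n j) * wzeta \<tau> (p i - p j)) - h))"

definition B_formula ::
  "complex \<Rightarrow> ('r::finite \<Rightarrow> real) \<Rightarrow> ('r \<Rightarrow> complex) \<Rightarrow> complex multiset \<Rightarrow> complex \<Rightarrow> 'r \<Rightarrow> complex"
  where
  "B_formula \<tau> n p a h i =
     (let A = A_formula \<tau> n p a h in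
        (A $ i)\<^sup>2 / (4 * (of_real (n i))\<^sup>2)
        - (\<Sum>j\<in>UNIV - {i}. of_real (n j * (n j + 2 * n i)) * wp \<tau> (p i - p j))
        - (\<Sum>j\<in>UNIV - {i}. A $ j * wzeta \<tau> (p i - p j))
        + of_real (2 * n i - 1) * (\<Sum>x\<in>#a. wp \<tau> (p i - x)))"

text \<open>On \<open>GLC\<close> the value does not depend on the representative, nor \<open>B\<close> on the index \<open>i\<close>.\<close>

definition glc_map ::
  "complex \<Rightarrow> ('r::finite \<Rightarrow> real) \<Rightarrow> ('r \<Rightarrow> complex) \<Rightarrow> pre_point set \<Rightarrow> (complex ^ 'r) \<times> complex"
  where
  "glc_map \<tau> n p x = (THE (A, B). \<exists>a h. (a, Some h) \<in> x \<and>
     A = A_formula \<tau> n p a h \<and> (\<forall>i. B = B_formula \<tau> n p a h i))"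

definition glc_map_proj ::
  "complex \<Rightarrow> ('r::finite \<Rightarrow> real) \<Rightarrow> ('r \<Rightarrow> complex) \<Rightarrow> pre_point set \<Rightarrow> 'r hcoords set" where
  "glc_map_proj \<tau> n p x = (case glc_map \<tau> n p x of (A, B) \<Rightarrow> wproj (1, A, B))"

text \<open>The extension to the closure is by limits along the curve.\<close>

definition glc_limit ::
  "complex \<Rightarrow> ('r::finite \<Rightarrow> real) \<Rightarrow> ('r \<Rightarrow> complex) \<Rightarrow> pre_point set \<Rightarrow> 'r hcoords set \<Rightarrow> bool" where
  "glc_limit \<tau> n p x q \<longleftrightarrow>
     limitin wproj_topology (glc_map_proj \<tau> n p) q
       (atin_within (P_topology \<tau> (total_weight n)) x (GLC \<tau> n p))"

definition glc_map_ext ::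
  "complex \<Rightarrow> ('r::finite \<Rightarrow> real) \<Rightarrow> ('r \<Rightarrow> complex) \<Rightarrow> pre_point set \<Rightarrow> 'r hcoords set" where
  "glc_map_ext \<tau> n p x =
     (if x \<in> GLC \<tau> n p then glc_map_proj \<tau> n p x else (THE q. glc_limit \<tau> n p x q))"

text \<open>
  The extended morphism takes \<open>x\<close> to \<open>fst \<beta>\<close>, and the image of every sufficiently small open
  neighborhood of \<open>x\<close> in the closed curve is a representative of the germ \<open>snd \<beta>\<close>.
\<close>

definition maps_nbhds_onto ::
  "complex \<Rightarrow> ('r::finite \<Rightarrow> real) \<Rightarrow> ('r \<Rightarrow> complex) \<Rightarrow> pre_point set \<Rightarrow>
     'r hcoords set \<times> 'r hcoords set set set \<Rightarrow> bool" where
  "maps_nbhds_onto \<tau> n p x \<beta> \<longleftrightarrow>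
     (let Y = subtopology (P_topology \<tau> (total_weight n)) (GLC_closure \<tau> n p) in
        glc_limit \<tau> n p x (fst \<beta>) \<and>
        (\<exists>U0. openin Y U0 \<and> x \<in> U0 \<and>
           (\<forall>U. openin Y U \<and> x \<in> U \<and> U \<subseteq> U0 \<longrightarrow>
              germ (fst \<beta>) (glc_map_ext \<tau> n p ` U) = snd \<beta>)))"

end

theory Submission
  imports Defs "HOL-Computational_Algebra.Fundamental_Theorem_Algebra"
begin

unbundle no fps_syntax

text \<open>
  On the curve, the function \<open>g(z) = h + \<Sum> \<zeta>(z - a_\<mu>) - \<Sum> n_i \<zeta>(z - p_i)\<close> satisfies the Riccati equation
  \<open>g' + g\<^sup>2 = Q\<close>, which identifies the image point \<open>(A, B)\<close> and makes it log-free. When \<open>h\<close> tends to infinity, the nodes cluster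
  at the \<open>p_i\<close> with \<open>k_i\<close> nodes at \<open>p_i\<close>, and \<open>A_i / h\<close> tends to \<open>2 (k_i - n_i)\<close>, \<open>B / h\<^sup>2\<close> to 1. Conversely, for every \<open>k\<close>
  the nodes \<open>p_i + u x\<close> with \<open>u = 1/h\<close> satisfy a perturbation of the stationarity equations of the roots of a Laguerre-type
  polynomial, whose Jacobian is invertible, so a contraction produces a continuous branch of the curve through each boundary point.
  At infinity the obstructions reduce to polynomials with the simple roots \<open>2 k_i - 2 n_i\<close>; hence the variety is near each of its
  points at infinity the graph of a holomorphic function of \<open>s\<close>, where \<open>s\<^sup>2 B = 1\<close>, which has an irreducible germ. By Brouwer's theorem
  the branch of the curve attains all small \<open>s\<close>.
\<close>

section \<open>Weierstrass functions\<close>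

text \<open>The node equations degenerate at h = infinity, where nodes collide at the p_i and zeta
  terms blow up. Two devices replace expansions of the node positions. In limits, the equations are
  summed over a cluster: oddness removes the interactions inside it and leaves bounded terms plus a
  multiple of h, apart from the pole terms at p_i. In the converse direction the scale 1/h is
  factored out, after which distinct clusters decouple at u = 0. The closed curve near a boundary
  point might contain further boundary points with finite h. A collision at p_i with finite h takes
  exactly 2 n_i + 1 nodes, one more than k_i <= 2 n_i can supply. The local graph comes from the
  log-free equations alone; that its points also have sum A_i = 0, and so lie on the closure of the
  variety, is read off from the curve that covers it. The sign ambiguity of s = B^(-1/2) is the
  source of the equivalence: -1 acts on (0, A, 1) by A -> -A, which exchanges k and 2n - k. At a
  symmetric index s and -s name the same point, so the curve is compared with the branch through
  germs of images.\<close>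

lemma has_field_derivative_infsum:
  fixes f f' :: "'i \<Rightarrow> complex \<Rightarrow> complex"
  assumes "\<And>i z. i \<in> X \<Longrightarrow> z \<in> cball c r \<Longrightarrow> (f i has_field_derivative f' i z) (at z)"
    and "\<And>i z. i \<in> X \<Longrightarrow> z \<in> cball c r \<Longrightarrow> norm (f i z) \<le> M i"
    and "M summable_on X" and "w \<in> ball c r"
  shows "((\<lambda>z. \<Sum>\<^sub>\<infinity>i\<in>X. f i z) has_field_derivative (\<Sum>\<^sub>\<infinity>i\<in>X. f' i w)) (at w)"
proof -
  have r: "0 < r" using assms(4) by (metis ball_eq_empty empty_iff not_le)
  have ul: "uniform_limit (cball c r) (\<lambda>S z. \<Sum>i\<in>S. f i z) (\<lambda>z. \<Sum>\<^sub>\<infinity>i\<in>X. f i z)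
      (finite_subsets_at_top X)"
    by (rule Weierstrass_m_test_general[OF _ assms(3)]) (use assms(2) in auto)
  have "eventually (\<lambda>S. continuous_on (cball c r) (\<lambda>z. \<Sum>i\<in>S. f i z) \<and>
     (\<forall>w\<in>ball c r. ((\<lambda>z. \<Sum>i\<in>S. f i z) has_field_derivative (\<Sum>i\<in>S. f' i w)) (at w)))
     (finite_subsets_at_top X)"
  proof (rule eventually_finite_subsets_at_top_weakI)
    fix S assume S: "finite S" "S \<subseteq> X"
    have d: "((\<lambda>z. \<Sum>i\<in>S. f i z) has_field_derivative (\<Sum>i\<in>S. f' i w)) (at w)"
      if "w \<in> cball c r" for w
      using S assms(1) that by (intro DERIV_sum) auto
    show "continuous_on (cball c r) (\<lambda>z. \<Sum>i\<in>S. f i z) \<and>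
       (\<forall>w\<in>ball c r. ((\<lambda>z. \<Sum>i\<in>S. f i z) has_field_derivative (\<Sum>i\<in>S. f' i w)) (at w))"
    proof (intro conjI ballI)
      show "continuous_on (cball c r) (\<lambda>z. \<Sum>i\<in>S. f i z)"
        by (rule DERIV_continuous_on, rule has_field_derivative_at_within, rule d)
    next
      fix w assume "w \<in> ball c r"
      then show "((\<lambda>z. \<Sum>i\<in>S. f i z) has_field_derivative (\<Sum>i\<in>S. f' i w)) (at w)"
        by (intro d) simp
    qed
  qed
  then obtain g' where g': "\<And>w. w \<in> ball c r \<Longrightarrow>
      ((\<lambda>z. \<Sum>\<^sub>\<infinity>i\<in>X. f i z) has_field_derivative (g' w)) (at w) \<and>
      ((\<lambda>S. \<Sum>i\<in>S. f' i w) \<longlongrightarrow> g' w) (finite_subsets_at_top X)"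
    by (rule has_complex_derivative_uniform_limit[OF _ ul _ r]) auto
  \<comment> \<open>Weierstrass' theorem on uniform limits also delivers convergence of the
    differentiated finite sums, which identifies the derivative of the limit as the sum of the
    \<open>f'\<close>.\<close>
  have "((\<lambda>i. f' i w) has_sum g' w) X"
    using g'[OF assms(4)] by (simp add: has_sum_def)
  then have "g' w = (\<Sum>\<^sub>\<infinity>i\<in>X. f' i w)" by (simp add: infsumI)
  then show ?thesis using g'[OF assms(4)] by simp
qed

text \<open>The exponent is half of -3: a product of two such factors majorizes inverse cubes over a
  lattice of rank two.\<close>

lemma summable_on_int_powr:
  "(\<lambda>m::int. (1 + \<bar>real_of_int m\<bar>) powr (-3/2)) summable_on UNIV" (is "?f summable_on _")
proof -
  have s: "summable (\<lambda>n. real (Suc n) powr (-3/2))"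
    using summable_real_powr_iff[of "-3/2"] summable_Suc_iff[of "\<lambda>n. real n powr (-3/2)"] by simp
  have "(\<lambda>n. real (Suc n) powr (-3/2)) summable_on UNIV"
    by (rule norm_summable_imp_summable_on) (use s in simp)
  then have *: "(\<lambda>n::nat. (1 + real n) powr (-3/2)) summable_on UNIV"
    by (simp add: add.commute)
  have 1: "?f summable_on range int"
    by (subst summable_on_reindex) (use * in \<open>auto simp: o_def inj_on_def\<close>)
  have 2: "?f summable_on range (\<lambda>n. - int n)"
    by (subst summable_on_reindex) (use * in \<open>auto simp: o_def inj_on_def\<close>)
  have "(UNIV :: int set) = range int \<union> (range (\<lambda>n. - int n) - range int)"
    by (auto simp: image_iff) (metis int_cases2)
  then show ?thesis
    using summable_on_Un_disjoint[OF 1 summable_on_subset[OF 2, of "range (\<lambda>n. - int n) - range int"]]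
    by auto
qed

locale weierstrass =
  fixes \<tau> :: complex
  assumes Im_pos: "Im \<tau> > 0"
begin

abbreviation \<Lambda> :: "complex set" where "\<Lambda> \<equiv> lattice \<tau>"
abbreviation \<zeta> :: "complex \<Rightarrow> complex" where "\<zeta> \<equiv> wzeta \<tau>"
abbreviation \<P> :: "complex \<Rightarrow> complex" where "\<P> \<equiv> wp \<tau>"

definition lat :: "int \<times> int \<Rightarrow> complex" where
  "lat = (\<lambda>(m1, m2). of_int m1 + of_int m2 * \<tau>)"

lemma lattice_eq_range: "\<Lambda> = range lat"
  by (auto simp: lattice_def lat_def)

lemma lat_eq_iff: "lat x = lat y \<longleftrightarrow> x = y"
proof
  assume h: "lat x = lat y"
  obtain a b c d where [simp]: "x = (a, b)" "y = (c, d)" by (metis surj_pair)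
  have "Im (lat x) = Im (lat y)" using h by simp
  then have "b = d" using Im_pos by (simp add: lat_def)
  then show "x = y" using h by (simp add: lat_def)
qed auto

lemma inj_lat: "inj lat" by (auto simp: inj_on_def lat_eq_iff)

lemma zero_in_lattice [simp]: "0 \<in> \<Lambda>" using lattice_eq_range lat_def by (auto intro!: image_eqI[of _ _ "(0,0)"])

lemma lat_add: "lat (a, b) + lat (c, d) = lat (a + c, b + d)"
  by (simp add: lat_def algebra_simps)

lemma lat_uminus: "- lat (a, b) = lat (- a, - b)"
  by (simp add: lat_def)

lemma lattice_add: "x \<in> \<Lambda> \<Longrightarrow> y \<in> \<Lambda> \<Longrightarrow> x + y \<in> \<Lambda>"
  unfolding lattice_eq_range by (auto simp: lat_add)

lemma lattice_uminus: "x \<in> \<Lambda> \<Longrightarrow> - x \<in> \<Lambda>"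
  unfolding lattice_eq_range by (auto simp: lat_uminus)

lemma lattice_uminus_iff [simp]: "- x \<in> \<Lambda> \<longleftrightarrow> x \<in> \<Lambda>"
  using lattice_uminus[of x] lattice_uminus[of "-x"] by auto

lemma lattice_diff: "x \<in> \<Lambda> \<Longrightarrow> y \<in> \<Lambda> \<Longrightarrow> x - y \<in> \<Lambda>"
  using lattice_add[of x "-y"] lattice_uminus by simp

lemma lattice_diff_commute: "x - y \<in> \<Lambda> \<longleftrightarrow> y - x \<in> \<Lambda>"
  using lattice_uminus_iff[of "x - y"] by simp

lemma lattice_add_iff [simp]: "y \<in> \<Lambda> \<Longrightarrow> x + y \<in> \<Lambda> \<longleftrightarrow> x \<in> \<Lambda>" "y \<in> \<Lambda> \<Longrightarrow> y + x \<in> \<Lambda> \<longleftrightarrow> x \<in> \<Lambda>"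
  using lattice_add lattice_diff[of "x+y" y] by (auto simp: add.commute)

lemma lattice_diff_iff [simp]: "y \<in> \<Lambda> \<Longrightarrow> x - y \<in> \<Lambda> \<longleftrightarrow> x \<in> \<Lambda>" "y \<in> \<Lambda> \<Longrightarrow> y - x \<in> \<Lambda> \<longleftrightarrow> x \<in> \<Lambda>"
  using lattice_diff[of x y] lattice_add[of "x-y" y] lattice_diff_commute[of x y] by auto

lemma countable_lattice: "countable \<Lambda>"
  unfolding lattice_eq_range by simp

text \<open>Compares the integer coefficients of a lattice point with its modulus: the imaginary
  part controls the second coefficient, and solving for the first one brings in
  \<open>norm \<tau>\<close>.\<close>

definition lat_const :: real where "lat_const = 1 + norm \<tau> / Im \<tau> + 1 / Im \<tau>"

lemma lat_const_pos: "lat_const > 0"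
  unfolding lat_const_def using Im_pos by (intro add_pos_nonneg) auto

lemma lat_norm_ge:
  "\<bar>real_of_int m1\<bar> \<le> lat_const * norm (lat (m1, m2))" "\<bar>real_of_int m2\<bar> \<le> lat_const * norm (lat (m1, m2))"
proof -
  let ?w = "lat (m1, m2)"
  have "\<bar>Im ?w\<bar> \<le> norm ?w" by (rule abs_Im_le_cmod)
  then have i: "\<bar>real_of_int m2\<bar> * Im \<tau> \<le> norm ?w" using Im_pos by (simp add: lat_def abs_mult)
  then have m2: "\<bar>real_of_int m2\<bar> \<le> norm ?w / Im \<tau>" using Im_pos by (simp add: field_simps)
  have "of_int m1 = ?w - of_int m2 * \<tau>" by (simp add: lat_def)
  then have "norm (of_int m1 :: complex) \<le> norm ?w + norm (of_int m2 * \<tau>)"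
    using norm_triangle_ineq4[of ?w "of_int m2 * \<tau>"] by simp
  then have m1: "\<bar>real_of_int m1\<bar> \<le> norm ?w + \<bar>real_of_int m2\<bar> * norm \<tau>" by (simp add: norm_mult)
  have "\<bar>real_of_int m2\<bar> * norm \<tau> \<le> norm ?w / Im \<tau> * norm \<tau>" by (intro mult_right_mono m2) auto
  then have "\<bar>real_of_int m1\<bar> \<le> (1 + norm \<tau> / Im \<tau>) * norm ?w" using m1 by (simp add: field_simps)
  also have "\<dots> \<le> lat_const * norm ?w"
    unfolding lat_const_def using Im_pos by (intro mult_right_mono) auto
  finally show "\<bar>real_of_int m1\<bar> \<le> lat_const * norm ?w" .
  have "norm ?w / Im \<tau> = (1 / Im \<tau>) * norm ?w" by simp
  also have "\<dots> \<le> lat_const * norm ?w"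
    unfolding lat_const_def using Im_pos by (intro mult_right_mono) auto
  finally show "\<bar>real_of_int m2\<bar> \<le> lat_const * norm ?w" using m2 by linarith
qed

lemma finite_lattice_bounded: "finite {w \<in> \<Lambda>. norm w \<le> R}"
proof -
  define K where "K = \<lceil>lat_const * R\<rceil>"
  have "{w \<in> \<Lambda>. norm w \<le> R} \<subseteq> lat ` ({-K..K} \<times> {-K..K})"
  proof
    fix w assume "w \<in> {w \<in> \<Lambda>. norm w \<le> R}"
    then obtain m1 m2 where w: "w = lat (m1, m2)" "norm (lat (m1, m2)) \<le> R"
      unfolding lattice_eq_range by auto
    have "lat_const * norm (lat (m1, m2)) \<le> lat_const * R"
      using w lat_const_pos by simp
    then have "\<bar>real_of_int m1\<bar> \<le> lat_const * R" "\<bar>real_of_int m2\<bar> \<le> lat_const * R"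
      by (auto intro: order_trans[OF lat_norm_ge(1)] order_trans[OF lat_norm_ge(2)])
    then have "\<bar>m1\<bar> \<le> K" "\<bar>m2\<bar> \<le> K" unfolding K_def by linarith+
    then show "w \<in> lat ` ({-K..K} \<times> {-K..K})" using w by (auto simp: abs_le_iff)
  qed
  then show ?thesis by (rule finite_subset) auto
qed

lemma not_islimpt_lattice: "\<not> z islimpt \<Lambda>"
proof
  assume "z islimpt \<Lambda>"
  then have "infinite (\<Lambda> \<inter> ball z 1)" by (simp add: islimpt_eq_infinite_ball)
  moreover have "\<Lambda> \<inter> ball z 1 \<subseteq> {w \<in> \<Lambda>. norm w \<le> norm z + 1}"
  proof
    fix w assume w: "w \<in> \<Lambda> \<inter> ball z 1"
    then have "norm (w - z) < 1" by (simp add: dist_norm norm_minus_commute)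
    then show "w \<in> {w \<in> \<Lambda>. norm w \<le> norm z + 1}" using w norm_triangle_ineq2[of w z] by auto
  qed
  ultimately show False using finite_subset[OF _ finite_lattice_bounded] by metis
qed

lemma closed_lattice_subset: "S \<subseteq> \<Lambda> \<Longrightarrow> closed S"
  unfolding closed_limpt using not_islimpt_lattice by (metis islimpt_subset)

lemma closed_lattice: "closed \<Lambda>" by (rule closed_lattice_subset) simp

text \<open>Off the origin some coefficient has modulus at least 1, so
  \<open>lat_const * norm w\<close> is at least 1, and 1 plus the modulus of either coefficient is
  at most twice that product. The term is then bounded by a constant times a product of two summable
  one-variable terms.\<close>

lemma summable_on_lattice: "(\<lambda>w. 1 / norm w ^ 3) summable_on (\<Lambda> - {0})"
proof -
  define C where "C = (2 * lat_const) powr 3"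
  define g where "g = (\<lambda>m::int. (1 + \<bar>real_of_int m\<bar>) powr (-3/2))"
  have gs: "g summable_on UNIV" unfolding g_def by (rule summable_on_int_powr)
  have "((\<lambda>(x, y). g x * g y)) summable_on UNIV \<times> UNIV"
  proof (rule summable_on_SigmaI[where g = "\<lambda>x. g x * infsum g UNIV"])
    show "((\<lambda>y. case (x, y) of (x, y) \<Rightarrow> g x * g y) has_sum g x * infsum g UNIV) UNIV" for x
      using gs by (simp add: has_sum_cmult_right)
    show "(\<lambda>x. g x * infsum g UNIV) summable_on UNIV"
      using gs by (rule summable_on_cmult_left)
  qed (auto simp: g_def)
  then have "(\<lambda>(x, y). g x * g y) summable_on (UNIV - {(0,0)})"
    by (rule summable_on_subset) auto
  then have "(\<lambda>x. C * (case x of (x, y) \<Rightarrow> g x * g y)) summable_on (UNIV - {(0,0)})"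
    by (rule summable_on_cmult_right)
  then have "(\<lambda>x. 1 / norm (lat x) ^ 3) summable_on (UNIV - {(0,0)})"
  proof (rule summable_on_comparison_test)
    fix x :: "int \<times> int" assume x: "x \<in> UNIV - {(0,0)}"
    obtain m1 m2 where m: "x = (m1, m2)" by (metis surj_pair)
    have nz: "norm (lat x) > 0" using x lat_eq_iff[of x "(0,0)"] by (auto simp: lat_def)
    have "1 \<le> max \<bar>m1\<bar> \<bar>m2\<bar>" using x m by auto
    then have "1 \<le> max \<bar>real_of_int m1\<bar> \<bar>real_of_int m2\<bar>" by linarith
    then have one: "1 \<le> lat_const * norm (lat x)" using lat_norm_ge(1)[of m1 m2] lat_norm_ge(2)[of m2 m1] m by auto
    have a: "1 + \<bar>real_of_int m1\<bar> \<le> 2 * lat_const * norm (lat x)"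
            "1 + \<bar>real_of_int m2\<bar> \<le> 2 * lat_const * norm (lat x)"
      using one lat_norm_ge(1)[of m1 m2] lat_norm_ge(2)[of m2 m1] m by auto
    let ?t = "2 * lat_const * norm (lat x)"
    have tp: "?t > 0" using nz lat_const_pos by simp
    have "?t powr (-3/2) \<le> g m1" "?t powr (-3/2) \<le> g m2"
      unfolding g_def using a by (auto intro!: powr_mono2')
    then have "?t powr (-3/2) * ?t powr (-3/2) \<le> g m1 * g m2"
      by (intro mult_mono) (auto simp: g_def)
    then have "?t powr (-3) \<le> g m1 * g m2" by (simp flip: powr_add)
    then have "C * ?t powr (-3) \<le> C * (g m1 * g m2)" unfolding C_def by (intro mult_left_mono) auto
    moreover have "C * ?t powr (-3) = 1 / norm (lat x) ^ 3"
      unfolding C_def using nz lat_const_pos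
      by (simp add: powr_mult powr_minus powr_numeral field_simps)
    ultimately show "1 / norm (lat x) ^ 3 \<le> C * (case x of (x, y) \<Rightarrow> g x * g y)" using m by simp
  qed auto
  then have "((\<lambda>w. 1 / norm w ^ 3) \<circ> lat) summable_on (UNIV - {(0,0)})" by (simp add: o_def)
  then have "(\<lambda>w. 1 / norm w ^ 3) summable_on lat ` (UNIV - {(0,0)})"
    by (subst summable_on_reindex) (auto intro: inj_on_subset[OF inj_lat])
  moreover have "lat ` (UNIV - {(0,0)}) = \<Lambda> - {0}"
    unfolding lattice_eq_range using lat_eq_iff[of _ "(0,0)"] by (force simp: lat_def)
  ultimately show ?thesis by simp
qed

section \<open>Termwise differentiation of the lattice sums\<close>

definition zeta_term :: "complex \<Rightarrow> complex \<Rightarrow> complex" where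
  "zeta_term w z = 1 / (z - w) + 1 / w + z / w\<^sup>2"

definition wp_term :: "complex \<Rightarrow> complex \<Rightarrow> complex" where
  "wp_term w z = 1 / (z - w)\<^sup>2 - 1 / w\<^sup>2"

text \<open>The correction terms raise the decay in w to order 3: the combined fraction has
  numerator z^2 over a denominator of degree 3 in w. For w far from z, \<open>norm (z - w)\<close>
  is at least half of \<open>norm w\<close>.\<close>

lemma zeta_term_bound:
  assumes "norm z \<le> R" "2 * R \<le> norm w" "w \<noteq> 0"
  shows "norm (zeta_term w z) \<le> 2 * R\<^sup>2 * (1 / norm w ^ 3)"
proof -
  have R: "0 \<le> R" using assms(1) norm_ge_zero order_trans by blast
  have nz: "norm w > 0" using assms(3) by simp
  have "norm w - norm z \<le> norm (w - z)" by (rule norm_triangle_ineq2)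
  then have d: "norm w / 2 \<le> norm (z - w)" using assms by (simp add: norm_minus_commute)
  then have zw: "z \<noteq> w" using nz by auto
  have "zeta_term w z = z\<^sup>2 / (w\<^sup>2 * (z - w))"
    unfolding zeta_term_def using zw assms(3) by (simp add: field_simps power2_eq_square)
  then have "norm (zeta_term w z) = norm z ^ 2 / (norm w ^ 2 * norm (z - w))"
    by (simp add: norm_divide norm_mult norm_power)
  also have "\<dots> \<le> R ^ 2 / (norm w ^ 2 * (norm w / 2))"
    using assms d nz R by (intro frac_le mult_left_mono power_mono) auto
  also have "\<dots> = 2 * R\<^sup>2 * (1 / norm w ^ 3)" using nz by (simp add: field_simps power2_eq_square power3_eq_cube)
  finally show ?thesis .
qed

text \<open>Cubic decay again, now from the numerator \<open>z * (2 * w - z)\<close> over a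
  denominator of degree 4 in w. The constant 10 is 5/2 from the numerator times 4 from the halved
  distance.\<close>

lemma wp_term_bound:
  assumes "norm z \<le> R" "2 * R \<le> norm w" "w \<noteq> 0"
  shows "norm (wp_term w z) \<le> 10 * R * (1 / norm w ^ 3)"
proof -
  have R: "0 \<le> R" using assms(1) norm_ge_zero order_trans by blast
  have nz: "norm w > 0" using assms(3) by simp
  have "norm w - norm z \<le> norm (w - z)" by (rule norm_triangle_ineq2)
  then have d: "norm w / 2 \<le> norm (z - w)" using assms by (simp add: norm_minus_commute)
  then have zw: "z \<noteq> w" using nz by auto
  have "wp_term w z = z * (2 * w - z) / (w\<^sup>2 * (z - w)\<^sup>2)"
    unfolding wp_term_def using zw assms(3) by (simp add: divide_simps) (simp add: algebra_simps power2_eq_square)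
  then have "norm (wp_term w z) = norm z * norm (2 * w - z) / (norm w ^ 2 * norm (z - w) ^ 2)"
    by (simp add: norm_divide norm_mult norm_power)
  also have "\<dots> \<le> R * (5 / 2 * norm w) / (norm w ^ 2 * (norm w / 2) ^ 2)"
  proof (intro frac_le mult_mono power_mono)
    have "norm (2 * w - z) \<le> norm (2 * w) + norm z" by (rule norm_triangle_ineq4)
    then show "norm (2 * w - z) \<le> 5 / 2 * norm w" using assms by (simp add: norm_mult)
  qed (use assms d nz R in auto)
  also have "\<dots> = 10 * R * (1 / norm w ^ 3)"
    using nz by (simp add: field_simps power2_eq_square power3_eq_cube)
  finally show ?thesis .
qed

lemma zeta_term_deriv:
  "z \<noteq> w \<Longrightarrow> (zeta_term w has_field_derivative - wp_term w z) (at z)"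
proof -
  assume zw: "z \<noteq> w"
  have "((\<lambda>z. inverse (z - w) + 1 / w + z * c) has_field_derivative - (inverse (z - w))\<^sup>2 + c) (at z)" for c
    using zw by (auto intro!: derivative_eq_intros simp: power2_eq_square)
  from this[of "1 / w\<^sup>2"] show ?thesis
    by (simp add: zeta_term_def[abs_def] wp_term_def inverse_eq_divide power_one_over)
qed

lemma wp_term_deriv:
  "z \<noteq> w \<Longrightarrow> (wp_term w has_field_derivative - 2 / (z - w) ^ 3) (at z)"
proof -
  assume zw: "z \<noteq> w"
  have "((\<lambda>z. (inverse (z - w))\<^sup>2 - c) has_field_derivative - 2 * inverse (z - w) ^ 3) (at z)" for c
    using zw by (auto intro!: derivative_eq_intros simp: power2_eq_square power3_eq_cube)
  from this[of "1 / w\<^sup>2"] show ?thesis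
    by (simp add: wp_term_def[abs_def] inverse_eq_divide power_one_over)
qed

text \<open>The majorants hold only for lattice points with norm at least 2 R; the remaining ones,
  which carry the poles in the disc, form a finite sum.\<close>

lemma split_lattice:
  obtains S1 S2 where "finite S1" "S1 \<union> S2 = \<Lambda> - {0}" "S1 \<inter> S2 = {}"
    "\<And>w. w \<in> S2 \<Longrightarrow> w \<in> \<Lambda> \<and> w \<noteq> 0 \<and> 2 * R \<le> norm w" "S1 \<subseteq> \<Lambda>"
proof
  show "finite {w \<in> \<Lambda> - {0}. norm w \<le> 2 * R}"
    by (rule finite_subset[OF _ finite_lattice_bounded[of "2 * R"]]) auto
  show "{w \<in> \<Lambda> - {0}. norm w \<le> 2 * R} \<union> {w \<in> \<Lambda> - {0}. \<not> norm w \<le> 2 * R} = \<Lambda> - {0}"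
    by auto
qed auto

text \<open>The regular parts of the Weierstrass functions at the origin.\<close>

definition zeta0 :: "complex \<Rightarrow> complex" where "zeta0 z = (\<Sum>\<^sub>\<infinity>w\<in>\<Lambda> - {0}. zeta_term w z)"
definition wp0 :: "complex \<Rightarrow> complex" where "wp0 z = (\<Sum>\<^sub>\<infinity>w\<in>\<Lambda> - {0}. wp_term w z)"
definition wp0' :: "complex \<Rightarrow> complex" where "wp0' z = (\<Sum>\<^sub>\<infinity>w\<in>\<Lambda> - {0}. - 2 / (z - w) ^ 3)"

lemma wzeta_eq: "\<zeta> z = 1 / z + zeta0 z"
  by (simp add: wzeta_def zeta0_def zeta_term_def)

lemma wp_eq: "\<P> z = 1 / z\<^sup>2 + wp0 z"
  by (simp add: wp_def wp0_def wp_term_def)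

text \<open>Near terms are differentiated one by one, far terms through the M-test. Since w = 0 is
  omitted, the origin is an admissible point, and this is what makes the regular parts
  \<open>zeta0\<close> and \<open>wp0\<close> differentiable there.\<close>

lemma infsum_lattice_deriv:
  assumes bound: "\<And>w. w \<in> \<Lambda> \<Longrightarrow> w \<noteq> 0 \<Longrightarrow> 2 * R \<le> norm w \<Longrightarrow> (\<And>z. norm z \<le> R \<Longrightarrow> norm (f w z) \<le> C * (1 / norm w ^ 3))"
    and deriv: "\<And>w z. z \<noteq> w \<Longrightarrow> (f w has_field_derivative f' w z) (at z)"
    and R: "norm z < R" and z: "z \<notin> \<Lambda> - {0}"
    and f's: "\<And>S. S \<subseteq> \<Lambda> - {0} \<Longrightarrow> (\<lambda>w. f' w z) summable_on S"
  shows "((\<lambda>z. \<Sum>\<^sub>\<infinity>w\<in>\<Lambda> - {0}. f w z) has_field_derivative (\<Sum>\<^sub>\<infinity>w\<in>\<Lambda> - {0}. f' w z)) (at z)"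
proof -
  obtain S1 S2 where S: "finite S1" "S1 \<union> S2 = \<Lambda> - {0}" "S1 \<inter> S2 = {}" "S1 \<subseteq> \<Lambda>"
    and S2: "\<And>w. w \<in> S2 \<Longrightarrow> w \<in> \<Lambda> \<and> w \<noteq> 0 \<and> 2 * R \<le> norm w"
    by (rule split_lattice) blast
  have R0: "R > 0" using R norm_ge_zero[of z] by linarith
  have sM: "(\<lambda>w. C * (1 / norm w ^ 3)) summable_on S2"
    by (rule summable_on_cmult_right, rule summable_on_subset[OF summable_on_lattice]) (use S2 in auto)
  have ne: "v \<noteq> w" if "w \<in> S2" "norm v \<le> R" for v w
    using S2[OF that(1)] that(2) R0 by auto
  have sf: "(\<lambda>w. f w v) summable_on S2" if "norm v \<le> R" for v
    by (rule abs_summable_summable, rule summable_on_comparison_test[OF sM])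
       (use bound S2 that in auto)
  have split: "(\<Sum>\<^sub>\<infinity>w\<in>\<Lambda> - {0}. f w v) = (\<Sum>w\<in>S1. f w v) + (\<Sum>\<^sub>\<infinity>w\<in>S2. f w v)" if "norm v \<le> R" for v
    unfolding S(2)[symmetric] using S sf[OF that] by (subst infsum_Un_disjoint) auto
  have split': "(\<Sum>\<^sub>\<infinity>w\<in>\<Lambda> - {0}. f' w z) = (\<Sum>w\<in>S1. f' w z) + (\<Sum>\<^sub>\<infinity>w\<in>S2. f' w z)"
    unfolding S(2)[symmetric] using S f's[of S2] S2 by (subst infsum_Un_disjoint) auto
  have zz: "z \<in> ball 0 R" using R by simp
  have 1: "((\<lambda>z. \<Sum>\<^sub>\<infinity>w\<in>S2. f w z) has_field_derivative (\<Sum>\<^sub>\<infinity>w\<in>S2. f' w z)) (at z)"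
    by (rule has_field_derivative_infsum[OF _ _ sM zz]) (use deriv ne bound S2 in auto)
  have 2: "((\<lambda>z. \<Sum>w\<in>S1. f w z) has_field_derivative (\<Sum>w\<in>S1. f' w z)) (at z)"
    by (intro DERIV_sum deriv) (use z S in auto)
  have "((\<lambda>v. (\<Sum>w\<in>S1. f w v) + (\<Sum>\<^sub>\<infinity>w\<in>S2. f w v)) has_field_derivative
      (\<Sum>w\<in>S1. f' w z) + (\<Sum>\<^sub>\<infinity>w\<in>S2. f' w z)) (at z)"
    by (rule DERIV_add[OF 2 1])
  then show ?thesis unfolding split'
    by (rule has_field_derivative_transform_within_open[of _ _ _ "ball 0 R"])
       (use zz split in auto)
qed

lemma summable_wp_term: "S \<subseteq> \<Lambda> - {0} \<Longrightarrow> (\<lambda>w. wp_term w z) summable_on S"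
proof -
  assume S: "S \<subseteq> \<Lambda> - {0}"
  obtain S1 S2 where SS: "finite S1" "S1 \<union> S2 = \<Lambda> - {0}" "S1 \<inter> S2 = {}" "S1 \<subseteq> \<Lambda>"
    and S2: "\<And>w. w \<in> S2 \<Longrightarrow> w \<in> \<Lambda> \<and> w \<noteq> 0 \<and> 2 * norm z \<le> norm w"
    by (rule split_lattice) blast
  have sM: "(\<lambda>w. 10 * norm z * (1 / norm w ^ 3)) summable_on S2"
    by (rule summable_on_cmult_right, rule summable_on_subset[OF summable_on_lattice]) (use S2 in auto)
  have "(\<lambda>w. wp_term w z) summable_on S2"
    by (rule abs_summable_summable, rule summable_on_comparison_test[OF sM])
       (use wp_term_bound[OF order_refl] S2 in auto)
  then have "(\<lambda>w. wp_term w z) summable_on S1 \<union> S2"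
    using SS by (intro summable_on_Un_disjoint) auto
  then show ?thesis using S SS(2) summable_on_subset_banach by metis
qed

lemma summable_wp_term': "S \<subseteq> \<Lambda> - {0} \<Longrightarrow> (\<lambda>w. - 2 / (z - w) ^ 3) summable_on S"
proof -
  assume S: "S \<subseteq> \<Lambda> - {0}"
  obtain S1 S2 where SS: "finite S1" "S1 \<union> S2 = \<Lambda> - {0}" "S1 \<inter> S2 = {}" "S1 \<subseteq> \<Lambda>"
    and S2: "\<And>w. w \<in> S2 \<Longrightarrow> w \<in> \<Lambda> \<and> w \<noteq> 0 \<and> 2 * norm z \<le> norm w"
    by (rule split_lattice) blast
  have sM: "(\<lambda>w. 16 * (1 / norm w ^ 3)) summable_on S2"
    by (rule summable_on_cmult_right, rule summable_on_subset[OF summable_on_lattice]) (use S2 in auto)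
  have b: "norm (- 2 / (z - w) ^ 3) \<le> 16 * (1 / norm w ^ 3)" if "w \<in> S2" for w
  proof -
    have "norm w - norm z \<le> norm (w - z)" by (rule norm_triangle_ineq2)
    then have d: "norm w / 2 \<le> norm (z - w)" using S2[OF that] by (simp add: norm_minus_commute)
    have "2 / norm (z - w) ^ 3 \<le> 2 / (norm w / 2) ^ 3"
      using d S2[OF that] by (intro divide_left_mono power_mono mult_pos_pos) auto
    then show ?thesis by (simp add: norm_divide norm_power power_divide)
  qed
  have "(\<lambda>w. - 2 / (z - w) ^ 3) summable_on S2"
    by (rule abs_summable_summable, rule summable_on_comparison_test[OF sM]) (use b in auto)
  then have "(\<lambda>w. - 2 / (z - w) ^ 3) summable_on S1 \<union> S2"
    using SS by (intro summable_on_Un_disjoint) auto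
  then show ?thesis using S SS(2) summable_on_subset_banach by metis
qed

lemma zeta0_deriv:
  assumes "z \<notin> \<Lambda> - {0}"
  shows "(zeta0 has_field_derivative - wp0 z) (at z)"
proof -
  have "((\<lambda>z. \<Sum>\<^sub>\<infinity>w\<in>\<Lambda> - {0}. zeta_term w z) has_field_derivative
      (\<Sum>\<^sub>\<infinity>w\<in>\<Lambda> - {0}. - wp_term w z)) (at z)"
    by (rule infsum_lattice_deriv[where R = "norm z + 1" and C = "2 * (norm z + 1)\<^sup>2"])
       (use assms zeta_term_bound zeta_term_deriv summable_wp_term in \<open>auto simp: summable_on_uminus\<close>)
  then show ?thesis by (simp add: zeta0_def[abs_def] wp0_def infsum_uminus)
qed

lemma wp0_deriv:
  assumes "z \<notin> \<Lambda> - {0}"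
  shows "(wp0 has_field_derivative wp0' z) (at z)"
proof -
  have "((\<lambda>z. \<Sum>\<^sub>\<infinity>w\<in>\<Lambda> - {0}. wp_term w z) has_field_derivative
      (\<Sum>\<^sub>\<infinity>w\<in>\<Lambda> - {0}. - 2 / (z - w) ^ 3)) (at z)"
    by (rule infsum_lattice_deriv[where R = "norm z + 1" and C = "10 * (norm z + 1)"])
       (rule wp_term_bound wp_term_deriv summable_wp_term' assms | simp)+
  then show ?thesis by (simp add: wp0_def[abs_def] wp0'_def)
qed

lemma zeta0_0 [simp]: "zeta0 0 = 0"
  unfolding zeta0_def by (rule infsum_0) (simp add: zeta_term_def)

lemma wp0_0 [simp]: "wp0 0 = 0"
  unfolding wp0_def by (rule infsum_0) (simp add: wp_term_def)

lemma wzeta_deriv: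
  assumes "z \<notin> \<Lambda>"
  shows "(\<zeta> has_field_derivative - \<P> z) (at z)"
proof -
  have z: "z \<noteq> 0" using assms zero_in_lattice by metis
  have "((\<lambda>z. 1 / z + zeta0 z) has_field_derivative - 1 / z\<^sup>2 + - wp0 z) (at z)"
    using z assms by (auto intro!: derivative_eq_intros zeta0_deriv simp: power2_eq_square)
  then show ?thesis by (simp add: wzeta_eq[abs_def] wp_eq)
qed

definition wp' :: "complex \<Rightarrow> complex" where "wp' z = (\<Sum>\<^sub>\<infinity>w\<in>\<Lambda>. - 2 / (z - w) ^ 3)"

lemma wp_deriv:
  assumes "z \<notin> \<Lambda>"
  shows "(\<P> has_field_derivative wp' z) (at z)"
proof -
  have z: "z \<noteq> 0" using assms zero_in_lattice by metis
  have "wp' z = - 2 / (z - 0) ^ 3 + wp0' z"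
    unfolding wp'_def wp0'_def
    by (subst insert_Diff[OF zero_in_lattice, symmetric], subst infsum_insert)
       (use summable_wp_term' in auto)
  moreover have "((\<lambda>z. (inverse z)\<^sup>2) has_field_derivative - 2 * inverse z ^ 3) (at z)"
    using z by (auto intro!: derivative_eq_intros simp: power2_eq_square power3_eq_cube)
  then have "((\<lambda>z. (inverse z)\<^sup>2 + wp0 z) has_field_derivative - 2 * inverse z ^ 3 + wp0' z) (at z)"
    using assms by (intro DERIV_add wp0_deriv) auto
  ultimately show ?thesis by (simp add: wp_eq[abs_def] inverse_eq_divide power_one_over)
qed

lemma bij_uminus_lattice: "bij_betw uminus (\<Lambda> - {0}) (\<Lambda> - {0})"
  by (rule bij_betwI[where g = uminus]) auto

lemma zeta0_uminus: "zeta0 (- z) = - zeta0 z"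
proof -
  have "zeta0 (- z) = (\<Sum>\<^sub>\<infinity>w\<in>\<Lambda> - {0}. zeta_term (- w) (- z))"
    unfolding zeta0_def by (rule infsum_reindex_bij_betw[OF bij_uminus_lattice, symmetric])
  also have "\<dots> = (\<Sum>\<^sub>\<infinity>w\<in>\<Lambda> - {0}. - zeta_term w z)"
  proof (rule infsum_cong)
    fix w
    have "- z - (- w) = - (z - w)" by simp
    then show "zeta_term (- w) (- z) = - zeta_term w z"
      unfolding zeta_term_def by (metis (no_types, opaque_lifting) add.inverse_inverse add_uminus_conv_diff minus_add_distrib minus_divide_left minus_divide_right power2_minus)
  qed
  finally show ?thesis by (simp add: zeta0_def infsum_uminus)
qed

lemma wp0_uminus: "wp0 (- z) = wp0 z"
proof -
  have "wp0 (- z) = (\<Sum>\<^sub>\<infinity>w\<in>\<Lambda> - {0}. wp_term (- w) (- z))"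
    unfolding wp0_def by (rule infsum_reindex_bij_betw[OF bij_uminus_lattice, symmetric])
  also have "\<dots> = (\<Sum>\<^sub>\<infinity>w\<in>\<Lambda> - {0}. wp_term w z)"
    by (rule infsum_cong) (simp add: wp_term_def power2_eq_square algebra_simps)
  finally show ?thesis by (simp add: wp0_def)
qed

lemma wzeta_uminus: "\<zeta> (- z) = - \<zeta> z" by (simp add: wzeta_eq zeta0_uminus)
lemma wp_uminus: "\<P> (- z) = \<P> z" by (simp add: wp_eq wp0_uminus)
lemma wzeta_diff_commute: "\<zeta> (x - y) = - \<zeta> (y - x)" using wzeta_uminus[of "y - x"] by simp
text \<open>The sum for \<open>wp'\<close> carries no correction terms, so a lattice shift merely
  permutes its summands. Periodicity of the P function and quasi-periodicity of zeta follow by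
  integrating twice.\<close>

lemma wp'_add_lattice: "v \<in> \<Lambda> \<Longrightarrow> wp' (z + v) = wp' z"
proof -
  assume v: "v \<in> \<Lambda>"
  have b: "bij_betw (\<lambda>w. w + v) \<Lambda> \<Lambda>" by (rule bij_betwI[where g = "\<lambda>w. w - v"]) (use v in auto)
  have "wp' (z + v) = (\<Sum>\<^sub>\<infinity>w\<in>\<Lambda>. - 2 / ((z + v) - (w + v)) ^ 3)"
    unfolding wp'_def by (rule infsum_reindex_bij_betw[OF b, symmetric])
  then show ?thesis by (simp add: wp'_def)
qed

lemma connected_compl_lattice: "connected (- \<Lambda>)"
  using connected_open_diff_countable[of UNIV \<Lambda>] countable_lattice 
  by (simp add: Compl_eq_Diff_UNIV connected_UNIV)

lemma open_compl_lattice: "open (- \<Lambda>)"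
  using closed_lattice by (simp add: open_Compl)

text \<open>The lattice is countable and closed, so its complement is open and connected.\<close>

lemma const_on_compl_lattice:
  assumes "\<And>z. z \<notin> \<Lambda> \<Longrightarrow> (f has_field_derivative 0) (at z)" "a \<notin> \<Lambda>" "b \<notin> \<Lambda>"
  shows "f a = f b"
  using DERIV_zero_connected_constant[OF connected_compl_lattice open_compl_lattice finite.emptyI, of f]
    assms DERIV_continuous_on[of "- \<Lambda>" f "\<lambda>_. 0"] has_field_derivative_at_within[of f 0]
  by (metis ComplD ComplI Diff_iff)

lemma half_not_in_lattice: "1 / 2 \<notin> \<Lambda>" "\<tau> / 2 \<notin> \<Lambda>"
proof -
  show "1 / 2 \<notin> \<Lambda>"
  proof
    assume "1 / 2 \<in> \<Lambda>"
    then obtain m1 m2 where m: "1 / 2 = of_int m1 + of_int m2 * \<tau>" unfolding lattice_def by blast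
    have "Im (1/2) = Im (of_int m1 + of_int m2 * \<tau>)" by (rule arg_cong[OF m])
    then have "m2 = 0" using Im_pos by simp
    have "Re (1/2) = Re (of_int m1 + of_int m2 * \<tau>)" by (rule arg_cong[OF m])
    then have "real_of_int (2 * m1) = real_of_int 1" using \<open>m2 = 0\<close> by simp
    then have "2 * m1 = 1" by (simp only: of_int_eq_iff)
    then show False by presburger
  qed
  show "\<tau> / 2 \<notin> \<Lambda>"
  proof
    assume "\<tau> / 2 \<in> \<Lambda>"
    then obtain m1 m2 where m: "\<tau> / 2 = of_int m1 + of_int m2 * \<tau>" unfolding lattice_def by blast
    have "Im (\<tau>/2) = Im (of_int m1 + of_int m2 * \<tau>)" by (rule arg_cong[OF m])
    then have "Im \<tau> * real_of_int (2 * m2) = Im \<tau> * real_of_int 1" by (auto simp: mult.commute)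
    then have "real_of_int (2 * m2) = real_of_int 1" using Im_pos by (simp only: mult_cancel_left) auto
    then have "2 * m2 = 1" by (simp only: of_int_eq_iff)
    then show False by presburger
  qed
qed

lemma one_in_lattice: "1 \<in> \<Lambda>" and tau_in_lattice: "\<tau> \<in> \<Lambda>"
  unfolding lattice_def by (force intro: exI[of _ 1] exI[of _ 0])+

text \<open>The difference has derivative zero, hence is constant; at -v/2 it vanishes because the
  function is even. This evaluation point is the reason for assuming that v/2 is not a lattice
  point.\<close>

lemma wp_add_half_period:
  assumes "v \<in> \<Lambda>" "v / 2 \<notin> \<Lambda>" "z \<notin> \<Lambda>"
  shows "\<P> (z + v) = \<P> z"
proof -
  have "\<P> (z + v) - \<P> z = \<P> (- (v / 2) + v) - \<P> (- (v / 2))"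
  proof (rule const_on_compl_lattice[where f = "\<lambda>z. \<P> (z + v) - \<P> z"])
    fix z assume z: "z \<notin> \<Lambda>"
    have "((\<lambda>z. \<P> (z + v)) has_field_derivative wp' (z + v)) (at z)"
      using wp_deriv[of "z + v"] z assms(1) by (simp add: DERIV_shift)
    then show "((\<lambda>z. \<P> (z + v) - \<P> z) has_field_derivative 0) (at z)"
      using DERIV_diff[OF _ wp_deriv[OF z]] wp'_add_lattice[OF assms(1)] by force
  qed (use assms in auto)
  also have "- (v / 2) + v = v / 2" by simp
  finally show ?thesis by (simp add: wp_uminus)
qed

text \<open>Same evaluation at -v/2, where oddness now produces twice the value at v/2: the
  quasi-period.\<close>

lemma wzeta_add_half_period:
  assumes "v \<in> \<Lambda>" "v / 2 \<notin> \<Lambda>" "z \<notin> \<Lambda>"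
  shows "\<zeta> (z + v) = \<zeta> z + 2 * \<zeta> (v / 2)"
proof -
  have "\<zeta> (z + v) - \<zeta> z = \<zeta> (- (v / 2) + v) - \<zeta> (- (v / 2))"
  proof (rule const_on_compl_lattice[where f = "\<lambda>z. \<zeta> (z + v) - \<zeta> z"])
    fix z assume z: "z \<notin> \<Lambda>"
    have "((\<lambda>z. \<zeta> (z + v)) has_field_derivative - \<P> (z + v)) (at z)"
      using wzeta_deriv[of "z + v"] z assms(1) by (simp add: DERIV_shift)
    then show "((\<lambda>z. \<zeta> (z + v) - \<zeta> z) has_field_derivative 0) (at z)"
      using DERIV_diff[OF _ wzeta_deriv[OF z]] wp_add_half_period[OF assms(1,2) z] by force
  qed (use assms in auto)
  also have "- (v / 2) + v = v / 2" by simp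
  finally show ?thesis by (simp add: wzeta_uminus algebra_simps)
qed

text \<open>Shared by zeta (increment a quasi-period) and the P function (increment 0) to pass from
  the two generators to all lattice points.\<close>

lemma additive_int_induct:
  fixes f :: "complex \<Rightarrow> complex"
  assumes step: "\<And>z. z \<notin> \<Lambda> \<Longrightarrow> f (z + v) = f z + c" and v: "v \<in> \<Lambda>" and z: "z \<notin> \<Lambda>"
  shows "f (z + of_int m * v) = f z + of_int m * c"
proof -
  have mv: "of_int k * v \<in> \<Lambda>" for k
  proof (induction k rule: int_induct[where k = 0])
    case (step1 i) then show ?case using v by (auto simp: algebra_simps intro: lattice_add)
  next
    case (step2 i) then show ?case using v by (auto simp: algebra_simps intro: lattice_diff)
  qed simp
  show ?thesis
  proof (induction m rule: int_induct[where k = 0])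
    case (step1 i)
    have "f ((z + of_int i * v) + v) = f (z + of_int i * v) + c" using z mv by (intro step) simp
    then show ?case using step1 by (simp add: algebra_simps)
  next
    case (step2 i)
    have "f ((z + of_int (i - 1) * v) + v) = f (z + of_int (i - 1) * v) + c"
      using z mv[of "i - 1"] by (intro step) (simp del: of_int_diff)
    then show ?case using step2 by (simp add: algebra_simps)
  qed simp
qed

lemma wzeta_add_lattice:
  assumes "z \<notin> \<Lambda>"
  shows "\<zeta> (z + (of_int m1 + of_int m2 * \<tau>)) = \<zeta> z + quasi_period \<tau> m1 m2"
proof -
  have 1: "\<zeta> (z + of_int m1 * 1) = \<zeta> z + of_int m1 * (2 * \<zeta> (1 / 2))"
    using assms half_not_in_lattice one_in_lattice
    by (intro additive_int_induct wzeta_add_half_period) auto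
  have "of_int m1 + of_int 0 * \<tau> \<in> \<Lambda>" unfolding lattice_def by blast
  then have "z + of_int m1 * 1 \<notin> \<Lambda>" using assms by simp
  then have "\<zeta> ((z + of_int m1 * 1) + of_int m2 * \<tau>) = \<zeta> (z + of_int m1 * 1) + of_int m2 * (2 * \<zeta> (\<tau> / 2))"
    using half_not_in_lattice tau_in_lattice
    by (intro additive_int_induct wzeta_add_half_period) auto
  then show ?thesis using 1 by (simp add: quasi_period_def algebra_simps)
qed

lemma wp_add_lattice:
  assumes "z \<notin> \<Lambda>" "v \<in> \<Lambda>"
  shows "\<P> (z + v) = \<P> z"
proof -
  obtain m1 m2 where v: "v = of_int m1 + of_int m2 * \<tau>" using assms(2) unfolding lattice_def by blast
  have 1: "\<P> (z + of_int m1 * 1) = \<P> z + of_int m1 * 0"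
    using assms half_not_in_lattice one_in_lattice wp_add_half_period
    by (intro additive_int_induct) auto
  have "of_int m1 + of_int 0 * \<tau> \<in> \<Lambda>" unfolding lattice_def by blast
  then have "z + of_int m1 * 1 \<notin> \<Lambda>" using assms by simp
  then have "\<P> ((z + of_int m1 * 1) + of_int m2 * \<tau>) = \<P> (z + of_int m1 * 1) + of_int m2 * 0"
    using half_not_in_lattice tau_in_lattice wp_add_half_period
    by (intro additive_int_induct) auto
  then show ?thesis using 1 v by (simp add: algebra_simps)
qed

end

section \<open>Liouville's theorem and the addition identity\<close>

context weierstrass begin

text \<open>Subtracting the integer parts of the two real coordinates moves every argument into the
  closed period parallelogram, which is compact.\<close>

lemma continuous_on_elliptic_bounded:
  assumes cont: "continuous_on UNIV (f :: complex \<Rightarrow> complex)"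
    and per: "\<And>z v. v \<in> \<Lambda> \<Longrightarrow> f (z + v) = f z"
  shows "bounded (range f)"
proof -
  define K where "K = (\<lambda>(a, b). of_real a + of_real b * \<tau>) ` ({0..1::real} \<times> {0..1::real})"
  have "compact K" unfolding K_def
    by (intro compact_continuous_image compact_Times) (auto simp: case_prod_unfold intro!: continuous_intros)
  then have "bounded (f ` K)"
    using cont by (intro compact_imp_bounded compact_continuous_image) (auto intro: continuous_on_subset)
  moreover have "range f \<subseteq> f ` K"
  proof
    fix y assume "y \<in> range f"
    then obtain z where y: "y = f z" by auto
    define b where "b = Im z / Im \<tau>"
    define a where "a = Re (z - of_real b * \<tau>)"
    have z: "z = of_real a + of_real b * \<tau>"
      using Im_pos by (simp add: complex_eq_iff a_def b_def)
    define v where "v = of_int \<lfloor>a\<rfloor> + of_int \<lfloor>b\<rfloor> * \<tau>"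
    have v: "v \<in> \<Lambda>" unfolding v_def lattice_def by blast
    have "z - v = of_real (frac a) + of_real (frac b) * \<tau>"
      unfolding z v_def frac_def by (simp add: algebra_simps)
    moreover have "(frac a, frac b) \<in> {0..1} \<times> {0..1}"
      using frac_ge_0 frac_lt_1 by (auto intro: less_imp_le)
    ultimately have "z - v \<in> K" unfolding K_def by (metis (mono_tags, lifting) case_prod_conv image_eqI)
    moreover have "f (z - v) = f z" using per[of "- v" z] v by simp
    ultimately show "y \<in> f ` K" using y by (metis image_eqI)
  qed
  ultimately show ?thesis using bounded_subset by blast
qed

lemma finite_lattice_shift_ball: "finite {z \<in> ball c r. z - a \<in> \<Lambda>}"
proof -
  have "{z \<in> ball c r. z - a \<in> \<Lambda>} \<subseteq> (\<lambda>w. w + a) ` {w \<in> \<Lambda>. norm w \<le> norm c + r + norm a}"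
  proof
    fix z assume z: "z \<in> {z \<in> ball c r. z - a \<in> \<Lambda>}"
    have "norm (z - a) \<le> norm c + norm (z - c) + norm a"
      using norm_triangle_ineq4[of z a] norm_triangle_ineq[of c "z - c"] by simp
    then have "z - a \<in> {w \<in> \<Lambda>. norm w \<le> norm c + r + norm a}"
      using z by (auto simp: dist_norm norm_minus_commute)
    then show "z \<in> (\<lambda>w. w + a) ` {w \<in> \<Lambda>. norm w \<le> norm c + r + norm a}"
      by (metis (no_types, lifting) diff_add_cancel image_eqI)
  qed
  then show ?thesis using finite_lattice_bounded finite_subset by blast
qed

text \<open>Setting the function to 0 on the two cosets of possible singularities gives a
  continuous, hence entire, function, since the limits there are 0. It is periodic, hence bounded,
  hence constant, and its value at the origin is 0.\<close>

lemma elliptic_eq_0: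
  assumes hol: "\<And>z. z \<notin> \<Lambda> \<Longrightarrow> z + y \<notin> \<Lambda> \<Longrightarrow> f field_differentiable at z"
    and per: "\<And>z v. z \<notin> \<Lambda> \<Longrightarrow> z + y \<notin> \<Lambda> \<Longrightarrow> v \<in> \<Lambda> \<Longrightarrow> f (z + v) = f z"
    and l0: "(f \<longlongrightarrow> 0) (at 0)" and ly: "(f \<longlongrightarrow> 0) (at (- y))"
    and z: "z \<notin> \<Lambda>" "z + y \<notin> \<Lambda>"
  shows "f z = 0"
proof -
  define g where "g z = (if z \<in> \<Lambda> \<or> z + y \<in> \<Lambda> then 0 else f z)" for z
  \<comment> \<open>The removable singularity theorem is applied to finite exceptional sets, so
    holomorphy is checked one unit disc at a time.\<close>
  define B where "B c = {z \<in> ball c 1. z - 0 \<in> \<Lambda>} \<union> {z \<in> ball c 1. z - (- y) \<in> \<Lambda>}" for c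
  have finB: "finite (B c)" for c unfolding B_def using finite_lattice_shift_ball by blast
  have gper: "g (z + v) = g z" if "v \<in> \<Lambda>" for z v
  proof -
    have "z + v + y \<in> \<Lambda> \<longleftrightarrow> z + y \<in> \<Lambda>" using that by (metis add.assoc add.commute lattice_add_iff(1))
    then show ?thesis unfolding g_def using per that by auto
  qed
  have op: "open (ball c 1 - B c)" for c using finB by (intro open_Diff finite_imp_closed) auto
  have ev: "\<forall>\<^sub>F z in at c. z \<in> ball c 1 - B c" for c
  proof -
    have "open (ball c 1 - (B c - {c}))" using finB by (intro open_Diff finite_imp_closed) auto
    then have "\<forall>\<^sub>F z in at c. z \<in> ball c 1 - (B c - {c})"
      using eventually_at_in_open[of "ball c 1 - (B c - {c})" c] by (auto elim: eventually_mono)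
    then show ?thesis using eventually_neq_at_within[of c c UNIV] by eventually_elim auto
  qed
  have geq: "g z = f z" if "z \<in> ball c 1 - B c" for z c
    using that unfolding g_def B_def by auto
  have gd: "g field_differentiable at z" if "z \<in> ball c 1 - B c" for z c
  proof -
    have "f field_differentiable at z" using that by (intro hol) (auto simp: B_def)
    then obtain D where "(f has_field_derivative D) (at z)" unfolding field_differentiable_def ..
    then have "(g has_field_derivative D) (at z)"
      by (rule has_field_derivative_transform_within_open[OF _ op that]) (use geq in auto)
    then show ?thesis unfolding field_differentiable_def ..
  qed
  have lim0: "(g \<longlongrightarrow> 0) (at 0)" 
    by (rule Lim_transform_eventually[OF l0]) (use ev[of 0] geq[of _ 0] in \<open>auto elim: eventually_mono\<close>)
  have limy: "(g \<longlongrightarrow> 0) (at (- y))"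
    by (rule Lim_transform_eventually[OF ly]) (use ev[of "-y"] geq[of _ "-y"] in \<open>auto elim: eventually_mono\<close>)
  have shift: "isCont g (a + v)" if "(g \<longlongrightarrow> 0) (at a)" "g a = 0" "v \<in> \<Lambda>" for a v
  proof -
    have "((\<lambda>x. g (x + v)) \<longlongrightarrow> 0) (at a)" using that gper by simp
    then have "(g \<longlongrightarrow> 0) (at (a + v))" using LIM_offset_zero_iff[of "a+v" g 0] LIM_offset_zero_iff[of a "\<lambda>x. g (x + v)" 0]
      by (simp add: algebra_simps)
    then show ?thesis using that gper by (simp add: isCont_def)
  qed
  have cont: "isCont g z" for z
  proof (cases "z \<in> \<Lambda> \<or> z + y \<in> \<Lambda>")
    case True
    then show ?thesis
    proof
      assume "z \<in> \<Lambda>" then show ?thesis using shift[OF lim0, of z] by (simp add: g_def)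
    next
      assume "z + y \<in> \<Lambda>" then show ?thesis using shift[OF limy, of "z + y"] by (simp add: g_def)
    qed
  next
    case False
    then have "z \<in> ball z 1 - B z" by (auto simp: B_def)
    then show ?thesis using gd field_differentiable_imp_continuous_at by blast
  qed
  have "g holomorphic_on ball c 1" for c
  proof (rule no_isolated_singularity[OF _ _ _ finB[of c]])
    show "continuous_on (ball c 1) g" using cont by (intro continuous_at_imp_continuous_on) auto
    show "g holomorphic_on ball c 1 - B c"
      unfolding holomorphic_on_def using gd[of _ c] field_differentiable_at_within by blast
  qed auto
  then have "g holomorphic_on UNIV"
    unfolding holomorphic_on_def
    by (metis UNIV_I centre_in_ball field_differentiable_at_within holomorphic_on_def
        holomorphic_on_imp_differentiable_at open_ball zero_less_one)
  moreover have "bounded (range g)"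
    by (rule continuous_on_elliptic_bounded) (use cont gper in \<open>auto intro: continuous_at_imp_continuous_on\<close>)
  ultimately have "g constant_on UNIV" by (intro Liouville_theorem)
  then obtain c where c: "\<And>z. g z = c" unfolding constant_on_def by blast
  have "g 0 = 0" by (simp add: g_def)
  then show ?thesis using c[of z] c[of 0] z by (simp add: g_def)
qed

lemma tendsto_zeta0: "(zeta0 \<longlongrightarrow> 0) (at 0)" "((\<lambda>z. zeta0 z / z) \<longlongrightarrow> 0) (at 0)"
proof -
  have d: "(zeta0 has_field_derivative 0) (at 0)" using zeta0_deriv[of 0] by simp
  show "(zeta0 \<longlongrightarrow> 0) (at 0)" using DERIV_isCont[OF d] by (simp add: isCont_def)
  show "((\<lambda>z. zeta0 z / z) \<longlongrightarrow> 0) (at 0)" using d by (simp add: DERIV_def)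
qed

lemma tendsto_wp0: "(wp0 \<longlongrightarrow> 0) (at 0)"
  using DERIV_isCont[OF wp0_deriv[of 0]] by (simp add: isCont_def)

lemma eventually_nonzero_at_0: "\<forall>\<^sub>F z in at (0::complex). z \<noteq> 0"
  by (rule eventually_neq_at_within)

text \<open>As a function of x, the difference of the two sides is elliptic with possible poles only
  at 0 and -y modulo the lattice. It tends to 0 at the first by expansion and at the second by
  symmetry, so the Liouville argument makes it vanish.\<close>

lemma three_term_identity:
  assumes "x \<notin> \<Lambda>" "y \<notin> \<Lambda>" "x + y \<notin> \<Lambda>"
  shows "(\<zeta> x + \<zeta> y - \<zeta> (x + y))\<^sup>2 = \<P> x + \<P> y + \<P> (x + y)"
proof -
  define f where "f x = (\<zeta> x + \<zeta> y - \<zeta> (x + y))\<^sup>2 - \<P> x - \<P> y - \<P> (x + y)" for x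
  have lim: "(f \<longlongrightarrow> 0) (at 0)"
  proof -
    have d1: "((\<lambda>z. \<zeta> (z + y)) has_field_derivative - \<P> y) (at 0)"
      using wzeta_deriv[OF assms(2)] DERIV_shift[of \<zeta> "- \<P> y" 0 y] by simp
    define k where "k z = \<zeta> y - \<zeta> (z + y)" for z
    have k1: "((\<lambda>z. k z / z) \<longlongrightarrow> \<P> y) (at 0)"
    proof -
      have "((\<lambda>z. - ((\<zeta> (z + y) - \<zeta> y) / z)) \<longlongrightarrow> - (- \<P> y)) (at 0)"
        using d1 by (intro tendsto_minus) (simp add: DERIV_def)
      then show ?thesis by (simp add: k_def diff_divide_distrib)
    qed
    have k0: "(k \<longlongrightarrow> 0) (at 0)"
    proof -
      have "isCont (\<lambda>z. \<zeta> (z + y)) 0" using d1 DERIV_isCont by blast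
      then have "((\<lambda>z. \<zeta> (z + y)) \<longlongrightarrow> \<zeta> y) (at 0)" by (simp add: isCont_def)
      then show ?thesis unfolding k_def by (auto intro!: tendsto_eq_intros)
    qed
    have p: "((\<lambda>z. \<P> (z + y)) \<longlongrightarrow> \<P> y) (at 0)"
    proof -
      have "((\<lambda>z. \<P> (z + y)) has_field_derivative wp' y) (at 0)"
        using wp_deriv[OF assms(2)] DERIV_shift[of \<P> "wp' y" 0 y] by simp
      from DERIV_isCont[OF this] show ?thesis by (simp add: isCont_def)
    qed
    \<comment> \<open>Square expanded with zeta split as \<open>1 / z + zeta0 z\<close>: the double
      pole cancels against that of the P function, and the simple pole times \<open>k\<close>
      contributes twice the value of P at y, which balances the last two terms.\<close>
    have "((\<lambda>z. 2 * (zeta0 z / z) + 2 * (k z / z) + (zeta0 z + k z)\<^sup>2 - wp0 z - \<P> y - \<P> (z + y))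
        \<longlongrightarrow> 2 * 0 + 2 * \<P> y + (0 + 0)\<^sup>2 - 0 - \<P> y - \<P> y) (at 0)"
      by (intro tendsto_intros tendsto_zeta0 k1 k0 p tendsto_wp0)
    then have "((\<lambda>z. 2 * (zeta0 z / z) + 2 * (k z / z) + (zeta0 z + k z)\<^sup>2 - wp0 z - \<P> y - \<P> (z + y))
        \<longlongrightarrow> 0) (at 0)" by simp
    then show ?thesis
    proof (rule Lim_transform_eventually)
      show "\<forall>\<^sub>F z in at 0. 2 * (zeta0 z / z) + 2 * (k z / z) + (zeta0 z + k z)\<^sup>2 - wp0 z - \<P> y - \<P> (z + y) = f z"
        using eventually_nonzero_at_0
      proof eventually_elim
        case (elim z)
        have "f z = (1 / z + (zeta0 z + k z))\<^sup>2 - 1 / z\<^sup>2 - wp0 z - \<P> y - \<P> (z + y)"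
          unfolding f_def wzeta_eq[of z] wp_eq[of z] k_def by (simp add: algebra_simps)
        also have "(1 / z + (zeta0 z + k z))\<^sup>2 = 1 / z\<^sup>2 + 2 * (zeta0 z / z) + 2 * (k z / z) + (zeta0 z + k z)\<^sup>2"
          using elim by (simp add: power2_eq_square field_simps)
        finally show ?case by simp
      qed
    qed
  qed
  \<comment> \<open>This involution exchanges the two singular points 0 and -y, so one expansion
    serves for both.\<close>
  have sym: "f z = f (- y - z)" for z
  proof -
    have e: "- y - z + y = - z" by simp
    have "\<zeta> (- y - z) = - \<zeta> (z + y)" "\<P> (- y - z) = \<P> (z + y)"
      using wzeta_uminus[of "z + y"] wp_uminus[of "z + y"]
      by (simp_all add: algebra_simps)
    then show ?thesis unfolding f_def e by (simp add: wzeta_uminus wp_uminus algebra_simps)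
  qed
  have limy: "(f \<longlongrightarrow> 0) (at (- y))"
  proof -
    have "((\<lambda>h. f (- h)) \<longlongrightarrow> 0) (at 0)"
    proof (rule filterlim_compose[OF lim])
      have "(uminus \<longlongrightarrow> (0::complex)) (at 0)" using tendsto_minus[OF tendsto_ident_at, of 0 UNIV] by simp
      then show "filterlim uminus (at (0::complex)) (at 0)"
        using eventually_nonzero_at_0 by (auto simp: filterlim_at)
    qed
    moreover have "f (- h) = f (- y + h)" for h using sym[of "- h"] by simp
    ultimately show ?thesis using LIM_offset_zero_iff[of "-y" f 0] by simp
  qed
  have "f x = 0"
  proof (rule elliptic_eq_0[OF _ _ lim limy assms(1,3)])
    fix z assume z: "z \<notin> \<Lambda>" "z + y \<notin> \<Lambda>"
    have 1: "((\<lambda>z. \<zeta> (z + y)) has_field_derivative - \<P> (z + y)) (at z)"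
      using wzeta_deriv[OF z(2)] by (simp add: DERIV_shift)
    have 2: "((\<lambda>z. \<P> (z + y)) has_field_derivative wp' (z + y)) (at z)"
      using wp_deriv[OF z(2)] by (simp add: DERIV_shift)
    have "(f has_field_derivative 2 * (\<zeta> z + \<zeta> y - \<zeta> (z + y)) * (- \<P> z + \<P> (z + y)) - wp' z - wp' (z + y)) (at z)"
      unfolding f_def by (auto intro!: derivative_eq_intros wzeta_deriv wp_deriv 1 2 z)
    then show "f field_differentiable at z" unfolding field_differentiable_def by blast
    fix v assume v: "v \<in> \<Lambda>"
    obtain m1 m2 where v': "v = of_int m1 + of_int m2 * \<tau>" using v unfolding lattice_def by blast
    have e: "z + v + y = (z + y) + v" by simp
    show "f (z + v) = f z"
      unfolding f_def e using z v wp_add_lattice wzeta_add_lattice[of z m1 m2] wzeta_add_lattice[of "z + y" m1 m2] v'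
      by simp (simp add: algebra_simps)
  qed
  then show ?thesis by (simp add: f_def algebra_simps)
qed

section \<open>Off-diagonal double sums and the Riccati identity\<close>

lemma sum_offdiag_swap:
  fixes f :: "'k \<Rightarrow> 'k \<Rightarrow> 'b::ab_group_add"
  assumes "finite K"
  shows "(\<Sum>i\<in>K. \<Sum>j\<in>K - {i}. f i j) = (\<Sum>i\<in>K. \<Sum>j\<in>K - {i}. f j i)"
proof -
  have 1: "(\<Sum>i\<in>K. \<Sum>j\<in>K - {i}. f i j) = (\<Sum>i\<in>K. \<Sum>j\<in>K. f i j) - (\<Sum>i\<in>K. f i i)" for f :: "'k \<Rightarrow> 'k \<Rightarrow> 'b"
    using assms by (simp add: sum_diff1 sum_subtractf)
  show ?thesis unfolding 1 by (subst sum.swap) simp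
qed

lemma sum_offdiag_antisym:
  fixes f :: "'k \<Rightarrow> 'k \<Rightarrow> complex"
  assumes "finite K" "\<And>i j. i \<in> K \<Longrightarrow> j \<in> K \<Longrightarrow> i \<noteq> j \<Longrightarrow> f j i = - f i j"
  shows "(\<Sum>i\<in>K. \<Sum>j\<in>K - {i}. f i j) = 0"
proof -
  have "(\<Sum>i\<in>K. \<Sum>j\<in>K - {i}. f i j) = (\<Sum>i\<in>K. \<Sum>j\<in>K - {i}. f j i)"
    by (rule sum_offdiag_swap[OF assms(1)])
  also have "\<dots> = (\<Sum>i\<in>K. \<Sum>j\<in>K - {i}. - f i j)"
    by (intro sum.cong refl assms(2)) auto
  also have "\<dots> = - (\<Sum>i\<in>K. \<Sum>j\<in>K - {i}. f i j)" by (simp add: sum_negf)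
  finally show ?thesis by simp
qed

lemma square_sum_offdiag:
  fixes f :: "'k \<Rightarrow> complex"
  assumes "finite K"
  shows "(\<Sum>i\<in>K. f i)\<^sup>2 = (\<Sum>i\<in>K. (f i)\<^sup>2) + (\<Sum>i\<in>K. \<Sum>j\<in>K - {i}. f i * f j)"
proof -
  have "(\<Sum>i\<in>K. \<Sum>j\<in>K - {i}. f i * f j) = (\<Sum>i\<in>K. \<Sum>j\<in>K. f i * f j) - (\<Sum>i\<in>K. f i * f i)"
    using assms by (simp add: sum_diff1 sum_subtractf)
  then show ?thesis by (simp add: power2_eq_square sum_product)
qed

text \<open>
  The Riccati equation of \<open>w = exp (h z) \<Prod> \<sigma> (z - x i) ^ c i\<close>. Because the weights sum to zero, the
  pairwise three term identities eliminate all products of two zeta functions.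
\<close>

lemma riccati_identity:
  fixes x :: "'k \<Rightarrow> complex" and c :: "'k \<Rightarrow> complex" and h z :: complex
  assumes K: "finite K" and c: "(\<Sum>i\<in>K. c i) = 0"
    and x: "\<And>i j. i \<in> K \<Longrightarrow> j \<in> K \<Longrightarrow> i \<noteq> j \<Longrightarrow> x i - x j \<notin> \<Lambda>"
    and z: "\<And>i. i \<in> K \<Longrightarrow> z - x i \<notin> \<Lambda>"
  shows "(h + (\<Sum>i\<in>K. c i * \<zeta> (z - x i)))\<^sup>2 - (\<Sum>i\<in>K. c i * \<P> (z - x i)) =
     (\<Sum>i\<in>K. c i * (c i - 1) * \<P> (z - x i)) +
     (\<Sum>i\<in>K. 2 * c i * (h + (\<Sum>j\<in>K - {i}. c j * \<zeta> (x i - x j))) * \<zeta> (z - x i)) +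
     (h\<^sup>2 + 1 / 2 * (\<Sum>i\<in>K. \<Sum>j\<in>K - {i}. c i * c j * ((\<zeta> (x i - x j))\<^sup>2 - \<P> (x i - x j))))"
proof -
  define Z where "Z i = \<zeta> (z - x i)" for i
  define W where "W i = \<P> (z - x i)" for i
  define e where "e i j = \<zeta> (x i - x j)" for i j
  define q where "q i j = (e i j)\<^sup>2 - \<P> (x i - x j)" for i j
  have cs: "(\<Sum>j\<in>K - {i}. c j) = - c i" if "i \<in> K" for i
    using sum.remove[OF K that, of c] c by (simp add: add_eq_0_iff2)
  \<comment> \<open>The three term identity at the arguments \<open>z - x i\<close> and
    \<open>x i - x j\<close>, whose sum is \<open>z - x j\<close>, solved for the product of the two
    z-dependent zeta values.\<close>
  have pair: "Z i * Z j = 1/2 * ((Z i)\<^sup>2 - W i) + 1/2 * ((Z j)\<^sup>2 - W j) + (e i j * Z i - e i j * Z j) + 1/2 * q i j"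
    if "i \<in> K" "j \<in> K" "i \<noteq> j" for i j
  proof -
    have "(\<zeta> (z - x i) + \<zeta> (x i - x j) - \<zeta> ((z - x i) + (x i - x j)))\<^sup>2
        = \<P> (z - x i) + \<P> (x i - x j) + \<P> ((z - x i) + (x i - x j))"
      using z x that by (intro three_term_identity) auto
    then have "(Z i + e i j - Z j)\<^sup>2 = W i + \<P> (x i - x j) + W j"
      by (simp add: Z_def W_def e_def)
    then have "2 * (Z i * Z j) = 2 * (1/2 * ((Z i)\<^sup>2 - W i) + 1/2 * ((Z j)\<^sup>2 - W j) +
        (e i j * Z i - e i j * Z j) + 1/2 * ((e i j)\<^sup>2 - \<P> (x i - x j)))"
      by (simp add: power2_eq_square algebra_simps)
    then show ?thesis unfolding q_def by (simp only: mult_cancel_left) simp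
  qed
  define T where "T f = (\<Sum>i\<in>K. \<Sum>j\<in>K - {i}. f i j)" for f :: "'k \<Rightarrow> 'k \<Rightarrow> complex"
  have Tadd: "T (\<lambda>i j. f i j + g i j) = T f + T g" and Tsub: "T (\<lambda>i j. f i j - g i j) = T f - T g" for f g
    unfolding T_def by (simp_all add: sum.distrib sum_subtractf)
  have Tswap: "T f = T (\<lambda>i j. f j i)" for f unfolding T_def by (rule sum_offdiag_swap[OF K])
  define s where "s i = 1/2 * ((Z i)\<^sup>2 - W i)" for i
  have eanti: "e j i = - e i j" for i j unfolding e_def by (rule wzeta_diff_commute)
  have "T (\<lambda>i j. (c i * Z i) * (c j * Z j)) =
     T (\<lambda>i j. c i * c j * s i + c i * c j * s j + (c i * c j * e i j * Z i - c i * c j * e i j * Z j) + 1/2 * (c i * c j * q i j))"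
    unfolding T_def
  proof (intro sum.cong refl)
    fix i j assume ij: "i \<in> K" "j \<in> K - {i}"
    have "(c i * Z i) * (c j * Z j) = c i * c j * (Z i * Z j)" by simp
    also have "Z i * Z j = s i + s j + (e i j * Z i - e i j * Z j) + 1/2 * q i j"
      unfolding s_def using ij by (intro pair) auto
    finally show "(c i * Z i) * (c j * Z j) =
       c i * c j * s i + c i * c j * s j + (c i * c j * e i j * Z i - c i * c j * e i j * Z j) + 1/2 * (c i * c j * q i j)"
      by (simp add: algebra_simps)
  qed
  also have "\<dots> = 2 * T (\<lambda>i j. c i * c j * s i) + 2 * T (\<lambda>i j. c i * c j * e i j * Z i) + 1/2 * T (\<lambda>i j. c i * c j * q i j)"
  proof -
    have "T (\<lambda>i j. c i * c j * s j) = T (\<lambda>i j. c i * c j * s i)"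
      by (subst Tswap) (simp add: mult.commute)
    moreover have "T (\<lambda>i j. c i * c j * e i j * Z j) = - T (\<lambda>i j. c i * c j * e i j * Z i)"
    proof -
      have "c j * c i * e j i * Z i = - (c i * c j * e i j * Z i)" for i j
        unfolding eanti[where i = i and j = j] by simp
      then have "T (\<lambda>i j. c i * c j * e i j * Z j) = T (\<lambda>i j. - (c i * c j * e i j * Z i))"
        by (subst Tswap) simp
      then show ?thesis by (simp add: T_def sum_negf)
    qed
    moreover have "T (\<lambda>i j. 1/2 * (c i * c j * q i j)) = 1/2 * T (\<lambda>i j. c i * c j * q i j)"
      unfolding T_def by (simp only: sum_distrib_left)
    ultimately show ?thesis by (simp add: Tadd Tsub)
  qed
  \<comment> \<open>Here the zero total weight enters: summing over j turns the off-diagonal squares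
    into minus the diagonal ones, so the squares of zeta cancel below.\<close>
  also have "T (\<lambda>i j. c i * c j * s i) = - (\<Sum>i\<in>K. (c i)\<^sup>2 * s i)"
  proof -
    have "T (\<lambda>i j. c i * c j * s i) = (\<Sum>i\<in>K. c i * s i * (\<Sum>j\<in>K - {i}. c j))"
      unfolding T_def sum_distrib_left by (intro sum.cong refl) simp
    also have "\<dots> = (\<Sum>i\<in>K. - ((c i)\<^sup>2 * s i))"
      by (intro sum.cong refl) (simp add: cs power2_eq_square)
    finally show ?thesis by (simp add: sum_negf)
  qed
  finally have off: "T (\<lambda>i j. (c i * Z i) * (c j * Z j)) = - (\<Sum>i\<in>K. (c i)\<^sup>2 * ((Z i)\<^sup>2 - W i))
      + 2 * T (\<lambda>i j. c i * c j * e i j * Z i) + 1/2 * T (\<lambda>i j. c i * c j * q i j)"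
    by (simp add: s_def sum_distrib_left)
  have sq: "(\<Sum>i\<in>K. c i * Z i)\<^sup>2 = (\<Sum>i\<in>K. (c i * Z i)\<^sup>2) + T (\<lambda>i j. (c i * Z i) * (c j * Z j))"
    unfolding T_def by (rule square_sum_offdiag[OF K])
  have lin: "2 * T (\<lambda>i j. c i * c j * e i j * Z i) = (\<Sum>i\<in>K. 2 * c i * (\<Sum>j\<in>K - {i}. c j * e i j) * Z i)"
    unfolding T_def sum_distrib_left sum_distrib_right by (intro sum.cong refl) (simp add: mult_ac)
  have "(h + (\<Sum>i\<in>K. c i * Z i))\<^sup>2 - (\<Sum>i\<in>K. c i * W i) =
     h\<^sup>2 + (\<Sum>i\<in>K. 2 * c i * h * Z i) + (\<Sum>i\<in>K. (c i * Z i)\<^sup>2) - (\<Sum>i\<in>K. (c i)\<^sup>2 * ((Z i)\<^sup>2 - W i))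
      + (\<Sum>i\<in>K. 2 * c i * (\<Sum>j\<in>K - {i}. c j * e i j) * Z i) + 1/2 * T (\<lambda>i j. c i * c j * q i j) - (\<Sum>i\<in>K. c i * W i)"
  proof -
    have "(\<Sum>i\<in>K. 2 * c i * h * Z i) = 2 * h * (\<Sum>i\<in>K. c i * Z i)"
      unfolding sum_distrib_left by (intro sum.cong refl) (simp add: mult_ac)
    then show ?thesis using sq off lin by (simp add: power2_sum)
  qed
  also have "\<dots> = (\<Sum>i\<in>K. c i * (c i - 1) * W i) + (\<Sum>i\<in>K. 2 * c i * (h + (\<Sum>j\<in>K - {i}. c j * e i j)) * Z i)
      + (h\<^sup>2 + 1/2 * T (\<lambda>i j. c i * c j * q i j))"
    by (simp add: algebra_simps power2_eq_square sum.distrib sum_subtractf)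
  finally show ?thesis unfolding T_def Z_def W_def e_def q_def .
qed

end

section \<open>The curve and the Riccati equation\<close>

lemma image_mset_remove_index:
  "finite I \<Longrightarrow> \<mu> \<in> I \<Longrightarrow> image_mset a (mset_set I) = add_mset (a \<mu>) (image_mset a (mset_set (I - {\<mu>})))"
  by (simp add: mset_set.remove)

lemma ex_index_mset:
  fixes M :: "'a multiset"
  assumes "size M = N"
  shows "\<exists>a. M = image_mset a (mset_set {..<N})"
proof -
  obtain xs where xs: "mset xs = M" using ex_mset by blast
  then have l: "length xs = N" using assms by auto
  have "M = mset (map ((!) xs) [0..<length xs])" by (simp add: map_nth xs)
  also have "\<dots> = image_mset ((!) xs) (mset_set {..<N})" by (simp add: l lessThan_atLeast0)
  finally show ?thesis by blast
qed

lemma sum_mset_index: "finite I \<Longrightarrow> (\<Sum>x\<in>#image_mset a (mset_set I). f x) = (\<Sum>\<mu>\<in>I. f (a \<mu>))"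
  by (simp add: multiset.map_comp o_def sum_unfold_sum_mset)

context weierstrass begin

definition eta :: "int \<times> int \<Rightarrow> complex" where "eta m = quasi_period \<tau> (fst m) (snd m)"

lemma eta_add: "eta (m + k) = eta m + eta k"
  by (simp add: eta_def quasi_period_def algebra_simps)

lemma eta_0 [simp]: "eta 0 = 0" and eta_uminus: "eta (- m) = - eta m"
  by (simp_all add: eta_def quasi_period_def algebra_simps)

lemma lat_plus: "lat (m + k) = lat m + lat k"
  by (simp add: lat_def case_prod_unfold algebra_simps)

lemma lat_0 [simp]: "lat 0 = 0" and lat_minus: "lat (- m) = - lat m"
  by (simp_all add: lat_def case_prod_unfold)

lemma lat_in_lattice [simp]: "lat m \<in> \<Lambda>" by (simp add: lattice_eq_range)

lemma wzeta_add_lat: "z \<notin> \<Lambda> \<Longrightarrow> \<zeta> (z + lat m) = \<zeta> z + eta m"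
  using wzeta_add_lattice[of z "fst m" "snd m"] by (simp add: lat_def eta_def case_prod_unfold)

lemma shift_step_iff:
  "shift_step \<tau> x y \<longleftrightarrow> (\<exists>z a h m. x = (add_mset z a, h) \<and> y = (add_mset (z + lat m) a, map_option (\<lambda>h. h + eta m) h))"
  unfolding shift_step.simps lat_def eta_def by auto

text \<open>Indexing the multiset lets a chain of generating steps be recorded by a single family m
  of lattice shifts: each step changes m at one index, and a step by k taken backwards is a forward
  step by -k. The second component moves by the total quasi-period.\<close>

lemma equivclp_shift_step_imp:
  assumes "equivclp (shift_step \<tau>) x y" "x = (image_mset a (mset_set I), H)" "finite I"
  shows "\<exists>m. y = (image_mset (\<lambda>\<mu>. a \<mu> + lat (m \<mu>)) (mset_set I), map_option (\<lambda>h. h + (\<Sum>\<mu>\<in>I. eta (m \<mu>))) H)"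
  using assms(1) unfolding equivclp_def
proof (induction rule: rtranclp_induct)
  case base
  show ?case using assms(2) by (intro exI[of _ "\<lambda>_. 0"]) (simp add: option.map_ident)
next
  case (step y z)
  then obtain m where y: "y = (image_mset (\<lambda>\<mu>. a \<mu> + lat (m \<mu>)) (mset_set I), map_option (\<lambda>h. h + (\<Sum>\<mu>\<in>I. eta (m \<mu>))) H)"
    by blast
  have "\<exists>x0 c h k. y = (add_mset x0 c, h) \<and> z = (add_mset (x0 + lat k) c, map_option (\<lambda>h. h + eta k) h)"
    using step(2)
  proof (cases rule: symclpE)
    case base then show ?thesis by (auto simp: shift_step_iff)
  next
    case sym
    then obtain x0 c h k where zy: "z = (add_mset x0 c, h)" "y = (add_mset (x0 + lat k) c, map_option (\<lambda>h. h + eta k) h)"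
      by (auto simp: shift_step_iff)
    then have "z = (add_mset ((x0 + lat k) + lat (- k)) c, map_option (\<lambda>h. h + eta (- k)) (map_option (\<lambda>h. h + eta k) h))"
      by (simp add: lat_minus eta_uminus option.map_comp o_def option.map_ident)
    then show ?thesis using zy(2) by blast
  qed
  then obtain x0 c h k where k: "y = (add_mset x0 c, h)" "z = (add_mset (x0 + lat k) c, map_option (\<lambda>h. h + eta k) h)"
    by blast
  have e: "image_mset (\<lambda>\<mu>. a \<mu> + lat (m \<mu>)) (mset_set I) = add_mset x0 c" using y k by simp
  then have "x0 \<in># image_mset (\<lambda>\<mu>. a \<mu> + lat (m \<mu>)) (mset_set I)" by simp
  then obtain \<mu> where \<mu>: "\<mu> \<in> I" "x0 = a \<mu> + lat (m \<mu>)" using assms(3) by auto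
  have c: "c = image_mset (\<lambda>\<mu>. a \<mu> + lat (m \<mu>)) (mset_set (I - {\<mu>}))"
    using e image_mset_remove_index[OF assms(3) \<mu>(1), of "\<lambda>\<mu>. a \<mu> + lat (m \<mu>)"] \<mu>(2) by simp
  define m' where "m' = m(\<mu> := m \<mu> + k)"
  have "image_mset (\<lambda>\<mu>. a \<mu> + lat (m' \<mu>)) (mset_set I) = add_mset (x0 + lat k) c"
    unfolding image_mset_remove_index[OF assms(3) \<mu>(1)] c
  proof (rule arg_cong2[where f = add_mset])
    show "a \<mu> + lat (m' \<mu>) = x0 + lat k" using \<mu> by (simp add: m'_def lat_plus)
    show "image_mset (\<lambda>\<mu>. a \<mu> + lat (m' \<mu>)) (mset_set (I - {\<mu>})) = image_mset (\<lambda>\<mu>. a \<mu> + lat (m \<mu>)) (mset_set (I - {\<mu>}))"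
      by (rule image_mset_cong) (use assms(3) in \<open>auto simp: m'_def\<close>)
  qed
  moreover have "(\<Sum>\<mu>\<in>I. eta (m' \<mu>)) = (\<Sum>\<mu>\<in>I. eta (m \<mu>)) + eta k"
  proof -
    have "(\<Sum>\<mu>\<in>I. eta (m' \<mu>)) = eta (m' \<mu>) + (\<Sum>\<mu>\<in>I - {\<mu>}. eta (m' \<mu>))" by (rule sum.remove[OF assms(3) \<mu>(1)])
    also have "(\<Sum>\<mu>\<in>I - {\<mu>}. eta (m' \<mu>)) = (\<Sum>\<mu>\<in>I - {\<mu>}. eta (m \<mu>))" by (rule sum.cong) (auto simp: m'_def)
    finally show ?thesis using sum.remove[OF assms(3) \<mu>(1), of "\<lambda>\<mu>. eta (m \<mu>)"] by (simp add: m'_def eta_add)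
  qed
  ultimately have "z = (image_mset (\<lambda>\<mu>. a \<mu> + lat (m' \<mu>)) (mset_set I), map_option (\<lambda>h. h + (\<Sum>\<mu>\<in>I. eta (m' \<mu>))) H)"
    using k y by (auto simp: option.map_comp o_def add.assoc)
  then show ?case by blast
qed

lemma equivclp_shift_step_shift:
  assumes "finite I"
  shows "equivclp (shift_step \<tau>) (image_mset a (mset_set I) + c, H)
    (image_mset (\<lambda>\<mu>. a \<mu> + lat (m \<mu>)) (mset_set I) + c, map_option (\<lambda>h. h + (\<Sum>\<mu>\<in>I. eta (m \<mu>))) H)"
  using assms
proof (induction I arbitrary: c H rule: finite_induct)
  case empty
  then show ?case by (simp add: option.map_ident)
next
  case (insert \<nu> I)
  let ?H = "map_option (\<lambda>h. h + (\<Sum>\<mu>\<in>I. eta (m \<mu>))) H"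
  have "equivclp (shift_step \<tau>) (image_mset a (mset_set I) + add_mset (a \<nu>) c, H)
    (image_mset (\<lambda>\<mu>. a \<mu> + lat (m \<mu>)) (mset_set I) + add_mset (a \<nu>) c, ?H)"
    by (rule insert.IH)
  moreover have "shift_step \<tau> (add_mset (a \<nu>) (image_mset (\<lambda>\<mu>. a \<mu> + lat (m \<mu>)) (mset_set I) + c), ?H)
      (add_mset (a \<nu> + lat (m \<nu>)) (image_mset (\<lambda>\<mu>. a \<mu> + lat (m \<mu>)) (mset_set I) + c), map_option (\<lambda>h. h + eta (m \<nu>)) ?H)"
    unfolding shift_step_iff by blast
  then have "equivclp (shift_step \<tau>) (add_mset (a \<nu>) (image_mset (\<lambda>\<mu>. a \<mu> + lat (m \<mu>)) (mset_set I) + c), ?H)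
      (add_mset (a \<nu> + lat (m \<nu>)) (image_mset (\<lambda>\<mu>. a \<mu> + lat (m \<mu>)) (mset_set I) + c), map_option (\<lambda>h. h + eta (m \<nu>)) ?H)"
    by (rule r_into_equivclp)
  ultimately show ?case using insert(1,2)
    by (auto simp: option.map_comp o_def ac_simps intro: equivclp_trans)
qed

text \<open>Replaces the generated equivalence by explicit shifts; every later argument about points
  of the quotient goes through this description.\<close>

lemma glc_class_mem_iff:
  assumes "finite I"
  shows "y \<in> glc_class \<tau> (image_mset a (mset_set I), H) \<longleftrightarrow>
    (\<exists>m. y = (image_mset (\<lambda>\<mu>. a \<mu> + lat (m \<mu>)) (mset_set I), map_option (\<lambda>h. h + (\<Sum>\<mu>\<in>I. eta (m \<mu>))) H))"
  unfolding glc_class_def mem_Collect_eq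
  using equivclp_shift_step_imp[OF _ refl assms] equivclp_shift_step_shift[OF assms, where c = "{#}"] by fastforce

lemma glc_class_eq_iff: "glc_class \<tau> x = glc_class \<tau> y \<longleftrightarrow> y \<in> glc_class \<tau> x"
  unfolding glc_class_def
  by (auto intro: equivclp_trans equivclp_sym)

lemma glc_class_self: "x \<in> glc_class \<tau> x" unfolding glc_class_def by simp

end

locale glc = weierstrass \<tau> for \<tau> :: complex +
  fixes n :: "'r::finite \<Rightarrow> real" and p :: "'r \<Rightarrow> complex"
  assumes n_pos: "n i > 0" and n_half: "2 * n i \<in> \<nat>" and n_sum: "(\<Sum>i\<in>UNIV. n i) \<in> \<nat>"
    and p_distinct: "i \<noteq> j \<Longrightarrow> p i - p j \<notin> lattice \<tau>"
begin

abbreviation N :: nat where "N \<equiv> total_weight n"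
abbreviation cn :: "'r \<Rightarrow> complex" where "cn i \<equiv> complex_of_real (n i)"

lemma real_N: "real N = (\<Sum>i\<in>UNIV. n i)"
  using n_sum unfolding total_weight_def by (auto elim!: Nats_cases)

lemma of_nat_N: "of_nat N = (\<Sum>i\<in>UNIV. cn i)"
proof -
  have "of_nat N = complex_of_real (real N)" by simp
  then show ?thesis by (simp add: real_N)
qed

lemma real_ell: "real (ell n i) = 2 * n i"
  using n_half[of i] unfolding ell_def by (auto elim!: Nats_cases)

lemma of_nat_ell: "of_nat (ell n i) = 2 * cn i"
proof -
  have "of_nat (ell n i) = complex_of_real (real (ell n i))" by simp
  then show ?thesis by (simp add: real_ell)
qed

lemma cn_nonzero [simp]: "cn i \<noteq> 0" using n_pos[of i] by simp

lemma N_pos: "N > 0"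
proof -
  have "(\<Sum>i\<in>UNIV. n i) > 0" by (rule sum_pos) (auto simp: n_pos)
  then show ?thesis using real_N by simp
qed

text \<open>The constant term at \<open>a \<mu>\<close> of the function g of the overview. The
  simple pole of g^2 there has coefficient 2 \<open>res\<close>, so it is this number that must
  vanish for g' + g^2 to be regular at the node.\<close>

definition res :: "'k set \<Rightarrow> ('k \<Rightarrow> complex) \<Rightarrow> complex \<Rightarrow> 'k \<Rightarrow> complex" where
  "res I a h \<mu> = (\<Sum>\<nu>\<in>I - {\<mu>}. \<zeta> (a \<mu> - a \<nu>)) - (\<Sum>i\<in>UNIV. cn i * \<zeta> (a \<mu> - p i)) + h"

definition generic :: "'k set \<Rightarrow> ('k \<Rightarrow> complex) \<Rightarrow> bool" where
  "generic I a \<longleftrightarrow> finite I \<and> card I = N \<and> (\<forall>\<mu>\<in>I. \<forall>\<nu>\<in>I. \<mu> \<noteq> \<nu> \<longrightarrow> a \<mu> - a \<nu> \<notin> \<Lambda>) \<and>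
     (\<forall>\<mu>\<in>I. \<forall>i. a \<mu> - p i \<notin> \<Lambda>)"

text \<open>Vanishing of \<open>res\<close> at every node is equivalent to the defining equations of the curve,
  including the formula for \<open>h\<close>, which is the sum of the equations over all nodes.\<close>

definition glc_eqs :: "'k set \<Rightarrow> ('k \<Rightarrow> complex) \<Rightarrow> complex \<Rightarrow> bool" where
  "glc_eqs I a h \<longleftrightarrow> generic I a \<and> (\<forall>\<mu>\<in>I. res I a h \<mu> = 0)"

lemma sum_res:
  assumes "generic I a"
  shows "(\<Sum>\<mu>\<in>I. res I a h \<mu>) = of_nat N * h - (\<Sum>\<mu>\<in>I. \<Sum>i\<in>UNIV. cn i * \<zeta> (a \<mu> - p i))"
proof -
  have "(\<Sum>\<mu>\<in>I. \<Sum>\<nu>\<in>I - {\<mu>}. \<zeta> (a \<mu> - a \<nu>)) = 0"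
    by (rule sum_offdiag_antisym) (use assms in \<open>auto simp: generic_def intro: wzeta_diff_commute\<close>)
  then show ?thesis using assms
    by (simp add: res_def sum.distrib sum_subtractf generic_def)
qed

text \<open>The formula for h expresses the terms in the other nodes as N h minus the term of the
  node itself; the weights then add up to N in front of every remaining term.\<close>

lemma glc_condition_eq:
  assumes g: "generic I a" and h: "of_nat N * h = (\<Sum>\<mu>\<in>I. \<Sum>i\<in>UNIV. cn i * \<zeta> (a \<mu> - p i))" and m: "\<mu> \<in> I"
  shows "(\<Sum>i\<in>UNIV. \<Sum>\<nu>\<in>I - {\<mu>}. cn i * (\<zeta> (a \<mu> - a \<nu>) - \<zeta> (a \<mu> - p i) + \<zeta> (a \<nu> - p i)))
     = of_nat N * res I a h \<mu>"
proof -
  have fin: "finite I" "card I = N" using g by (auto simp: generic_def)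
  define S where "S \<nu> = (\<Sum>i\<in>UNIV. cn i * \<zeta> (a \<nu> - p i))" for \<nu>
  have "(\<Sum>i\<in>UNIV. \<Sum>\<nu>\<in>I - {\<mu>}. cn i * (\<zeta> (a \<mu> - a \<nu>) - \<zeta> (a \<mu> - p i) + \<zeta> (a \<nu> - p i)))
     = (\<Sum>i\<in>UNIV. cn i * (\<Sum>\<nu>\<in>I - {\<mu>}. \<zeta> (a \<mu> - a \<nu>))) - (\<Sum>i\<in>UNIV. of_nat (N - 1) * (cn i * \<zeta> (a \<mu> - p i)))
       + (\<Sum>i\<in>UNIV. \<Sum>\<nu>\<in>I - {\<mu>}. cn i * \<zeta> (a \<nu> - p i))"
    using fin m by (simp add: algebra_simps sum.distrib sum_subtractf sum_distrib_left)
  also have "(\<Sum>i\<in>UNIV. cn i * (\<Sum>\<nu>\<in>I - {\<mu>}. \<zeta> (a \<mu> - a \<nu>))) = of_nat N * (\<Sum>\<nu>\<in>I - {\<mu>}. \<zeta> (a \<mu> - a \<nu>))"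
    by (simp only: of_nat_N sum_distrib_right)
  also have "(\<Sum>i\<in>UNIV. of_nat (N - 1) * (cn i * \<zeta> (a \<mu> - p i))) = of_nat (N - 1) * S \<mu>"
    by (simp only: S_def sum_distrib_left)
  also have "(\<Sum>i\<in>UNIV. \<Sum>\<nu>\<in>I - {\<mu>}. cn i * \<zeta> (a \<nu> - p i)) = (\<Sum>\<nu>\<in>I - {\<mu>}. S \<nu>)"
    unfolding S_def by (rule sum.swap)
  also have "(\<Sum>\<nu>\<in>I - {\<mu>}. S \<nu>) = of_nat N * h - S \<mu>"
    using sum.remove[OF fin(1) m, of S] h by (simp add: S_def algebra_simps)
  finally show ?thesis using N_pos by (simp add: res_def S_def of_nat_diff algebra_simps)
qed

definition pt :: "(nat \<Rightarrow> complex) \<Rightarrow> complex option \<Rightarrow> pre_point set" where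
  "pt a H = glc_class \<tau> (image_mset a (mset_set {..<N}), H)"

lemma GLC_eq: "GLC \<tau> n p = {pt a (Some h) |a h. glc_eqs {..<N} a h}"
proof -
  have key: "(size M = N \<and> (\<forall>x\<in>#M. \<forall>y\<in>#M - {#x#}. x - y \<notin> \<Lambda>) \<and> (\<forall>x\<in>#M. \<forall>i. x - p i \<notin> \<Lambda>) \<and>
     h = 1 / of_nat N * (\<Sum>x\<in>#M. \<Sum>i\<in>UNIV. cn i * \<zeta> (x - p i)) \<and>
     (\<forall>x\<in>#M. (\<Sum>i\<in>UNIV. \<Sum>y\<in>#M - {#x#}. cn i * (\<zeta> (x - y) - \<zeta> (x - p i) + \<zeta> (y - p i))) = 0))
     \<longleftrightarrow> glc_eqs {..<N} a h" if M: "M = image_mset a (mset_set {..<N})" for M a h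
  proof -
    let ?I = "{..<N}"
    have rm: "M - {#a \<mu>#} = image_mset a (mset_set (?I - {\<mu>}))" if "\<mu> \<in> ?I" for \<mu>
      unfolding M using image_mset_remove_index[OF finite_lessThan that, of a] by simp
    have ballM: "(\<forall>x\<in>#M. P x) \<longleftrightarrow> (\<forall>\<mu>\<in>?I. P (a \<mu>))" for P unfolding M by simp
    have 1: "(\<forall>x\<in>#M. \<forall>y\<in>#M - {#x#}. x - y \<notin> \<Lambda>) \<longleftrightarrow> (\<forall>\<mu>\<in>?I. \<forall>\<nu>\<in>?I. \<mu> \<noteq> \<nu> \<longrightarrow> a \<mu> - a \<nu> \<notin> \<Lambda>)"
      unfolding ballM by (intro ball_cong refl, subst rm) auto
    have 2: "(\<forall>x\<in>#M. \<forall>i. x - p i \<notin> \<Lambda>) \<longleftrightarrow> (\<forall>\<mu>\<in>?I. \<forall>i. a \<mu> - p i \<notin> \<Lambda>)"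
      unfolding ballM ..
    have 3: "(\<Sum>x\<in>#M. \<Sum>i\<in>UNIV. cn i * \<zeta> (x - p i)) = (\<Sum>\<mu>\<in>?I. \<Sum>i\<in>UNIV. cn i * \<zeta> (a \<mu> - p i))"
      unfolding M by (rule sum_mset_index) simp
    have 4: "(\<forall>x\<in>#M. (\<Sum>i\<in>UNIV. \<Sum>y\<in>#M - {#x#}. cn i * (\<zeta> (x - y) - \<zeta> (x - p i) + \<zeta> (y - p i))) = 0)
      \<longleftrightarrow> (\<forall>\<mu>\<in>?I. (\<Sum>i\<in>UNIV. \<Sum>\<nu>\<in>?I - {\<mu>}. cn i * (\<zeta> (a \<mu> - a \<nu>) - \<zeta> (a \<mu> - p i) + \<zeta> (a \<nu> - p i))) = 0)"
      unfolding ballM by (intro ball_cong refl) (simp only: rm sum_mset_index finite_Diff finite_lessThan)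
    have 5: "size M = N" unfolding M by simp
    have gen: "generic ?I a \<longleftrightarrow> (\<forall>\<mu>\<in>?I. \<forall>\<nu>\<in>?I. \<mu> \<noteq> \<nu> \<longrightarrow> a \<mu> - a \<nu> \<notin> \<Lambda>) \<and> (\<forall>\<mu>\<in>?I. \<forall>i. a \<mu> - p i \<notin> \<Lambda>)"
      unfolding generic_def by simp
    have hh: "h = 1 / of_nat N * s \<longleftrightarrow> of_nat N * h = s" for s :: complex
      using N_pos by (auto simp: field_simps)
    show ?thesis
    proof (cases "generic ?I a")
      case False then show ?thesis unfolding 1 2 using gen by (auto simp: glc_eqs_def)
    next
      case True
      show ?thesis
      proof (cases "of_nat N * h = (\<Sum>\<mu>\<in>?I. \<Sum>i\<in>UNIV. cn i * \<zeta> (a \<mu> - p i))")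
        case h: True
        have "(\<forall>\<mu>\<in>?I. (\<Sum>i\<in>UNIV. \<Sum>\<nu>\<in>?I - {\<mu>}. cn i * (\<zeta> (a \<mu> - a \<nu>) - \<zeta> (a \<mu> - p i) + \<zeta> (a \<nu> - p i))) = 0)
           \<longleftrightarrow> (\<forall>\<mu>\<in>?I. res ?I a h \<mu> = 0)"
          using N_pos by (intro ball_cong refl, subst glc_condition_eq[OF True h]) auto
        then show ?thesis unfolding 1 2 3 4 hh using True h gen 5 by (auto simp: glc_eqs_def)
      next
        case False
        \<comment> \<open>If h violates its formula, the sum of all node equations is nonzero, so
          they cannot all hold.\<close>
        then have "\<not> (\<forall>\<mu>\<in>?I. res ?I a h \<mu> = 0)" using sum_res[OF True, of h] by (metis (no_types, lifting) eq_iff_diff_eq_0 sum.neutral)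
        then show ?thesis unfolding 3 hh using False by (auto simp: glc_eqs_def)
      qed
    qed
  qed
  show ?thesis
    unfolding GLC_def pt_def
  proof (intro Collect_cong iffI; elim exE conjE)
    fix x M h assume "x = glc_class \<tau> (M, Some h)" and sz: "size M = N"
      and "\<forall>x\<in>#M. \<forall>y\<in>#M - {#x#}. x - y \<notin> \<Lambda>" "\<forall>x\<in>#M. \<forall>i. x - p i \<notin> \<Lambda>"
      "h = 1 / of_nat N * (\<Sum>x\<in>#M. \<Sum>i\<in>UNIV. cn i * \<zeta> (x - p i))"
      "\<forall>x\<in>#M. (\<Sum>i\<in>UNIV. \<Sum>y\<in>#M - {#x#}. cn i * (\<zeta> (x - y) - \<zeta> (x - p i) + \<zeta> (y - p i))) = 0"
    then show "\<exists>a h. x = glc_class \<tau> (image_mset a (mset_set {..<N}), Some h) \<and> glc_eqs {..<N} a h"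
      using ex_index_mset[OF sz] key by blast
  next
    fix x a h assume "x = glc_class \<tau> (image_mset a (mset_set {..<N}), Some h)" "glc_eqs {..<N} a h"
    then show "\<exists>M h. x = glc_class \<tau> (M, Some h) \<and> size M = N \<and> (\<forall>x\<in>#M. \<forall>y\<in>#M - {#x#}. x - y \<notin> \<Lambda>) \<and>
      (\<forall>x\<in>#M. \<forall>i. x - p i \<notin> \<Lambda>) \<and> h = 1 / of_nat N * (\<Sum>x\<in>#M. \<Sum>i\<in>UNIV. cn i * \<zeta> (x - p i)) \<and>
      (\<forall>x\<in>#M. (\<Sum>i\<in>UNIV. \<Sum>y\<in>#M - {#x#}. cn i * (\<zeta> (x - y) - \<zeta> (x - p i) + \<zeta> (y - p i))) = 0)"
      using key[OF refl, of a h] by blast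
  qed
qed

definition Af :: "'k set \<Rightarrow> ('k \<Rightarrow> complex) \<Rightarrow> complex \<Rightarrow> complex ^ 'r" where
  "Af I a h = A_formula \<tau> n p (image_mset a (mset_set I)) h"

text \<open>The constant term of the Riccati identity with weight 1 at each node and -n_i at each
  singular point. Unlike \<open>B_formula\<close> it singles out no index i, so agreement with it
  proves the independence of i.\<close>

definition Bf :: "'k set \<Rightarrow> ('k \<Rightarrow> complex) \<Rightarrow> complex \<Rightarrow> complex" where
  "Bf I a h = (let K = I <+> (UNIV :: 'r set); x = case_sum a p; c = case_sum (\<lambda>_. 1) (\<lambda>i. - cn i) in
     h\<^sup>2 + 1 / 2 * (\<Sum>i\<in>K. \<Sum>j\<in>K - {i}. c i * c j * ((\<zeta> (x i - x j))\<^sup>2 - \<P> (x i - x j))))"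

lemma Af_nth:
  assumes "finite I"
  shows "Af I a h $ i = 2 * cn i * (- (\<Sum>\<mu>\<in>I. \<zeta> (p i - a \<mu>)) + (\<Sum>j\<in>UNIV - {i}. cn j * \<zeta> (p i - p j)) - h)"
  by (simp add: Af_def A_formula_def sum_mset_index[OF assms])

text \<open>The terms in differences of singular points cancel pairwise by oddness; what remains is
  twice the node sum minus N h, zero by the formula for h.\<close>

lemma sum_Af:
  assumes "glc_eqs I a h"
  shows "(\<Sum>i\<in>UNIV. Af I a h $ i) = 0"
proof -
  have g: "generic I a" "finite I" using assms by (auto simp: glc_eqs_def generic_def)
  have h: "of_nat N * h = (\<Sum>\<mu>\<in>I. \<Sum>i\<in>UNIV. cn i * \<zeta> (a \<mu> - p i))"
    using sum_res[OF g(1), of h] assms by (simp add: glc_eqs_def)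
  have "(\<Sum>i\<in>UNIV. \<Sum>j\<in>UNIV - {i}. cn i * cn j * \<zeta> (p i - p j)) = 0"
  proof (rule sum_offdiag_antisym)
    show "cn j * cn i * \<zeta> (p j - p i) = - (cn i * cn j * \<zeta> (p i - p j))" for i j
      by (subst wzeta_diff_commute) simp
  qed simp
  moreover have "(\<Sum>i\<in>UNIV. Af I a h $ i) = 2 * ((\<Sum>i\<in>UNIV. \<Sum>\<mu>\<in>I. cn i * \<zeta> (a \<mu> - p i))
      + (\<Sum>i\<in>UNIV. \<Sum>j\<in>UNIV - {i}. cn i * cn j * \<zeta> (p i - p j)) - (\<Sum>i\<in>UNIV. cn i) * h)"
    unfolding Af_nth[OF g(2)] sum_distrib_left sum_distrib_right sum.distrib[symmetric] sum_subtractf[symmetric]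
  proof (intro sum.cong refl)
    fix i
    have "\<zeta> (p i - a \<mu>) = - \<zeta> (a \<mu> - p i)" for \<mu> by (rule wzeta_diff_commute)
    then show "2 * cn i * (- (\<Sum>\<mu>\<in>I. \<zeta> (p i - a \<mu>)) + (\<Sum>j\<in>UNIV - {i}. cn j * \<zeta> (p i - p j)) - h) =
      2 * ((\<Sum>\<mu>\<in>I. cn i * \<zeta> (a \<mu> - p i)) + (\<Sum>j\<in>UNIV - {i}. cn i * cn j * \<zeta> (p i - p j)) - cn i * h)"
      by (simp add: sum_negf sum_distrib_left algebra_simps)
  qed
  ultimately show ?thesis using h unfolding of_nat_N by (simp add: sum.swap[of _ UNIV I])
qed

definition gfun :: "'k set \<Rightarrow> ('k \<Rightarrow> complex) \<Rightarrow> complex \<Rightarrow> complex \<Rightarrow> complex" where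
  "gfun I a h z = h + (\<Sum>\<mu>\<in>I. \<zeta> (z - a \<mu>)) - (\<Sum>i\<in>UNIV. cn i * \<zeta> (z - p i))"

text \<open>The general identity with weights 1 and -n_i, whose sum is zero because there are N
  nodes. At a node the factor c (c - 1) vanishes and the coefficient of zeta is 2 \<open>res\<close>
  = 0; at p_i the factor is n_i (n_i + 1) and the coefficient is the component of
  \<open>Af\<close>.\<close>

lemma riccati:
  fixes I :: "'k set"
  assumes e: "glc_eqs I a h" and z: "\<And>\<mu>. \<mu> \<in> I \<Longrightarrow> z - a \<mu> \<notin> \<Lambda>" "\<And>i. z - p i \<notin> \<Lambda>"
  shows "(gfun I a h z)\<^sup>2 - (\<Sum>\<mu>\<in>I. \<P> (z - a \<mu>)) + (\<Sum>i\<in>UNIV. cn i * \<P> (z - p i)) = Qpot \<tau> n p (Af I a h) (Bf I a h) z"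
proof -
  have fin: "finite I" and g: "generic I a" using e by (auto simp: glc_eqs_def generic_def)
  define K where "K = I <+> (UNIV :: 'r set)"
  define x where "x = case_sum a p"
  define c :: "'k + 'r \<Rightarrow> complex" where "c = case_sum (\<lambda>_. 1) (\<lambda>i. - cn i)"
  have K: "finite K" using fin by (simp add: K_def)
  have sumK: "(\<Sum>k\<in>K. f k) = (\<Sum>\<mu>\<in>I. f (Inl \<mu>)) + (\<Sum>i\<in>UNIV. f (Inr i))" for f :: "_ \<Rightarrow> complex"
    unfolding K_def using fin by (simp add: sum.Plus)
  have c0: "(\<Sum>k\<in>K. c k) = 0"
    using g by (simp add: sumK c_def sum_negf generic_def of_nat_N[symmetric])
  have xd: "x i - x j \<notin> \<Lambda>" if "i \<in> K" "j \<in> K" "i \<noteq> j" for i j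
  proof -
    have ap: "a \<mu> - p l \<notin> \<Lambda>" "p l - a \<mu> \<notin> \<Lambda>" if "\<mu> \<in> I" for \<mu> l
      using g that lattice_diff_commute[of "p l" "a \<mu>"] by (auto simp: generic_def)
    show ?thesis using that g ap p_distinct unfolding K_def x_def generic_def by (cases i; cases j) auto
  qed
  have xz: "z - x k \<notin> \<Lambda>" if "k \<in> K" for k using that z unfolding K_def x_def by auto
  have KI: "K - {Inl \<mu>} = (I - {\<mu>}) <+> UNIV" and KP: "K - {Inr i} = I <+> (UNIV - {i})" for \<mu> i
    unfolding K_def by auto
  have rI: "h + (\<Sum>j\<in>K - {Inl \<mu>}. c j * \<zeta> (x (Inl \<mu>) - x j)) = 0" if "\<mu> \<in> I" for \<mu>
  proof -
    have "h + (\<Sum>j\<in>K - {Inl \<mu>}. c j * \<zeta> (x (Inl \<mu>) - x j)) = res I a h \<mu>"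
      unfolding KI res_def using fin by (simp add: sum.Plus c_def x_def sum_negf)
    then show ?thesis using e that by (simp add: glc_eqs_def)
  qed
  have rP: "2 * c (Inr i) * (h + (\<Sum>j\<in>K - {Inr i}. c j * \<zeta> (x (Inr i) - x j))) = Af I a h $ i" for i
    unfolding KP using fin by (simp add: sum.Plus c_def x_def sum_negf Af_nth algebra_simps)
  have "(h + (\<Sum>i\<in>K. c i * \<zeta> (z - x i)))\<^sup>2 - (\<Sum>i\<in>K. c i * \<P> (z - x i)) =
     (\<Sum>i\<in>K. c i * (c i - 1) * \<P> (z - x i)) +
     (\<Sum>i\<in>K. 2 * c i * (h + (\<Sum>j\<in>K - {i}. c j * \<zeta> (x i - x j))) * \<zeta> (z - x i)) +
     (h\<^sup>2 + 1 / 2 * (\<Sum>i\<in>K. \<Sum>j\<in>K - {i}. c i * c j * ((\<zeta> (x i - x j))\<^sup>2 - \<P> (x i - x j))))"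
    by (rule riccati_identity[OF K c0 xd xz])
  also have "h\<^sup>2 + 1 / 2 * (\<Sum>i\<in>K. \<Sum>j\<in>K - {i}. c i * c j * ((\<zeta> (x i - x j))\<^sup>2 - \<P> (x i - x j))) = Bf I a h"
    unfolding Bf_def Let_def K_def x_def c_def by simp
  also have "(\<Sum>i\<in>K. c i * (c i - 1) * \<P> (z - x i)) = (\<Sum>i\<in>UNIV. of_real (n i * (n i + 1)) * \<P> (z - p i))"
    unfolding sumK by (simp add: c_def x_def algebra_simps)
  also have "(\<Sum>i\<in>K. 2 * c i * (h + (\<Sum>j\<in>K - {i}. c j * \<zeta> (x i - x j))) * \<zeta> (z - x i)) = (\<Sum>i\<in>UNIV. Af I a h $ i * \<zeta> (z - p i))"
    unfolding sumK using rI rP by (simp add: x_def)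
  also have "(\<Sum>i\<in>K. c i * \<P> (z - x i)) = (\<Sum>\<mu>\<in>I. \<P> (z - a \<mu>)) - (\<Sum>i\<in>UNIV. cn i * \<P> (z - p i))"
    unfolding sumK by (simp add: c_def x_def sum_negf)
  also have "h + (\<Sum>i\<in>K. c i * \<zeta> (z - x i)) = gfun I a h z"
    unfolding sumK gfun_def by (simp add: c_def x_def sum_negf)
  finally show ?thesis unfolding Qpot_def by (simp add: algebra_simps)
qed

lemma eventually_notin_lattice:
  assumes "a \<notin> \<Lambda>"
  shows "\<forall>\<^sub>F y in at 0. a + y \<notin> \<Lambda>"
proof -
  have "((\<lambda>y. a + y) \<longlongrightarrow> a + 0) (at 0)" by (intro tendsto_intros)
  then have "\<forall>\<^sub>F y in at 0. a + y \<in> - \<Lambda>"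
    by (rule topological_tendstoD) (use assms open_compl_lattice in auto)
  then show ?thesis by simp
qed

lemma eventually_notin_lattice_0: "\<forall>\<^sub>F y in at 0. y \<notin> \<Lambda>"
proof -
  have "open (- (\<Lambda> - {0}))" by (rule open_Compl, rule closed_lattice_subset) auto
  then have "\<forall>\<^sub>F y in at 0. y \<in> - (\<Lambda> - {0})" using eventually_at_in_open'[of "- (\<Lambda> - {0})" 0] by auto
  then show ?thesis using eventually_nonzero_at_0 by eventually_elim auto
qed

lemma wzeta_deriv_shift: "a + y \<notin> \<Lambda> \<Longrightarrow> ((\<lambda>y. \<zeta> (a + y)) has_field_derivative - \<P> (a + y)) (at y)"
  using DERIV_shift[of \<zeta> "- \<P> (a + y)" y a] wzeta_deriv[of "a + y"] by (simp add: add.commute)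

lemma wp_deriv_shift: "a + y \<notin> \<Lambda> \<Longrightarrow> ((\<lambda>y. \<P> (a + y)) has_field_derivative wp' (a + y)) (at y)"
  using DERIV_shift[of \<P> "wp' (a + y)" y a] wp_deriv[of "a + y"] by (simp add: add.commute)

text \<open>Constant terms at p_i of the Riccati equation are compared. The Laurent expansion is
  replaced by a limit: with the poles cancelled by hand, the equation exhibits the constant
  \<open>Bf\<close> as an expression continuous at the singular point.\<close>

lemma B_formula_eq:
  assumes e: "glc_eqs I a h"
  shows "B_formula \<tau> n p (image_mset a (mset_set I)) h i = Bf I a h"
proof -
  have fin: "finite I" and g: "generic I a" using e by (auto simp: glc_eqs_def generic_def)
  have pa: "p i - a \<mu> \<notin> \<Lambda>" if "\<mu> \<in> I" for \<mu>
    using g that lattice_diff_commute unfolding generic_def by blast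
  define A where "A = Af I a h"
  define J where "J = UNIV - {i}"
  have pJ: "p i - p j \<notin> \<Lambda>" if "j \<in> J" for j using p_distinct that by (auto simp: J_def)
  have UJ: "(\<Sum>j\<in>UNIV. f j) = f i + (\<Sum>j\<in>J. f j)" for f :: "'r \<Rightarrow> complex"
    unfolding J_def by (rule sum.remove) auto
  define s where "s y = h + (\<Sum>\<mu>\<in>I. \<zeta> (p i - a \<mu> + y)) - (\<Sum>j\<in>J. cn j * \<zeta> (p i - p j + y))" for y
  define s' where "s' y = - (\<Sum>\<mu>\<in>I. \<P> (p i - a \<mu> + y)) + (\<Sum>j\<in>J. cn j * \<P> (p i - p j + y))" for y
  have A_i: "A $ i = - 2 * cn i * s 0"
    unfolding A_def Af_nth[OF fin] s_def J_def by (simp add: algebra_simps)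
  have ds: "(s has_field_derivative s' 0) (at 0)"
  proof -
    have "(s has_field_derivative 0 + (\<Sum>\<mu>\<in>I. - \<P> (p i - a \<mu> + 0)) - (\<Sum>j\<in>J. cn j * (- \<P> (p i - p j + 0)))) (at 0)"
      unfolding s_def using pa pJ
      by (intro DERIV_add DERIV_diff DERIV_sum DERIV_cmult wzeta_deriv_shift DERIV_const) auto
    then show ?thesis by (simp add: s'_def sum_negf)
  qed
  have slim: "(s \<longlongrightarrow> s 0) (at 0)" using DERIV_isCont[OF ds] by (simp add: isCont_def)
  have dlim: "((\<lambda>y. (s y - s 0) / y) \<longlongrightarrow> s' 0) (at 0)" using ds by (simp add: DERIV_def)
  have zlim: "((\<lambda>y. \<zeta> (b + y)) \<longlongrightarrow> \<zeta> b) (at 0)" "((\<lambda>y. \<P> (b + y)) \<longlongrightarrow> \<P> b) (at 0)" if "b \<notin> \<Lambda>" for b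
    using DERIV_isCont[OF wzeta_deriv_shift[of b 0]] DERIV_isCont[OF wp_deriv_shift[of b 0]] that
    by (auto simp: isCont_def)
  have s'lim: "(s' \<longlongrightarrow> s' 0) (at 0)"
    unfolding s'_def using pa pJ zlim by (auto intro!: tendsto_intros)
  \<comment> \<open>The Riccati equation at p_i + y solved for B. The double poles cancel since
    n_i^2 + n_i = n_i (n_i + 1), the simple ones since A_i = -2 n_i s(0); the latter leaves the
    difference quotient of s.\<close>
  define E where "E y = s' y + (s y)\<^sup>2 - 2 * cn i * ((1 + y * zeta0 y) * ((s y - s 0) / y))
     + (cn i)\<^sup>2 * (2 * (zeta0 y / y) + (zeta0 y)\<^sup>2 - wp0 y)
     - (\<Sum>j\<in>J. cn j * (cn j + 1) * \<P> (p i - p j + y)) - (\<Sum>j\<in>J. A $ j * \<zeta> (p i - p j + y))" for y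
  define L where "L = s' 0 + (s 0)\<^sup>2 - 2 * cn i * ((1 + 0 * 0) * s' 0) + (cn i)\<^sup>2 * (2 * 0 + 0\<^sup>2 - 0)
     - (\<Sum>j\<in>J. cn j * (cn j + 1) * \<P> (p i - p j)) - (\<Sum>j\<in>J. A $ j * \<zeta> (p i - p j))"
  have "(E \<longlongrightarrow> L) (at 0)"
    unfolding E_def L_def using pJ
    by (intro tendsto_intros slim dlim s'lim tendsto_zeta0 tendsto_wp0 zlim) auto
  moreover have "\<forall>\<^sub>F y in at 0. E y = Bf I a h"
  proof -
    have "\<forall>\<^sub>F y in at 0. \<forall>\<mu>\<in>I. p i - a \<mu> + y \<notin> \<Lambda>"
      using fin pa eventually_notin_lattice by (auto intro!: eventually_ball_finite)
    moreover have "\<forall>\<^sub>F y in at 0. \<forall>j\<in>J. p i - p j + y \<notin> \<Lambda>"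
      using pJ eventually_notin_lattice by (auto intro!: eventually_ball_finite)
    ultimately show ?thesis using eventually_notin_lattice_0 eventually_nonzero_at_0
    proof eventually_elim
      case (elim y)
      let ?z = "p i + y"
      have zz: "?z - a \<mu> = p i - a \<mu> + y" "?z - p j = p i - p j + y" for \<mu> j by simp_all
      have pz: "?z - p j \<notin> \<Lambda>" for j using elim by (cases "j = i") (auto simp: J_def algebra_simps)
      have R: "(gfun I a h ?z)\<^sup>2 - (\<Sum>\<mu>\<in>I. \<P> (?z - a \<mu>)) + (\<Sum>i\<in>UNIV. cn i * \<P> (?z - p i)) = Qpot \<tau> n p A (Bf I a h) ?z"
        unfolding A_def by (rule riccati[OF e _ pz]) (use elim in \<open>simp add: algebra_simps\<close>)
      have gz: "gfun I a h ?z = s y - cn i * (1 / y + zeta0 y)"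
        unfolding gfun_def UJ s_def zz by (simp add: wzeta_eq)
      have Qz: "Qpot \<tau> n p A (Bf I a h) ?z = cn i * (cn i + 1) * (1 / y\<^sup>2 + wp0 y) + (\<Sum>j\<in>J. cn j * (cn j + 1) * \<P> (p i - p j + y))
          + A $ i * (1 / y + zeta0 y) + (\<Sum>j\<in>J. A $ j * \<zeta> (p i - p j + y)) + Bf I a h"
        unfolding Qpot_def UJ zz by (simp add: wzeta_eq wp_eq)
      have R': "(s y - cn i * (1 / y + zeta0 y))\<^sup>2 + s' y + cn i * (1 / y\<^sup>2 + wp0 y) = cn i * (cn i + 1) * (1 / y\<^sup>2 + wp0 y) + (\<Sum>j\<in>J. cn j * (cn j + 1) * \<P> (p i - p j + y))
          + A $ i * (1 / y + zeta0 y) + (\<Sum>j\<in>J. A $ j * \<zeta> (p i - p j + y)) + Bf I a h"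
        using R unfolding gz Qz UJ zz s'_def by (simp add: wp_eq algebra_simps)
      have alg: "X + (s y)\<^sup>2 - 2 * c * ((1 + y * \<zeta>') * ((s y - s0) / y)) + c\<^sup>2 * (2 * (\<zeta>' / y) + \<zeta>'\<^sup>2 - w) - P - Q = B"
        if "(s y - c * (1 / y + \<zeta>'))\<^sup>2 + X + c * (1 / y\<^sup>2 + w) = c * (c + 1) * (1 / y\<^sup>2 + w) + P + (- 2 * c * s0) * (1 / y + \<zeta>') + Q + B"
        for X c \<zeta>' s0 w P Q B
      proof -
        define Y where "Y = 1 / y"
        have e1: "(1 + y * \<zeta>') * ((s y - s0) / y) = (s y - s0) * Y + \<zeta>' * (s y - s0)"
          using elim(4) by (simp add: Y_def field_simps)
        have e2: "\<zeta>' / y = \<zeta>' * Y" by (simp add: Y_def)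
        have "1 / y\<^sup>2 = Y\<^sup>2" by (simp add: Y_def power_one_over)
        then have e3: "B = (s y - c * (Y + \<zeta>'))\<^sup>2 + X + c * (Y\<^sup>2 + w) -
            (c * (c + 1) * (Y\<^sup>2 + w) + P + (- 2 * c * s0) * (Y + \<zeta>') + Q)"
          using that unfolding Y_def[symmetric] by simp
        show ?thesis unfolding e1 e2 e3 by (simp add: algebra_simps power2_eq_square)
      qed
      show "E y = Bf I a h" unfolding E_def by (rule alg[OF R'[unfolded A_i]])
    qed
  qed
  then have "(E \<longlongrightarrow> Bf I a h) (at 0)" by (rule tendsto_eventually)
  ultimately have L: "Bf I a h = L" by (metis LIM_unique)
  have Aeq: "A_formula \<tau> n p (image_mset a (mset_set I)) h = A" by (simp add: A_def Af_def)
  have "(A $ i)\<^sup>2 / (4 * (cn i)\<^sup>2) = (s 0)\<^sup>2" unfolding A_i using n_pos[of i] by (simp add: power2_eq_square)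
  then have "B_formula \<tau> n p (image_mset a (mset_set I)) h i = (s 0)\<^sup>2 - (\<Sum>j\<in>J. cn j * (cn j + 2 * cn i) * \<P> (p i - p j))
     - (\<Sum>j\<in>J. A $ j * \<zeta> (p i - p j)) + (2 * cn i - 1) * (\<Sum>\<mu>\<in>I. \<P> (p i - a \<mu>))"
    unfolding B_formula_def Let_def Aeq J_def by (simp add: sum_mset_index[OF fin])
  also have "\<dots> = L" unfolding L_def s'_def
    by (simp add: algebra_simps sum.distrib sum_distrib_left sum_subtractf)
  finally show ?thesis using L by simp
qed

text \<open>Quasi-periods in the equation of node mu: N - 1 copies of its own from the other nodes,
  minus the quasi-periods of those nodes, minus N copies from the weights, plus the total added to
  h. They cancel.\<close>

lemma res_shift:
  assumes "generic I a" "\<mu> \<in> I"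
  shows "res I (\<lambda>\<mu>. a \<mu> + lat (m \<mu>)) (h + (\<Sum>\<mu>\<in>I. eta (m \<mu>))) \<mu> = res I a h \<mu>"
proof -
  have fin: "finite I" "card I = N" using assms(1) by (auto simp: generic_def)
  have 1: "\<zeta> (a \<mu> + lat (m \<mu>) - (a \<nu> + lat (m \<nu>))) = \<zeta> (a \<mu> - a \<nu>) + (eta (m \<mu>) - eta (m \<nu>))" if "\<nu> \<in> I - {\<mu>}" for \<nu>
  proof -
    have "\<zeta> ((a \<mu> - a \<nu>) + lat (m \<mu> + - m \<nu>)) = \<zeta> (a \<mu> - a \<nu>) + eta (m \<mu> + - m \<nu>)"
      using assms that by (intro wzeta_add_lat) (auto simp: generic_def)
    then show ?thesis by (simp only: lat_plus lat_minus eta_add eta_uminus) (simp add: algebra_simps)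
  qed
  have 2: "\<zeta> (a \<mu> + lat (m \<mu>) - p i) = \<zeta> (a \<mu> - p i) + eta (m \<mu>)" for i
  proof -
    have "\<zeta> ((a \<mu> - p i) + lat (m \<mu>)) = \<zeta> (a \<mu> - p i) + eta (m \<mu>)"
      using assms by (intro wzeta_add_lat) (auto simp: generic_def)
    then show ?thesis by (simp add: algebra_simps)
  qed
  have 3: "(\<Sum>\<nu>\<in>I - {\<mu>}. \<zeta> (a \<mu> + lat (m \<mu>) - (a \<nu> + lat (m \<nu>)))) = (\<Sum>\<nu>\<in>I - {\<mu>}. \<zeta> (a \<mu> - a \<nu>)) + (of_nat N - 1) * eta (m \<mu>) - (\<Sum>\<nu>\<in>I - {\<mu>}. eta (m \<nu>))"
    using fin assms(2) N_pos by (simp add: 1 sum.distrib sum_subtractf of_nat_diff)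
  have 4: "(\<Sum>i\<in>UNIV. cn i * \<zeta> (a \<mu> + lat (m \<mu>) - p i)) = (\<Sum>i\<in>UNIV. cn i * \<zeta> (a \<mu> - p i)) + of_nat N * eta (m \<mu>)"
    unfolding 2 of_nat_N by (simp add: distrib_left sum.distrib sum_distrib_right)
  show ?thesis unfolding res_def 3 4 using sum.remove[OF fin(1) assms(2), of "\<lambda>\<mu>. eta (m \<mu>)"]
    by (simp add: algebra_simps)
qed

lemma generic_shift: "generic I a \<Longrightarrow> generic I (\<lambda>\<mu>. a \<mu> + lat (m \<mu>))"
  unfolding generic_def
proof (elim conjE, intro conjI ballI allI impI)
  fix \<mu> \<nu> assume h: "\<forall>\<mu>\<in>I. \<forall>\<nu>\<in>I. \<mu> \<noteq> \<nu> \<longrightarrow> a \<mu> - a \<nu> \<notin> \<Lambda>" "\<mu> \<in> I" "\<nu> \<in> I" "\<mu> \<noteq> \<nu>"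
  have "(a \<mu> - a \<nu>) + (lat (m \<mu>) - lat (m \<nu>)) \<notin> \<Lambda>" using h by (simp add: lattice_diff)
  then show "a \<mu> + lat (m \<mu>) - (a \<nu> + lat (m \<nu>)) \<notin> \<Lambda>" by (simp add: algebra_simps)
next
  fix \<mu> i assume h: "\<forall>\<mu>\<in>I. \<forall>i. a \<mu> - p i \<notin> \<Lambda>" "\<mu> \<in> I"
  have "(a \<mu> - p i) + lat (m \<mu>) \<notin> \<Lambda>" using h by simp
  then show "a \<mu> + lat (m \<mu>) - p i \<notin> \<Lambda>" by (simp add: algebra_simps)
qed auto

lemma glc_eqs_shift:
  "glc_eqs I a h \<Longrightarrow> glc_eqs I (\<lambda>\<mu>. a \<mu> + lat (m \<mu>)) (h + (\<Sum>\<mu>\<in>I. eta (m \<mu>)))"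
  by (simp add: glc_eqs_def generic_shift res_shift)

lemma formulas_shift:
  assumes "generic I a"
  shows "Af I (\<lambda>\<mu>. a \<mu> + lat (m \<mu>)) (h + (\<Sum>\<mu>\<in>I. eta (m \<mu>))) = Af I a h"
    "B_formula \<tau> n p (image_mset (\<lambda>\<mu>. a \<mu> + lat (m \<mu>)) (mset_set I)) (h + (\<Sum>\<mu>\<in>I. eta (m \<mu>))) i
      = B_formula \<tau> n p (image_mset a (mset_set I)) h i"
proof -
  have fin: "finite I" using assms by (simp add: generic_def)
  have pa: "p i - a \<mu> \<notin> \<Lambda>" if "\<mu> \<in> I" for \<mu> i
    using assms that lattice_diff_commute unfolding generic_def by blast
  have z: "\<zeta> (p i - (a \<mu> + lat (m \<mu>))) = \<zeta> (p i - a \<mu>) - eta (m \<mu>)" if "\<mu> \<in> I" for \<mu> i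
    using wzeta_add_lat[OF pa[OF that, of i], of "- m \<mu>"] by (simp add: lat_minus eta_uminus diff_diff_eq)
  have w: "\<P> (p i - (a \<mu> + lat (m \<mu>))) = \<P> (p i - a \<mu>)" if "\<mu> \<in> I" for \<mu> i
    using wp_add_lattice[OF pa[OF that, of i], of "- lat (m \<mu>)"] by (simp add: diff_diff_eq)
  have zs: "(\<Sum>\<mu>\<in>I. \<zeta> (p i - (a \<mu> + lat (m \<mu>)))) = (\<Sum>\<mu>\<in>I. \<zeta> (p i - a \<mu>)) - (\<Sum>\<mu>\<in>I. eta (m \<mu>))" for i
    by (simp add: z sum_subtractf)
  have ws: "(\<Sum>\<mu>\<in>I. \<P> (p i - (a \<mu> + lat (m \<mu>)))) = (\<Sum>\<mu>\<in>I. \<P> (p i - a \<mu>))" for i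
    by (simp add: w)
  show A: "Af I (\<lambda>\<mu>. a \<mu> + lat (m \<mu>)) (h + (\<Sum>\<mu>\<in>I. eta (m \<mu>))) = Af I a h"
    by (simp add: vec_eq_iff Af_nth[OF fin] zs)
  then show "B_formula \<tau> n p (image_mset (\<lambda>\<mu>. a \<mu> + lat (m \<mu>)) (mset_set I)) (h + (\<Sum>\<mu>\<in>I. eta (m \<mu>))) i
      = B_formula \<tau> n p (image_mset a (mset_set I)) h i"
    unfolding B_formula_def Let_def Af_def by (simp add: sum_mset_index[OF fin] ws)
qed

text \<open>The definite description is legitimate: representatives differ by lattice shifts, under
  which both formulas are invariant, and \<open>B_formula\<close> has the same value for all
  i.\<close>

lemma glc_map_pt:
  assumes "glc_eqs {..<N} a h"
  shows "glc_map \<tau> n p (pt a (Some h)) = (Af {..<N} a h, Bf {..<N} a h)"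
  unfolding glc_map_def
proof (rule the_equality)
  show "case (Af {..<N} a h, Bf {..<N} a h) of (A, B) \<Rightarrow> \<exists>b k. (b, Some k) \<in> pt a (Some h) \<and> A = A_formula \<tau> n p b k \<and> (\<forall>i. B = B_formula \<tau> n p b k i)"
    unfolding pt_def using B_formula_eq[OF assms] glc_class_self by (force simp: Af_def)
next
  fix AB assume "case AB of (A, B) \<Rightarrow> \<exists>b k. (b, Some k) \<in> pt a (Some h) \<and> A = A_formula \<tau> n p b k \<and> (\<forall>i. B = B_formula \<tau> n p b k i)"
  then obtain A B b k where AB: "AB = (A, B)" "(b, Some k) \<in> pt a (Some h)" "A = A_formula \<tau> n p b k" "\<forall>i. B = B_formula \<tau> n p b k i"
    by auto
  obtain m where m: "b = image_mset (\<lambda>\<mu>. a \<mu> + lat (m \<mu>)) (mset_set {..<N})" "k = h + (\<Sum>\<mu>\<in>{..<N}. eta (m \<mu>))"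
    using AB(2) unfolding pt_def by (subst (asm) glc_class_mem_iff) auto
  have g: "generic {..<N} a" using assms by (simp add: glc_eqs_def)
  show "AB = (Af {..<N} a h, Bf {..<N} a h)"
    using AB formulas_shift[OF g, of m h] B_formula_eq[OF assms] unfolding m by (auto simp: Af_def)
qed

end

section \<open>Log-freeness\<close>

lemma frob_0: "frob l q 0 = 1" by (simp add: frob.simps)

lemma frob_rec: "k > 0 \<Longrightarrow> frob l q k = 1 / (of_nat k * (of_nat k - 1 - of_nat l)) * (\<Sum>j<k. q (int k - 2 - int j) * frob l q j)"
  by (simp add: frob.simps[of l q k])

lemma frob_cong:
  assumes "\<And>m. m \<ge> -1 \<Longrightarrow> q m = q' m"
  shows "frob l q k = frob l q' k"
proof (induction k rule: less_induct)
  case (less k)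
  show ?case
  proof (cases "k = 0")
    case False
    then show ?thesis using less by (simp add: frob_rec assms)
  qed (simp add: frob_0)
qed

definition frob_obstruction :: "nat \<Rightarrow> (int \<Rightarrow> complex) \<Rightarrow> complex" where
  "frob_obstruction l q = (\<Sum>j\<le>l. q (int l - 1 - int j) * frob l q j)"

lemma frob_denom_nonzero:
  assumes "0 < k" "k \<le> l"
  shows "of_nat k * (of_nat k - 1 - of_nat l) \<noteq> (0::complex)"
proof -
  have "(of_nat k :: complex) \<noteq> of_nat (Suc l)" using assms by (simp only: of_nat_eq_iff)
  then have "of_nat k - 1 - of_nat l \<noteq> (0::complex)" by (auto simp: algebra_simps)
  then show ?thesis using assms by simp
qed

text \<open>At k = l + 1 the factor in front of \<open>d k\<close> is zero, so the recursion at that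
  index says precisely that the obstruction vanishes. Below it the factors are nonzero and the
  recursion determines the sequence.\<close>

lemma frob_eqI:
  assumes d0: "d 0 = 1"
    and rec: "\<And>k. 0 < k \<Longrightarrow> k \<le> Suc l \<Longrightarrow> of_nat k * (of_nat k - 1 - of_nat l) * d k = (\<Sum>j<k. q (int k - 2 - int j) * d j)"
  shows "k \<le> l \<Longrightarrow> frob l q k = d k" and "frob_obstruction l q = 0"
proof -
  show *: "frob l q k = d k" if "k \<le> l" for k
    using that
  proof (induction k rule: less_induct)
    case (less k)
    show ?case
    proof (cases "k = 0")
      case False
      then have "frob l q k = 1 / (of_nat k * (of_nat k - 1 - of_nat l)) * (\<Sum>j<k. q (int k - 2 - int j) * d j)"
        using less by (simp add: frob_rec)
      also have "\<dots> = d k"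
        using rec[of k] frob_denom_nonzero[of k l] False less.prems by (simp add: field_simps)
      finally show ?thesis .
    qed (simp add: frob_0 d0)
  qed
  have "frob_obstruction l q = (\<Sum>j<Suc l. q (int (Suc l) - 2 - int j) * d j)"
    unfolding frob_obstruction_def lessThan_Suc_atMost by (intro sum.cong) (auto simp: *)
  also have "\<dots> = of_nat (Suc l) * (of_nat (Suc l) - 1 - of_nat l) * d (Suc l)"
    using rec[of "Suc l"] by simp
  finally show "frob_obstruction l q = 0" by simp
qed

context glc begin

text \<open>Multiplication by y, respectively y^2, clears the pole at p_i for j = i; the removable
  value at 0 is filled in explicitly. Taylor coefficients of these functions are Laurent
  coefficients shifted by 1 and 2.\<close>

definition regZ :: "'r \<Rightarrow> 'r \<Rightarrow> complex \<Rightarrow> complex" where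
  "regZ i j y = (if j = i then 1 + y * zeta0 y else y * \<zeta> (p i - p j + y))"
definition regW :: "'r \<Rightarrow> 'r \<Rightarrow> complex \<Rightarrow> complex" where
  "regW i j y = (if j = i then 1 + y\<^sup>2 * wp0 y else y\<^sup>2 * \<P> (p i - p j + y))"
definition Zc :: "'r \<Rightarrow> 'r \<Rightarrow> complex fps" where "Zc i j = fps_expansion (regZ i j) 0"
definition Wc :: "'r \<Rightarrow> 'r \<Rightarrow> complex fps" where "Wc i j = fps_expansion (regW i j) 0"

lemma open_shift_lattice: "open {y. b + y \<in> - \<Lambda>}"
proof -
  have "open ((\<lambda>y. b + y) -` (- \<Lambda>))" by (intro open_vimage open_compl_lattice continuous_intros)
  then show ?thesis by (simp add: vimage_def)
qed

lemma holomorphic_near_0: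
  "\<exists>r>0. (\<forall>y\<in>ball 0 r. y \<notin> \<Lambda> - {0}) \<and> (\<forall>y\<in>ball 0 r. \<forall>j. j \<noteq> i \<longrightarrow> p i - p j + y \<notin> \<Lambda>)"
proof -
  have o1: "open (- (\<Lambda> - {0}))" by (rule open_Compl, rule closed_lattice_subset) auto
  have o2: "open (\<Inter>j\<in>UNIV - {i}. {y. p i - p j + y \<in> - \<Lambda>})" by (intro open_INT ballI open_shift_lattice) auto
  have "0 \<in> - (\<Lambda> - {0}) \<inter> (\<Inter>j\<in>UNIV - {i}. {y. p i - p j + y \<in> - \<Lambda>})" using p_distinct by auto
  then obtain r where "r > 0" "ball 0 r \<subseteq> - (\<Lambda> - {0}) \<inter> (\<Inter>j\<in>UNIV - {i}. {y. p i - p j + y \<in> - \<Lambda>})"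
    using open_contains_ball[of "- (\<Lambda> - {0}) \<inter> (\<Inter>j\<in>UNIV - {i}. {y. p i - p j + y \<in> - \<Lambda>})"] o1 o2 by blast
  then show ?thesis by (intro exI[of _ r]) auto
qed

lemma reg_expansion: "regZ i j has_fps_expansion Zc i j" "regW i j has_fps_expansion Wc i j"
proof -
  obtain r where r: "r > 0" "\<And>y. y \<in> ball 0 r \<Longrightarrow> y \<notin> \<Lambda> - {0}" "\<And>y j. y \<in> ball 0 r \<Longrightarrow> j \<noteq> i \<Longrightarrow> p i - p j + y \<notin> \<Lambda>"
    using holomorphic_near_0[of i] by blast
  have z: "regZ i j field_differentiable at y" if "y \<in> ball 0 r" for y
    unfolding regZ_def using zeta0_deriv[OF r(2)[OF that]] wzeta_deriv_shift[OF r(3)[OF that, of j]]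
    by (cases "j = i") (auto intro!: field_differentiable_add field_differentiable_mult field_differentiable_ident field_differentiable_const simp: field_differentiable_def[of zeta0] field_differentiable_def[of "\<lambda>y. \<zeta> (p i - p j + y)"])
  have w: "regW i j field_differentiable at y" if "y \<in> ball 0 r" for y
    unfolding regW_def using wp0_deriv[OF r(2)[OF that]] wp_deriv_shift[OF r(3)[OF that, of j]]
    by (cases "j = i") (auto intro!: field_differentiable_add field_differentiable_mult field_differentiable_ident field_differentiable_const field_differentiable_power simp: field_differentiable_def[of wp0] field_differentiable_def[of "\<lambda>y. \<P> (p i - p j + y)"])
  have "regZ i j analytic_on {0}" "regW i j analytic_on {0}"
    unfolding analytic_on_def holomorphic_on_def using z w r(1) field_differentiable_at_within by (blast intro: exI[of _ r])+
  then show "regZ i j has_fps_expansion Zc i j" "regW i j has_fps_expansion Wc i j"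
    unfolding Zc_def Wc_def by (auto intro: analytic_at_imp_has_fps_expansion_0)
qed

lemma Zc_0: "fps_nth (Zc i j) 0 = (if j = i then 1 else 0)"
  using has_fps_expansion_imp_0_eq_fps_nth_0[OF reg_expansion(1)[of i j], symmetric] by (simp add: regZ_def)

lemma Wc_0: "fps_nth (Wc i j) 0 = (if j = i then 1 else 0)"
  using has_fps_expansion_imp_0_eq_fps_nth_0[OF reg_expansion(2)[of i j], symmetric] by (simp add: regW_def)

text \<open>The coefficients of \<open>Q\<close> at \<open>p i\<close>, homogenized so that the coefficient of order \<open>m\<close> has weight \<open>m + 2\<close>.\<close>

definition qhat :: "'r \<Rightarrow> 'r hcoords \<Rightarrow> int \<Rightarrow> complex" where
  "qhat i = (\<lambda>(A0, A, B) m.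
     A0 ^ nat (m + 2) * (\<Sum>j\<in>UNIV. cn j * (cn j + 1) * fps_nth (Wc i j) (nat (m + 2))) +
     (if m \<ge> -1 then A0 ^ nat (m + 1) * (\<Sum>j\<in>UNIV. A $ j * fps_nth (Zc i j) (nat (m + 1))) else 0) +
     (if m = 0 then B else 0))"

text \<open>Homogenization of \<open>log_obstruction\<close> by the coordinate A0: at A0 = 1 it is
  the obstruction itself, at A0 = 0 its leading part.\<close>

definition Fh :: "'r \<Rightarrow> 'r hcoords \<Rightarrow> complex" where
  "Fh i x = frob_obstruction (ell n i) (qhat i x)"

lemma Qpot_reg:
  assumes y: "y \<noteq> 0"
  shows "(\<Sum>j\<in>UNIV. cn j * (cn j + 1) * regW i j y) + y * (\<Sum>j\<in>UNIV. A $ j * regZ i j y) + B * y\<^sup>2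
     = y\<^sup>2 * Qpot \<tau> n p A B (p i + y)"
proof -
  have w: "y\<^sup>2 * (of_real (n j * (n j + 1)) * \<P> (p i + y - p j)) = cn j * (cn j + 1) * regW i j y" for j
  proof -
    have "regW i j y = y\<^sup>2 * \<P> (p i + y - p j)"
      using y by (auto simp: regW_def wp_eq distrib_left algebra_simps)
    then show ?thesis by simp
  qed
  have z: "y\<^sup>2 * (A $ j * \<zeta> (p i + y - p j)) = y * (A $ j * regZ i j y)" for j
    using y by (auto simp: regZ_def wzeta_eq field_simps power2_eq_square)
  have 1: "(\<Sum>j\<in>UNIV. cn j * (cn j + 1) * regW i j y) = y\<^sup>2 * (\<Sum>j\<in>UNIV. of_real (n j * (n j + 1)) * \<P> (p i + y - p j))"
    unfolding sum_distrib_left w ..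
  have 2: "y * (\<Sum>j\<in>UNIV. A $ j * regZ i j y) = y\<^sup>2 * (\<Sum>j\<in>UNIV. A $ j * \<zeta> (p i + y - p j))"
    unfolding sum_distrib_left z ..
  show ?thesis unfolding Qpot_def 1 2 by (simp add: distrib_left mult.commute)
qed

lemma Q_expansion:
  "(\<lambda>y. Qpot \<tau> n p A B (p i + y)) has_laurent_expansion
     fls_shift 2 (fps_to_fls ((\<Sum>j\<in>UNIV. fps_const (cn j * (cn j + 1)) * Wc i j) + fps_X * (\<Sum>j\<in>UNIV. fps_const (A $ j) * Zc i j) + fps_const B * fps_X ^ 2))"
    (is "_ has_laurent_expansion fls_shift 2 (fps_to_fls ?R)")
proof -
  define R where "R y = (\<Sum>j\<in>UNIV. cn j * (cn j + 1) * regW i j y) + y * (\<Sum>j\<in>UNIV. A $ j * regZ i j y) + B * y\<^sup>2" for y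
  have "R has_fps_expansion ?R"
    unfolding R_def by (intro fps_expansion_intros reg_expansion)
  then have "(\<lambda>y. R y * y powi (- 2)) has_laurent_expansion fls_shift 2 (fps_to_fls ?R)"
    by (intro has_laurent_expansion_shift' has_laurent_expansion_fps)
  moreover have "\<forall>\<^sub>F y in at 0. R y * y powi (- 2) = Qpot \<tau> n p A B (p i + y)"
    using eventually_nonzero_at_0
  proof eventually_elim
    case (elim y)
    have "y powi (- 2) = 1 / y\<^sup>2" using elim by (simp add: power_int_minus field_simps)
    then show ?case using Qpot_reg[OF elim, of i A B] elim by (simp add: R_def)
  qed
  ultimately show ?thesis by (rule has_laurent_expansion_cong[THEN iffD1, OF _ refl, rotated])
qed

lemma laurent_Q_nth:
  "m \<ge> -2 \<Longrightarrow> fls_nth (laurent_expansion (Qpot \<tau> n p A B) (p i)) m = qhat i (1, A, B) m"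
proof -
  assume m: "m \<ge> -2"
  have e: "laurent_expansion (Qpot \<tau> n p A B) (p i) = fls_shift 2 (fps_to_fls ((\<Sum>j\<in>UNIV. fps_const (cn j * (cn j + 1)) * Wc i j) + fps_X * (\<Sum>j\<in>UNIV. fps_const (A $ j) * Zc i j) + fps_const B * fps_X ^ 2))"
    by (rule laurent_expansion_eqI[OF Q_expansion])
  have 1: "nat (m + 2) \<noteq> 0 \<longleftrightarrow> m \<ge> -1" "nat (m + 2) - Suc 0 = nat (m + 1)" "nat (m + 2) = 2 \<longleftrightarrow> m = 0" using m by auto
  have xm: "fps_nth (fps_X * G) k = (if k \<noteq> 0 then fps_nth G (k - 1) else 0)" for G :: "complex fps" and k by simp
  have x2: "fps_nth (fps_const B * fps_X ^ 2) k = (if k = 2 then B else 0)" for k by simp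
  show ?thesis unfolding e qhat_def using m
    by (simp add: fps_sum_nth xm x2 1 del: fps_X_mult_nth)
qed

lemma Fh_1: "Fh i (1, A, B) = log_obstruction \<tau> n p i A B"
proof -
  let ?q = "fls_nth (laurent_expansion (Qpot \<tau> n p A B) (p i))"
  have "frob (ell n i) ?q j = frob (ell n i) (qhat i (1, A, B)) j" for j
    by (rule frob_cong) (rule laurent_Q_nth, simp)
  then show ?thesis
    unfolding Fh_def frob_obstruction_def log_obstruction_def Let_def
    by (intro sum.cong refl) (simp add: laurent_Q_nth)
qed

lemma qhat_scale: "m \<ge> -1 \<Longrightarrow> qhat i (c * A0, c *s A, c\<^sup>2 * B) m = c ^ nat (m + 2) * qhat i (A0, A, B) m"
proof -
  assume m: "m \<ge> -1"
  define k where "k = nat (m + 1)"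
  have k: "m = int k - 1" using m by (simp add: k_def)
  have e: "nat (m + 2) = Suc k" "nat (m + 1) = k" "m = 0 \<longleftrightarrow> k = 1" by (auto simp: k)
  have s: "(\<Sum>j\<in>UNIV. (c *s A) $ j * fps_nth (Zc i j) k) = c * (\<Sum>j\<in>UNIV. A $ j * fps_nth (Zc i j) k)"
    by (simp add: sum_distrib_left mult.assoc)
  show ?thesis using m
    unfolding qhat_def prod.case e s by (auto simp: power_mult_distrib algebra_simps power2_eq_square)
qed

lemma frob_scale:
  assumes "\<And>m. m \<ge> -1 \<Longrightarrow> q' m = c ^ nat (m + 2) * q m"
  shows "frob l q' k = c ^ k * frob l q k"
proof (induction k rule: less_induct)
  case (less k)
  show ?case
  proof (cases "k = 0")
    case False
    have "(\<Sum>j<k. q' (int k - 2 - int j) * frob l q' j) = (\<Sum>j<k. c ^ k * (q (int k - 2 - int j) * frob l q j))"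
    proof (intro sum.cong refl)
      fix j assume j: "j \<in> {..<k}"
      then have "nat (int k - 2 - int j + 2) + j = k" by simp
      then have "c ^ nat (int k - 2 - int j + 2) * c ^ j = c ^ k" by (metis power_add)
      then show "q' (int k - 2 - int j) * frob l q' j = c ^ k * (q (int k - 2 - int j) * frob l q j)"
        using j less.IH[of j] assms[of "int k - 2 - int j"] by (simp add: algebra_simps)
    qed
    then show ?thesis using False by (simp add: frob_rec sum_distrib_left[symmetric])
  qed (simp add: frob_0)
qed

text \<open>The coefficient q_m has weight m + 2 and the Frobenius coefficient c_j has weight j, so
  each summand of the obstruction has weight l + 1.\<close>

lemma Fh_scale: "Fh i (c * A0, c *s A, c\<^sup>2 * B) = c ^ Suc (ell n i) * Fh i (A0, A, B)"
proof -
  let ?l = "ell n i"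
  have f: "frob ?l (qhat i (c * A0, c *s A, c\<^sup>2 * B)) j = c ^ j * frob ?l (qhat i (A0, A, B)) j" for j
    by (rule frob_scale, rule qhat_scale)
  show ?thesis unfolding Fh_def frob_obstruction_def sum_distrib_left
  proof (intro sum.cong refl)
    fix j assume j: "j \<in> {..?l}"
    then have "nat (int ?l - 1 - int j + 2) + j = Suc ?l" by simp
    then have "c ^ nat (int ?l - 1 - int j + 2) * c ^ j = c ^ Suc ?l" by (metis power_add)
    then show "qhat i (c * A0, c *s A, c\<^sup>2 * B) (int ?l - 1 - int j) * frob ?l (qhat i (c * A0, c *s A, c\<^sup>2 * B)) j
       = c ^ Suc ?l * (qhat i (A0, A, B) (int ?l - 1 - int j) * frob ?l (qhat i (A0, A, B)) j)"
      using j f[of j] qhat_scale[of "int ?l - 1 - int j" i c A0 A B] by (simp add: algebra_simps)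
  qed
qed

text \<open>With w = y^(-n_i) v, where v'/v is the part of g regular at p_i, the Riccati equation
  becomes w'' = Q w. Since v is analytic with v(0) = 1, its Taylor coefficients obey the Frobenius
  recursion for every k, including the resonant k = l + 1. Only v is ever formed, so half-integral
  n_i cause no multivaluedness.\<close>

lemma log_free:
  assumes e: "glc_eqs I a h"
  shows "log_obstruction \<tau> n p i (Af I a h) (Bf I a h) = 0"
proof -
  have fin: "finite I" and g: "generic I a" using e by (auto simp: glc_eqs_def generic_def)
  have pa: "p i - a \<mu> \<notin> \<Lambda>" if "\<mu> \<in> I" for \<mu>
    using g that lattice_diff_commute unfolding generic_def by blast
  define J where "J = UNIV - {i}"
  have UJ: "(\<Sum>j\<in>UNIV. f j) = f i + (\<Sum>j\<in>J. f j)" for f :: "'r \<Rightarrow> complex"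
    unfolding J_def by (rule sum.remove) auto
  obtain r1 where r1: "r1 > 0" "\<And>y. y \<in> ball 0 r1 \<Longrightarrow> y \<notin> \<Lambda> - {0}" "\<And>y j. y \<in> ball 0 r1 \<Longrightarrow> j \<in> J \<Longrightarrow> p i - p j + y \<notin> \<Lambda>"
    using holomorphic_near_0[of i] unfolding J_def by blast
  have o2: "open (\<Inter>\<mu>\<in>I. {y. p i - a \<mu> + y \<in> - \<Lambda>})" using fin by (intro open_INT ballI open_shift_lattice)
  have "0 \<in> (\<Inter>\<mu>\<in>I. {y. p i - a \<mu> + y \<in> - \<Lambda>})" using pa by auto
  then obtain r2 where r2: "r2 > 0" "ball 0 r2 \<subseteq> (\<Inter>\<mu>\<in>I. {y. p i - a \<mu> + y \<in> - \<Lambda>})"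
    using open_contains_ball o2 by blast
  define r where "r = min r1 r2"
  have r: "r > 0" "\<And>y. y \<in> ball 0 r \<Longrightarrow> y \<notin> \<Lambda> - {0}" "\<And>y j. y \<in> ball 0 r \<Longrightarrow> j \<in> J \<Longrightarrow> p i - p j + y \<notin> \<Lambda>"
    "\<And>y \<mu>. y \<in> ball 0 r \<Longrightarrow> \<mu> \<in> I \<Longrightarrow> p i - a \<mu> + y \<notin> \<Lambda>"
    using r1 r2 unfolding r_def by auto
  \<comment> \<open>This is g + n_i / y in the local coordinate y: only the pole at p_i itself has
    been removed.\<close>
  define G where "G y = h + (\<Sum>\<mu>\<in>I. \<zeta> (p i - a \<mu> + y)) - (\<Sum>j\<in>J. cn j * \<zeta> (p i - p j + y)) - cn i * zeta0 y" for y
  define G' where "G' y = - (\<Sum>\<mu>\<in>I. \<P> (p i - a \<mu> + y)) + (\<Sum>j\<in>J. cn j * \<P> (p i - p j + y)) + cn i * wp0 y" for y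
  have dG: "(G has_field_derivative G' y) (at y)" if "y \<in> ball 0 r" for y
  proof -
    have "(G has_field_derivative 0 + (\<Sum>\<mu>\<in>I. - \<P> (p i - a \<mu> + y)) - (\<Sum>j\<in>J. cn j * (- \<P> (p i - p j + y))) - cn i * (- wp0 y)) (at y)"
      unfolding G_def using r that
      by (intro DERIV_add DERIV_diff DERIV_sum DERIV_cmult wzeta_deriv_shift DERIV_const zeta0_deriv) auto
    then show ?thesis by (simp add: G'_def sum_negf)
  qed
  have "G holomorphic_on ball 0 r"
    unfolding holomorphic_on_open[OF open_ball] using dG by blast
  then obtain f where f: "\<And>y. y \<in> ball 0 r \<Longrightarrow> (f has_field_derivative G y) (at y within ball 0 r)"
    using holomorphic_convex_primitive'[of "ball 0 r" G] by auto
  have f': "(f has_field_derivative G y) (at y)" if "y \<in> ball 0 r" for y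
    using f[OF that] that at_within_open[OF that open_ball] by simp
  define v where "v y = exp (f y - f 0)" for y
  have dv: "(v has_field_derivative G y * v y) (at y)" if "y \<in> ball 0 r" for y
    unfolding v_def using f'[OF that] by (auto intro!: derivative_eq_intros)
  have dv': "((\<lambda>y. G y * v y) has_field_derivative (G' y + (G y)\<^sup>2) * v y) (at y)" if "y \<in> ball 0 r" for y
    using dG[OF that] dv[OF that] by (auto intro!: derivative_eq_intros simp: power2_eq_square algebra_simps)
  have "v holomorphic_on ball 0 r" unfolding holomorphic_on_open[OF open_ball] using dv by blast
  then have "v analytic_on {0}" unfolding analytic_on_def using r(1) by auto
  then obtain V where V: "v has_fps_expansion V" using analytic_at_imp_has_fps_expansion_0 by blast
  have ev: "\<forall>\<^sub>F y in nhds 0. y \<in> ball 0 r" using r(1) by (intro eventually_nhds_in_open) auto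
  have "deriv v has_fps_expansion fps_deriv V" by (rule has_fps_expansion_deriv[OF V])
  moreover have ed: "\<forall>\<^sub>F y in nhds 0. deriv v y = G y * v y"
    using ev by eventually_elim (rule DERIV_imp_deriv, rule dv)
  ultimately have V1: "(\<lambda>y. G y * v y) has_fps_expansion fps_deriv V"
    by (rule has_fps_expansion_cong[THEN iffD1, OF _ refl, rotated])
  have "deriv (\<lambda>y. G y * v y) has_fps_expansion fps_deriv (fps_deriv V)" by (rule has_fps_expansion_deriv[OF V1])
  moreover have "\<forall>\<^sub>F y in nhds 0. deriv (\<lambda>y. G y * v y) y = (G' y + (G y)\<^sup>2) * v y"
    using ev by eventually_elim (rule DERIV_imp_deriv, rule dv')
  ultimately have V2: "(\<lambda>y. (G' y + (G y)\<^sup>2) * v y) has_fps_expansion fps_deriv (fps_deriv V)"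
    by (rule has_fps_expansion_cong[THEN iffD1, OF _ refl, rotated])
  define A where "A = Af I a h"
  define B where "B = Bf I a h"
  define Rf where "Rf = (\<Sum>j\<in>UNIV. fps_const (cn j * (cn j + 1)) * Wc i j) + fps_X * (\<Sum>j\<in>UNIV. fps_const (A $ j) * Zc i j) + fps_const B * fps_X ^ 2"
  define R where "R y = (\<Sum>j\<in>UNIV. cn j * (cn j + 1) * regW i j y) + y * (\<Sum>j\<in>UNIV. A $ j * regZ i j y) + B * y\<^sup>2" for y
  have Rx: "R has_fps_expansion Rf"
    unfolding R_def Rf_def by (intro fps_expansion_intros reg_expansion)
  have RQ: "R y = y\<^sup>2 * Qpot \<tau> n p A B (p i + y)" if "y \<noteq> 0" for y
    unfolding R_def by (rule Qpot_reg[OF that])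
  \<comment> \<open>The equation y^2 w'' = y^2 Q w for w = y^(-n_i) v, written in terms of v: the
    left side becomes y^2 v'' - 2 n_i y v' + n_i (n_i + 1) v.\<close>
  define E where "E y = y\<^sup>2 * ((G' y + (G y)\<^sup>2) * v y) - 2 * cn i * (y * (G y * v y)) + cn i * (cn i + 1) * v y" for y
  have Ex: "E has_fps_expansion fps_X ^ 2 * fps_deriv (fps_deriv V) - fps_const (2 * cn i) * (fps_X * fps_deriv V) + fps_const (cn i * (cn i + 1)) * V"
    unfolding E_def by (intro fps_expansion_intros V V1 V2)
  have RE: "R y * v y = E y" if "y \<in> ball 0 r" for y
  proof (cases "y = 0")
    case True
    have "R 0 = cn i * (cn i + 1)"
      unfolding R_def by (subst sum.remove[of UNIV i]) (auto simp: regW_def)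
    then show ?thesis by (simp add: E_def True)
  next
    case False
    let ?z = "p i + y"
    have zz: "?z - a \<mu> = p i - a \<mu> + y" "?z - p j = p i - p j + y" for \<mu> j by simp_all
    have yL: "y \<notin> \<Lambda>" using r(2)[OF that] False by auto
    have pz: "?z - p j \<notin> \<Lambda>" for j using r(3)[OF that, of j] yL by (cases "j = i") (auto simp: J_def algebra_simps)
    have Ri: "(gfun I a h ?z)\<^sup>2 - (\<Sum>\<mu>\<in>I. \<P> (?z - a \<mu>)) + (\<Sum>i\<in>UNIV. cn i * \<P> (?z - p i)) = Qpot \<tau> n p A B ?z"
      unfolding A_def B_def by (rule riccati[OF e _ pz]) (use r(4)[OF that] in \<open>simp add: algebra_simps\<close>)
    have gz: "gfun I a h ?z = G y - cn i / y"
      unfolding gfun_def UJ G_def zz by (simp add: wzeta_eq algebra_simps)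
    have wz: "- (\<Sum>\<mu>\<in>I. \<P> (?z - a \<mu>)) + (\<Sum>i\<in>UNIV. cn i * \<P> (?z - p i)) = G' y + cn i / y\<^sup>2"
      unfolding UJ G'_def zz by (simp add: wp_eq algebra_simps)
    have Qeq: "Qpot \<tau> n p A B ?z = (G y - cn i / y)\<^sup>2 + (G' y + cn i / y\<^sup>2)"
      unfolding wz[symmetric] gz[symmetric] Ri[symmetric] by simp
    show ?thesis unfolding RQ[OF False] E_def Qeq using False by (simp add: field_simps power2_eq_square)
  qed
  have "(\<lambda>y. R y * v y) has_fps_expansion Rf * V" by (intro fps_expansion_intros Rx V)
  moreover have "\<forall>\<^sub>F y in nhds 0. R y * v y = E y" using ev by eventually_elim (rule RE)
  ultimately have "E has_fps_expansion Rf * V"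
    by (rule has_fps_expansion_cong[THEN iffD1, OF _ refl, rotated])
  then have eq: "Rf * V = fps_X ^ 2 * fps_deriv (fps_deriv V) - fps_const (2 * cn i) * (fps_X * fps_deriv V) + fps_const (cn i * (cn i + 1)) * V"
    using Ex fps_expansion_unique_complex by blast
  define q where "q = fls_nth (laurent_expansion (Qpot \<tau> n p A B) (p i))"
  have qR: "q (int k - 2) = fps_nth Rf k" for k
    unfolding q_def laurent_expansion_eqI[OF Q_expansion] Rf_def[symmetric] by simp
  have R0: "fps_nth Rf 0 = cn i * (cn i + 1)"
    unfolding Rf_def by (simp add: fps_sum_nth Wc_0 if_distrib sum.delta cong: if_cong)
  have V0: "fps_nth V 0 = 1" using has_fps_expansion_imp_0_eq_fps_nth_0[OF V] by (simp add: v_def)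
  have rec: "of_nat k * (of_nat k - 1 - of_nat (ell n i)) * fps_nth V k = (\<Sum>j<k. q (int k - 2 - int j) * fps_nth V j)" if k: "0 < k" for k
  proof -
    have "fps_nth (Rf * V) k = (\<Sum>j=0..k. fps_nth V j * fps_nth Rf (k - j))"
      by (subst mult.commute, rule fps_mult_nth)
    also have "\<dots> = (\<Sum>j<k. fps_nth V j * fps_nth Rf (k - j)) + fps_nth V k * fps_nth Rf 0"
      by (simp add: atLeast0AtMost lessThan_Suc_atMost[symmetric])
    also have "(\<Sum>j<k. fps_nth V j * fps_nth Rf (k - j)) = (\<Sum>j<k. q (int k - 2 - int j) * fps_nth V j)"
    proof (intro sum.cong refl)
      fix j assume "j \<in> {..<k}"
      then have e: "int k - 2 - int j = int (k - j) - 2" by simp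
      show "fps_nth V j * fps_nth Rf (k - j) = q (int k - 2 - int j) * fps_nth V j"
        unfolding e qR by (rule mult.commute)
    qed
    finally have 1: "fps_nth (Rf * V) k = (\<Sum>j<k. q (int k - 2 - int j) * fps_nth V j) + fps_nth V k * (cn i * (cn i + 1))"
      by (simp add: R0)
    have x1: "fps_nth (fps_X * fps_deriv V) k = of_nat k * fps_nth V k" using k by (cases k) auto
    have x2: "fps_nth (fps_X ^ 2 * fps_deriv (fps_deriv V)) k = of_nat k * (of_nat k - 1) * fps_nth V k"
    proof (cases "k = 1")
      case False
      then obtain m where m: "k = m + 2" using k le_Suc_ex[of 2 k] by (auto simp: add.commute)
      show ?thesis unfolding m by (simp add: fps_X_power_mult_nth)
    qed (simp add: fps_X_power_mult_nth)
    have 2: "fps_nth (Rf * V) k = of_nat k * (of_nat k - 1) * fps_nth V k - 2 * cn i * (of_nat k * fps_nth V k) + cn i * (cn i + 1) * fps_nth V k"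
      unfolding eq using x1 x2 by (simp add: mult.assoc)
    show ?thesis using 1 2 by (simp add: of_nat_ell algebra_simps)
  qed
  have "frob_obstruction (ell n i) q = 0"
    by (rule frob_eqI(2)[of "fps_nth V"]) (use V0 rec in auto)
  then show ?thesis by (simp add: log_obstruction_def frob_obstruction_def Let_def q_def A_def B_def)
qed

lemma mem_log_free_variety:
  "glc_eqs I a h \<Longrightarrow> (Af I a h, Bf I a h) \<in> log_free_variety \<tau> n p"
  unfolding log_free_variety_def using log_free sum_Af by auto

end

section \<open>The leading part of the obstruction and its roots\<close>

fun cpoly :: "nat \<Rightarrow> complex \<Rightarrow> nat \<Rightarrow> complex poly" where
  "cpoly l b 0 = 1"
| "cpoly l b (Suc 0) = smult (1 / (of_nat 1 * (of_nat 1 - 1 - of_nat l))) [:0, 1:]"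
| "cpoly l b (Suc (Suc k)) = smult (1 / (of_nat (k + 2) * (of_nat (k + 2) - 1 - of_nat l)))
     ([:0, 1:] * cpoly l b (Suc k) + smult b (cpoly l b k))"

text \<open>The obstruction when, besides the double pole, the potential has only the coefficients
  alpha in order -1 and b in order 0, as a polynomial in alpha. The recursion then involves just the
  two preceding coefficients.\<close>

definition Fpoly :: "nat \<Rightarrow> complex \<Rightarrow> complex poly" where
  "Fpoly l b = [:0, 1:] * cpoly l b l + smult b (cpoly l b (l - 1))"

lemma sum_two_terms:
  assumes "\<And>j. j < k \<Longrightarrow> f j = 0"
  shows "(\<Sum>j<Suc (Suc k). f j) = f (Suc k) + (f k :: complex)"
  using assms by simp

lemma frob_eq_cpoly:
  assumes q: "q (-1) = \<alpha>" "q 0 = b" "\<And>m. m \<ge> 1 \<Longrightarrow> q m = 0"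
  shows "frob l q k = poly (cpoly l b k) \<alpha>"
proof (induction k rule: cpoly.induct[where ?P = "\<lambda>l' b' k. frob l q k = poly (cpoly l b k) \<alpha>"])
  case (3 l' b' k)
  have "(\<Sum>j<Suc (Suc k). q (int (Suc (Suc k)) - 2 - int j) * frob l q j) = \<alpha> * frob l q (Suc k) + b * frob l q k"
    by (subst sum_two_terms) (auto simp: q)
  then have "frob l q (Suc (Suc k)) = 1 / (of_nat (Suc (Suc k)) * (of_nat (Suc (Suc k)) - 1 - of_nat l)) * (\<alpha> * frob l q (Suc k) + b * frob l q k)"
    by (subst frob_rec) simp_all
  then show ?case using 3 by (simp add: algebra_simps)
qed (simp_all add: frob_0 frob_rec q)

lemma frob_obstruction_eq_Fpoly:
  assumes q: "q (-1) = \<alpha>" "q 0 = b" "\<And>m. m \<ge> 1 \<Longrightarrow> q m = 0" and l: "l > 0"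
  shows "frob_obstruction l q = poly (Fpoly l b) \<alpha>"
proof -
  obtain k where k: "l = Suc k" using l gr0_implies_Suc by blast
  have "frob_obstruction l q = \<alpha> * frob l q (Suc k) + b * frob l q k"
    unfolding frob_obstruction_def k lessThan_Suc_atMost[symmetric]
    by (subst sum_two_terms) (auto simp: q)
  then show ?thesis by (simp add: frob_eq_cpoly[OF q] Fpoly_def k)
qed

lemma cpoly_degree:
  "k \<le> l \<Longrightarrow> degree (cpoly l b k) \<le> k \<and> coeff (cpoly l b k) k \<noteq> 0"
proof (induction l b k rule: cpoly.induct)
  case (2 l b)
  then show ?case using frob_denom_nonzero[of 1 l] by simp
next
  case (3 l b k)
  have IH: "degree (cpoly l b (Suc k)) \<le> Suc k" "coeff (cpoly l b (Suc k)) (Suc k) \<noteq> 0" "degree (cpoly l b k) \<le> k"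
    using 3 by auto
  have nz: "of_nat (k + 2) * (of_nat (k + 2) - 1 - of_nat l) \<noteq> (0::complex)"
    using frob_denom_nonzero[of "k + 2" l] 3 by simp
  have d: "degree ([:0, 1:] * cpoly l b (Suc k) + smult b (cpoly l b k)) \<le> Suc (Suc k)"
    using IH degree_pCons_le[of 0 "cpoly l b (Suc k)"] degree_smult_le[of b "cpoly l b k"]
    by (intro degree_add_le) auto
  have c: "coeff ([:0, 1:] * cpoly l b (Suc k) + smult b (cpoly l b k)) (Suc (Suc k)) \<noteq> 0"
    using IH by (simp add: coeff_eq_0)
  have "degree (cpoly l b (Suc (Suc k))) \<le> Suc (Suc k)"
    unfolding cpoly.simps by (rule order_trans[OF degree_smult_le d])
  moreover have "coeff (cpoly l b (Suc (Suc k))) (Suc (Suc k)) \<noteq> 0"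
    unfolding cpoly.simps coeff_smult using nz c by simp
  ultimately show ?case by blast
qed simp

lemma Fpoly_degree: "degree (Fpoly l b) \<le> Suc l" "Fpoly l b \<noteq> 0"
proof -
  have d: "degree (cpoly l b l) \<le> l" "coeff (cpoly l b l) l \<noteq> 0" "degree (cpoly l b (l - 1)) \<le> l - 1"
    using cpoly_degree[of l l b] cpoly_degree[of "l - 1" l b] by auto
  show "degree (Fpoly l b) \<le> Suc l"
    unfolding Fpoly_def using d degree_pCons_le[of 0 "cpoly l b l"] degree_smult_le[of b "cpoly l b (l - 1)"]
    by (intro degree_add_le) auto
  have "coeff (Fpoly l b) (Suc l) \<noteq> 0"
    unfolding Fpoly_def using d by (simp add: coeff_eq_0)
  then show "Fpoly l b \<noteq> 0" by auto
qed

text \<open>For b = 0 each recursion step only multiplies by alpha and a nonzero constant, leaving a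
  nonzero multiple of a power of alpha. This excludes points at infinity with B = 0.\<close>

lemma Fpoly_0_root: "poly (Fpoly l 0) \<alpha> = 0 \<Longrightarrow> \<alpha> = 0"
proof (rule ccontr)
  assume a: "poly (Fpoly l 0) \<alpha> = 0" "\<alpha> \<noteq> 0"
  have "poly (cpoly l 0 k) \<alpha> \<noteq> 0" if "k \<le> l" for k
    using that
  proof (induction l "0::complex" k rule: cpoly.induct)
    case (2 l) then show ?case using a frob_denom_nonzero[of 1 l] by simp
  next
    case (3 l k)
    then show ?case using a frob_denom_nonzero[of "k + 2" l] by simp
  qed simp
  then show False using a by (simp add: Fpoly_def)
qed

text \<open>
  The polynomials of the rational solutions \<open>exp x * x ^ (- l / 2) * P x\<close> of the limiting equation,
  normalized by \<open>P 0 = 1\<close>.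
\<close>

primrec lagc :: "nat \<Rightarrow> nat \<Rightarrow> nat \<Rightarrow> complex" where
  "lagc l k 0 = 1"
| "lagc l k (Suc j) = lagc l k j * (2 * of_nat k - 2 * of_nat j) / (of_nat (Suc j) * (of_nat j - of_nat l))"

definition lagpoly :: "nat \<Rightarrow> nat \<Rightarrow> complex poly" where
  "lagpoly l k = Abs_poly (\<lambda>j. if j \<le> k then lagc l k j else 0)"

lemma coeff_lagpoly: "coeff (lagpoly l k) j = (if j \<le> k then lagc l k j else 0)"
  unfolding lagpoly_def by (rule coeff_Abs_poly[where n = k, THEN fun_cong, simplified] | simp add: coeff_Abs_poly[of k])+

lemma lagc_nonzero: "j \<le> k \<Longrightarrow> k \<le> l \<Longrightarrow> lagc l k j \<noteq> 0"
proof (induction j)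
  case (Suc j)
  have "(of_nat j :: complex) \<noteq> of_nat k" "(of_nat j :: complex) \<noteq> of_nat l" using Suc by (simp_all only: of_nat_eq_iff)
  then show ?case using Suc by (simp del: of_nat_Suc)
qed simp

lemma degree_lagpoly: "k \<le> l \<Longrightarrow> degree (lagpoly l k) = k"
  by (rule antisym, rule degree_le, simp add: coeff_lagpoly, rule le_degree, simp add: coeff_lagpoly lagc_nonzero)

lemma poly_lagpoly_0: "poly (lagpoly l k) 0 = 1"
  by (simp add: poly_0_coeff_0 coeff_lagpoly)

text \<open>Comparing coefficients gives exactly the recursion of \<open>lagc\<close>; cutting off
  after degree k is consistent because the factor 2 k - 2 j vanishes at j = k.\<close>

lemma lagpoly_ode:
  assumes "k \<le> l"
  shows "[:0, 1:] * pderiv (pderiv (lagpoly l k)) - smult (of_nat l) (pderiv (lagpoly l k)) + smult 2 ([:0, 1:] * pderiv (lagpoly l k))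
     = smult (2 * of_nat k) (lagpoly l k)" (is "?L = ?R")
proof (rule poly_eqI)
  fix j
  let ?c = "coeff (lagpoly l k)"
  have "coeff ?L j = of_nat (Suc j) * (of_nat j - of_nat l) * ?c (Suc j) + 2 * of_nat j * ?c j"
    by (cases j) (simp_all add: coeff_pderiv algebra_simps)
  also have "\<dots> = 2 * of_nat k * ?c j"
  proof (cases "j < k")
    case True
    have "(of_nat j :: complex) \<noteq> of_nat l" using True assms by (simp only: of_nat_eq_iff)
    then have nz: "of_nat (Suc j) * (of_nat j - of_nat l) \<noteq> (0 :: complex)" by (simp del: of_nat_Suc)
    have "?c (Suc j) = ?c j * (2 * of_nat k - 2 * of_nat j) / (of_nat (Suc j) * (of_nat j - of_nat l))"
      using True by (simp add: coeff_lagpoly)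
    then have "?c (Suc j) * (of_nat (Suc j) * (of_nat j - of_nat l)) = ?c j * (2 * of_nat k - 2 * of_nat j)"
      using nz by (simp only: nonzero_eq_divide_eq not_False_eq_True)
    then have "of_nat (Suc j) * (of_nat j - of_nat l) * ?c (Suc j) = ?c j * (2 * of_nat k - 2 * of_nat j)"
      by (simp only: mult.commute)
    then show ?thesis by (simp only:) (simp add: algebra_simps)
  next
    case False
    then show ?thesis by (cases "j = k") (auto simp: coeff_lagpoly)
  qed
  finally show "coeff ?L j = coeff ?R j" by simp
qed

text \<open>Multiplying \<open>lagpoly\<close> by exp x yields a power series V with V(0) = 1 and x
  V'' - l V' = (x + alpha) V for alpha = 2 k - l. This is the Frobenius recursion of the limiting
  potential at all indices, so its obstruction is zero.\<close>

lemma Fpoly_root: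
  assumes "k \<le> l" "l > 0"
  shows "poly (Fpoly l 1) (2 * of_nat k - of_nat l) = 0"
proof -
  define \<alpha> :: complex where "\<alpha> = 2 * of_nat k - of_nat l"
  define q :: "int \<Rightarrow> complex" where "q m = (if m = -1 then \<alpha> else if m = 0 then 1 else 0)" for m
  define P where "P = fps_of_poly (lagpoly l k)"
  define E where "E = fps_exp (1::complex)"
  define V where "V = E * P"
  have dE: "fps_deriv E = E" unfolding E_def by simp
  have dV: "fps_deriv V = E * (P + fps_deriv P)"
    unfolding V_def by (simp add: dE algebra_simps)
  have dV2: "fps_deriv (fps_deriv V) = E * (P + 2 * fps_deriv P + fps_deriv (fps_deriv P))"
    unfolding dV by (simp add: dE algebra_simps)
  have X: "fps_of_poly [:0, 1:] = (fps_X :: complex fps)"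
    by (rule fps_ext) (auto simp: fps_of_poly_nth coeff_pCons split: nat.splits)
  have "fps_of_poly ([:0, 1:] * pderiv (pderiv (lagpoly l k)) - smult (of_nat l) (pderiv (lagpoly l k)) + smult 2 ([:0, 1:] * pderiv (lagpoly l k)))
     = fps_of_poly (smult (2 * of_nat k) (lagpoly l k))"
    by (simp only: lagpoly_ode[OF assms(1)])
  then have ode: "fps_X * fps_deriv (fps_deriv P) - fps_const (of_nat l) * fps_deriv P + fps_const 2 * (fps_X * fps_deriv P) = fps_const (2 * of_nat k) * P"
    unfolding P_def by (simp only: fps_of_poly_add fps_of_poly_diff fps_of_poly_mult fps_of_poly_smult fps_of_poly_pderiv X)
  note ode = ode[folded numeral_fps_const]
  have "fps_X * fps_deriv (fps_deriv V) - fps_const (of_nat l) * fps_deriv V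
      = E * (fps_X * P + fps_const (2 * of_nat k) * P - fps_const (of_nat l) * P)"
    unfolding dV dV2 ode[symmetric] by (simp add: dE algebra_simps)
  also have "\<dots> = fps_X * V + fps_const \<alpha> * V"
    unfolding V_def \<alpha>_def by (simp add: algebra_simps flip: fps_const_sub)
  finally have Vode: "fps_X * fps_deriv (fps_deriv V) - fps_const (of_nat l) * fps_deriv V = fps_X * V + fps_const \<alpha> * V" .
  have "frob_obstruction l q = 0"
  proof (rule frob_eqI(2)[of "fps_nth V"])
    show "fps_nth V 0 = 1"
      by (simp add: V_def E_def P_def fps_of_poly_nth coeff_lagpoly)
  next
    fix m :: nat assume m: "0 < m" "m \<le> Suc l"
    then obtain j where j: "m = Suc j" using gr0_implies_Suc by blast
    have "fps_nth (fps_X * fps_deriv (fps_deriv V) - fps_const (of_nat l) * fps_deriv V) j = of_nat m * (of_nat m - 1 - of_nat l) * fps_nth V m"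
      by (cases j) (simp_all add: j algebra_simps)
    moreover have "fps_nth (fps_X * V + fps_const \<alpha> * V) j = (\<Sum>i<m. q (int m - 2 - int i) * fps_nth V i)"
    proof (cases j)
      case 0 then show ?thesis by (simp add: j q_def)
    next
      case (Suc i)
      show ?thesis unfolding j Suc by (subst sum_two_terms) (auto simp: q_def)
    qed
    ultimately show "of_nat m * (of_nat m - 1 - of_nat l) * fps_nth V m = (\<Sum>i<m. q (int m - 2 - int i) * fps_nth V i)"
      using Vode by simp
  qed
  moreover have "frob_obstruction l q = poly (Fpoly l 1) \<alpha>"
    by (rule frob_obstruction_eq_Fpoly) (auto simp: q_def assms)
  ultimately show ?thesis by (simp add: \<alpha>_def)
qed

text \<open>The degree is at most l + 1 and l + 1 distinct roots are already known, so there are no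
  others. A double root would give the cofactor of one linear factor, of degree at most l, the same
  l + 1 roots.\<close>

lemma Fpoly_roots:
  assumes l: "l > 0"
  shows "{x. poly (Fpoly l 1) x = 0} = (\<lambda>k. 2 * of_nat k - of_nat l) ` {..l}"
    and "k \<le> l \<Longrightarrow> poly (pderiv (Fpoly l 1)) (2 * of_nat k - of_nat l) \<noteq> 0"
proof -
  let ?f = "\<lambda>k. 2 * of_nat k - of_nat l :: complex"
  have inj: "inj_on ?f {..l}" by (auto simp: inj_on_def)
  have sub: "?f ` {..l} \<subseteq> {x. poly (Fpoly l 1) x = 0}" using Fpoly_root l by auto
  have fin: "finite {x. poly (Fpoly l 1) x = 0}" by (rule poly_roots_finite[OF Fpoly_degree(2)])
  have "card {x. poly (Fpoly l 1) x = 0} \<le> Suc l"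
    using card_poly_roots_bound[OF Fpoly_degree(2)[of l 1]] Fpoly_degree(1)[of l 1] by linarith
  then show eq: "{x. poly (Fpoly l 1) x = 0} = ?f ` {..l}"
    using card_seteq[OF fin sub] card_image[OF inj] by simp
  assume k: "k \<le> l"
  obtain H where H: "Fpoly l 1 = [:- ?f k, 1:] * H" using Fpoly_root[OF k l] by (metis dvdE poly_eq_0_iff_dvd)
  have H0: "H \<noteq> 0" using H Fpoly_degree(2) by auto
  have "degree (Fpoly l 1) = Suc (degree H)" unfolding H using H0 by (subst degree_mult_eq) auto
  then have dH: "degree H \<le> l" using Fpoly_degree(1)[of l 1] by simp
  have d: "poly (pderiv (Fpoly l 1)) (?f k) = poly H (?f k)" unfolding H pderiv_mult by (simp add: pderiv_pCons algebra_simps)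
  show "poly (pderiv (Fpoly l 1)) (?f k) \<noteq> 0"
  proof
    assume z: "poly (pderiv (Fpoly l 1)) (?f k) = 0"
    have "?f ` {..l} \<subseteq> {x. poly H x = 0}"
    proof clarify
      fix j assume j: "j \<le> l"
      show "poly H (?f j) = 0"
      proof (cases "j = k")
        case False
        then have "poly [:- ?f k, 1:] (?f j) \<noteq> 0" by simp
        moreover have "poly [:- ?f k, 1:] (?f j) * poly H (?f j) = 0"
          using Fpoly_root[OF j l] unfolding H poly_mult .
        ultimately show ?thesis by (metis mult_eq_0_iff)
      qed (use z d in simp)
    qed
    then have "card (?f ` {..l}) \<le> card {x. poly H x = 0}" by (intro card_mono poly_roots_finite H0)
    also have "\<dots> \<le> degree H" by (rule card_poly_roots_bound[OF H0])
    finally show False using dH card_image[OF inj] by simp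
  qed
qed

section \<open>Complex differentiability and the local graph at infinity\<close>

lemma has_derivative_vec_lambda:
  fixes f :: "'i::finite \<Rightarrow> 'a::real_normed_vector \<Rightarrow> 'b::euclidean_space"
  assumes "\<And>i. (f i has_derivative f' i) (at x)"
  shows "((\<lambda>x. \<chi> i. f i x) has_derivative (\<lambda>v. \<chi> i. f' i v)) (at x)"
proof (subst has_derivative_componentwise_within, rule ballI)
  fix e :: "'b ^ 'i" assume "e \<in> Basis"
  then obtain i b where e: "e = axis i b" unfolding Basis_vec_def by blast
  show "((\<lambda>x. (\<chi> i. f i x) \<bullet> e) has_derivative (\<lambda>v. (\<chi> i. f' i v) \<bullet> e)) (at x)"
    unfolding e inner_axis by (auto intro!: has_derivative_inner_left assms)
qed

text \<open>Complex linearity of the derivative is what makes the local inverses below holomorphic.\<close>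

definition C1_several :: "('r::finite hcoords \<Rightarrow> complex) \<Rightarrow> bool" where
  "C1_several f \<longleftrightarrow> (\<exists>D. (\<forall>x. (f has_derivative D x) (at x)) \<and> (\<forall>v. continuous_on UNIV (\<lambda>x. D x v)) \<and>
     (\<forall>x c v. D x (cscale c v) = c * D x v))"

lemma C1_several_continuous: "C1_several f \<Longrightarrow> continuous_on UNIV f"
  unfolding C1_several_def by (metis continuous_at_imp_continuous_on has_derivative_continuous)

lemma C1_several_const [intro]: "C1_several (\<lambda>_. c)"
  unfolding C1_several_def by (intro exI[of _ "\<lambda>_ _. 0"]) auto

lemma C1_several_linear:
  assumes "bounded_linear f" "\<And>c v. f (cscale c v) = c * f v"
  shows "C1_several f"
  unfolding C1_several_def using assms
  by (intro exI[of _ "\<lambda>_. f"]) (auto intro: bounded_linear_imp_has_derivative)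

lemma C1_several_proj [intro]:
  "C1_several (\<lambda>x. fst x)" "C1_several (\<lambda>x. fst (snd x) $ i)" "C1_several (\<lambda>x. snd (snd x))"
  by (rule C1_several_linear;
      auto simp: cscale_def case_prod_unfold
        intro!: bounded_linear_fst_comp bounded_linear_snd_comp bounded_linear_ident
          bounded_linear_compose[OF bounded_linear_vec_nth])+

lemma C1_several_add [intro]:
  assumes "C1_several f" "C1_several g" shows "C1_several (\<lambda>x. f x + g x)"
proof -
  obtain D where D: "\<forall>x. (f has_derivative D x) (at x)" "\<forall>v. continuous_on UNIV (\<lambda>x. D x v)" "\<forall>x c v. D x (cscale c v) = c * D x v"
    using assms(1) unfolding C1_several_def by blast
  obtain E where E: "\<forall>x. (g has_derivative E x) (at x)" "\<forall>v. continuous_on UNIV (\<lambda>x. E x v)" "\<forall>x c v. E x (cscale c v) = c * E x v"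
    using assms(2) unfolding C1_several_def by blast
  show ?thesis unfolding C1_several_def
  proof (intro exI[of _ "\<lambda>x v. D x v + E x v"] conjI allI)
    show "((\<lambda>x. f x + g x) has_derivative (\<lambda>v. D x v + E x v)) (at x)" for x
      using D(1) E(1) by (intro has_derivative_add) blast+
    show "continuous_on UNIV (\<lambda>x. D x v + E x v)" for v
      using D(2) E(2) by (intro continuous_on_add) blast+
    show "D x (cscale c v) + E x (cscale c v) = c * (D x v + E x v)" for x c v
      using D(3) E(3) by (simp only: distrib_left)
  qed
qed

lemma C1_several_mult [intro]:
  assumes "C1_several f" "C1_several g" shows "C1_several (\<lambda>x. f x * g x)"
proof -
  obtain D where D: "\<forall>x. (f has_derivative D x) (at x)" "\<forall>v. continuous_on UNIV (\<lambda>x. D x v)" "\<forall>x c v. D x (cscale c v) = c * D x v"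
    using assms(1) unfolding C1_several_def by blast
  obtain E where E: "\<forall>x. (g has_derivative E x) (at x)" "\<forall>v. continuous_on UNIV (\<lambda>x. E x v)" "\<forall>x c v. E x (cscale c v) = c * E x v"
    using assms(2) unfolding C1_several_def by blast
  have c: "continuous_on UNIV f" "continuous_on UNIV g" using assms by (auto intro: C1_several_continuous)
  show ?thesis unfolding C1_several_def
  proof (intro exI[of _ "\<lambda>x v. f x * E x v + D x v * g x"] conjI allI)
    show "((\<lambda>x. f x * g x) has_derivative (\<lambda>v. f x * E x v + D x v * g x)) (at x)" for x
      using D(1) E(1) by (intro has_derivative_mult) blast+
    show "continuous_on UNIV (\<lambda>x. f x * E x v + D x v * g x)" for v
      using D(2) E(2) c by (intro continuous_on_add continuous_on_mult) blast+
    show "f x * E x (cscale c v) + D x (cscale c v) * g x = c * (f x * E x v + D x v * g x)" for x c v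
      using D(3) E(3) by (simp only: distrib_left mult.assoc mult.left_commute)
  qed
qed

lemma C1_several_sum [intro]:
  "(\<And>i. i \<in> S \<Longrightarrow> C1_several (f i)) \<Longrightarrow> C1_several (\<lambda>x. \<Sum>i\<in>S. f i x)"
  by (induction S rule: infinite_finite_induct) auto

lemma C1_several_power [intro]: "C1_several f \<Longrightarrow> C1_several (\<lambda>x. f x ^ k)"
  by (induction k) auto

lemma C1_several_if: "C1_several f \<Longrightarrow> C1_several g \<Longrightarrow> C1_several (\<lambda>x. if P then f x else g x)"
  by (cases P) auto

context glc begin

lemma ell_pos: "ell n i > 0"
proof -
  have "real (ell n i) > 0" unfolding real_ell using n_pos[of i] by simp
  then show ?thesis by simp
qed

lemma C1_qhat: "C1_several (\<lambda>x. qhat i x m)"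
  unfolding qhat_def case_prod_unfold
  by (intro C1_several_add C1_several_mult C1_several_const C1_several_sum C1_several_power C1_several_proj C1_several_if)

lemma C1_frob: "C1_several (\<lambda>x. frob l (qhat i x) k)"
proof (induction k rule: less_induct)
  case (less k)
  show ?case
  proof (cases "k = 0")
    case False
    then show ?thesis
      by (subst frob_rec) (simp, intro C1_several_mult C1_several_const C1_several_sum C1_qhat less.IH, simp)
  qed (simp add: frob_0 C1_several_const)
qed

lemma C1_Fh: "C1_several (Fh i)"
  unfolding Fh_def frob_obstruction_def[abs_def]
  by (intro C1_several_sum C1_several_mult C1_qhat C1_frob)

text \<open>At A0 = 0 every coefficient of order at least 1 disappears, and the coefficient of order
  -1 is A_i alone because the other zeta functions have no pole at p_i.\<close>

lemma Fh_infinity: "Fh i (0, A, B) = poly (Fpoly (ell n i) B) (A $ i)"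
  unfolding Fh_def
proof (rule frob_obstruction_eq_Fpoly[OF _ _ _ ell_pos])
  show "qhat i (0, A, B) (-1) = A $ i"
    by (simp add: qhat_def Zc_0 if_distrib cong: if_cong)
  show "qhat i (0, A, B) 0 = B" by (simp add: qhat_def)
  show "qhat i (0, A, B) m = 0" if "m \<ge> 1" for m using that by (simp add: qhat_def power_0_left)
qed

text \<open>Inverse function theorem for (s, A) -> (s, F(s, A, 1)). At s = 0 the i-th equation
  involves only A_i, so the derivative in A is diagonal, and its entries are nonzero because the
  roots of \<open>Fpoly\<close> are simple.\<close>

lemma Fh_local_graph:
  fixes \<alpha> :: "complex ^ 'r"
  assumes \<alpha>: "\<And>i. \<exists>k\<le>ell n i. \<alpha> $ i = 2 * of_nat k - of_nat (ell n i)"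
  obtains \<epsilon> \<rho> :: real and \<beta> :: "complex \<Rightarrow> complex ^ 'r" where "\<epsilon> > 0" "\<rho> > 0" "\<beta> 0 = \<alpha>" "\<And>i. (\<lambda>s. \<beta> s $ i) holomorphic_on ball 0 \<epsilon>"
    "\<And>s i. s \<in> ball 0 \<epsilon> \<Longrightarrow> Fh i (s, \<beta> s, 1) = 0" "\<And>s. s \<in> ball 0 \<epsilon> \<Longrightarrow> \<beta> s \<in> ball \<alpha> \<rho>"
    "\<And>s A. s \<in> ball 0 \<epsilon> \<Longrightarrow> A \<in> ball \<alpha> \<rho> \<Longrightarrow> (\<And>i. Fh i (s, A, 1) = 0) \<Longrightarrow> A = \<beta> s"
proof -
  have "\<forall>i. \<exists>D. (\<forall>x. (Fh i has_derivative D x) (at x)) \<and> (\<forall>v. continuous_on UNIV (\<lambda>x. D x v)) \<and>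
     (\<forall>x c v. D x (cscale c v) = c * D x v)"
    using C1_Fh unfolding C1_several_def by blast
  then obtain D where D: "\<And>i x. (Fh i has_derivative D i x) (at x)" "\<And>i v. continuous_on UNIV (\<lambda>x. D i x v)"
     "\<And>i x c v. D i x (cscale c v) = c * D i x v" by metis
  define \<Phi> :: "complex \<times> (complex ^ 'r) \<Rightarrow> complex \<times> (complex ^ 'r)" where "\<Phi> = (\<lambda>x. (fst x, \<chi> i. Fh i (fst x, snd x, 1)))"
  define d\<Phi> :: "complex \<times> (complex ^ 'r) \<Rightarrow> complex \<times> (complex ^ 'r) \<Rightarrow> complex \<times> (complex ^ 'r)" where
    "d\<Phi> x v = (fst v, \<chi> i. D i (fst x, snd x, 1) (fst v, snd v, 0))" for x v
  have der: "(\<Phi> has_derivative d\<Phi> x) (at x)" for x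
  proof -
    have "((\<lambda>x. (fst x, snd x, 1)) has_derivative (\<lambda>v. (fst v, snd v, 0))) (at x)"
      by (intro has_derivative_Pair has_derivative_fst has_derivative_snd has_derivative_ident has_derivative_const)
    then have "((\<lambda>x. Fh i (fst x, snd x, 1)) has_derivative (\<lambda>v. D i (fst x, snd x, 1) (fst v, snd v, 0))) (at x)" for i
      by (rule has_derivative_compose) (rule D(1))
    then have "((\<lambda>x. \<chi> i. Fh i (fst x, snd x, 1)) has_derivative (\<lambda>v. \<chi> i. D i (fst x, snd x, 1) (fst v, snd v, 0))) (at x)"
      by (rule has_derivative_vec_lambda)
    then show ?thesis unfolding \<Phi>_def d\<Phi>_def
      by (intro has_derivative_Pair has_derivative_fst has_derivative_ident)
  qed
  have bl: "bounded_linear (d\<Phi> x)" for x by (rule has_derivative_bounded_linear[OF der])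
  define f' where "f' x = Blinfun (d\<Phi> x)" for x
  have f'[simp]: "blinfun_apply (f' x) = d\<Phi> x" for x unfolding f'_def by (rule bounded_linear_Blinfun_apply[OF bl])
  have contf': "continuous_on UNIV f'"
  proof (rule continuous_on_blinfun_componentwise)
    fix v :: "complex \<times> (complex ^ 'r)"
    have "continuous_on UNIV (\<lambda>x. D i (fst x, snd x, 1) (fst v, snd v, 0))" for i
      by (rule continuous_on_compose2[OF D(2)]) (auto intro!: continuous_intros)
    then show "continuous_on UNIV (\<lambda>x. blinfun_apply (f' x) v)"
      unfolding f' d\<Phi>_def by (intro continuous_on_Pair continuous_on_const continuous_on_vec_lambda)
  qed
  \<comment> \<open>Computed along the complex line alpha + t v, on which the i-th function is the
    one-variable polynomial \<open>Fpoly\<close>.\<close>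
  have D0: "D i (0, \<alpha>, 1) (0, v, 0) = poly (pderiv (Fpoly (ell n i) 1)) (\<alpha> $ i) * v $ i" for i v
  proof -
    have "((\<lambda>t. (0, \<alpha> + t *s v, 1) :: 'r hcoords) has_derivative (\<lambda>t. (0, t *s v, 0))) (at 0)"
    proof (intro has_derivative_Pair has_derivative_const)
      have "((\<lambda>t. \<chi> i. \<alpha> $ i + t * v $ i) has_derivative (\<lambda>t. \<chi> i. 0 + t * v $ i)) (at 0)"
        by (intro has_derivative_vec_lambda has_derivative_add has_derivative_const has_derivative_mult_left has_derivative_ident)
      moreover have "(\<lambda>t. \<chi> i. \<alpha> $ i + t * v $ i) = (\<lambda>t. \<alpha> + t *s v)" "(\<lambda>t. \<chi> i. 0 + t * v $ i) = (\<lambda>t. t *s v)"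
        by (auto simp: fun_eq_iff vec_eq_iff)
      ultimately show "((\<lambda>t. \<alpha> + t *s v) has_derivative (\<lambda>t. t *s v)) (at 0)" by metis
    qed
    then have "((\<lambda>t. Fh i (0, \<alpha> + t *s v, 1)) has_derivative (\<lambda>t. D i (0, \<alpha> + 0 *s v, 1) (0, t *s v, 0))) (at 0)"
      by (rule has_derivative_compose) (rule D(1))
    then have 1: "((\<lambda>t. poly (Fpoly (ell n i) 1) (\<alpha> $ i + t * v $ i)) has_derivative (\<lambda>t. D i (0, \<alpha>, 1) (0, t *s v, 0))) (at 0)"
      by (simp add: Fh_infinity vector_smult_lzero)
    have "((\<lambda>t. poly (Fpoly (ell n i) 1) (\<alpha> $ i + t * v $ i)) has_field_derivative poly (pderiv (Fpoly (ell n i) 1)) (\<alpha> $ i + 0 * v $ i) * (v $ i)) (at 0)"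
      by (rule DERIV_chain2[OF poly_DERIV]) (auto intro!: derivative_eq_intros)
    then have 2: "((\<lambda>t. poly (Fpoly (ell n i) 1) (\<alpha> $ i + t * v $ i)) has_derivative (\<lambda>t. (poly (pderiv (Fpoly (ell n i) 1)) (\<alpha> $ i) * (v $ i)) * t)) (at 0)"
      by (simp add: has_field_derivative_def)
    have "D i (0, \<alpha>, 1) (0, 1 *s v, 0) = (poly (pderiv (Fpoly (ell n i) 1)) (\<alpha> $ i) * (v $ i)) * 1"
      using has_derivative_unique[OF 1 2] by meson
    then show ?thesis by simp
  qed
  have "inj (d\<Phi> (0, \<alpha>))"
  proof (rule linear_injective_0[THEN iffD2, rule_format])
    show "linear (d\<Phi> (0, \<alpha>))" using bl bounded_linear.linear by blast
    fix v assume v: "d\<Phi> (0, \<alpha>) v = 0"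
    then have v1: "fst v = 0" unfolding d\<Phi>_def by (simp add: prod_eq_iff)
    have "snd v $ i = 0" for i
    proof -
      have "D i (0, \<alpha>, 1) (0, snd v, 0) = 0" using v v1 unfolding d\<Phi>_def by (simp add: prod_eq_iff vec_eq_iff)
      moreover obtain k where "k \<le> ell n i" "\<alpha> $ i = 2 * of_nat k - of_nat (ell n i)" using \<alpha> by blast
      then have "poly (pderiv (Fpoly (ell n i) 1)) (\<alpha> $ i) \<noteq> 0" using Fpoly_roots(2)[OF ell_pos] by simp
      ultimately show ?thesis unfolding D0 by simp
    qed
    then show "v = 0" using v1 by (simp add: prod_eq_iff vec_eq_iff)
  qed
  then obtain L where L: "linear L" "L \<circ> d\<Phi> (0, \<alpha>) = id"
    using linear_injective_left_inverse bl bounded_linear.linear by blast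
  have bL: "bounded_linear L" using L(1) by (rule linear_conv_bounded_linear[THEN iffD1])
  have inv: "Blinfun L o\<^sub>L f' (0, \<alpha>) = id_blinfun"
  proof (rule blinfun_eqI)
    fix v
    have "L (d\<Phi> (0, \<alpha>) v) = v" using L(2) by (metis comp_apply id_apply)
    then show "blinfun_apply (Blinfun L o\<^sub>L f' (0, \<alpha>)) v = blinfun_apply id_blinfun v"
      by (simp add: bounded_linear_Blinfun_apply[OF bL])
  qed
  have derf: "\<And>x. x \<in> UNIV \<Longrightarrow> (\<Phi> has_derivative blinfun_apply (f' x)) (at x)" by (simp only: f' der)
  obtain U' V g g' where IFT0: "open U'" "U' \<subseteq> UNIV" "(0, \<alpha>) \<in> U'" "open V" "\<Phi> (0, \<alpha>) \<in> V" "homeomorphism U' V \<Phi> g"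
    "\<And>y. y \<in> V \<Longrightarrow> (g has_derivative (g' y)) (at y)"
    "\<And>y. y \<in> V \<Longrightarrow> g' y = inv (blinfun_apply (f' (g y)))" "\<And>y. y \<in> V \<Longrightarrow> bij (blinfun_apply (f' (g y)))"
    using inverse_function_theorem[OF open_UNIV derf contf' UNIV_I inv] by metis
  note IFT = IFT0(1,3-7) IFT0(8,9)[unfolded f']
  have \<Phi>0: "\<Phi> (0, \<alpha>) = (0, 0)"
  proof -
    have "poly (Fpoly (ell n i) 1) (\<alpha> $ i) = 0" for i
      using \<alpha>[of i] Fpoly_root[OF _ ell_pos] by auto
    then show ?thesis by (simp add: \<Phi>_def Fh_infinity vec_eq_iff)
  qed
  define \<beta> where "\<beta> s = snd (g (s, 0))" for s
  have g\<Phi>: "g (\<Phi> x) = x" if "x \<in> U'" for x using IFT(5) that by (auto simp: homeomorphism_def)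
  have \<Phi>g: "\<Phi> (g y) = y" "g y \<in> U'" if "y \<in> V" for y using IFT(5) that by (auto simp: homeomorphism_def)
  obtain r1 where r1: "r1 > 0" "ball (0, \<alpha>) r1 \<subseteq> U'" using IFT(1,2) open_contains_ball by blast
  have o: "open {s. (s, 0) \<in> V \<and> g (s, 0) \<in> ball (0, \<alpha>) (r1 / 2)}"
  proof -
    have cg: "continuous_on V g" using IFT(5) by (simp add: homeomorphism_def)
    have "open (V \<inter> g -` ball (0, \<alpha>) (r1 / 2))"
      by (rule continuous_open_preimage[OF cg IFT(3) open_ball])
    then have "open ((\<lambda>s. (s, 0)) -` (V \<inter> g -` ball (0, \<alpha>) (r1 / 2)))"
      by (rule open_vimage) (intro continuous_intros)
    then show ?thesis by (simp add: vimage_def)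
  qed
  have g0: "g (0, 0) = (0, \<alpha>)" using g\<Phi>[OF IFT(2)] \<Phi>0 by simp
  have "0 \<in> {s. (s, 0) \<in> V \<and> g (s, 0) \<in> ball (0, \<alpha>) (r1 / 2)}" using IFT(4) \<Phi>0 g0 r1 by simp
  then obtain r2 where r2: "r2 > 0" "ball 0 r2 \<subseteq> {s. (s, 0) \<in> V \<and> g (s, 0) \<in> ball (0, \<alpha>) (r1 / 2)}"
    using o open_contains_ball by blast
  \<comment> \<open>If s and A - alpha both have norm below \<open>r1 / 2\<close>, then (s, A) lies
    in the ball of radius r1, where the map is injective; this gives uniqueness of A.\<close>
  define \<epsilon> where "\<epsilon> = min r2 (r1 / 2)"
  have e: "\<epsilon> > 0" using r1 r2 by (simp add: \<epsilon>_def)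
  have inV: "(s, 0) \<in> V" "g (s, 0) \<in> ball (0, \<alpha>) (r1 / 2)" if "s \<in> ball 0 \<epsilon>" for s
    using r2(2) that unfolding \<epsilon>_def by auto
  have gs: "g (s, 0) = (s, \<beta> s)" if "s \<in> ball 0 \<epsilon>" for s
    using \<Phi>g(1)[OF inV(1)[OF that]] unfolding \<Phi>_def \<beta>_def by (metis fst_conv prod.collapse)
  show thesis
  proof
    show "\<epsilon> > 0" "r1 / 2 > 0" using e r1 by auto
    show "\<beta> 0 = \<alpha>" by (simp add: \<beta>_def g0)
    show "Fh i (s, \<beta> s, 1) = 0" if "s \<in> ball 0 \<epsilon>" for s i
      using \<Phi>g(1)[OF inV(1)[OF that]] unfolding gs[OF that] \<Phi>_def by (simp add: vec_eq_iff)
    show "\<beta> s \<in> ball \<alpha> (r1 / 2)" if "s \<in> ball 0 \<epsilon>" for s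
    proof -
      have "dist \<alpha> (\<beta> s) \<le> dist (0, \<alpha>) (s, \<beta> s)" by (metis dist_snd_le snd_conv)
      then show ?thesis using inV(2)[OF that] unfolding gs[OF that] by simp
    qed
    show "A = \<beta> s" if sA: "s \<in> ball 0 \<epsilon>" "A \<in> ball \<alpha> (r1 / 2)" "\<And>i. Fh i (s, A, 1) = 0" for s A
    proof -
      have "dist (0, \<alpha>) (s, A) \<le> dist 0 s + dist \<alpha> A" unfolding dist_Pair_Pair by (rule sqrt_sum_squares_le_sum) auto
      also have "\<dots> < r1" using sA unfolding \<epsilon>_def by simp
      finally have "(s, A) \<in> U'" using r1 by auto
      from g\<Phi>[OF this] have "g (s, 0) = (s, A)" using sA(3) by (simp add: \<Phi>_def zero_vec_def)
      then show ?thesis by (simp add: \<beta>_def)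
    qed
    show "(\<lambda>s. \<beta> s $ i) holomorphic_on ball 0 \<epsilon>" for i
      unfolding holomorphic_on_open[OF open_ball]
    proof
      fix s :: complex assume s: "s \<in> ball 0 \<epsilon>"
      let ?y = "(s, 0) :: complex \<times> (complex ^ 'r)"
      let ?T = "d\<Phi> (g ?y)"
      have cl: "?T (c * fst v, c *s snd v) = (c * fst (?T v), c *s snd (?T v))" for c v
      proof -
        have "D i x (c * fst v, c *s snd v, 0) = c * D i x (fst v, snd v, 0)" for i x
          using D(3)[of i x c "(fst v, snd v, 0)"] by (simp add: cscale_def)
        then show ?thesis unfolding d\<Phi>_def by (simp add: vec_eq_iff)
      qed
      have bij: "bij ?T" using IFT(8) inV(1)[OF s] by blast
      \<comment> \<open>The inverse function theorem is a real one. The derivative of the inverse is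
        the inverse of a complex linear bijection, hence complex linear, and the graph is therefore
        holomorphic.\<close>
      have icl: "inv ?T (c * fst v, c *s snd v) = (c * fst (inv ?T v), c *s snd (inv ?T v))" for c v
      proof -
        have "?T (c * fst (inv ?T v), c *s snd (inv ?T v)) = (c * fst v, c *s snd v)"
          unfolding cl using bij by (simp add: bij_is_surj surj_f_inv_f)
        then show ?thesis by (metis bij bij_inv_eq_iff)
      qed
      have "((\<lambda>s. (s, 0) :: complex \<times> (complex ^ 'r)) has_derivative (\<lambda>v. (v, 0))) (at s)"
        by (intro has_derivative_Pair has_derivative_ident has_derivative_const)
      then have "((\<lambda>s. g (s, 0)) has_derivative (\<lambda>v. inv ?T (v, 0))) (at s)"
        by (rule has_derivative_compose) (use IFT(6,7) inV(1)[OF s] in force)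
      then have "((\<lambda>s. snd (g (s, 0))) has_derivative (\<lambda>v. snd (inv ?T (v, 0)))) (at s)"
        by (rule has_derivative_snd)
      then have "((\<lambda>s. snd (g (s, 0)) $ i) has_derivative (\<lambda>v. snd (inv ?T (v, 0)) $ i)) (at s)"
        by (rule bounded_linear.has_derivative[OF bounded_linear_vec_nth])
      moreover have "(\<lambda>v. snd (inv ?T (v, 0)) $ i) = (*) (snd (inv ?T (1, 0)) $ i)"
      proof
        fix v show "snd (inv ?T (v, 0)) $ i = snd (inv ?T (1, 0)) $ i * v"
          using icl[of v "(1, 0)"] by (simp add: mult.commute)
      qed
      ultimately show "\<exists>f'. ((\<lambda>s. \<beta> s $ i) has_field_derivative f') (at s)"
        unfolding has_field_derivative_def \<beta>_def by auto
    qed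
  qed
qed

end

context glc begin

section \<open>Limits along the curve\<close>

lemma tendsto_wzeta:
  assumes "(f \<longlongrightarrow> l) F" "l \<notin> \<Lambda>" shows "((\<lambda>x. \<zeta> (f x)) \<longlongrightarrow> \<zeta> l) F"
  using isCont_tendsto_compose[OF DERIV_isCont[OF wzeta_deriv[OF assms(2)]] assms(1)] .

lemma tendsto_wp:
  assumes "(f \<longlongrightarrow> l) F" "l \<notin> \<Lambda>" shows "((\<lambda>x. \<P> (f x)) \<longlongrightarrow> \<P> l) F"
  using isCont_tendsto_compose[OF DERIV_isCont[OF wp_deriv[OF assms(2)]] assms(1)] .

lemma eventually_tendsto_notin_lattice:
  assumes "(f \<longlongrightarrow> l) F" "l \<notin> \<Lambda>" shows "\<forall>\<^sub>F x in F. f x \<notin> \<Lambda>"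
  using topological_tendstoD[OF assms(1) open_compl_lattice] assms(2) by auto

lemma tendsto_times_wzeta:
  assumes t: "(t \<longlongrightarrow> 0) F" and nz: "\<forall>\<^sub>F x in F. t x \<noteq> 0"
  shows "((\<lambda>x. t x * \<zeta> (t x)) \<longlongrightarrow> 1) F"
proof -
  have "isCont zeta0 0" using DERIV_isCont[OF zeta0_deriv[of 0]] by simp
  then have "((\<lambda>x. zeta0 (t x)) \<longlongrightarrow> zeta0 0) F" by (rule isCont_tendsto_compose[OF _ t])
  then have "((\<lambda>x. 1 + t x * zeta0 (t x)) \<longlongrightarrow> 1 + 0 * zeta0 0) F" by (intro tendsto_intros t)
  then have "((\<lambda>x. 1 + t x * zeta0 (t x)) \<longlongrightarrow> 1) F" by simp
  then show ?thesis
    by (rule Lim_transform_eventually) (use nz in \<open>eventually_elim, simp add: wzeta_eq field_simps\<close>)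
qed

text \<open>A choice of representatives in which congruent limit points, and limit points congruent
  to a p_i, coincide. Distinct clusters then have differences off the lattice, so zeta stays bounded
  between them.\<close>

definition normalized :: "'k set \<Rightarrow> ('k \<Rightarrow> complex) \<Rightarrow> bool" where
  "normalized I a \<longleftrightarrow> (\<forall>\<mu>\<in>I. \<forall>\<nu>\<in>I. a \<mu> - a \<nu> \<in> \<Lambda> \<longrightarrow> a \<mu> = a \<nu>) \<and> (\<forall>\<mu>\<in>I. \<forall>i. a \<mu> - p i \<in> \<Lambda> \<longrightarrow> a \<mu> = p i)"

definition cluster :: "'k set \<Rightarrow> ('k \<Rightarrow> complex) \<Rightarrow> complex \<Rightarrow> 'k set" where
  "cluster I a c = {\<mu> \<in> I. a \<mu> = c}"

lemma sum_res_subset: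
  assumes "finite I" "K \<subseteq> I"
  shows "(\<Sum>\<mu>\<in>K. f \<mu> * res I b h \<mu>) = (\<Sum>\<mu>\<in>K. \<Sum>\<nu>\<in>K - {\<mu>}. f \<mu> * \<zeta> (b \<mu> - b \<nu>))
     + (\<Sum>\<mu>\<in>K. \<Sum>\<nu>\<in>I - K. f \<mu> * \<zeta> (b \<mu> - b \<nu>)) - (\<Sum>\<mu>\<in>K. \<Sum>i\<in>UNIV. f \<mu> * (cn i * \<zeta> (b \<mu> - p i))) + (\<Sum>\<mu>\<in>K. f \<mu>) * h"
proof -
  have fK: "finite K" using assms finite_subset by blast
  have "f \<mu> * res I b h \<mu> = (\<Sum>\<nu>\<in>K - {\<mu>}. f \<mu> * \<zeta> (b \<mu> - b \<nu>)) + (\<Sum>\<nu>\<in>I - K. f \<mu> * \<zeta> (b \<mu> - b \<nu>))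
      - (\<Sum>i\<in>UNIV. f \<mu> * (cn i * \<zeta> (b \<mu> - p i))) + f \<mu> * h" if "\<mu> \<in> K" for \<mu>
  proof -
    have e: "I - {\<mu>} = (K - {\<mu>}) \<union> (I - K)" using that assms by auto
    have "(\<Sum>\<nu>\<in>I - {\<mu>}. \<zeta> (b \<mu> - b \<nu>)) = (\<Sum>\<nu>\<in>K - {\<mu>}. \<zeta> (b \<mu> - b \<nu>)) + (\<Sum>\<nu>\<in>I - K. \<zeta> (b \<mu> - b \<nu>))"
      unfolding e by (rule sum.union_disjoint) (use assms fK in auto)
    then show ?thesis unfolding res_def by (simp add: sum_distrib_left algebra_simps)
  qed
  then show ?thesis by (simp add: sum.distrib sum_subtractf sum_distrib_right)
qed

context
  fixes I :: "'k set" and a :: "'k \<Rightarrow> complex" and b :: "'x \<Rightarrow> 'k \<Rightarrow> complex" and h :: "'x \<Rightarrow> complex" and F :: "'x filter"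
  assumes fin: "finite I" and norm: "normalized I a" and lim: "\<And>\<mu>. \<mu> \<in> I \<Longrightarrow> ((\<lambda>x. b x \<mu>) \<longlongrightarrow> a \<mu>) F"
    and eqs: "\<forall>\<^sub>F x in F. glc_eqs I (b x) (h x)" and F: "F \<noteq> bot"
begin

lemma cluster_pair_notin: "\<mu> \<in> cluster I a c \<Longrightarrow> \<nu> \<in> I - cluster I a c \<Longrightarrow> a \<mu> - a \<nu> \<notin> \<Lambda>"
  using norm unfolding normalized_def cluster_def by (metis (mono_tags, lifting) DiffE mem_Collect_eq)

lemma cluster_p_notin: "\<mu> \<in> I \<Longrightarrow> a \<mu> \<noteq> p i \<Longrightarrow> a \<mu> - p i \<notin> \<Lambda>"
  using norm unfolding normalized_def by blast

lemma tendsto_cross: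
  assumes "\<mu> \<in> cluster I a c" "\<nu> \<in> I - cluster I a c"
  shows "((\<lambda>x. \<zeta> (b x \<mu> - b x \<nu>)) \<longlongrightarrow> \<zeta> (a \<mu> - a \<nu>)) F"
  using assms by (intro tendsto_wzeta tendsto_diff lim cluster_pair_notin[OF assms]) (auto simp: cluster_def)

lemma tendsto_p:
  assumes "\<mu> \<in> I" "a \<mu> \<noteq> p i"
  shows "((\<lambda>x. \<zeta> (b x \<mu> - p i)) \<longlongrightarrow> \<zeta> (a \<mu> - p i)) F"
  using assms by (intro tendsto_wzeta tendsto_diff lim cluster_p_notin tendsto_const) auto

text \<open>Oddness of zeta cancels all interactions inside the cluster, the only node-node terms
  that are unbounded in the limit.\<close>

lemma cluster_sum_zero:
  "\<forall>\<^sub>F x in F. (\<Sum>\<mu>\<in>cluster I a c. \<Sum>\<nu>\<in>I - cluster I a c. \<zeta> (b x \<mu> - b x \<nu>))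
     - (\<Sum>\<mu>\<in>cluster I a c. \<Sum>i\<in>UNIV. cn i * \<zeta> (b x \<mu> - p i)) + of_nat (card (cluster I a c)) * h x = 0"
  using eqs
proof eventually_elim
  case (elim x)
  let ?K = "cluster I a c"
  have K: "?K \<subseteq> I" "finite ?K" using fin by (auto simp: cluster_def)
  have "(\<Sum>\<mu>\<in>?K. \<Sum>\<nu>\<in>?K - {\<mu>}. \<zeta> (b x \<mu> - b x \<nu>)) = 0"
    by (rule sum_offdiag_antisym[OF K(2)]) (rule wzeta_diff_commute)
  moreover have "(\<Sum>\<mu>\<in>?K. 1 * res I (b x) (h x) \<mu>) = 0"
    using elim K by (intro sum.neutral) (auto simp: glc_eqs_def)
  ultimately show ?case using sum_res_subset[OF fin K(1), of "\<lambda>_. 1" "b x" "h x"] by simp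
qed

context
  assumes hinf: "filterlim h at_infinity F"
begin

lemma tendsto_over_h: "(X \<longlongrightarrow> L) F \<Longrightarrow> ((\<lambda>x. X x / h x) \<longlongrightarrow> 0) F"
  using tendsto_divide_0[OF _ hinf] .

lemma eventually_h_nonzero: "\<forall>\<^sub>F x in F. h x \<noteq> 0"
  by (rule filterlim_at_infinity_imp_eventually_ne[OF hinf])

text \<open>For a cluster away from all p_i every term of the summed equation converges except the
  cluster size times h. Division by h would force the size to be zero.\<close>

lemma infinite_limit_in_p:
  assumes "\<mu> \<in> I" shows "\<exists>i. a \<mu> = p i"
proof (rule ccontr)
  assume np: "\<not> (\<exists>i. a \<mu> = p i)"
  let ?K = "cluster I a (a \<mu>)"
  define X where "X x = (\<Sum>\<mu>\<in>?K. \<Sum>\<nu>\<in>I - ?K. \<zeta> (b x \<mu> - b x \<nu>)) - (\<Sum>\<mu>\<in>?K. \<Sum>i\<in>UNIV. cn i * \<zeta> (b x \<mu> - p i))" for x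
  have "(X \<longlongrightarrow> (\<Sum>\<mu>\<in>?K. \<Sum>\<nu>\<in>I - ?K. \<zeta> (a \<mu> - a \<nu>)) - (\<Sum>\<mu>\<in>?K. \<Sum>i\<in>UNIV. cn i * \<zeta> (a \<mu> - p i))) F"
    unfolding X_def using np
    by (intro tendsto_diff tendsto_sum tendsto_mult tendsto_const tendsto_cross[of _ "a \<mu>"] tendsto_p) (auto simp: cluster_def)
  then have "((\<lambda>x. X x / h x) \<longlongrightarrow> 0) F" by (rule tendsto_over_h)
  moreover have "\<forall>\<^sub>F x in F. X x / h x = - of_nat (card ?K)"
    using cluster_sum_zero[of "a \<mu>"] eventually_h_nonzero
  proof eventually_elim
    case (elim x)
    then have "X x = - of_nat (card ?K) * h x" unfolding X_def by (simp add: add_eq_0_iff2)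
    then show ?case using elim by simp
  qed
  then have "((\<lambda>x. X x / h x) \<longlongrightarrow> - of_nat (card ?K)) F" by (rule tendsto_eventually)
  ultimately have "(of_nat (card ?K) :: complex) = 0" using tendsto_unique[OF F] by fastforce
  then have "card ?K = 0" by simp
  then show False using assms fin by (auto simp: cluster_def)
qed

text \<open>The unbounded part of A_i is T, the sum of zeta at the differences from p_i over the
  cluster. The summed cluster equation determines it: n_i T = k h plus bounded terms. Hence A_i = 2
  n_i (T - h) plus bounded terms is 2 (k - n_i) h to leading order, without asymptotics for single
  nodes.\<close>

lemma Af_over_h:
  "((\<lambda>x. Af I (b x) (h x) $ i / h x) \<longlongrightarrow> 2 * of_nat (card (cluster I a (p i))) - 2 * cn i) F"
proof -
  let ?K = "cluster I a (p i)"
  have K: "?K \<subseteq> I" "finite ?K" using fin by (auto simp: cluster_def)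
  have pne: "p i \<noteq> p j" if "j \<noteq> i" for j using p_distinct[of i j] that by auto
  define Y where "Y x = (\<Sum>\<mu>\<in>?K. \<Sum>\<nu>\<in>I - ?K. \<zeta> (b x \<mu> - b x \<nu>)) - (\<Sum>\<mu>\<in>?K. \<Sum>j\<in>UNIV - {i}. cn j * \<zeta> (b x \<mu> - p j))" for x
  have Y: "(Y \<longlongrightarrow> (\<Sum>\<mu>\<in>?K. \<Sum>\<nu>\<in>I - ?K. \<zeta> (a \<mu> - a \<nu>)) - (\<Sum>\<mu>\<in>?K. \<Sum>j\<in>UNIV - {i}. cn j * \<zeta> (a \<mu> - p j))) F"
    unfolding Y_def using pne
    by (intro tendsto_diff tendsto_sum tendsto_mult tendsto_const tendsto_cross[of _ "p i"] tendsto_p) (auto simp: cluster_def)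
  define Z where "Z x = (\<Sum>\<mu>\<in>I - ?K. \<zeta> (b x \<mu> - p i))" for x
  have Z: "(Z \<longlongrightarrow> (\<Sum>\<mu>\<in>I - ?K. \<zeta> (a \<mu> - p i))) F"
    unfolding Z_def by (intro tendsto_sum tendsto_p) (auto simp: cluster_def)
  define S where "S = (\<Sum>j\<in>UNIV - {i}. cn j * \<zeta> (p i - p j))"
  have "((\<lambda>x. 2 * (Y x / h x) + 2 * cn i * (Z x / h x) + 2 * cn i * (S / h x) + (2 * of_nat (card ?K) - 2 * cn i)) \<longlongrightarrow>
     2 * 0 + 2 * cn i * 0 + 2 * cn i * 0 + (2 * of_nat (card ?K) - 2 * cn i)) F"
    by (intro tendsto_intros tendsto_over_h[OF Y] tendsto_over_h[OF Z] tendsto_over_h[OF tendsto_const])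
  then have "((\<lambda>x. 2 * (Y x / h x) + 2 * cn i * (Z x / h x) + 2 * cn i * (S / h x) + (2 * of_nat (card ?K) - 2 * cn i)) \<longlongrightarrow>
     2 * of_nat (card ?K) - 2 * cn i) F" by simp
  then show ?thesis
  proof (rule Lim_transform_eventually)
    show "\<forall>\<^sub>F x in F. 2 * (Y x / h x) + 2 * cn i * (Z x / h x) + 2 * cn i * (S / h x) + (2 * of_nat (card ?K) - 2 * cn i) = Af I (b x) (h x) $ i / h x"
      using cluster_sum_zero[of "p i"] eventually_h_nonzero
    proof eventually_elim
      case (elim x)
      define T where "T = (\<Sum>\<mu>\<in>?K. \<zeta> (b x \<mu> - p i))"
      have "(\<Sum>\<mu>\<in>?K. \<Sum>j\<in>UNIV. cn j * \<zeta> (b x \<mu> - p j)) = cn i * T + (\<Sum>\<mu>\<in>?K. \<Sum>j\<in>UNIV - {i}. cn j * \<zeta> (b x \<mu> - p j))"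
        unfolding T_def sum_distrib_left sum.distrib[symmetric] by (intro sum.cong refl sum.remove) auto
      then have e1: "cn i * T = Y x + of_nat (card ?K) * h x" using elim(1) unfolding Y_def by (simp add: algebra_simps)
      have "(\<Sum>\<mu>\<in>I. \<zeta> (p i - b x \<mu>)) = - (\<Sum>\<mu>\<in>I. \<zeta> (b x \<mu> - p i))"
        unfolding sum_negf[symmetric] by (intro sum.cong refl wzeta_diff_commute)
      also have "(\<Sum>\<mu>\<in>I. \<zeta> (b x \<mu> - p i)) = Z x + T"
        unfolding Z_def T_def by (rule sum.subset_diff[OF K(1) fin])
      finally have "Af I (b x) (h x) $ i = 2 * cn i * (Z x + T + S - h x)" unfolding Af_nth[OF fin] S_def by simp
      also have "\<dots> = 2 * (cn i * T) + 2 * cn i * (Z x + S - h x)" by (simp add: algebra_simps)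
      also have "\<dots> = 2 * (Y x + of_nat (card ?K) * h x) + 2 * cn i * (Z x + S - h x)" unfolding e1 ..
      finally have A: "Af I (b x) (h x) $ i = 2 * (Y x + of_nat (card ?K) * h x) + 2 * cn i * (Z x + S - h x)" .
      show ?case unfolding A using elim(2) by (simp add: add_divide_distrib diff_divide_distrib algebra_simps)
    qed
  qed
qed

text \<open>The Riccati equation is evaluated at one fixed point z away from all limit points: there
  g = h + O(1), g' is bounded and the A_i are O(h), so B = h^2 + O(h).\<close>

lemma Bf_over_h2: "((\<lambda>x. Bf I (b x) (h x) / (h x)\<^sup>2) \<longlongrightarrow> 1) F"
proof -
  \<comment> \<open>Such a base point z exists because the forbidden translates of the lattice form
    a countable set.\<close>
  have "countable ((\<Union>\<mu>\<in>I. (\<lambda>w. a \<mu> + w) ` \<Lambda>) \<union> (\<Union>i. (\<lambda>w. p i + w) ` \<Lambda>))"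
    by (intro countable_Un countable_UN countable_image countable_lattice countable_finite fin finite)
  then have "(\<Union>\<mu>\<in>I. (\<lambda>w. a \<mu> + w) ` \<Lambda>) \<union> (\<Union>i. (\<lambda>w. p i + w) ` \<Lambda>) \<noteq> UNIV"
    using uncountable_UNIV_complex by metis
  then obtain z where "z \<notin> (\<Union>\<mu>\<in>I. (\<lambda>w. a \<mu> + w) ` \<Lambda>) \<union> (\<Union>i. (\<lambda>w. p i + w) ` \<Lambda>)" by blast
  then have z: "z - a \<mu> \<notin> \<Lambda>" "z - p i \<notin> \<Lambda>" if "\<mu> \<in> I" for \<mu> i
    using that by (auto simp: image_iff) (metis add_diff_cancel_left' diff_add_cancel add.commute)+
  have zp: "z - p i \<notin> \<Lambda>" for i
    using \<open>z \<notin> _\<close> by (auto simp: image_iff) (metis diff_add_cancel add.commute)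
  have lz: "((\<lambda>x. z - b x \<mu>) \<longlongrightarrow> z - a \<mu>) F" if "\<mu> \<in> I" for \<mu>
    using that by (intro tendsto_intros lim)
  define f where "f x = (\<Sum>\<mu>\<in>I. \<zeta> (z - b x \<mu>)) - (\<Sum>i\<in>UNIV. cn i * \<zeta> (z - p i))" for x
  have f: "(f \<longlongrightarrow> (\<Sum>\<mu>\<in>I. \<zeta> (z - a \<mu>)) - (\<Sum>i\<in>UNIV. cn i * \<zeta> (z - p i))) F"
    unfolding f_def using z by (intro tendsto_diff tendsto_sum tendsto_const tendsto_wzeta lz) auto
  define w where "w x = - (\<Sum>\<mu>\<in>I. \<P> (z - b x \<mu>)) + (\<Sum>i\<in>UNIV. cn i * \<P> (z - p i)) - (\<Sum>i\<in>UNIV. of_real (n i * (n i + 1)) * \<P> (z - p i))" for x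
  have w: "(w \<longlongrightarrow> - (\<Sum>\<mu>\<in>I. \<P> (z - a \<mu>)) + (\<Sum>i\<in>UNIV. cn i * \<P> (z - p i)) - (\<Sum>i\<in>UNIV. of_real (n i * (n i + 1)) * \<P> (z - p i))) F"
    unfolding w_def using z by (intro tendsto_diff tendsto_add tendsto_minus tendsto_sum tendsto_const tendsto_wp lz) auto
  have one: "((\<lambda>x. 1 / h x) \<longlongrightarrow> 0) F" by (rule tendsto_over_h) (rule tendsto_const)
  have "((\<lambda>x. (1 + f x / h x)\<^sup>2 + (w x / h x) * (1 / h x) - (\<Sum>i\<in>UNIV. (Af I (b x) (h x) $ i / h x) * (1 / h x) * \<zeta> (z - p i))) \<longlongrightarrow>
     (1 + 0)\<^sup>2 + 0 * 0 - (\<Sum>i\<in>UNIV. (2 * of_nat (card (cluster I a (p i))) - 2 * cn i) * 0 * \<zeta> (z - p i))) F"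
    by (intro tendsto_intros tendsto_over_h[OF f] tendsto_over_h[OF w] one Af_over_h)
  then have "((\<lambda>x. (1 + f x / h x)\<^sup>2 + (w x / h x) * (1 / h x) - (\<Sum>i\<in>UNIV. (Af I (b x) (h x) $ i / h x) * (1 / h x) * \<zeta> (z - p i))) \<longlongrightarrow> 1) F"
    by simp
  then show ?thesis
  proof (rule Lim_transform_eventually)
    have "\<forall>\<^sub>F x in F. \<forall>\<mu>\<in>I. z - b x \<mu> \<notin> \<Lambda>"
      using fin z lz by (auto intro!: eventually_ball_finite eventually_tendsto_notin_lattice)
    then show "\<forall>\<^sub>F x in F. (1 + f x / h x)\<^sup>2 + (w x / h x) * (1 / h x) - (\<Sum>i\<in>UNIV. (Af I (b x) (h x) $ i / h x) * (1 / h x) * \<zeta> (z - p i)) = Bf I (b x) (h x) / (h x)\<^sup>2"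
      using eqs eventually_h_nonzero
    proof eventually_elim
      case (elim x)
      have "(gfun I (b x) (h x) z)\<^sup>2 - (\<Sum>\<mu>\<in>I. \<P> (z - b x \<mu>)) + (\<Sum>i\<in>UNIV. cn i * \<P> (z - p i)) = Qpot \<tau> n p (Af I (b x) (h x)) (Bf I (b x) (h x)) z"
        by (rule riccati[OF elim(2)]) (use elim(1) zp in auto)
      moreover have "gfun I (b x) (h x) z = h x + f x" unfolding gfun_def f_def by simp
      ultimately have B: "Bf I (b x) (h x) = (h x + f x)\<^sup>2 + w x - (\<Sum>i\<in>UNIV. Af I (b x) (h x) $ i * \<zeta> (z - p i))"
        unfolding Qpot_def w_def by (simp add: algebra_simps)
      have s: "(\<Sum>i\<in>UNIV. (Af I (b x) (h x) $ i / h x) * (1 / h x) * \<zeta> (z - p i)) = (\<Sum>i\<in>UNIV. Af I (b x) (h x) $ i * \<zeta> (z - p i)) / (h x)\<^sup>2"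
        unfolding sum_divide_distrib by (intro sum.cong refl) (simp add: power2_eq_square)
      have q: "(1 + f x / h x)\<^sup>2 = (h x + f x)\<^sup>2 / (h x)\<^sup>2" using elim(3) by (simp add: field_simps power2_eq_square)
      show ?case unfolding B s q by (simp add: add_divide_distrib diff_divide_distrib power2_eq_square)
    qed
  qed
qed

text \<open>The rescaled triples (1/h, A/h, B/h^2) are zeros of the weighted homogeneous
  obstructions, and so is their limit. There 2 k_i - 2 n_i must be among the listed roots of
  \<open>Fpoly\<close>, which bounds the cluster size; all nodes end at some p_i, which gives the
  sum.\<close>

lemma limit_index:
  shows "(\<lambda>i. card (cluster I a (p i))) \<in> boundary_indices n"
    and "\<forall>i. Fh i (0, \<chi> i. 2 * of_nat (card (cluster I a (p i))) - 2 * cn i, 1) = 0"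
proof -
  let ?\<alpha> = "\<chi> i. 2 * of_nat (card (cluster I a (p i))) - 2 * cn i"
  have one: "((\<lambda>x. 1 / h x) \<longlongrightarrow> 0) F" by (rule tendsto_over_h) (rule tendsto_const)
  have "((\<lambda>x. \<chi> i. Af I (b x) (h x) $ i / h x) \<longlongrightarrow> ?\<alpha>) F"
    by (intro tendsto_vec_lambda Af_over_h)
  then have l: "((\<lambda>x. (1 / h x, \<chi> i. Af I (b x) (h x) $ i / h x, Bf I (b x) (h x) / (h x)\<^sup>2)) \<longlongrightarrow> (0, ?\<alpha>, 1)) F"
    by (intro tendsto_Pair one Bf_over_h2)
  have z: "Fh i (0, ?\<alpha>, 1) = 0" for i
  proof -
    have "isCont (Fh i) (0, ?\<alpha>, 1)"
      using C1_several_continuous[OF C1_Fh] by (simp add: continuous_on_eq_continuous_at)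
    from isCont_tendsto_compose[OF this l]
    have "((\<lambda>x. Fh i (1 / h x, \<chi> i. Af I (b x) (h x) $ i / h x, Bf I (b x) (h x) / (h x)\<^sup>2)) \<longlongrightarrow> Fh i (0, ?\<alpha>, 1)) F" .
    moreover have "\<forall>\<^sub>F x in F. Fh i (1 / h x, \<chi> i. Af I (b x) (h x) $ i / h x, Bf I (b x) (h x) / (h x)\<^sup>2) = 0"
      using eqs
    proof eventually_elim
      case (elim x)
      have e: "(1 / h x, \<chi> i. Af I (b x) (h x) $ i / h x, Bf I (b x) (h x) / (h x)\<^sup>2) =
         ((1 / h x) * 1, (1 / h x) *s Af I (b x) (h x), (1 / h x)\<^sup>2 * Bf I (b x) (h x))"
        by (simp add: vec_eq_iff power_one_over)
      show ?case unfolding e Fh_scale Fh_1 log_free[OF elim] by simp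
    qed
    then have "((\<lambda>x. Fh i (1 / h x, \<chi> i. Af I (b x) (h x) $ i / h x, Bf I (b x) (h x) / (h x)\<^sup>2)) \<longlongrightarrow> 0) F"
      by (rule tendsto_eventually)
    ultimately show ?thesis using tendsto_unique[OF F] by blast
  qed
  then show "\<forall>i. Fh i (0, ?\<alpha>, 1) = 0" by blast
  have le: "card (cluster I a (p i)) \<le> ell n i" for i
  proof -
    have "poly (Fpoly (ell n i) 1) (2 * of_nat (card (cluster I a (p i))) - of_nat (ell n i)) = 0"
      using z[of i] unfolding Fh_infinity of_nat_ell by simp
    then have "2 * of_nat (card (cluster I a (p i))) - of_nat (ell n i) \<in> (\<lambda>k. 2 * of_nat k - of_nat (ell n i) :: complex) ` {..ell n i}"
      unfolding Fpoly_roots(1)[OF ell_pos, symmetric] by simp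
    then obtain k where "k \<le> ell n i" "2 * of_nat (card (cluster I a (p i))) - of_nat (ell n i) = (2 * of_nat k - of_nat (ell n i) :: complex)" by auto
    then show ?thesis by simp
  qed
  have "card I = (\<Sum>i\<in>UNIV. card (cluster I a (p i)))"
  proof -
    have "I = (\<Union>i. cluster I a (p i))" using infinite_limit_in_p by (auto simp: cluster_def)
    then have "card I = card (\<Union>i. cluster I a (p i))" by simp
    also have "\<dots> = (\<Sum>i\<in>UNIV. card (cluster I a (p i)))"
    proof (rule card_UN_disjoint)
      show "\<forall>i\<in>UNIV. finite (cluster I a (p i))" using fin by (auto simp: cluster_def)
      show "\<forall>i\<in>UNIV. \<forall>j\<in>UNIV. i \<noteq> j \<longrightarrow> cluster I a (p i) \<inter> cluster I a (p j) = {}"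
        using p_distinct by (force simp: cluster_def)
    qed simp
    finally show ?thesis .
  qed
  moreover have "card I = N"
    using eventually_happens[OF eqs] F by (auto simp: glc_eqs_def generic_def)
  ultimately show "(\<lambda>i. card (cluster I a (p i))) \<in> boundary_indices n"
    using le by (simp add: boundary_indices_def)
qed

end

text \<open>Weighting the equations of a cluster at \<open>c\<close> by \<open>b x \<mu> - c\<close> gives \<open>k (k - 1) / 2 - n i k = 0\<close>
  for its size \<open>k\<close> (with \<open>n i = 0\<close> if \<open>c\<close> is not a singular point).\<close>

lemma finite_limit_glc_eqs:
  assumes h: "(h \<longlongrightarrow> h0) F" and le: "\<And>i. card (cluster I a (p i)) \<le> ell n i"
  shows "glc_eqs I a h0"
proof -
  have gen: "\<forall>\<^sub>F x in F. generic I (b x)" using eqs by eventually_elim (simp add: glc_eqs_def)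
  have size: "of_nat (card (cluster I a c)) * (of_nat (card (cluster I a c)) - 1) =
      2 * (\<Sum>\<mu>\<in>cluster I a c. \<Sum>i\<in>UNIV. (if c = p i then cn i else 0))" for c
  proof -
    let ?K = "cluster I a c"
    have K: "?K \<subseteq> I" "finite ?K" using fin by (auto simp: cluster_def)
    have l0: "((\<lambda>x. b x \<mu> - c) \<longlongrightarrow> 0) F" if "\<mu> \<in> ?K" for \<mu>
      using tendsto_diff[OF lim tendsto_const, of \<mu> c] that by (auto simp: cluster_def)
    define W where "W x = (\<Sum>\<mu>\<in>?K. \<Sum>\<nu>\<in>?K - {\<mu>}. (b x \<mu> - c) * \<zeta> (b x \<mu> - b x \<nu>))" for x
    \<comment> \<open>Averaging over the two orders of a pair turns the weight into the difference
      of the two nodes, so that each summand has the form t zeta(t), with limit 1.\<close>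
    have W2: "2 * W x = (\<Sum>\<mu>\<in>?K. \<Sum>\<nu>\<in>?K - {\<mu>}. (b x \<mu> - b x \<nu>) * \<zeta> (b x \<mu> - b x \<nu>))" for x
    proof -
      have "W x = (\<Sum>\<mu>\<in>?K. \<Sum>\<nu>\<in>?K - {\<mu>}. (b x \<nu> - c) * \<zeta> (b x \<nu> - b x \<mu>))"
        unfolding W_def by (rule sum_offdiag_swap[OF K(2)])
      also have "\<dots> = (\<Sum>\<mu>\<in>?K. \<Sum>\<nu>\<in>?K - {\<mu>}. - ((b x \<nu> - c) * \<zeta> (b x \<mu> - b x \<nu>)))"
      proof (intro sum.cong refl)
        fix \<mu> \<nu> show "(b x \<nu> - c) * \<zeta> (b x \<nu> - b x \<mu>) = - ((b x \<nu> - c) * \<zeta> (b x \<mu> - b x \<nu>))"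
          by (subst wzeta_diff_commute) simp
      qed
      finally have "2 * W x = W x + (\<Sum>\<mu>\<in>?K. \<Sum>\<nu>\<in>?K - {\<mu>}. - ((b x \<nu> - c) * \<zeta> (b x \<mu> - b x \<nu>)))" by simp
      also have "\<dots> = (\<Sum>\<mu>\<in>?K. \<Sum>\<nu>\<in>?K - {\<mu>}. (b x \<mu> - b x \<nu>) * \<zeta> (b x \<mu> - b x \<nu>))"
        unfolding W_def sum.distrib[symmetric] by (intro sum.cong refl) (simp add: algebra_simps)
      finally show ?thesis .
    qed
    have "((\<lambda>x. (b x \<mu> - b x \<nu>) * \<zeta> (b x \<mu> - b x \<nu>)) \<longlongrightarrow> 1) F" if "\<mu> \<in> ?K" "\<nu> \<in> ?K - {\<mu>}" for \<mu> \<nu>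
    proof (rule tendsto_times_wzeta)
      show "((\<lambda>x. b x \<mu> - b x \<nu>) \<longlongrightarrow> 0) F"
        using tendsto_diff[OF l0[OF that(1)], of "\<lambda>x. b x \<nu> - c" 0] l0[of \<nu>] that by simp
      show "\<forall>\<^sub>F x in F. b x \<mu> - b x \<nu> \<noteq> 0"
        using gen
      proof eventually_elim
        case (elim x)
        have "\<mu> \<in> I" "\<nu> \<in> I" "\<mu> \<noteq> \<nu>" using that K by auto
        then have "b x \<mu> - b x \<nu> \<notin> \<Lambda>" using elim by (simp add: generic_def)
        then show ?case using zero_in_lattice by metis
      qed
    qed
    then have "((\<lambda>x. 2 * W x) \<longlongrightarrow> (\<Sum>\<mu>\<in>?K. \<Sum>\<nu>\<in>?K - {\<mu>}. 1)) F"
      unfolding W2 by (intro tendsto_sum) auto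
    moreover have "(\<Sum>\<mu>\<in>?K. \<Sum>\<nu>\<in>?K - {\<mu>}. 1 :: complex) = of_nat (card ?K) * (of_nat (card ?K) - 1)"
    proof -
      have "(\<Sum>\<nu>\<in>?K - {\<mu>}. 1 :: complex) = of_nat (card ?K) - 1" if "\<mu> \<in> ?K" for \<mu>
        using that K card_gt_0_iff[of ?K] by (auto simp: of_nat_diff Suc_leI)
      then show ?thesis by simp
    qed
    ultimately have lW: "((\<lambda>x. 2 * W x) \<longlongrightarrow> of_nat (card ?K) * (of_nat (card ?K) - 1)) F" by (simp only:)
    have lp: "((\<lambda>x. (b x \<mu> - c) * (cn i * \<zeta> (b x \<mu> - p i))) \<longlongrightarrow> (if c = p i then cn i else 0)) F" if "\<mu> \<in> ?K" for \<mu> i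
    proof (cases "c = p i")
      case True
      have "((\<lambda>x. (b x \<mu> - p i) * \<zeta> (b x \<mu> - p i)) \<longlongrightarrow> 1) F"
      proof (rule tendsto_times_wzeta)
        show "((\<lambda>x. b x \<mu> - p i) \<longlongrightarrow> 0) F" using l0[OF that] True by simp
        show "\<forall>\<^sub>F x in F. b x \<mu> - p i \<noteq> 0"
          using gen
        proof eventually_elim
          case (elim x)
          have "b x \<mu> - p i \<notin> \<Lambda>" using elim that K by (auto simp: generic_def)
          then show ?case using zero_in_lattice by metis
        qed
      qed
      from tendsto_mult[OF tendsto_const[of "cn i"] this] show ?thesis using True by (simp add: mult_ac)
    next
      case False
      have "((\<lambda>x. (b x \<mu> - c) * (cn i * \<zeta> (b x \<mu> - p i))) \<longlongrightarrow> 0 * (cn i * \<zeta> (a \<mu> - p i))) F"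
        using that False by (intro tendsto_mult l0 tendsto_const tendsto_p) (auto simp: cluster_def)
      then show ?thesis using False by simp
    qed
    have lc: "((\<lambda>x. (b x \<mu> - c) * \<zeta> (b x \<mu> - b x \<nu>)) \<longlongrightarrow> 0) F" if "\<mu> \<in> ?K" "\<nu> \<in> I - ?K" for \<mu> \<nu>
      using tendsto_mult[OF l0[OF that(1)] tendsto_cross[OF that]] by simp
    have "((\<lambda>x. 2 * W x + 2 * (\<Sum>\<mu>\<in>?K. \<Sum>\<nu>\<in>I - ?K. (b x \<mu> - c) * \<zeta> (b x \<mu> - b x \<nu>)) - 2 * (\<Sum>\<mu>\<in>?K. \<Sum>i\<in>UNIV. (b x \<mu> - c) * (cn i * \<zeta> (b x \<mu> - p i))) + 2 * ((\<Sum>\<mu>\<in>?K. b x \<mu> - c) * h x))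
       \<longlongrightarrow> of_nat (card ?K) * (of_nat (card ?K) - 1) + 2 * (\<Sum>\<mu>\<in>?K. \<Sum>\<nu>\<in>I - ?K. 0) - 2 * (\<Sum>\<mu>\<in>?K. \<Sum>i\<in>UNIV. (if c = p i then cn i else 0)) + 2 * ((\<Sum>\<mu>\<in>?K. 0) * h0)) F"
      by (intro tendsto_add tendsto_diff tendsto_mult tendsto_sum lW lc lp l0 h tendsto_const)
    moreover have "\<forall>\<^sub>F x in F. 2 * W x + 2 * (\<Sum>\<mu>\<in>?K. \<Sum>\<nu>\<in>I - ?K. (b x \<mu> - c) * \<zeta> (b x \<mu> - b x \<nu>)) - 2 * (\<Sum>\<mu>\<in>?K. \<Sum>i\<in>UNIV. (b x \<mu> - c) * (cn i * \<zeta> (b x \<mu> - p i))) + 2 * ((\<Sum>\<mu>\<in>?K. b x \<mu> - c) * h x) = 0"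
      using eqs
    proof eventually_elim
      case (elim x)
      have "(\<Sum>\<mu>\<in>?K. (b x \<mu> - c) * res I (b x) (h x) \<mu>) = 0"
        using elim K by (intro sum.neutral) (auto simp: glc_eqs_def)
      then show ?case using sum_res_subset[OF fin K(1), of "\<lambda>\<mu>. b x \<mu> - c" "b x" "h x"] unfolding W_def
        by (simp add: algebra_simps)
    qed
    ultimately have "of_nat (card ?K) * (of_nat (card ?K) - 1) + 2 * (\<Sum>\<mu>\<in>?K. \<Sum>\<nu>\<in>I - ?K. 0) - 2 * (\<Sum>\<mu>\<in>?K. \<Sum>i\<in>UNIV. (if c = p i then cn i else 0)) + 2 * ((\<Sum>\<mu>\<in>?K. 0) * h0) = 0"
      by (rule tendsto_unique[OF F _ tendsto_eventually])
    then show ?thesis by simp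
  qed
  \<comment> \<open>For a nonempty cluster at p_i the size equation gives k = 2 n_i + 1, exceeding
    the assumed bound by one.\<close>
  have np: "a \<mu> \<noteq> p i" if "\<mu> \<in> I" for \<mu> i
  proof
    assume e: "a \<mu> = p i"
    let ?k = "card (cluster I a (p i))"
    have "(\<Sum>j\<in>UNIV. (if p i = p j then cn j else 0)) = cn i"
    proof -
      have "(if p i = p j then cn j else 0) = (if j = i then cn j else 0)" for j using p_distinct[of i j] by auto
      then show ?thesis by simp
    qed
    then have "of_nat ?k * (of_nat ?k - 1) = of_nat ?k * (of_nat (ell n i) :: complex)"
      using size[of "p i"] by (simp add: of_nat_ell)
    moreover have "?k > 0" using that e fin by (auto simp: cluster_def card_gt_0_iff)
    ultimately have "(of_nat ?k :: complex) - 1 = of_nat (ell n i)"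
      by (simp only: mult_cancel_left of_nat_eq_0_iff) simp
    then have "(of_nat ?k :: complex) = of_nat (Suc (ell n i))" by (simp add: algebra_simps)
    then have "?k = Suc (ell n i)" by (simp only: of_nat_eq_iff)
    then show False using le[of i] by simp
  qed
  \<comment> \<open>Away from the singular points the size equation reads k (k - 1) = 0, so every
    cluster is a single node.\<close>
  have inj: "\<mu> = \<nu>" if "\<mu> \<in> I" "\<nu> \<in> I" "a \<mu> = a \<nu>" for \<mu> \<nu>
  proof -
    let ?K = "cluster I a (a \<mu>)"
    have K: "finite ?K" "\<mu> \<in> ?K" "\<nu> \<in> ?K" using fin that by (auto simp: cluster_def)
    have "(of_nat (card ?K) :: complex) * (of_nat (card ?K) - 1) = 0" using size[of "a \<mu>"] np[OF that(1)] by simp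
    moreover have "card ?K \<noteq> 0" using K by auto
    ultimately have "card ?K = 1" by (metis eq_iff_diff_eq_0 mult_eq_0_iff of_nat_1 of_nat_eq_0_iff of_nat_eq_iff)
    then show ?thesis using K by (metis card_1_singletonE singletonD)
  qed
  have g: "generic I a"
    unfolding generic_def
  proof (intro conjI ballI allI impI)
    show "finite I" by (rule fin)
    show "card I = N" using eventually_happens[OF gen] F by (auto simp: generic_def)
    show "a \<mu> - a \<nu> \<notin> \<Lambda>" if "\<mu> \<in> I" "\<nu> \<in> I" "\<mu> \<noteq> \<nu>" for \<mu> \<nu>
      using norm inj that unfolding normalized_def by blast
    show "a \<mu> - p i \<notin> \<Lambda>" if "\<mu> \<in> I" for \<mu> i using cluster_p_notin np that by blast
  qed
  have "res I a h0 \<mu> = 0" if \<mu>: "\<mu> \<in> I" for \<mu>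
  proof -
    have "((\<lambda>x. res I (b x) (h x) \<mu>) \<longlongrightarrow> res I a h0 \<mu>) F"
      unfolding res_def using g \<mu>
      by (intro tendsto_add tendsto_diff tendsto_sum tendsto_mult tendsto_const tendsto_wzeta lim h) (auto simp: generic_def)
    moreover have "\<forall>\<^sub>F x in F. res I (b x) (h x) \<mu> = 0" using eqs by eventually_elim (use \<mu> in \<open>auto simp: glc_eqs_def\<close>)
    ultimately show ?thesis by (rule tendsto_unique[OF F _ tendsto_eventually])
  qed
  then show ?thesis using g by (simp add: glc_eqs_def)
qed

end

end

section \<open>Branches of the curve at infinity\<close>

text \<open>Gaussian elimination with one pivot per step, by induction on the number of columns.
  Rows and columns are arbitrary finite sets of equal size, so the nodes can serve as indices
  directly.\<close>

lemma injective_imp_solvable: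
  fixes J :: "'a \<Rightarrow> 'b \<Rightarrow> complex"
  assumes "finite R" "finite C" "card R = card C"
    and "\<And>v. (\<forall>i\<in>R. (\<Sum>j\<in>C. J i j * v j) = 0) \<Longrightarrow> (\<forall>j\<in>C. v j = 0)"
  shows "\<exists>v. \<forall>i\<in>R. (\<Sum>j\<in>C. J i j * v j) = f i"
  using assms
proof (induction "card C" arbitrary: R C J f)
  case 0
  then show ?case by auto
next
  case (Suc m)
  obtain a where a: "a \<in> C" using Suc.hyps(2) by (metis card.empty ex_in_conv nat.distinct(1))
  have "\<exists>b\<in>R. J b a \<noteq> 0"
  proof (rule ccontr)
    assume "\<not> (\<exists>b\<in>R. J b a \<noteq> 0)"
    then have "\<forall>i\<in>R. (\<Sum>j\<in>C. J i j * (if j = a then 1 else 0)) = 0"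
      using a Suc.prems(2) by (simp add: if_distrib cong: if_cong)
    then have "\<forall>j\<in>C. (if j = a then 1 else 0) = (0::complex)" by (rule Suc.prems(4))
    then show False using a by auto
  qed
  then obtain b where b: "b \<in> R" "J b a \<noteq> 0" by blast
  \<comment> \<open>The Schur complement of the pivot entry; a kernel vector of it extends uniquely
    to one of J, so injectivity is inherited.\<close>
  define J' where "J' i j = J i j - J i a * J b j / J b a" for i j
  have rC: "(\<Sum>j\<in>C. g j) = g a + (\<Sum>j\<in>C - {a}. g j)" for g :: "'b \<Rightarrow> complex"
    by (rule sum.remove[OF Suc.prems(2) a])
  have J's: "(\<Sum>j\<in>C - {a}. J' i j * w j) = (\<Sum>j\<in>C - {a}. J i j * w j) - J i a / J b a * (\<Sum>j\<in>C - {a}. J b j * w j)" for i w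
    unfolding J'_def sum_distrib_left sum_subtractf[symmetric] by (intro sum.cong refl) (simp add: algebra_simps)
  have rest: "(\<Sum>j\<in>C - {a}. J i j * (if j = a then x else w j)) = (\<Sum>j\<in>C - {a}. J i j * w j)" for i x w
    by (intro sum.cong) auto
  have inj': "\<forall>j\<in>C - {a}. w j = 0" if w: "\<forall>i\<in>R - {b}. (\<Sum>j\<in>C - {a}. J' i j * w j) = 0" for w
  proof -
    define v where "v j = (if j = a then - (\<Sum>j\<in>C - {a}. J b j * w j) / J b a else w j)" for j
    have "(\<Sum>j\<in>C. J i j * v j) = 0" if "i \<in> R" for i
    proof (cases "i = b")
      case True
      then show ?thesis unfolding rC v_def rest using b by simp
    next
      case False
      then show ?thesis unfolding rC v_def rest using w that J's[of i w] by (simp add: algebra_simps)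
    qed
    then have v0: "\<forall>j\<in>C. v j = 0" using Suc.prems(4) by blast
    show ?thesis
    proof
      fix j assume "j \<in> C - {a}"
      then show "w j = 0" using v0 by (auto simp: v_def)
    qed
  qed
  have "\<exists>w. \<forall>i\<in>R - {b}. (\<Sum>j\<in>C - {a}. J' i j * w j) = f i - J i a * f b / J b a"
    by (rule Suc.hyps(1)) (use Suc.hyps(2) Suc.prems a b inj' in auto)
  then obtain w where w: "\<forall>i\<in>R - {b}. (\<Sum>j\<in>C - {a}. J' i j * w j) = f i - J i a * f b / J b a" by blast
  define v where "v j = (if j = a then (f b - (\<Sum>j\<in>C - {a}. J b j * w j)) / J b a else w j)" for j
  have "(\<Sum>j\<in>C. J i j * v j) = f i" if "i \<in> R" for i
  proof (cases "i = b")
    case True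
    then show ?thesis unfolding rC v_def rest using b by simp
  next
    case False
    then have "(\<Sum>j\<in>C - {a}. J' i j * w j) = f i - J i a * f b / J b a" using w that by blast
    then have e: "(\<Sum>j\<in>C - {a}. J i j * w j) = f i - J i a * f b / J b a + J i a / J b a * (\<Sum>j\<in>C - {a}. J b j * w j)"
      unfolding J's by (simp add: algebra_simps)
    show ?thesis unfolding rC v_def rest e by (simp add: algebra_simps diff_divide_distrib)
  qed
  then show ?case by blast
qed

text \<open>Solving for the unit vectors gives a right inverse M. Then J annihilates the columns of
  M J - 1, and injectivity makes M a left inverse as well.\<close>

lemma injective_imp_inverse_matrix:
  fixes J :: "'k \<Rightarrow> 'k \<Rightarrow> complex"
  assumes I: "finite I" and inj: "\<And>v. (\<forall>i\<in>I. (\<Sum>j\<in>I. J i j * v j) = 0) \<Longrightarrow> (\<forall>j\<in>I. v j = 0)"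
  obtains L where "\<And>i j. i \<in> I \<Longrightarrow> j \<in> I \<Longrightarrow> (\<Sum>m\<in>I. J i m * L m j) = (if i = j then 1 else 0)"
    "\<And>i j. i \<in> I \<Longrightarrow> j \<in> I \<Longrightarrow> (\<Sum>m\<in>I. L i m * J m j) = (if i = j then 1 else 0)"
proof -
  have "\<exists>v. \<forall>i\<in>I. (\<Sum>m\<in>I. J i m * v m) = (if i = j then 1 else 0)" for j
    by (rule injective_imp_solvable[OF I I refl inj])
  then obtain M where M: "\<And>j i. i \<in> I \<Longrightarrow> (\<Sum>m\<in>I. J i m * M j m) = (if i = j then 1 else 0)" by metis
  have "(\<Sum>m\<in>I. M m i * J m j) = (if i = j then 1 else 0)" if ij: "i \<in> I" "j \<in> I" for i j
  proof -
    define w where "w i = (\<Sum>m\<in>I. M m i * J m j) - (if i = j then 1 else 0)" for i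
    have "(\<Sum>i\<in>I. J l i * w i) = 0" if l: "l \<in> I" for l
    proof -
      have "(\<Sum>i\<in>I. J l i * w i) = (\<Sum>i\<in>I. \<Sum>m\<in>I. J l i * M m i * J m j) - J l j"
      proof -
        have "J l i * w i = (\<Sum>m\<in>I. J l i * M m i * J m j) - (if i = j then J l i else 0)" for i
          by (simp add: w_def right_diff_distrib sum_distrib_left mult.assoc)
        then show ?thesis using ij I by (simp add: sum_subtractf)
      qed
      also have "(\<Sum>i\<in>I. \<Sum>m\<in>I. J l i * M m i * J m j) = (\<Sum>m\<in>I. (\<Sum>i\<in>I. J l i * M m i) * J m j)"
        by (subst sum.swap) (simp add: sum_distrib_right)
      also have "\<dots> = (\<Sum>m\<in>I. (if l = m then 1 else 0) * J m j)"
        by (intro sum.cong refl) (simp add: M[OF l])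
      also have "\<dots> = J l j" using l I by (simp add: if_distrib[of "\<lambda>x. x * _"] cong: if_cong)
      finally show ?thesis by simp
    qed
    then have "\<forall>i\<in>I. w i = 0" using inj by blast
    then show ?thesis using ij by (simp add: w_def)
  qed
  then show thesis using that[of "\<lambda>i m. M m i"] M by auto
qed

text \<open>Banach iteration in the maximum norm over I. The contraction factor 1/2 and an initial
  displacement of at most half the radius keep the iterates in the polydisc; convergence is obtained
  coordinatewise, as values outside I are arbitrary.\<close>

lemma contraction_fixpoint_polydisc:
  fixes T :: "('k \<Rightarrow> complex) \<Rightarrow> 'k \<Rightarrow> complex"
  assumes I: "finite I" and \<rho>: "\<rho> > 0"
    and contr: "\<And>x y d. \<forall>i\<in>I. x i \<in> cball (c i) \<rho> \<Longrightarrow> \<forall>i\<in>I. y i \<in> cball (c i) \<rho> \<Longrightarrow> \<forall>i\<in>I. norm (x i - y i) \<le> d \<Longrightarrow>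
       \<forall>i\<in>I. norm (T x i - T y i) \<le> d / 2"
    and start: "\<forall>i\<in>I. norm (T c i - c i) \<le> \<rho> / 2"
  obtains x where "\<forall>i\<in>I. x i \<in> cball (c i) \<rho>" "\<forall>i\<in>I. T x i = x i"
proof -
  define X where "X m = (T ^^ m) c" for m
  have XS: "X (Suc m) = T (X m)" for m by (simp add: X_def)
  have inb: "\<forall>i\<in>I. X m i \<in> cball (c i) \<rho>" for m
  proof (induction m)
    case 0 then show ?case using \<rho> by (simp add: X_def)
  next
    case (Suc m)
    have "\<forall>i\<in>I. norm (T (X m) i - T c i) \<le> \<rho> / 2"
      by (rule contr[OF Suc]) (use \<rho> Suc in \<open>auto simp: dist_norm norm_minus_commute\<close>)
    then show ?case unfolding XS using start
    proof (intro ballI)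
      fix i assume i: "i \<in> I"
      have "norm (T (X m) i - c i) \<le> norm (T (X m) i - T c i) + norm (T c i - c i)"
        using norm_triangle_ineq[of "T (X m) i - T c i" "T c i - c i"] by simp
      then show "T (X m) i \<in> cball (c i) \<rho>"
        using \<open>\<forall>i\<in>I. norm (T (X m) i - T c i) \<le> \<rho> / 2\<close> start i by (fastforce simp: dist_norm norm_minus_commute)
    qed
  qed
  have step: "\<forall>i\<in>I. norm (X (Suc m) i - X m i) \<le> \<rho> * (1/2) ^ Suc m" for m
  proof (induction m)
    case 0 then show ?case using start by (simp add: X_def)
  next
    case (Suc m)
    from contr[OF inb[of "Suc m"] inb[of m] Suc] show ?case by (simp add: XS)
  qed
  have "\<exists>l. (\<lambda>m. X m i) \<longlonglongrightarrow> l" if i: "i \<in> I" for i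
  proof -
    have "summable (\<lambda>m. \<rho> * (1/2 :: real) ^ Suc m)"
      by (intro summable_mult summable_ignore_initial_segment[of _ 1, simplified] summable_geometric) simp
    then have "summable (\<lambda>m. X (Suc m) i - X m i)"
      by (rule summable_comparison_test'[where N = 0]) (use step i in auto)
    then have "(\<lambda>m. (\<Sum>k<m. X (Suc k) i - X k i)) \<longlonglongrightarrow> (\<Sum>k. X (Suc k) i - X k i)" by (rule summable_LIMSEQ)
    moreover have "(\<Sum>k<m. X (Suc k) i - X k i) = X m i - X 0 i" for m
      by (rule sum_lessThan_telescope)
    ultimately have "(\<lambda>m. X m i - X 0 i) \<longlonglongrightarrow> (\<Sum>k. X (Suc k) i - X k i)" by simp
    from tendsto_add[OF this tendsto_const[of "X 0 i"]] show ?thesis by auto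
  qed
  then obtain x where x: "\<And>i. i \<in> I \<Longrightarrow> (\<lambda>m. X m i) \<longlonglongrightarrow> x i" by metis
  have xb: "\<forall>i\<in>I. x i \<in> cball (c i) \<rho>"
  proof
    fix i assume i: "i \<in> I"
    show "x i \<in> cball (c i) \<rho>"
      by (rule closed_sequentially[OF closed_cball _ x[OF i]]) (use inb i in blast)
  qed
  have "T x i = x i" if i: "i \<in> I" for i
  proof -
    have "(\<lambda>m. X (Suc m) i) \<longlonglongrightarrow> T x i"
    proof (rule tendstoI)
      fix e :: real assume e: "e > 0"
      have "\<forall>\<^sub>F m in sequentially. \<forall>j\<in>I. dist (X m j) (x j) < e"
        using I x e by (auto intro!: eventually_ball_finite tendstoD)
      then show "\<forall>\<^sub>F m in sequentially. dist (X (Suc m) i) (T x i) < e"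
      proof eventually_elim
        case (elim m)
        have "\<forall>j\<in>I. norm (T (X m) j - T x j) \<le> e / 2"
          by (rule contr[OF inb xb]) (use elim in \<open>auto simp: dist_norm less_imp_le\<close>)
        then have "norm (T (X m) i - T x i) \<le> e / 2" using i by blast
        then show ?case using e by (simp add: XS dist_norm)
      qed
    qed
    moreover have "(\<lambda>m. X (Suc m) i) \<longlonglongrightarrow> x i" using x[OF i] by (rule LIMSEQ_Suc)
    ultimately show ?thesis using LIMSEQ_unique by blast
  qed
  then show thesis using that xb by blast
qed

section \<open>Stieltjes relations for the roots of the limiting polynomials\<close>

lemma lagpoly_root_nonzero: "poly (lagpoly l k) x = 0 \<Longrightarrow> x \<noteq> 0"
  using poly_lagpoly_0[of l k] by auto

text \<open>A multiple root x is nonzero since the polynomial is 1 at 0. The differential equation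
  would then make x P'' divisible by the full power of the linear factor in P', whereas its order of
  vanishing is one lower.\<close>

lemma rsquarefree_lagpoly:
  assumes k: "k \<le> l"
  shows "rsquarefree (lagpoly l k)"
  unfolding rsquarefree_roots
proof (intro allI notI, elim conjE)
  fix x assume x: "poly (lagpoly l k) x = 0" "poly (pderiv (lagpoly l k)) x = 0"
  define P where "P = lagpoly l k"
  define q where "q = pderiv P"
  have x0: "x \<noteq> 0" using lagpoly_root_nonzero x(1) by blast
  have P0: "P \<noteq> 0" using poly_lagpoly_0[of l k] unfolding P_def by auto
  have Px: "poly P x = 0" "poly q x = 0" using x by (auto simp: P_def q_def)
  have "degree P \<noteq> 0"
  proof
    assume "degree P = 0"
    then obtain c where "P = [:c:]" by (rule degree_eq_zeroE)
    then show False using Px(1) P0 by simp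
  qed
  then have q0: "q \<noteq> 0" unfolding q_def by (simp add: pderiv_eq_0_iff)
  have "degree q \<noteq> 0"
  proof
    assume "degree q = 0"
    then obtain c where "q = [:c:]" by (rule degree_eq_zeroE)
    then show False using Px(2) q0 by simp
  qed
  then have q1: "pderiv q \<noteq> 0" by (simp add: pderiv_eq_0_iff)
  have o1: "order x P = Suc (order x q)" unfolding q_def by (rule order_pderiv[OF P0 Px(1)])
  have o2: "order x q = Suc (order x (pderiv q))" by (rule order_pderiv[OF q0 Px(2)])
  have dP: "[:- x, 1:] ^ order x q dvd P" using o1 by (simp add: order_divides)
  have dq: "[:- x, 1:] ^ order x q dvd q" by (rule order_1)
  have eq: "[:0, 1:] * pderiv q = smult (of_nat l) q - smult 2 ([:0, 1:] * q) + smult (2 * of_nat k) P"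
    using lagpoly_ode[OF k] unfolding P_def[symmetric] q_def[symmetric] by (simp add: algebra_simps)
  have "[:- x, 1:] ^ order x q dvd [:0, 1:] * pderiv q"
    unfolding eq by (intro dvd_add dvd_diff dvd_smult dvd_mult dP dq)
  moreover have nz: "[:0, 1:] * pderiv q \<noteq> 0" using q1 by simp
  ultimately have "order x q \<le> order x ([:0, 1:] * pderiv q)" by (simp only: order_divides) simp
  also have "\<dots> = order x [:0, 1:] + order x (pderiv q)" by (rule order_mult[OF nz])
  also have "order x [:0, 1:] = 0" by (rule order_0I) (use x0 in simp)
  finally show False using o2 by simp
qed

definition lagroots :: "nat \<Rightarrow> nat \<Rightarrow> complex set" where
  "lagroots l k = {x. poly (lagpoly l k) x = 0}"

lemma lagroots:
  assumes k: "k \<le> l"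
  shows finite_lagroots: "finite (lagroots l k)" and card_lagroots: "card (lagroots l k) = k"
    and lagroots_nonzero: "0 \<notin> lagroots l k"
    and lagpoly_prod: "lagpoly l k = smult (lead_coeff (lagpoly l k)) (\<Prod>z\<in>lagroots l k. [:- z, 1:])"
proof -
  have P0: "lagpoly l k \<noteq> 0" using poly_lagpoly_0[of l k] by auto
  show fin: "finite (lagroots l k)" unfolding lagroots_def by (rule poly_roots_finite[OF P0])
  show "0 \<notin> lagroots l k" using lagpoly_root_nonzero unfolding lagroots_def by blast
  show eq: "lagpoly l k = smult (lead_coeff (lagpoly l k)) (\<Prod>z\<in>lagroots l k. [:- z, 1:])"
    unfolding lagroots_def by (rule complex_poly_decompose_rsquarefree[OF rsquarefree_lagpoly[OF k], symmetric])
  have "degree (lagpoly l k) = degree (\<Prod>z\<in>lagroots l k. [:- z, 1::complex:])"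
    by (subst eq) (use P0 in simp)
  also have "\<dots> = (\<Sum>z\<in>lagroots l k. degree [:- z, 1:])" by (rule degree_prod_eq_sum_degree) auto
  finally show "card (lagroots l k) = k" using degree_lagpoly[OF k] by simp
qed

lemma poly_pderiv_prod_linear:
  fixes x :: complex
  assumes "finite R" "x \<notin> R"
  shows "poly (pderiv (\<Prod>z\<in>R. [:- z, 1:])) x = poly (\<Prod>z\<in>R. [:- z, 1:]) x * (\<Sum>z\<in>R. 1 / (x - z))"
  using assms
proof (induction R rule: finite_induct)
  case (insert z R)
  have xz: "x - z \<noteq> 0" using insert by auto
  define G where "G = (\<Prod>z\<in>R. [:- z, 1:])"
  have IH: "poly (pderiv G) x = poly G x * (\<Sum>z\<in>R. 1 / (x - z))" using insert unfolding G_def by auto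
  have "poly (pderiv ([:- z, 1:] * G)) x = poly G x + (x - z) * poly (pderiv G) x"
    unfolding pderiv_mult by (simp add: pderiv_pCons algebra_simps)
  also have "\<dots> = poly ([:- z, 1:] * G) x * (1 / (x - z) + (\<Sum>z\<in>R. 1 / (x - z)))"
    unfolding IH poly_mult using xz by (simp add: field_simps)
  finally show ?case using insert(1,2) by (simp add: G_def)
qed simp

text \<open>At a simple root, P''/P' is twice the sum of reciprocal distances to the other roots;
  dividing the differential equation by 2 x P' gives the relation.\<close>

lemma lagroots_stationary:
  assumes k: "k \<le> l" and x: "x \<in> lagroots l k"
  shows "(\<Sum>y\<in>lagroots l k - {x}. 1 / (x - y)) - (of_nat l / 2) / x + 1 = 0"
proof -
  let ?R = "lagroots l k"
  define G where "G = (\<Prod>z\<in>?R - {x}. [:- z, 1:])"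
  define c where "c = lead_coeff (lagpoly l k)"
  define S where "S = (\<Sum>y\<in>?R - {x}. 1 / (x - y))"
  have c0: "c \<noteq> 0" unfolding c_def using poly_lagpoly_0[of l k] by auto
  have x0: "x \<noteq> 0" using lagroots_nonzero[OF k] x by auto
  have P: "lagpoly l k = smult c ([:- x, 1:] * G)"
    unfolding c_def G_def using lagpoly_prod[OF k] prod.remove[OF finite_lagroots[OF k] x, of "\<lambda>z. [:- z, 1:]"] by simp
  have Gx: "poly G x \<noteq> 0" unfolding G_def using finite_lagroots[OF k] by (auto simp: poly_prod)
  have G': "poly (pderiv G) x = poly G x * S"
    unfolding G_def S_def by (rule poly_pderiv_prod_linear) (use finite_lagroots[OF k] in auto)
  have P1: "poly (pderiv (lagpoly l k)) x = c * poly G x"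
    unfolding P pderiv_smult pderiv_mult by (simp add: pderiv_pCons)
  have P2: "poly (pderiv (pderiv (lagpoly l k))) x = c * (2 * poly (pderiv G) x)"
    unfolding P pderiv_smult pderiv_mult pderiv_add by (simp add: pderiv_pCons pderiv_mult algebra_simps)
  have "poly ([:0, 1:] * pderiv (pderiv (lagpoly l k)) - smult (of_nat l) (pderiv (lagpoly l k)) + smult 2 ([:0, 1:] * pderiv (lagpoly l k))) x
     = poly (smult (2 * of_nat k) (lagpoly l k)) x"
    by (simp only: lagpoly_ode[OF k])
  then have "x * (c * (2 * (poly G x * S))) - of_nat l * (c * poly G x) + 2 * (x * (c * poly G x)) = 0"
    using x unfolding poly_add poly_diff poly_smult poly_mult P1 P2 G' by (simp add: lagroots_def)
  then have "2 * c * poly G x * x * (S - (of_nat l / 2) / x + 1) = 0"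
    using x0 by (simp add: algebra_simps)
  then show ?thesis using c0 Gx x0 by (simp add: S_def)
qed

lemma poly_eqI_cofinite:
  fixes P Q :: "complex poly"
  assumes "finite S" "\<And>x. x \<notin> S \<Longrightarrow> poly P x = poly Q x"
  shows "P = Q"
proof (rule ccontr)
  assume "P \<noteq> Q"
  then have "finite {x. poly (P - Q) x = 0}" by (intro poly_roots_finite) simp
  then have "finite (S \<union> {x. poly (P - Q) x = 0})" using assms(1) by simp
  moreover have "S \<union> {x. poly (P - Q) x = 0} = UNIV" using assms(2) by auto
  ultimately show False using infinite_UNIV_char_0 by metis
qed

text \<open>
  For \<open>\<gamma> = \<Sum> v / (x - \<xi>)\<^sup>2\<close> and \<open>g = \<Sum> 1 / (x - \<xi>) - c / x + 1\<close> a kernel vector makes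
  \<open>\<gamma>' + 2 g \<gamma>\<close> a multiple of \<open>1 / x\<close>; clearing denominators, degrees force \<open>\<gamma> = 0\<close>.
\<close>

lemma stieltjes_nondegenerate:
  fixes \<xi> v :: "'k \<Rightarrow> complex"
  assumes K: "finite K" and inj: "inj_on \<xi> K" and nz: "\<And>m. m \<in> K \<Longrightarrow> \<xi> m \<noteq> 0"
    and stat: "\<And>m. m \<in> K \<Longrightarrow> (\<Sum>j\<in>K - {m}. 1 / (\<xi> m - \<xi> j)) - c / \<xi> m + 1 = 0"
    and ker: "\<And>m. m \<in> K \<Longrightarrow> - (\<Sum>j\<in>K - {m}. (v m - v j) / (\<xi> m - \<xi> j)\<^sup>2) + c * v m / (\<xi> m)\<^sup>2 = 0"
    and m0: "m0 \<in> K"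
  shows "v m0 = 0"
proof -
  define Pp where "Pp = (\<Prod>m\<in>K. [:- \<xi> m, 1:])"
  \<comment> \<open>The polynomial obtained from gamma by multiplying with the square of Pp. Its
    value at a node isolates the corresponding component of v, so it suffices to show that it
    vanishes.\<close>
  define Nn where "Nn = (\<Sum>m\<in>K. smult (v m) ((\<Prod>j\<in>K - {m}. [:- \<xi> j, 1:])\<^sup>2))"
  define S where "S = insert 0 (\<xi> ` K)"
  have finS: "finite S" using K by (simp add: S_def)
  define \<gamma> where "\<gamma> x = (\<Sum>m\<in>K. v m / (x - \<xi> m)\<^sup>2)" for x
  define \<gamma>' where "\<gamma>' x = (\<Sum>m\<in>K. - 2 * v m / (x - \<xi> m) ^ 3)" for x
  define g where "g x = (\<Sum>m\<in>K. 1 / (x - \<xi> m)) - c / x + 1" for x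
  define \<kappa> where "\<kappa> = (\<Sum>m\<in>K. v m / (\<xi> m)\<^sup>2)"
  have xd: "x - \<xi> m \<noteq> 0" "x \<noteq> 0" if "x \<notin> S" "m \<in> K" for x m using that by (auto simp: S_def)
  have Px: "poly Pp x = (\<Prod>m\<in>K. x - \<xi> m)" for x by (simp add: Pp_def poly_prod)
  have NPx: "poly Nn x = (poly Pp x)\<^sup>2 * \<gamma> x" if "x \<notin> S" for x
  proof -
    have "v m * (\<Prod>j\<in>K - {m}. x - \<xi> j)\<^sup>2 = (poly Pp x)\<^sup>2 * (v m / (x - \<xi> m)\<^sup>2)" if "m \<in> K" for m
      unfolding Px using prod.remove[OF K that, of "\<lambda>j. x - \<xi> j"] xd[OF \<open>x \<notin> S\<close> that] by (simp add: power_mult_distrib)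
    then show ?thesis by (simp add: Nn_def \<gamma>_def poly_sum poly_prod sum_distrib_left)
  qed
  have P'x: "poly (pderiv Pp) x = poly Pp x * (\<Sum>m\<in>K. 1 / (x - \<xi> m))" if "x \<notin> S" for x
  proof -
    have "Pp = (\<Prod>z\<in>\<xi> ` K. [:- z, 1:])" unfolding Pp_def by (simp add: prod.reindex[OF inj] o_def)
    moreover have "(\<Sum>m\<in>K. 1 / (x - \<xi> m)) = (\<Sum>z\<in>\<xi> ` K. 1 / (x - z))" by (simp add: sum.reindex[OF inj] o_def)
    ultimately show ?thesis using poly_pderiv_prod_linear[of "\<xi> ` K" x] K that by (auto simp: S_def)
  qed
  have key: "\<gamma>' x + 2 * g x * \<gamma> x = - 2 * c * \<kappa> / x" if x: "x \<notin> S" for x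
  proof -
    define d where "d m = 1 / (x - \<xi> m)" for m
    \<comment> \<open>Partial fractions reduce all products of simple poles at different nodes; the
      stationarity relation then cancels the double poles.\<close>
    have d1: "d m * d j = (d m - d j) / (\<xi> m - \<xi> j)" if "m \<in> K" "j \<in> K" "m \<noteq> j" for m j
    proof -
      have "\<xi> m - \<xi> j \<noteq> 0" using inj that by (auto simp: inj_on_def)
      moreover have "d m - d j = (\<xi> m - \<xi> j) * (d m * d j)"
        using xd[OF x that(1)] xd[OF x that(2)] by (simp add: d_def divide_simps)
      ultimately show ?thesis by simp
    qed
    have d2: "(d m)\<^sup>2 * d j = (d m)\<^sup>2 / (\<xi> m - \<xi> j) - (d m - d j) / (\<xi> m - \<xi> j)\<^sup>2" if "m \<in> K" "j \<in> K" "m \<noteq> j" for m j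
    proof -
      have "(d m)\<^sup>2 * d j = d m * (d m * d j)" by (simp add: power2_eq_square)
      also have "\<dots> = d m * ((d m - d j) / (\<xi> m - \<xi> j))" by (simp only: d1[OF that])
      also have "\<dots> = (d m)\<^sup>2 / (\<xi> m - \<xi> j) - (d m * d j) / (\<xi> m - \<xi> j)"
        by (simp add: power2_eq_square right_diff_distrib diff_divide_distrib)
      also have "(d m * d j) / (\<xi> m - \<xi> j) = (d m - d j) / (\<xi> m - \<xi> j)\<^sup>2"
        unfolding d1[OF that] by (simp add: power2_eq_square)
      finally show ?thesis .
    qed
    have d3: "(d m)\<^sup>2 * (1 / x) = (d m)\<^sup>2 / \<xi> m - (d m - 1 / x) / (\<xi> m)\<^sup>2" if "m \<in> K" for m
      using xd[OF x that] nz[OF that] by (simp add: d_def divide_simps) (simp add: algebra_simps power2_eq_square)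
    have dd: "(\<Sum>j\<in>K. d j) * (d m)\<^sup>2 = d m ^ 3 + (\<Sum>j\<in>K - {m}. (d m)\<^sup>2 * d j)" if "m \<in> K" for m
      using sum.remove[OF K that, of d] by (simp add: sum_distrib_left algebra_simps power2_eq_square power3_eq_cube)
    have trm: "- 2 * v m * d m ^ 3 + 2 * g x * (v m * (d m)\<^sup>2) = - 2 * (\<Sum>j\<in>K - {m}. v m * (d m - d j) / (\<xi> m - \<xi> j)\<^sup>2)
        + 2 * c * v m * d m / (\<xi> m)\<^sup>2 - 2 * c / x * (v m / (\<xi> m)\<^sup>2)" if m: "m \<in> K" for m
    proof -
      have gx: "g x = (\<Sum>j\<in>K. d j) - c * (1 / x) + 1" by (simp add: g_def d_def)
      have "- 2 * v m * d m ^ 3 + 2 * g x * (v m * (d m)\<^sup>2) = 2 * v m * ((\<Sum>j\<in>K. d j) * (d m)\<^sup>2 - d m ^ 3 - c * ((d m)\<^sup>2 * (1 / x)) + (d m)\<^sup>2)"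
        unfolding gx by (simp add: algebra_simps)
      also have "\<dots> = 2 * v m * ((\<Sum>j\<in>K - {m}. (d m)\<^sup>2 * d j) - c * ((d m)\<^sup>2 * (1 / x)) + (d m)\<^sup>2)"
        unfolding dd[OF m] by simp
      also have "(\<Sum>j\<in>K - {m}. (d m)\<^sup>2 * d j) = (\<Sum>j\<in>K - {m}. (d m)\<^sup>2 / (\<xi> m - \<xi> j) - (d m - d j) / (\<xi> m - \<xi> j)\<^sup>2)"
        by (intro sum.cong refl d2) (use m in auto)
      also have "\<dots> = (d m)\<^sup>2 * (\<Sum>j\<in>K - {m}. 1 / (\<xi> m - \<xi> j)) - (\<Sum>j\<in>K - {m}. (d m - d j) / (\<xi> m - \<xi> j)\<^sup>2)"
        by (simp add: sum_subtractf sum_distrib_left)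
      also have "(\<Sum>j\<in>K - {m}. 1 / (\<xi> m - \<xi> j)) = c / \<xi> m - 1" using stat[OF m] by (simp add: algebra_simps)
      finally have "- 2 * v m * d m ^ 3 + 2 * g x * (v m * (d m)\<^sup>2) = 2 * v m * ((d m)\<^sup>2 * (c / \<xi> m - 1) - (\<Sum>j\<in>K - {m}. (d m - d j) / (\<xi> m - \<xi> j)\<^sup>2)
          - c * ((d m)\<^sup>2 / \<xi> m - (d m - 1 / x) / (\<xi> m)\<^sup>2) + (d m)\<^sup>2)"
        unfolding d3[OF m] .
      also have "\<dots> = - 2 * (v m * (\<Sum>j\<in>K - {m}. (d m - d j) / (\<xi> m - \<xi> j)\<^sup>2)) + 2 * c * v m * ((d m - 1 / x) / (\<xi> m)\<^sup>2)"
        by (simp add: algebra_simps)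
      also have "v m * (\<Sum>j\<in>K - {m}. (d m - d j) / (\<xi> m - \<xi> j)\<^sup>2) = (\<Sum>j\<in>K - {m}. v m * (d m - d j) / (\<xi> m - \<xi> j)\<^sup>2)"
        by (simp add: sum_distrib_left)
      finally show ?thesis by (simp add: diff_divide_distrib algebra_simps)
    qed
    have "\<gamma>' x + 2 * g x * \<gamma> x = (\<Sum>m\<in>K. - 2 * v m * d m ^ 3 + 2 * g x * (v m * (d m)\<^sup>2))"
      unfolding \<gamma>'_def \<gamma>_def sum_distrib_left sum.distrib[symmetric]
      by (intro sum.cong refl) (simp add: d_def power_one_over)
    also have "\<dots> = - 2 * (\<Sum>m\<in>K. \<Sum>j\<in>K - {m}. v m * (d m - d j) / (\<xi> m - \<xi> j)\<^sup>2) + (\<Sum>m\<in>K. 2 * c * v m * d m / (\<xi> m)\<^sup>2) - 2 * c / x * \<kappa>"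
    proof -
      have "(\<Sum>m\<in>K. - 2 * v m * d m ^ 3 + 2 * g x * (v m * (d m)\<^sup>2)) = (\<Sum>m\<in>K. - 2 * (\<Sum>j\<in>K - {m}. v m * (d m - d j) / (\<xi> m - \<xi> j)\<^sup>2)
        + 2 * c * v m * d m / (\<xi> m)\<^sup>2 - 2 * c / x * (v m / (\<xi> m)\<^sup>2))"
        by (intro sum.cong refl trm)
      then show ?thesis by (simp only: \<kappa>_def sum.distrib sum_subtractf sum_distrib_left[symmetric])
    qed
    \<comment> \<open>Exchanging m and j in half of the terms replaces v_m by v_m - v_j, which
      brings in the kernel equation.\<close>
    also have "(\<Sum>m\<in>K. \<Sum>j\<in>K - {m}. v m * (d m - d j) / (\<xi> m - \<xi> j)\<^sup>2) = (\<Sum>m\<in>K. d m * (\<Sum>j\<in>K - {m}. (v m - v j) / (\<xi> m - \<xi> j)\<^sup>2))"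
    proof -
      have sw: "(\<Sum>m\<in>K. \<Sum>j\<in>K - {m}. v m * d j / (\<xi> m - \<xi> j)\<^sup>2) = (\<Sum>m\<in>K. \<Sum>j\<in>K - {m}. v j * d m / (\<xi> m - \<xi> j)\<^sup>2)"
      proof -
        have "(\<Sum>m\<in>K. \<Sum>j\<in>K - {m}. v m * d j / (\<xi> m - \<xi> j)\<^sup>2) = (\<Sum>m\<in>K. \<Sum>j\<in>K - {m}. v j * d m / (\<xi> j - \<xi> m)\<^sup>2)"
          using K
        proof -
          have 1: "(\<Sum>i\<in>K. \<Sum>j\<in>K - {i}. f i j) = (\<Sum>i\<in>K. \<Sum>j\<in>K. f i j) - (\<Sum>i\<in>K. f i i)" for f :: "'k \<Rightarrow> 'k \<Rightarrow> complex"
            using K by (simp add: sum_diff1 sum_subtractf)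
          show ?thesis unfolding 1 by (subst sum.swap) simp
        qed
        then show ?thesis by (simp add: power2_commute)
      qed
      have "(\<Sum>m\<in>K. \<Sum>j\<in>K - {m}. v m * (d m - d j) / (\<xi> m - \<xi> j)\<^sup>2) = (\<Sum>m\<in>K. \<Sum>j\<in>K - {m}. v m * d m / (\<xi> m - \<xi> j)\<^sup>2)
           - (\<Sum>m\<in>K. \<Sum>j\<in>K - {m}. v m * d j / (\<xi> m - \<xi> j)\<^sup>2)"
        by (simp add: sum_subtractf[symmetric] diff_divide_distrib right_diff_distrib)
      then show ?thesis unfolding sw
        by (simp add: sum_subtractf[symmetric] sum_distrib_left diff_divide_distrib left_diff_distrib algebra_simps)
    qed
    also have "- 2 * (\<Sum>m\<in>K. d m * (\<Sum>j\<in>K - {m}. (v m - v j) / (\<xi> m - \<xi> j)\<^sup>2)) + (\<Sum>m\<in>K. 2 * c * v m * d m / (\<xi> m)\<^sup>2)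
       = (\<Sum>m\<in>K. 2 * d m * (- (\<Sum>j\<in>K - {m}. (v m - v j) / (\<xi> m - \<xi> j)\<^sup>2) + c * v m / (\<xi> m)\<^sup>2))"
      unfolding sum_distrib_left[of "- 2"] sum.distrib[symmetric] by (intro sum.cong refl) (simp add: algebra_simps)
    also have "\<dots> = 0" by (intro sum.neutral ballI) (simp only: ker mult_zero_right)
    finally show ?thesis by simp
  qed
  have N'x: "poly (pderiv Nn) x = 2 * poly Pp x * poly (pderiv Pp) x * \<gamma> x + (poly Pp x)\<^sup>2 * \<gamma>' x" if x: "x \<notin> S" for x
  proof -
    have dm: "((\<lambda>x. v m / (x - \<xi> m)\<^sup>2) has_field_derivative (- 2 * v m / (x - \<xi> m) ^ 3)) (at x)" if m: "m \<in> K" for m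
    proof -
      have "((\<lambda>x. v m * (inverse (x - \<xi> m))\<^sup>2) has_field_derivative v m * (- 2 * inverse (x - \<xi> m) ^ 3)) (at x)"
        using xd[OF x m] by (auto intro!: derivative_eq_intros simp: power2_eq_square power3_eq_cube)
      then show ?thesis by (simp add: inverse_eq_divide power_one_over mult.commute)
    qed
    have "(\<gamma> has_field_derivative \<gamma>' x) (at x)" unfolding \<gamma>_def \<gamma>'_def by (intro DERIV_sum dm)
    then have "((\<lambda>x. (poly Pp x)\<^sup>2 * \<gamma> x) has_field_derivative 2 * poly Pp x * poly (pderiv Pp) x * \<gamma> x + (poly Pp x)\<^sup>2 * \<gamma>' x) (at x)"
      by (auto intro!: derivative_eq_intros poly_DERIV)
    then have "(poly Nn has_field_derivative 2 * poly Pp x * poly (pderiv Pp) x * \<gamma> x + (poly Pp x)\<^sup>2 * \<gamma>' x) (at x)"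
      by (rule has_field_derivative_transform_within_open[where S = "- S"])
         (use finS x NPx in \<open>auto intro!: open_Compl finite_imp_closed\<close>)
    then show ?thesis using poly_DERIV DERIV_unique by blast
  qed
  \<comment> \<open>The differential relation multiplied by x times the square of Pp. It is verified
    off the finite pole set, which determines a polynomial.\<close>
  have polyeq: "[:0, 1:] * pderiv Nn + smult 2 ([:- c, 1:] * Nn) + smult (2 * c * \<kappa>) (Pp\<^sup>2) = 0"
  proof (rule poly_eqI_cofinite[OF finS])
    fix x assume x: "x \<notin> S"
    have x0: "x \<noteq> 0" using x by (simp add: S_def)
    have g1: "\<gamma>' x = - 2 * c * \<kappa> / x - 2 * g x * \<gamma> x" using key[OF x] by (simp add: algebra_simps)
    have g2: "poly (pderiv Pp) x = poly Pp x * (g x + c / x - 1)" unfolding P'x[OF x] g_def by simp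
    have "poly ([:0, 1:] * pderiv Nn + smult 2 ([:- c, 1:] * Nn) + smult (2 * c * \<kappa>) (Pp\<^sup>2)) x
        = x * poly (pderiv Nn) x + 2 * ((x - c) * poly Nn x) + 2 * c * \<kappa> * (poly Pp x)\<^sup>2"
      by (simp add: algebra_simps)
    also have "\<dots> = 0"
      unfolding N'x[OF x] NPx[OF x] g1 g2 using x0 by (simp add: field_simps power2_eq_square)
    finally show "poly ([:0, 1:] * pderiv Nn + smult 2 ([:- c, 1:] * Nn) + smult (2 * c * \<kappa>) (Pp\<^sup>2)) x = poly 0 x"
      by simp
  qed
  have kpos: "card K > 0" using K m0 card_gt_0_iff by blast
  have degP: "degree Pp = card K" unfolding Pp_def by (subst degree_prod_eq_sum_degree) auto
  have lcP: "lead_coeff Pp = 1" unfolding Pp_def by (simp add: lead_coeff_prod)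
  have degN: "degree Nn \<le> 2 * card K - 2"
    unfolding Nn_def
  proof (rule degree_sum_le[OF K])
    fix m assume m: "m \<in> K"
    have "degree (\<Prod>j\<in>K - {m}. [:- \<xi> j, 1:]) = card K - 1"
      by (subst degree_prod_eq_sum_degree) (use K m in auto)
    then have "degree ((\<Prod>j\<in>K - {m}. [:- \<xi> j, 1:])\<^sup>2) \<le> 2 * card K - 2"
      using degree_power_le[of "\<Prod>j\<in>K - {m}. [:- \<xi> j, 1:]" 2] by (simp add: algebra_simps)
    then show "degree (smult (v m) ((\<Prod>j\<in>K - {m}. [:- \<xi> j, 1:])\<^sup>2)) \<le> 2 * card K - 2"
      using degree_smult_le order_trans by blast
  qed
  have c1: "coeff ([:0, 1:] * pderiv Nn) (Suc j) = of_nat (Suc j) * coeff Nn (Suc j)" for j by (simp add: coeff_pderiv)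
  have c2: "coeff ([:- c, 1:] * Nn) (Suc j) = coeff Nn j - c * coeff Nn (Suc j)" for j by simp
  \<comment> \<open>Coefficient of degree 2 card K: Nn has degree at most 2 card K - 2, so both of
    its terms are invisible there and only the monic square of Pp contributes.\<close>
  have ck: "c * \<kappa> = 0"
  proof -
    obtain j where j: "2 * card K = Suc j" using kpos by (metis gr0_implies_Suc mult_pos_pos zero_less_numeral)
    have "j \<ge> 1" using j by presburger
    then have "degree Nn < j" using degN j by simp
    then have "coeff Nn (Suc j) = 0" "coeff Nn j = 0" by (auto intro!: coeff_eq_0)
    moreover have "coeff (Pp\<^sup>2) (Suc j) = 1"
    proof -
      have "Suc j = degree (Pp\<^sup>2)" using j degP lcP by (subst degree_power_eq) auto
      then show ?thesis using lcP by (simp add: lead_coeff_power)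
    qed
    moreover have "coeff ([:0, 1:] * pderiv Nn + smult 2 ([:- c, 1:] * Nn) + smult (2 * c * \<kappa>) (Pp\<^sup>2)) (Suc j) = 0"
      unfolding polyeq by simp
    ultimately show ?thesis by (simp only: coeff_add coeff_smult c1 c2) simp
  qed
  \<comment> \<open>With the inhomogeneous term gone, the coefficient one above the degree of Nn
    comes only from 2 x Nn, so the leading coefficient vanishes.\<close>
  have "Nn = 0"
  proof (rule ccontr)
    assume N0: "Nn \<noteq> 0"
    let ?j = "degree Nn"
    have "coeff ([:0, 1:] * pderiv Nn + smult 2 ([:- c, 1:] * Nn) + smult (2 * c * \<kappa>) (Pp\<^sup>2)) (Suc ?j) = 0"
      unfolding polyeq by simp
    moreover have "coeff Nn (Suc ?j) = 0" by (rule coeff_eq_0) simp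
    moreover have "2 * c * \<kappa> = 0" using ck by auto
    ultimately have "lead_coeff Nn = 0" by (simp only: coeff_add coeff_smult c1 c2) simp
    then show False using N0 by simp
  qed
  then have "poly Nn (\<xi> m0) = 0" by simp
  moreover have "poly Nn (\<xi> m0) = v m0 * (\<Prod>j\<in>K - {m0}. \<xi> m0 - \<xi> j)\<^sup>2"
  proof -
    have "poly Nn (\<xi> m0) = (\<Sum>m\<in>K. v m * (\<Prod>j\<in>K - {m}. \<xi> m0 - \<xi> j)\<^sup>2)"
      by (simp add: Nn_def poly_sum poly_prod)
    also have "\<dots> = v m0 * (\<Prod>j\<in>K - {m0}. \<xi> m0 - \<xi> j)\<^sup>2 + (\<Sum>m\<in>K - {m0}. v m * (\<Prod>j\<in>K - {m}. \<xi> m0 - \<xi> j)\<^sup>2)"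
      by (rule sum.remove[OF K m0])
    also have "(\<Sum>m\<in>K - {m0}. v m * (\<Prod>j\<in>K - {m}. \<xi> m0 - \<xi> j)\<^sup>2) = 0"
    proof (rule sum.neutral, rule ballI)
      fix m assume m: "m \<in> K - {m0}"
      have "(\<Prod>j\<in>K - {m}. \<xi> m0 - \<xi> j) = 0" by (rule prod_zero) (use K m m0 in auto)
      then show "v m * (\<Prod>j\<in>K - {m}. \<xi> m0 - \<xi> j)\<^sup>2 = 0" by simp
    qed
    finally show ?thesis by simp
  qed
  moreover have "(\<Prod>j\<in>K - {m0}. \<xi> m0 - \<xi> j) \<noteq> 0"
    using inj m0 K by (auto simp: prod_zero_iff inj_on_def)
  ultimately show ?thesis by simp
qed

section \<open>Continuation of the rescaled equations from u = 0\<close>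

context glc begin

text \<open>The rescaled interaction \<open>u \<zeta> (p i - p j + u d)\<close>, extended to \<open>u = 0\<close>.\<close>

definition Zs :: "'r \<Rightarrow> 'r \<Rightarrow> complex \<Rightarrow> complex \<Rightarrow> complex" where
  "Zs i j u d = (if i = j then 1 / d + u * zeta0 (u * d) else u * \<zeta> (p i - p j + u * d))"

definition Zs_ok :: "'r \<Rightarrow> 'r \<Rightarrow> complex \<Rightarrow> complex \<Rightarrow> bool" where
  "Zs_ok i j u d \<longleftrightarrow> (if i = j then d \<noteq> 0 \<and> u * d \<notin> \<Lambda> - {0} else p i - p j + u * d \<notin> \<Lambda>)"

text \<open>The derivative in d. At u = 0 only the case i = j survives, with value -1/d^2:
  interactions between different clusters vanish.\<close>

definition Zs' :: "'r \<Rightarrow> 'r \<Rightarrow> complex \<Rightarrow> complex \<Rightarrow> complex" where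
  "Zs' i j u d = (if i = j then - 1 / d\<^sup>2 - u\<^sup>2 * wp0 (u * d) else - u\<^sup>2 * \<P> (p i - p j + u * d))"

lemma Zs_eq: "u \<noteq> 0 \<Longrightarrow> Zs i j u d = u * \<zeta> (p i - p j + u * d)"
  by (cases "i = j") (auto simp: Zs_def wzeta_eq algebra_simps)

lemma Zs_ok_notin: "Zs_ok i j u d \<Longrightarrow> u \<noteq> 0 \<Longrightarrow> p i - p j + u * d \<notin> \<Lambda>"
  by (cases "i = j") (auto simp: Zs_ok_def)

lemma Zs_deriv:
  assumes "Zs_ok i j u d"
  shows "(Zs i j u has_field_derivative Zs' i j u d) (at d)"
proof (cases "i = j")
  case True
  have "(zeta0 has_field_derivative - wp0 (u * d)) (at (u * d))"
    using assms True by (intro zeta0_deriv) (auto simp: Zs_ok_def)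
  then have "((\<lambda>d. zeta0 (u * d)) has_field_derivative - wp0 (u * d) * u) (at d)"
    by (rule DERIV_chain2) (auto intro!: derivative_eq_intros)
  moreover have "((\<lambda>d. 1 / d) has_field_derivative - 1 / d\<^sup>2) (at d)"
    using assms True by (auto simp: Zs_ok_def power2_eq_square intro!: derivative_eq_intros)
  ultimately have "((\<lambda>d. 1 / d + u * zeta0 (u * d)) has_field_derivative - 1 / d\<^sup>2 + u * (- wp0 (u * d) * u)) (at d)"
    by (intro DERIV_add DERIV_cmult)
  then show ?thesis using True by (simp add: Zs_def[abs_def] Zs'_def power2_eq_square algebra_simps)
next
  case False
  have "(\<zeta> has_field_derivative - \<P> (p i - p j + u * d)) (at (p i - p j + u * d))"
    using assms False by (intro wzeta_deriv) (simp add: Zs_ok_def)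
  then have "((\<lambda>d. \<zeta> (p i - p j + u * d)) has_field_derivative - \<P> (p i - p j + u * d) * u) (at d)"
    by (rule DERIV_chain2) (auto intro!: derivative_eq_intros)
  then have "((\<lambda>d. u * \<zeta> (p i - p j + u * d)) has_field_derivative u * (- \<P> (p i - p j + u * d) * u)) (at d)"
    by (rule DERIV_cmult)
  then show ?thesis using False by (simp add: Zs_def[abs_def] Zs'_def power2_eq_square algebra_simps)
qed

lemma Zs_tendsto:
  assumes "Zs_ok i j u d" "(f \<longlongrightarrow> u) F" "(g \<longlongrightarrow> d) F"
  shows "((\<lambda>x. Zs i j (f x) (g x)) \<longlongrightarrow> Zs i j u d) F" "((\<lambda>x. Zs' i j (f x) (g x)) \<longlongrightarrow> Zs' i j u d) F"
proof -
  have m: "((\<lambda>x. f x * g x) \<longlongrightarrow> u * d) F" using assms by (intro tendsto_intros)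
  have "((\<lambda>x. Zs i j (f x) (g x)) \<longlongrightarrow> Zs i j u d) F \<and> ((\<lambda>x. Zs' i j (f x) (g x)) \<longlongrightarrow> Zs' i j u d) F"
  proof (cases "i = j")
    case True
    have ud: "u * d \<notin> \<Lambda> - {0}" "d \<noteq> 0" using assms(1) True by (auto simp: Zs_ok_def)
    have z: "((\<lambda>x. zeta0 (f x * g x)) \<longlongrightarrow> zeta0 (u * d)) F"
      by (rule isCont_tendsto_compose[OF DERIV_isCont[OF zeta0_deriv[OF ud(1)]] m])
    have w: "((\<lambda>x. wp0 (f x * g x)) \<longlongrightarrow> wp0 (u * d)) F"
      by (rule isCont_tendsto_compose[OF DERIV_isCont[OF wp0_deriv[OF ud(1)]] m])
    show ?thesis unfolding Zs_def Zs'_def using True ud assms(2,3) z w by (auto intro!: tendsto_intros)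
  next
    case False
    then have nl: "p i - p j + u * d \<notin> \<Lambda>" using assms(1) by (auto simp: Zs_ok_def)
    have m': "((\<lambda>x. p i - p j + f x * g x) \<longlongrightarrow> p i - p j + u * d) F" by (intro tendsto_intros m)
    show ?thesis unfolding Zs_def Zs'_def
      using False assms(2,3) tendsto_wzeta[OF m' nl] tendsto_wp[OF m' nl] by (auto intro!: tendsto_intros)
  qed
  then show "((\<lambda>x. Zs i j (f x) (g x)) \<longlongrightarrow> Zs i j u d) F" "((\<lambda>x. Zs' i j (f x) (g x)) \<longlongrightarrow> Zs' i j u d) F" by auto
qed

lemma Zs_ok_eventually:
  assumes "Zs_ok i j u d" "(f \<longlongrightarrow> u) F" "(g \<longlongrightarrow> d) F"
  shows "\<forall>\<^sub>F x in F. Zs_ok i j (f x) (g x)"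
proof (cases "i = j")
  case True
  have m: "((\<lambda>x. f x * g x) \<longlongrightarrow> u * d) F" using assms by (intro tendsto_intros)
  have "open (- (\<Lambda> - {0}))" by (rule open_Compl, rule closed_lattice_subset) auto
  from topological_tendstoD[OF m this] have 1: "\<forall>\<^sub>F x in F. f x * g x \<in> - (\<Lambda> - {0})"
    using assms(1) True by (auto simp: Zs_ok_def)
  have "\<forall>\<^sub>F x in F. g x \<noteq> 0"
    using assms(1,3) True by (intro tendsto_imp_eventually_ne) (auto simp: Zs_ok_def)
  with 1 show ?thesis by eventually_elim (auto simp: Zs_ok_def True)
next
  case False
  have m': "((\<lambda>x. p i - p j + f x * g x) \<longlongrightarrow> p i - p j + u * d) F" using assms by (intro tendsto_intros)
  have "\<forall>\<^sub>F x in F. p i - p j + f x * g x \<notin> \<Lambda>"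
    using assms(1) False by (intro eventually_tendsto_notin_lattice[OF m']) (simp add: Zs_ok_def)
  then show ?thesis by eventually_elim (auto simp: Zs_ok_def False)
qed

lemma Zs_ok_0: "(i = j \<Longrightarrow> d \<noteq> 0) \<Longrightarrow> Zs_ok i j 0 d"
  using p_distinct by (auto simp: Zs_ok_def)

text \<open>Linearization error controlled by continuity of the derivative at (0, d0) and the mean
  value inequality, uniformly for small u. The radius is 2 delta because d will be a difference of
  two coordinates, each within delta of its centre.\<close>

lemma Zs_lipschitz_eventually:
  assumes "i = j \<Longrightarrow> d0 \<noteq> 0" and e: "e > 0"
  shows "\<forall>\<^sub>F \<delta> in at_right 0. \<forall>u \<in> cball 0 \<delta>. (\<forall>d \<in> cball d0 (2 * \<delta>). Zs_ok i j u d) \<and>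
    (\<forall>d \<in> cball d0 (2 * \<delta>). \<forall>d' \<in> cball d0 (2 * \<delta>). norm (Zs i j u d - Zs i j u d' - Zs' i j 0 d0 * (d - d')) \<le> e * norm (d - d'))"
proof -
  have ok: "Zs_ok i j 0 d0" by (rule Zs_ok_0[OF assms(1)])
  have t1: "(fst \<longlongrightarrow> fst (0, d0)) (nhds (0::complex, d0))" 
    by (rule tendsto_fst) (rule filterlim_ident)
  have t2: "(snd \<longlongrightarrow> snd (0::complex, d0)) (nhds (0::complex, d0))"
    by (rule tendsto_snd) (rule filterlim_ident)
  have 1: "\<forall>\<^sub>F x in nhds (0, d0). Zs_ok i j (fst x) (snd x)"
    using Zs_ok_eventually[OF ok, of fst "nhds (0, d0)" snd] t1 t2 by simp
  have "((\<lambda>x. Zs' i j (fst x) (snd x)) \<longlongrightarrow> Zs' i j 0 d0) (nhds (0, d0))"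
    using Zs_tendsto(2)[OF ok, of fst "nhds (0, d0)" snd] t1 t2 by simp
  then have 2: "\<forall>\<^sub>F x in nhds (0, d0). dist (Zs' i j (fst x) (snd x)) (Zs' i j 0 d0) < e"
    using e by (rule tendstoD)
  from eventually_conj[OF 1 2] obtain r where r: "r > 0"
    "\<And>x. dist x (0, d0) < r \<Longrightarrow> Zs_ok i j (fst x) (snd x) \<and> dist (Zs' i j (fst x) (snd x)) (Zs' i j 0 d0) < e"
    unfolding eventually_nhds_metric by blast
  \<comment> \<open>The factor 4 leaves room for delta from u plus 2 delta from d inside the radius
    r.\<close>
  have main: "Zs_ok i j u d \<and> norm (Zs' i j u d - Zs' i j 0 d0) \<le> e" if "\<delta> < r / 4" "u \<in> cball 0 \<delta>" "d \<in> cball d0 (2 * \<delta>)" for \<delta> u d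
  proof -
    have "dist (u, d) (0, d0) \<le> dist u 0 + dist d d0" unfolding dist_Pair_Pair by (rule sqrt_sum_squares_le_sum) auto
    also have "\<dots> < r" using that r(1) by (auto simp: dist_norm norm_minus_commute)
    finally show ?thesis using r(2)[of "(u, d)"] by (auto simp: dist_norm)
  qed
  have "\<forall>\<^sub>F \<delta> in at_right 0. \<delta> < r / 4"
    using r(1) by (intro eventually_at_right_less | simp add: eventually_at_right_field, intro exI[of _ "r/4"])+ auto
  then show ?thesis
  proof eventually_elim
    case (elim \<delta>)
    show ?case
    proof (intro ballI conjI)
      fix u d :: complex assume "u \<in> cball 0 \<delta>" "d \<in> cball d0 (2 * \<delta>)" then show "Zs_ok i j u d" using main[OF elim] by blast
    next
      fix u d d' :: complex assume u: "u \<in> cball 0 \<delta>" and d: "d \<in> cball d0 (2 * \<delta>)" "d' \<in> cball d0 (2 * \<delta>)"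
      define \<Psi> where "\<Psi> t = Zs i j u t - Zs' i j 0 d0 * t" for t
      have "norm (\<Psi> d - \<Psi> d') \<le> e * norm (d - d')"
      proof (rule field_differentiable_bound[OF convex_cball _ _ d])
        fix t assume t: "t \<in> cball d0 (2 * \<delta>)"
        have "(\<Psi> has_field_derivative Zs' i j u t - Zs' i j 0 d0 * 1) (at t)"
          unfolding \<Psi>_def using main[OF elim u t] by (intro DERIV_diff Zs_deriv DERIV_cmult DERIV_ident) auto
        then show "(\<Psi> has_field_derivative Zs' i j u t - Zs' i j 0 d0 * 1) (at t within cball d0 (2 * \<delta>))"
          by (rule has_field_derivative_at_within)
        show "norm (Zs' i j u t - Zs' i j 0 d0 * 1) \<le> e" using main[OF elim u t] by simp
      qed
      then show "norm (Zs i j u d - Zs i j u d' - Zs' i j 0 d0 * (d - d')) \<le> e * norm (d - d')"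
        by (simp add: \<Psi>_def algebra_simps)
    qed
  qed
qed

definition Eq :: "nat \<Rightarrow> (nat \<Rightarrow> 'r) \<Rightarrow> complex \<Rightarrow> (nat \<Rightarrow> complex) \<Rightarrow> nat \<Rightarrow> complex" where
  "Eq M lab u x \<mu> = (\<Sum>\<nu>\<in>{..<M} - {\<mu>}. Zs (lab \<mu>) (lab \<nu>) u (x \<mu> - x \<nu>)) - (\<Sum>j\<in>UNIV. cn j * Zs (lab \<mu>) j u (x \<mu>)) + 1"

lemma Eq_res:
  assumes "u \<noteq> 0"
  shows "Eq M lab u x \<mu> = u * res {..<M} (\<lambda>\<mu>. p (lab \<mu>) + u * x \<mu>) (1 / u) \<mu>"
  unfolding Eq_def res_def using assms by (simp add: Zs_eq sum_distrib_left algebra_simps)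

text \<open>
  In the rescaled variables \<open>a = p + u x\<close>, \<open>u = 1 / h\<close>, the equations of the curve near a boundary point
  are a perturbation of uncoupled Stieltjes equations, with nondegenerate solution given by the roots of
  \<open>lagpoly\<close>; a quasi-Newton contraction with the inverse Jacobian at \<open>u = 0\<close> continues it to \<open>u \<noteq> 0\<close>.
\<close>

lemma rescaled_branch:
  fixes lab :: "nat \<Rightarrow> 'r" and \<xi> :: "nat \<Rightarrow> complex"
  assumes nz: "\<And>\<mu>. \<mu> < N \<Longrightarrow> \<xi> \<mu> \<noteq> 0"
    and inj: "\<And>\<mu> \<nu>. \<mu> < N \<Longrightarrow> \<nu> < N \<Longrightarrow> lab \<mu> = lab \<nu> \<Longrightarrow> \<xi> \<mu> = \<xi> \<nu> \<Longrightarrow> \<mu> = \<nu>"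
    and stat: "\<And>\<mu>. \<mu> < N \<Longrightarrow> (\<Sum>\<nu> | \<nu> < N \<and> lab \<nu> = lab \<mu> \<and> \<nu> \<noteq> \<mu>. 1 / (\<xi> \<mu> - \<xi> \<nu>)) - cn (lab \<mu>) / \<xi> \<mu> + 1 = 0"
  obtains u0 C x where "u0 > 0" "\<And>u \<mu>. u \<noteq> 0 \<Longrightarrow> norm u < u0 \<Longrightarrow> \<mu> < N \<Longrightarrow> norm (x u \<mu>) \<le> C"
    "\<And>u. u \<noteq> 0 \<Longrightarrow> norm u < u0 \<Longrightarrow> glc_eqs {..<N} (\<lambda>\<mu>. p (lab \<mu>) + u * x u \<mu>) (1 / u)"
    "\<And>u \<mu>. u \<noteq> 0 \<Longrightarrow> norm u < u0 \<Longrightarrow> \<mu> < N \<Longrightarrow> isCont (\<lambda>u. x u \<mu>) u"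
proof -
  let ?I = "{..<N}"
  \<comment> \<open>The Jacobian of \<open>Eq\<close> in x at u = 0 and x = xi.\<close>
  define J where "J \<mu> \<nu> = (if \<nu> = \<mu> then (\<Sum>\<nu>'\<in>?I - {\<mu>}. Zs' (lab \<mu>) (lab \<nu>') 0 (\<xi> \<mu> - \<xi> \<nu>')) - (\<Sum>j\<in>UNIV. cn j * Zs' (lab \<mu>) j 0 (\<xi> \<mu>))
      else - Zs' (lab \<mu>) (lab \<nu>) 0 (\<xi> \<mu> - \<xi> \<nu>))" for \<mu> \<nu>
  have Jv: "(\<Sum>\<nu>\<in>?I. J \<mu> \<nu> * v \<nu>) = (\<Sum>\<nu>\<in>?I - {\<mu>}. Zs' (lab \<mu>) (lab \<nu>) 0 (\<xi> \<mu> - \<xi> \<nu>) * (v \<mu> - v \<nu>)) - (\<Sum>j\<in>UNIV. cn j * (Zs' (lab \<mu>) j 0 (\<xi> \<mu>) * v \<mu>))"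
    if "\<mu> \<in> ?I" for \<mu> v
  proof -
    have "(\<Sum>\<nu>\<in>?I. J \<mu> \<nu> * v \<nu>) = J \<mu> \<mu> * v \<mu> + (\<Sum>\<nu>\<in>?I - {\<mu>}. J \<mu> \<nu> * v \<nu>)" by (rule sum.remove) (use that in auto)
    also have "(\<Sum>\<nu>\<in>?I - {\<mu>}. J \<mu> \<nu> * v \<nu>) = (\<Sum>\<nu>\<in>?I - {\<mu>}. - (Zs' (lab \<mu>) (lab \<nu>) 0 (\<xi> \<mu> - \<xi> \<nu>) * v \<nu>))"
      by (intro sum.cong refl) (auto simp: J_def)
    finally show ?thesis
      by (simp add: J_def left_diff_distrib right_diff_distrib sum_distrib_right sum_subtractf sum_negf mult.assoc)
  qed
  have Z0: "Zs' i j 0 d = (if i = j then - 1 / d\<^sup>2 else 0)" for i j d by (simp add: Zs'_def)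
  have split: "(\<Sum>\<nu>\<in>?I - {\<mu>}. if lab \<mu> = lab \<nu> then f \<nu> else 0) = (\<Sum>\<nu> | \<nu> < N \<and> lab \<nu> = lab \<mu> \<and> \<nu> \<noteq> \<mu>. f \<nu>)" for f :: "nat \<Rightarrow> complex" and \<mu>
  proof -
    have "(\<Sum>\<nu>\<in>?I - {\<mu>}. if lab \<mu> = lab \<nu> then f \<nu> else 0) = (\<Sum>\<nu>\<in>{\<nu> \<in> ?I - {\<mu>}. lab \<mu> = lab \<nu>}. f \<nu>)"
      by (rule sum.inter_filter[symmetric]) simp
    also have "{\<nu> \<in> ?I - {\<mu>}. lab \<mu> = lab \<nu>} = {\<nu>. \<nu> < N \<and> lab \<nu> = lab \<mu> \<and> \<nu> \<noteq> \<mu>}" by auto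
    finally show ?thesis .
  qed
  \<comment> \<open>The Jacobian is block diagonal with respect to the labels, and on the block of
    one label a kernel vector satisfies the hypotheses of the nondegeneracy lemma with c =
    n_i.\<close>
  have Jinj: "\<forall>\<nu>\<in>?I. v \<nu> = 0" if ker: "\<forall>\<mu>\<in>?I. (\<Sum>\<nu>\<in>?I. J \<mu> \<nu> * v \<nu>) = 0" for v
  proof
    fix m0 assume m0: "m0 \<in> ?I"
    define K where "K = {\<nu>. \<nu> < N \<and> lab \<nu> = lab m0}"
    have Km: "K - {m} = {\<nu>. \<nu> < N \<and> lab \<nu> = lab m \<and> \<nu> \<noteq> m}" if "m \<in> K" for m using that by (auto simp: K_def)
    show "v m0 = 0"
    proof (rule stieltjes_nondegenerate[where K = K and \<xi> = \<xi> and c = "cn (lab m0)"])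
      show "finite K" "m0 \<in> K" using m0 by (auto simp: K_def)
      show "inj_on \<xi> K" using inj by (auto simp: K_def inj_on_def)
      show "\<xi> m \<noteq> 0" if "m \<in> K" for m using nz that by (auto simp: K_def)
      show "(\<Sum>j\<in>K - {m}. 1 / (\<xi> m - \<xi> j)) - cn (lab m0) / \<xi> m + 1 = 0" if "m \<in> K" for m
        unfolding Km[OF that] using stat[of m] that by (auto simp: K_def)
      show "- (\<Sum>j\<in>K - {m}. (v m - v j) / (\<xi> m - \<xi> j)\<^sup>2) + cn (lab m0) * v m / (\<xi> m)\<^sup>2 = 0" if m: "m \<in> K" for m
      proof -
        have mI: "m \<in> ?I" "lab m = lab m0" using m by (auto simp: K_def)
        have "(\<Sum>\<nu>\<in>?I - {m}. Zs' (lab m) (lab \<nu>) 0 (\<xi> m - \<xi> \<nu>) * (v m - v \<nu>)) = (\<Sum>\<nu>\<in>?I - {m}. if lab m = lab \<nu> then - ((v m - v \<nu>) / (\<xi> m - \<xi> \<nu>)\<^sup>2) else 0)"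
          by (intro sum.cong refl) (simp add: Z0)
        also have "\<dots> = - (\<Sum>j\<in>K - {m}. (v m - v j) / (\<xi> m - \<xi> j)\<^sup>2)"
          unfolding split Km[OF m] by (simp add: sum_negf)
        finally have 1: "(\<Sum>\<nu>\<in>?I - {m}. Zs' (lab m) (lab \<nu>) 0 (\<xi> m - \<xi> \<nu>) * (v m - v \<nu>)) = - (\<Sum>j\<in>K - {m}. (v m - v j) / (\<xi> m - \<xi> j)\<^sup>2)" .
        have 2: "(\<Sum>j\<in>UNIV. cn j * (Zs' (lab m) j 0 (\<xi> m) * v m)) = - (cn (lab m0) * v m / (\<xi> m)\<^sup>2)"
        proof -
          have "cn j * (Zs' (lab m) j 0 (\<xi> m) * v m) = (if j = lab m then - (cn j * v m / (\<xi> m)\<^sup>2) else 0)" for j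
            by (simp add: Z0)
          then show ?thesis using mI by simp
        qed
        show ?thesis using ker mI(1) Jv[OF mI(1), of v] unfolding 1 2 by simp
      qed
    qed
  qed
  obtain L where JL: "\<And>i j. i \<in> ?I \<Longrightarrow> j \<in> ?I \<Longrightarrow> (\<Sum>m\<in>?I. J i m * L m j) = (if i = j then 1 else 0)"
    and LJ: "\<And>i j. i \<in> ?I \<Longrightarrow> j \<in> ?I \<Longrightarrow> (\<Sum>m\<in>?I. L i m * J m j) = (if i = j then 1 else 0)"
    using injective_imp_inverse_matrix[of ?I J, OF finite_lessThan Jinj] by blast
  define SL where "SL = (\<Sum>\<mu>\<in>?I. \<Sum>\<nu>\<in>?I. norm (L \<mu> \<nu>))"
  define W where "W = 2 * real N + (\<Sum>j\<in>UNIV. norm (cn j))"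
  \<comment> \<open>Chosen so that \<open>SL * W * e\<close> is at most 1/2. Here SL bounds the
    inverse Jacobian, and W counts the linearization errors in one equation: each pair term twice,
    since both coordinates move, and each singular point with its weight.\<close>
  define e where "e = 1 / (2 * (SL + 1) * (W + 1))"
  have SL0: "SL \<ge> 0" and W0: "W \<ge> 0" unfolding SL_def W_def by (auto intro!: sum_nonneg add_nonneg_nonneg)
  have e0: "e > 0" unfolding e_def using SL0 W0 by simp
  have eb: "SL * (W * e) \<le> 1 / 2"
  proof -
    have "SL * W \<le> (SL + 1) * (W + 1)" using SL0 W0 by (intro mult_mono) auto
    moreover have X: "(SL + 1) * (W + 1) > 0" using SL0 W0 by (intro mult_pos_pos) auto
    ultimately have "SL * W / ((SL + 1) * (W + 1)) \<le> 1" by (simp only: divide_le_eq_1_pos)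
    moreover have "SL * (W * e) = SL * W / ((SL + 1) * (W + 1)) / 2"
      unfolding e_def by (simp only: mult.assoc divide_divide_eq_left times_divide_eq_right mult_1_right mult.commute[of _ 2])
    ultimately show ?thesis by simp
  qed
  have ne: "lab \<mu> = lab \<nu> \<Longrightarrow> \<xi> \<mu> - \<xi> \<nu> \<noteq> 0" if "\<mu> \<in> ?I" "\<nu> \<in> ?I - {\<mu>}" for \<mu> \<nu>
    using inj[of \<mu> \<nu>] that by auto
  define P1 where "P1 \<delta> \<longleftrightarrow> (\<forall>\<mu>\<in>?I. \<forall>\<nu>\<in>?I - {\<mu>}. \<forall>u \<in> cball 0 \<delta>. (\<forall>d \<in> cball (\<xi> \<mu> - \<xi> \<nu>) (2 * \<delta>). Zs_ok (lab \<mu>) (lab \<nu>) u d) \<and>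
    (\<forall>d \<in> cball (\<xi> \<mu> - \<xi> \<nu>) (2 * \<delta>). \<forall>d' \<in> cball (\<xi> \<mu> - \<xi> \<nu>) (2 * \<delta>). norm (Zs (lab \<mu>) (lab \<nu>) u d - Zs (lab \<mu>) (lab \<nu>) u d' - Zs' (lab \<mu>) (lab \<nu>) 0 (\<xi> \<mu> - \<xi> \<nu>) * (d - d')) \<le> e * norm (d - d')))" for \<delta>
  have ev1: "\<forall>\<^sub>F \<delta> in at_right 0. P1 \<delta>"
    unfolding P1_def by (intro eventually_ball_finite finite_lessThan finite_Diff ballI Zs_lipschitz_eventually e0 ne)
  define P2 where "P2 \<delta> \<longleftrightarrow> (\<forall>\<mu>\<in>?I. \<forall>j\<in>UNIV. \<forall>u \<in> cball 0 \<delta>. (\<forall>d \<in> cball (\<xi> \<mu>) (2 * \<delta>). Zs_ok (lab \<mu>) j u d) \<and>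
    (\<forall>d \<in> cball (\<xi> \<mu>) (2 * \<delta>). \<forall>d' \<in> cball (\<xi> \<mu>) (2 * \<delta>). norm (Zs (lab \<mu>) j u d - Zs (lab \<mu>) j u d' - Zs' (lab \<mu>) j 0 (\<xi> \<mu>) * (d - d')) \<le> e * norm (d - d')))" for \<delta>
  have ev2: "\<forall>\<^sub>F \<delta> in at_right 0. P2 \<delta>"
    unfolding P2_def by (intro eventually_ball_finite finite_lessThan finite ballI Zs_lipschitz_eventually e0 nz) auto
  have "\<forall>\<^sub>F \<delta> in at_right (0::real). \<delta> > 0" by (rule eventually_at_right_less)
  from eventually_happens'[OF trivial_limit_at_right_real eventually_conj[OF this eventually_conj[OF ev1 ev2]]]
  obtain \<rho> where \<rho>: "\<rho> > 0" and P1: "P1 \<rho>" and P2: "P2 \<rho>" by blast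
  have ok1: "\<And>\<mu> \<nu> u d. \<mu> \<in> ?I \<Longrightarrow> \<nu> \<in> ?I - {\<mu>} \<Longrightarrow> u \<in> cball 0 \<rho> \<Longrightarrow> d \<in> cball (\<xi> \<mu> - \<xi> \<nu>) (2 * \<rho>) \<Longrightarrow> Zs_ok (lab \<mu>) (lab \<nu>) u d"
    and lp1: "\<And>\<mu> \<nu> u d d'. \<mu> \<in> ?I \<Longrightarrow> \<nu> \<in> ?I - {\<mu>} \<Longrightarrow> u \<in> cball 0 \<rho> \<Longrightarrow> d \<in> cball (\<xi> \<mu> - \<xi> \<nu>) (2 * \<rho>) \<Longrightarrow> d' \<in> cball (\<xi> \<mu> - \<xi> \<nu>) (2 * \<rho>) \<Longrightarrow>
       norm (Zs (lab \<mu>) (lab \<nu>) u d - Zs (lab \<mu>) (lab \<nu>) u d' - Zs' (lab \<mu>) (lab \<nu>) 0 (\<xi> \<mu> - \<xi> \<nu>) * (d - d')) \<le> e * norm (d - d')"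
    and ok2: "\<And>\<mu> j u d. \<mu> \<in> ?I \<Longrightarrow> u \<in> cball 0 \<rho> \<Longrightarrow> d \<in> cball (\<xi> \<mu>) (2 * \<rho>) \<Longrightarrow> Zs_ok (lab \<mu>) j u d"
    and lp2: "\<And>\<mu> j u d d'. \<mu> \<in> ?I \<Longrightarrow> u \<in> cball 0 \<rho> \<Longrightarrow> d \<in> cball (\<xi> \<mu>) (2 * \<rho>) \<Longrightarrow> d' \<in> cball (\<xi> \<mu>) (2 * \<rho>) \<Longrightarrow>
       norm (Zs (lab \<mu>) j u d - Zs (lab \<mu>) j u d' - Zs' (lab \<mu>) j 0 (\<xi> \<mu>) * (d - d')) \<le> e * norm (d - d')"
    using P1 P2 unfolding P1_def P2_def by blast+
  have cb1: "x \<mu> - x \<nu> \<in> cball (\<xi> \<mu> - \<xi> \<nu>) (2 * \<rho>)" if "\<forall>i\<in>?I. x i \<in> cball (\<xi> i) \<rho>" "\<mu> \<in> ?I" "\<nu> \<in> ?I" for x \<mu> \<nu>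
  proof -
    have "norm ((\<xi> \<mu> - x \<mu>) - (\<xi> \<nu> - x \<nu>)) \<le> norm (\<xi> \<mu> - x \<mu>) + norm (\<xi> \<nu> - x \<nu>)" by (rule norm_triangle_ineq4)
    also have "\<dots> \<le> \<rho> + \<rho>" using that by (intro add_mono) (auto simp: dist_norm)
    finally show ?thesis by (simp add: dist_norm algebra_simps)
  qed
  have cb2: "x \<mu> \<in> cball (\<xi> \<mu>) (2 * \<rho>)" if "\<forall>i\<in>?I. x i \<in> cball (\<xi> i) \<rho>" "\<mu> \<in> ?I" for x \<mu>
  proof -
    have "x \<mu> \<in> cball (\<xi> \<mu>) \<rho>" using that by blast
    then show ?thesis using \<rho> by simp
  qed
  \<comment> \<open>For all small u the equations differ from their linearization at u = 0 by an
    error with Lipschitz constant \<open>W * e\<close>.\<close>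
  have Elip: "norm (Eq N lab u x \<mu> - Eq N lab u y \<mu> - (\<Sum>\<nu>\<in>?I. J \<mu> \<nu> * (x \<nu> - y \<nu>))) \<le> W * e * D"
    if u: "u \<in> cball 0 \<rho>" and x: "\<forall>i\<in>?I. x i \<in> cball (\<xi> i) \<rho>" and y: "\<forall>i\<in>?I. y i \<in> cball (\<xi> i) \<rho>"
      and D: "\<forall>i\<in>?I. norm (x i - y i) \<le> D" and \<mu>: "\<mu> \<in> ?I" for u x y \<mu> D
  proof -
    have D0: "D \<ge> 0" using D \<mu> norm_ge_zero order_trans by blast
    define t1 where "t1 \<nu> = Zs (lab \<mu>) (lab \<nu>) u (x \<mu> - x \<nu>) - Zs (lab \<mu>) (lab \<nu>) u (y \<mu> - y \<nu>) - Zs' (lab \<mu>) (lab \<nu>) 0 (\<xi> \<mu> - \<xi> \<nu>) * ((x \<mu> - y \<mu>) - (x \<nu> - y \<nu>))" for \<nu>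
    define t2 where "t2 j = Zs (lab \<mu>) j u (x \<mu>) - Zs (lab \<mu>) j u (y \<mu>) - Zs' (lab \<mu>) j 0 (\<xi> \<mu>) * (x \<mu> - y \<mu>)" for j
    have "Eq N lab u x \<mu> - Eq N lab u y \<mu> - (\<Sum>\<nu>\<in>?I. J \<mu> \<nu> * (x \<nu> - y \<nu>)) = (\<Sum>\<nu>\<in>?I - {\<mu>}. t1 \<nu>) - (\<Sum>j\<in>UNIV. cn j * t2 j)"
    proof -
      have s1: "(\<Sum>\<nu>\<in>?I - {\<mu>}. t1 \<nu>) = (\<Sum>\<nu>\<in>?I - {\<mu>}. Zs (lab \<mu>) (lab \<nu>) u (x \<mu> - x \<nu>)) - (\<Sum>\<nu>\<in>?I - {\<mu>}. Zs (lab \<mu>) (lab \<nu>) u (y \<mu> - y \<nu>))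
          - (\<Sum>\<nu>\<in>?I - {\<mu>}. Zs' (lab \<mu>) (lab \<nu>) 0 (\<xi> \<mu> - \<xi> \<nu>) * ((x \<mu> - y \<mu>) - (x \<nu> - y \<nu>)))"
        by (simp only: t1_def sum_subtractf)
      have s2: "(\<Sum>j\<in>UNIV. cn j * t2 j) = (\<Sum>j\<in>UNIV. cn j * Zs (lab \<mu>) j u (x \<mu>)) - (\<Sum>j\<in>UNIV. cn j * Zs (lab \<mu>) j u (y \<mu>))
          - (\<Sum>j\<in>UNIV. cn j * (Zs' (lab \<mu>) j 0 (\<xi> \<mu>) * (x \<mu> - y \<mu>)))"
        unfolding t2_def sum_subtractf[symmetric] by (intro sum.cong refl) (simp add: algebra_simps)
      show ?thesis unfolding Jv[OF \<mu>] Eq_def s1 s2 by simp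
    qed
    also have "norm \<dots> \<le> (\<Sum>\<nu>\<in>?I - {\<mu>}. norm (t1 \<nu>)) + (\<Sum>j\<in>UNIV. norm (cn j) * norm (t2 j))"
      by (intro order_trans[OF norm_triangle_ineq4] add_mono order_trans[OF norm_sum]) (simp_all add: norm_mult)
    also have "\<dots> \<le> (\<Sum>\<nu>\<in>?I - {\<mu>}. e * (2 * D)) + (\<Sum>j\<in>UNIV. norm (cn j) * (e * D))"
    proof (intro add_mono sum_mono mult_left_mono norm_ge_zero)
      fix \<nu> assume \<nu>: "\<nu> \<in> ?I - {\<mu>}"
      have "norm (t1 \<nu>) \<le> e * norm ((x \<mu> - x \<nu>) - (y \<mu> - y \<nu>))"
      proof -
        have e: "(x \<mu> - y \<mu>) - (x \<nu> - y \<nu>) = (x \<mu> - x \<nu>) - (y \<mu> - y \<nu>)" by simp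
        show ?thesis unfolding t1_def e using \<nu> \<mu> u x y by (intro lp1 cb1) auto
      qed
      also have "norm ((x \<mu> - x \<nu>) - (y \<mu> - y \<nu>)) \<le> norm (x \<mu> - y \<mu>) + norm (x \<nu> - y \<nu>)"
        using norm_triangle_ineq4[of "x \<mu> - y \<mu>" "x \<nu> - y \<nu>"] by (simp add: algebra_simps)
      also have "\<dots> \<le> D + D" using D \<mu> \<nu> by (intro add_mono) auto
      also have "D + D = 2 * D" by simp
      finally show "norm (t1 \<nu>) \<le> e * (2 * D)" using e0 by simp
    next
      fix j
      have "norm (t2 j) \<le> e * norm (x \<mu> - y \<mu>)" unfolding t2_def using \<mu> u x y by (intro lp2 cb2) auto
      also have "\<dots> \<le> e * D" using D \<mu> e0 by (intro mult_left_mono) auto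
      finally show "norm (t2 j) \<le> e * D" .
    qed
    also have "\<dots> = (2 * real (card (?I - {\<mu>})) + (\<Sum>j\<in>UNIV. norm (cn j))) * e * D"
      unfolding sum_distrib_right[symmetric] sum_constant by (simp only: algebra_simps of_nat_id)
    also have "\<dots> \<le> W * e * D"
    proof -
      have "card (?I - {\<mu>}) \<le> N" using card_mono[of ?I "?I - {\<mu>}"] by simp
      then show ?thesis unfolding W_def using e0 D0 by (intro mult_right_mono) auto
    qed
    finally show ?thesis .
  qed
  \<comment> \<open>Newton's map with the inverse Jacobian frozen at u = 0; its deviation from a
    constant is the linearization error multiplied by L.\<close>
  define T where "T u x \<mu> = x \<mu> - (\<Sum>\<nu>\<in>?I. L \<mu> \<nu> * Eq N lab u x \<nu>)" for u x \<mu>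
  have contr: "\<forall>i\<in>?I. norm (T u x i - T u y i) \<le> D / 2"
    if u: "u \<in> cball 0 \<rho>" and x: "\<forall>i\<in>?I. x i \<in> cball (\<xi> i) \<rho>" and y: "\<forall>i\<in>?I. y i \<in> cball (\<xi> i) \<rho>"
      and D: "\<forall>i\<in>?I. norm (x i - y i) \<le> D" for u x y D
  proof
    fix \<mu> assume \<mu>: "\<mu> \<in> ?I"
    have D0: "D \<ge> 0" using D \<mu> norm_ge_zero order_trans by blast
    have id: "x \<mu> - y \<mu> = (\<Sum>\<nu>\<in>?I. L \<mu> \<nu> * (\<Sum>m\<in>?I. J \<nu> m * (x m - y m)))"
    proof -
      have "(\<Sum>\<nu>\<in>?I. L \<mu> \<nu> * (\<Sum>m\<in>?I. J \<nu> m * (x m - y m))) = (\<Sum>m\<in>?I. (\<Sum>\<nu>\<in>?I. L \<mu> \<nu> * J \<nu> m) * (x m - y m))"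
        unfolding sum_distrib_left sum_distrib_right by (subst sum.swap) (simp add: mult.assoc)
      also have "\<dots> = (\<Sum>m\<in>?I. if \<mu> = m then x m - y m else 0)"
        by (intro sum.cong refl) (simp add: LJ[OF \<mu>])
      also have "\<dots> = x \<mu> - y \<mu>" using \<mu> by simp
      finally show ?thesis by simp
    qed
    have "T u x \<mu> - T u y \<mu> = (x \<mu> - y \<mu>) - (\<Sum>\<nu>\<in>?I. L \<mu> \<nu> * (Eq N lab u x \<nu> - Eq N lab u y \<nu>))"
      by (simp add: T_def sum_subtractf right_diff_distrib)
    also have "\<dots> = - (\<Sum>\<nu>\<in>?I. L \<mu> \<nu> * (Eq N lab u x \<nu> - Eq N lab u y \<nu> - (\<Sum>m\<in>?I. J \<nu> m * (x m - y m))))"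
      unfolding id right_diff_distrib[of "L \<mu> _"] sum_subtractf by simp
    finally have eq: "T u x \<mu> - T u y \<mu> = - (\<Sum>\<nu>\<in>?I. L \<mu> \<nu> * (Eq N lab u x \<nu> - Eq N lab u y \<nu> - (\<Sum>m\<in>?I. J \<nu> m * (x m - y m))))" .
    have "norm (T u x \<mu> - T u y \<mu>) \<le> (\<Sum>\<nu>\<in>?I. norm (L \<mu> \<nu>) * norm (Eq N lab u x \<nu> - Eq N lab u y \<nu> - (\<Sum>m\<in>?I. J \<nu> m * (x m - y m))))"
      unfolding eq norm_minus_cancel by (rule order_trans[OF norm_sum]) (simp add: norm_mult)
    also have "\<dots> \<le> (\<Sum>\<nu>\<in>?I. norm (L \<mu> \<nu>) * (W * e * D))"
    proof (rule sum_mono)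
      fix \<nu> assume \<nu>: "\<nu> \<in> ?I"
      have "norm (Eq N lab u x \<nu> - Eq N lab u y \<nu> - (\<Sum>m\<in>?I. J \<nu> m * (x m - y m))) \<le> W * e * D"
        by (rule Elip[of u x y D \<nu>, OF u x y D \<nu>])
      then show "norm (L \<mu> \<nu>) * norm (Eq N lab u x \<nu> - Eq N lab u y \<nu> - (\<Sum>m\<in>?I. J \<nu> m * (x m - y m))) \<le> norm (L \<mu> \<nu>) * (W * e * D)"
        by (rule mult_left_mono[OF _ norm_ge_zero])
    qed
    also have "\<dots> = (\<Sum>\<nu>\<in>?I. norm (L \<mu> \<nu>)) * (W * e * D)" by (simp add: sum_distrib_right)
    also have "\<dots> \<le> SL * (W * e * D)"
    proof (rule mult_right_mono)
      show "(\<Sum>\<nu>\<in>?I. norm (L \<mu> \<nu>)) \<le> SL"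
        unfolding SL_def by (rule member_le_sum[OF \<mu>]) (auto intro: sum_nonneg)
    qed (use W0 e0 D0 in simp)
    also have "\<dots> = (SL * (W * e)) * D" by simp
    also have "\<dots> \<le> 1 / 2 * D" by (rule mult_right_mono[OF eb D0])
    finally show "norm (T u x \<mu> - T u y \<mu>) \<le> D / 2" by simp
  qed
  have Etend: "((\<lambda>u. Eq N lab u x \<mu>) \<longlongrightarrow> Eq N lab v x \<mu>) (at v within S)"
    if v: "v \<in> cball 0 \<rho>" and x: "\<forall>i\<in>?I. x i \<in> cball (\<xi> i) \<rho>" and \<mu>: "\<mu> \<in> ?I" for v x \<mu> S
    unfolding Eq_def
    by (intro tendsto_add tendsto_diff tendsto_sum tendsto_mult tendsto_const Zs_tendsto tendsto_ident_at ok1 ok2 cb1 cb2)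
       (use v x \<mu> in auto)
  have \<xi>b: "\<forall>i\<in>?I. \<xi> i \<in> cball (\<xi> i) \<rho>" using \<rho> by simp
  have E0: "Eq N lab 0 \<xi> \<mu> = 0" if \<mu>: "\<mu> \<in> ?I" for \<mu>
  proof -
    have "(\<Sum>\<nu>\<in>?I - {\<mu>}. Zs (lab \<mu>) (lab \<nu>) 0 (\<xi> \<mu> - \<xi> \<nu>)) = (\<Sum>\<nu>\<in>?I - {\<mu>}. if lab \<mu> = lab \<nu> then 1 / (\<xi> \<mu> - \<xi> \<nu>) else 0)"
      by (intro sum.cong refl) (simp add: Zs_def)
    moreover have "(\<Sum>j\<in>UNIV. cn j * Zs (lab \<mu>) j 0 (\<xi> \<mu>)) = cn (lab \<mu>) / \<xi> \<mu>"
    proof -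
      have "cn j * Zs (lab \<mu>) j 0 (\<xi> \<mu>) = (if j = lab \<mu> then cn j / \<xi> \<mu> else 0)" for j by (simp add: Zs_def)
      then show ?thesis by simp
    qed
    ultimately show ?thesis unfolding Eq_def split using stat[of \<mu>] \<mu> by simp
  qed
  have "((\<lambda>u. T u \<xi> \<mu> - \<xi> \<mu>) \<longlongrightarrow> T 0 \<xi> \<mu> - \<xi> \<mu>) (at 0)" if "\<mu> \<in> ?I" for \<mu>
    unfolding T_def using \<rho> \<xi>b by (intro tendsto_diff tendsto_sum tendsto_mult tendsto_const Etend) auto
  moreover have "T 0 \<xi> \<mu> - \<xi> \<mu> = 0" for \<mu> unfolding T_def by (simp add: E0)
  ultimately have "\<forall>\<^sub>F u in at 0. \<forall>\<mu>\<in>?I. dist (T u \<xi> \<mu> - \<xi> \<mu>) 0 < \<rho> / 2"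
    using \<rho> by (intro eventually_ball_finite ballI tendstoD) auto
  then obtain u1 where u1: "u1 > 0" "\<And>u. u \<noteq> 0 \<Longrightarrow> dist u 0 < u1 \<Longrightarrow> \<forall>\<mu>\<in>?I. dist (T u \<xi> \<mu> - \<xi> \<mu>) 0 < \<rho> / 2"
    unfolding eventually_at by auto
  define u0 where "u0 = min u1 \<rho>"
  have u0: "u0 > 0" using u1 \<rho> by (simp add: u0_def)
  have inb: "u \<in> cball 0 \<rho>" if "norm u < u0" for u using that by (simp add: u0_def)
  have "\<exists>x. (\<forall>i\<in>?I. x i \<in> cball (\<xi> i) \<rho>) \<and> (\<forall>i\<in>?I. T u x i = x i)" if u: "u \<noteq> 0" "norm u < u0" for u
  proof -
    have "\<forall>i\<in>?I. norm (T u \<xi> i - \<xi> i) \<le> \<rho> / 2"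
      using u1(2)[OF u(1)] u(2) unfolding u0_def by (auto simp: dist_norm less_imp_le)
    note small = this
    show ?thesis
    proof (rule contraction_fixpoint_polydisc[where I = ?I and \<rho> = \<rho> and c = \<xi> and T = "T u"])
      show "finite ?I" "\<rho> > 0" using \<rho> by auto
      show "\<forall>i\<in>?I. norm (T u \<xi> i - \<xi> i) \<le> \<rho> / 2" by (rule small)
      fix x y D assume "\<forall>i\<in>?I. x i \<in> cball (\<xi> i) \<rho>" "\<forall>i\<in>?I. y i \<in> cball (\<xi> i) \<rho>" "\<forall>i\<in>?I. norm (x i - y i) \<le> D"
      then show "\<forall>i\<in>?I. norm (T u x i - T u y i) \<le> D / 2" by (rule contr[OF inb[OF u(2)]])
    next
      fix x assume "\<forall>i\<in>?I. x i \<in> cball (\<xi> i) \<rho>" "\<forall>i\<in>?I. T u x i = x i"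
      then show ?thesis by blast
    qed
  qed
  then obtain x where xb: "\<And>u. u \<noteq> 0 \<Longrightarrow> norm u < u0 \<Longrightarrow> \<forall>i\<in>?I. x u i \<in> cball (\<xi> i) \<rho>"
    and xT: "\<And>u. u \<noteq> 0 \<Longrightarrow> norm u < u0 \<Longrightarrow> \<forall>i\<in>?I. T u (x u) i = x u i" by metis
  \<comment> \<open>A fixed point makes L applied to the equations zero; applying J, a left inverse
    of L, recovers the equations themselves.\<close>
  have xE: "Eq N lab u (x u) \<mu> = 0" if u: "u \<noteq> 0" "norm u < u0" and \<mu>: "\<mu> \<in> ?I" for u \<mu>
  proof -
    have z: "(\<Sum>\<nu>\<in>?I. L m \<nu> * Eq N lab u (x u) \<nu>) = 0" if "m \<in> ?I" for m
      using xT[OF u] that by (simp add: T_def)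
    have "0 = (\<Sum>m\<in>?I. J \<mu> m * (\<Sum>\<nu>\<in>?I. L m \<nu> * Eq N lab u (x u) \<nu>))" by (simp add: z)
    also have "\<dots> = (\<Sum>\<nu>\<in>?I. (\<Sum>m\<in>?I. J \<mu> m * L m \<nu>) * Eq N lab u (x u) \<nu>)"
      unfolding sum_distrib_left sum_distrib_right by (subst sum.swap) (simp add: mult.assoc)
    also have "\<dots> = (\<Sum>\<nu>\<in>?I. if \<mu> = \<nu> then Eq N lab u (x u) \<nu> else 0)"
      by (intro sum.cong refl) (simp add: JL[OF \<mu>])
    also have "\<dots> = Eq N lab u (x u) \<mu>" using \<mu> by simp
    finally show ?thesis by simp
  qed
  show thesis
  proof
    show "u0 > 0" by (rule u0)
    show "norm (x u \<mu>) \<le> (\<Sum>i\<in>?I. norm (\<xi> i)) + \<rho>" if u: "u \<noteq> 0" "norm u < u0" and \<mu>: "\<mu> < N" for u \<mu>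
    proof -
      have "norm (x u \<mu>) \<le> norm (\<xi> \<mu>) + norm (x u \<mu> - \<xi> \<mu>)" using norm_triangle_ineq[of "\<xi> \<mu>" "x u \<mu> - \<xi> \<mu>"] by simp
      also have "norm (\<xi> \<mu>) \<le> (\<Sum>i\<in>?I. norm (\<xi> i))" by (rule member_le_sum) (use \<mu> in auto)
      also have "norm (x u \<mu> - \<xi> \<mu>) \<le> \<rho>" using xb[OF u] \<mu> by (auto simp: dist_norm norm_minus_commute)
      finally show ?thesis by simp
    qed
    show "glc_eqs ?I (\<lambda>\<mu>. p (lab \<mu>) + u * x u \<mu>) (1 / u)" if u: "u \<noteq> 0" "norm u < u0" for u
      unfolding glc_eqs_def generic_def
    proof (intro conjI ballI allI impI)
      show "finite ?I" "card ?I = N" by auto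
      fix \<mu> assume \<mu>: "\<mu> \<in> ?I"
      show "res ?I (\<lambda>\<mu>. p (lab \<mu>) + u * x u \<mu>) (1 / u) \<mu> = 0"
        using xE[OF u \<mu>] Eq_res[OF u(1), of N lab "x u" \<mu>] u(1) by simp
      show "p (lab \<mu>) + u * x u \<mu> - p i \<notin> \<Lambda>" for i
        using Zs_ok_notin[OF ok2[OF \<mu> inb[OF u(2)] cb2[OF xb[OF u] \<mu>]] u(1), of i] by (simp add: algebra_simps)
      show "p (lab \<mu>) + u * x u \<mu> - (p (lab \<nu>) + u * x u \<nu>) \<notin> \<Lambda>" if \<nu>: "\<nu> \<in> ?I" "\<mu> \<noteq> \<nu>" for \<nu>
      proof -
        have "\<nu> \<in> ?I - {\<mu>}" using \<nu> by auto
        from Zs_ok_notin[OF ok1[OF \<mu> this inb[OF u(2)] cb1[OF xb[OF u] \<mu> \<nu>(1)]] u(1)]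
        show ?thesis by (simp add: algebra_simps)
      qed
    qed
    \<comment> \<open>Fixed points of a uniform contraction depend continuously on the parameter:
      the maximal displacement D satisfies D <= D/2 plus the change of T at the fixed argument
      \<open>x v\<close>.\<close>
    show "isCont (\<lambda>u. x u \<mu>) v" if v: "v \<noteq> 0" "norm v < u0" and \<mu>: "\<mu> < N" for v \<mu>
      unfolding isCont_def
    proof (rule tendstoI)
      fix \<epsilon> :: real assume \<epsilon>: "\<epsilon> > 0"
      have "((\<lambda>u. T u (x v) i) \<longlongrightarrow> T v (x v) i) (at v)" if "i \<in> ?I" for i
        unfolding T_def using inb[OF v(2)] xb[OF v] by (intro tendsto_diff tendsto_sum tendsto_mult tendsto_const Etend) auto
      then have "\<forall>\<^sub>F u in at v. \<forall>i\<in>?I. dist (T u (x v) i) (T v (x v) i) < \<epsilon> / 4"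
        using \<epsilon> by (intro eventually_ball_finite ballI tendstoD) auto
      moreover have "\<forall>\<^sub>F u in at v. u \<in> ball 0 u0 - {0}"
        by (rule eventually_at_in_open') (use v in \<open>auto intro!: open_delete\<close>)
      ultimately show "\<forall>\<^sub>F u in at v. dist (x u \<mu>) (x v \<mu>) < \<epsilon>"
      proof eventually_elim
        case (elim u)
        then have u: "u \<noteq> 0" "norm u < u0" by auto
        define D where "D = Max ((\<lambda>i. norm (x u i - x v i)) ` ?I)"
        have fin: "finite ((\<lambda>i. norm (x u i - x v i)) ` ?I)" "(\<lambda>i. norm (x u i - x v i)) ` ?I \<noteq> {}" using \<mu> by auto
        have le: "\<forall>i\<in>?I. norm (x u i - x v i) \<le> D" unfolding D_def using fin by (auto intro: Max_ge)
        have "D \<in> (\<lambda>i. norm (x u i - x v i)) ` ?I" unfolding D_def by (rule Max_in[OF fin])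
        then obtain i where i: "i \<in> ?I" "D = norm (x u i - x v i)" by auto
        have "x u i - x v i = (T u (x u) i - T u (x v) i) + (T u (x v) i - T v (x v) i)" using xT[OF u] xT[OF v] i by simp
        then have "D \<le> norm (T u (x u) i - T u (x v) i) + norm (T u (x v) i - T v (x v) i)"
          using i norm_triangle_ineq by metis
        also have "\<dots> \<le> D / 2 + \<epsilon> / 4"
          using contr[OF inb[OF u(2)] xb[OF u] xb[OF v] le] i(1) elim(1) by (intro add_mono) (auto simp: dist_norm less_imp_le)
        finally have "D \<le> \<epsilon> / 2" by simp
        have "norm (x u \<mu> - x v \<mu>) \<le> D" using le \<mu> by simp
        with \<open>D \<le> \<epsilon> / 2\<close> \<epsilon> show ?case by (simp add: dist_norm)
      qed
    qed
  qed
qed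

text \<open>The limit of A/h. Its sign is opposite to 2 (n_i - k_i); both vectors give the same
  point at infinity.\<close>

definition direction :: "('r \<Rightarrow> nat) \<Rightarrow> complex ^ 'r" where
  "direction k = (\<chi> i. 2 * of_nat (k i) - of_nat (ell n i))"

lemma direction_nth: "direction k $ i = 2 * of_nat (k i) - 2 * cn i"
  by (simp add: direction_def of_nat_ell)

text \<open>The N nodes enumerate the pairs of a singular point i and one of the k_i roots of the
  polynomial \<open>lagpoly\<close> attached to it; there are N pairs because the k_i sum to
  N.\<close>

lemma index_labelling:
  assumes k: "k \<in> boundary_indices n"
  obtains lab \<xi> where "\<And>i. card {\<mu>\<in>{..<N}. lab \<mu> = i} = k i" "\<And>\<mu>. \<mu> < N \<Longrightarrow> \<xi> \<mu> \<noteq> 0"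
    "\<And>\<mu> \<nu>. \<mu> < N \<Longrightarrow> \<nu> < N \<Longrightarrow> lab \<mu> = lab \<nu> \<Longrightarrow> \<xi> \<mu> = \<xi> \<nu> \<Longrightarrow> \<mu> = \<nu>"
    "\<And>\<mu>. \<mu> < N \<Longrightarrow> (\<Sum>\<nu> | \<nu> < N \<and> lab \<nu> = lab \<mu> \<and> \<nu> \<noteq> \<mu>. 1 / (\<xi> \<mu> - \<xi> \<nu>)) - cn (lab \<mu>) / \<xi> \<mu> + 1 = 0"
proof -
  have kl: "k i \<le> ell n i" for i using k by (simp add: boundary_indices_def)
  define S where "S = (SIGMA i:UNIV. lagroots (ell n i) (k i))"
  have "card S = N" unfolding S_def using k finite_lagroots[OF kl] card_lagroots[OF kl]
    by (subst card_SigmaI) (auto simp: boundary_indices_def)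
  moreover have finS: "finite S" unfolding S_def using finite_lagroots[OF kl] by (intro finite_SigmaI) auto
  ultimately obtain f where f: "bij_betw f {..<N} S"
    using ex_bij_betw_nat_finite[OF finS] by (auto simp: atLeast0LessThan)
  define lab where "lab = fst \<circ> f"
  define \<xi> where "\<xi> = snd \<circ> f"
  have inj: "\<mu> = \<nu>" if "\<mu> < N" "\<nu> < N" "lab \<mu> = lab \<nu>" "\<xi> \<mu> = \<xi> \<nu>" for \<mu> \<nu>
    using bij_betw_imp_inj_on[OF f] that by (auto simp: inj_on_def lab_def \<xi>_def prod_eq_iff)
  have fS: "f \<mu> = (lab \<mu>, \<xi> \<mu>)" for \<mu> by (simp add: lab_def \<xi>_def)
  have mem: "\<xi> \<mu> \<in> lagroots (ell n (lab \<mu>)) (k (lab \<mu>))" if "\<mu> < N" for \<mu>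
    using bij_betwE[OF f] that by (auto simp: S_def fS)
  have surj: "\<exists>\<mu><N. lab \<mu> = i \<and> \<xi> \<mu> = y" if "y \<in> lagroots (ell n i) (k i)" for i y
  proof -
    have "(i, y) \<in> f ` {..<N}" using that f by (auto simp: S_def bij_betw_def)
    then show ?thesis by (auto simp: fS)
  qed
  have bij: "bij_betw \<xi> {\<mu>\<in>{..<N}. lab \<mu> = i} (lagroots (ell n i) (k i))" for i
    unfolding bij_betw_def inj_on_def using inj mem surj by (auto simp: image_iff) blast+
  show thesis
  proof
    show "card {\<mu>\<in>{..<N}. lab \<mu> = i} = k i" for i
      using bij_betw_same_card[OF bij] card_lagroots[OF kl] by simp
    show "\<xi> \<mu> \<noteq> 0" if "\<mu> < N" for \<mu> using mem[OF that] lagroots_nonzero[OF kl] by metis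
    show "\<mu> = \<nu>" if "\<mu> < N" "\<nu> < N" "lab \<mu> = lab \<nu>" "\<xi> \<mu> = \<xi> \<nu>" for \<mu> \<nu> by (rule inj[OF that])
    show "(\<Sum>\<nu> | \<nu> < N \<and> lab \<nu> = lab \<mu> \<and> \<nu> \<noteq> \<mu>. 1 / (\<xi> \<mu> - \<xi> \<nu>)) - cn (lab \<mu>) / \<xi> \<mu> + 1 = 0" if \<mu>: "\<mu> < N" for \<mu>
    proof -
      let ?R = "lagroots (ell n (lab \<mu>)) (k (lab \<mu>))"
      have b: "bij_betw \<xi> {\<nu>. \<nu> < N \<and> lab \<nu> = lab \<mu> \<and> \<nu> \<noteq> \<mu>} (?R - {\<xi> \<mu>})"
      proof -
        have e: "{\<nu>. \<nu> < N \<and> lab \<nu> = lab \<mu> \<and> \<nu> \<noteq> \<mu>} = {\<nu>\<in>{..<N}. lab \<nu> = lab \<mu>} - {\<mu>}" by auto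
        show ?thesis unfolding e by (rule bij_betw_DiffI[OF bij]) (use \<mu> mem in auto)
      qed
      have "(\<Sum>\<nu> | \<nu> < N \<and> lab \<nu> = lab \<mu> \<and> \<nu> \<noteq> \<mu>. 1 / (\<xi> \<mu> - \<xi> \<nu>)) = (\<Sum>y\<in>?R - {\<xi> \<mu>}. 1 / (\<xi> \<mu> - y))"
        using sum.reindex_bij_betw[OF b, of "\<lambda>y. 1 / (\<xi> \<mu> - y)"] .
      moreover have "of_nat (ell n (lab \<mu>)) / 2 = cn (lab \<mu>)" by (simp add: of_nat_ell)
      ultimately show ?thesis using lagroots_stationary[OF kl mem[OF \<mu>]] by simp
    qed
  qed
qed

lemma normalized_labelled: "normalized I (\<lambda>\<mu>. p (lab \<mu>))"
  unfolding normalized_def using p_distinct by metis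

lemma card_cluster_labelled: "cluster I (\<lambda>\<mu>. p (lab \<mu>)) (p i) = {\<mu>\<in>I. lab \<mu> = i}"
proof -
  have "p j = p i \<longleftrightarrow> j = i" for j using p_distinct[of i j] by fastforce
  then show ?thesis by (simp add: cluster_def)
qed

lemma isCont_Bf:
  assumes "generic I (a v)" "\<And>\<mu>. \<mu> \<in> I \<Longrightarrow> isCont (\<lambda>u. a u \<mu>) v" "isCont h v"
  shows "isCont (\<lambda>u. Bf I (a u) (h u)) v"
proof -
  have notin: "case_sum (a v) p x - case_sum (a v) p y \<notin> \<Lambda>" if "x \<in> I <+> UNIV" "y \<in> (I <+> UNIV) - {x}" for x y
  proof -
    have g: "\<And>\<mu> \<nu>. \<mu> \<in> I \<Longrightarrow> \<nu> \<in> I \<Longrightarrow> \<mu> \<noteq> \<nu> \<Longrightarrow> a v \<mu> - a v \<nu> \<notin> \<Lambda>" "\<And>\<mu> i. \<mu> \<in> I \<Longrightarrow> a v \<mu> - p i \<notin> \<Lambda>"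
      "\<And>\<mu> i. \<mu> \<in> I \<Longrightarrow> p i - a v \<mu> \<notin> \<Lambda>"
      using assms(1) lattice_diff_commute by (auto simp: generic_def)
    show ?thesis using that g p_distinct by (cases x; cases y) auto
  qed
  have "((\<lambda>u. case_sum (a u) p x) \<longlongrightarrow> case_sum (a v) p x) (at v)" if "x \<in> I <+> (UNIV :: 'r set)" for x
    using assms(2) that by (auto simp: isCont_def)
  then show ?thesis unfolding isCont_def Bf_def Let_def using assms(3)
    by (intro tendsto_intros tendsto_wzeta tendsto_wp notin) (auto simp: isCont_def)
qed

text \<open>
  The parameter \<open>s = B powr (-1/2)\<close> of the branch of the variety is asymptotic to \<open>u = 1/h\<close>, so that
  Brouwer's theorem makes it attain every small value along the branch of the curve.
\<close>

lemma branch_surjective: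
  assumes k: "k \<in> boundary_indices n"
  obtains lab where "\<And>i. card {\<mu>\<in>{..<N}. lab \<mu> = i} = k i"
    "\<And>\<delta>. \<delta> > 0 \<Longrightarrow> \<exists>s0>0. \<forall>s. s \<noteq> 0 \<and> norm s < s0 \<longrightarrow> (\<exists>b h. glc_eqs {..<N} b h \<and>
       (\<forall>\<mu><N. dist (b \<mu>) (p (lab \<mu>)) < \<delta>) \<and> norm h > 1 / \<delta> \<and> s\<^sup>2 * Bf {..<N} b h = 1 \<and>
       (\<forall>i. dist (s * Af {..<N} b h $ i) (direction k $ i) < \<delta>))"
proof -
  let ?I = "{..<N}"
  obtain lab \<xi> where lab: "\<And>i. card {\<mu>\<in>?I. lab \<mu> = i} = k i"
    and \<xi>: "\<And>\<mu>. \<mu> < N \<Longrightarrow> \<xi> \<mu> \<noteq> 0"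
    "\<And>\<mu> \<nu>. \<mu> < N \<Longrightarrow> \<nu> < N \<Longrightarrow> lab \<mu> = lab \<nu> \<Longrightarrow> \<xi> \<mu> = \<xi> \<nu> \<Longrightarrow> \<mu> = \<nu>"
    "\<And>\<mu>. \<mu> < N \<Longrightarrow> (\<Sum>\<nu> | \<nu> < N \<and> lab \<nu> = lab \<mu> \<and> \<nu> \<noteq> \<mu>. 1 / (\<xi> \<mu> - \<xi> \<nu>)) - cn (lab \<mu>) / \<xi> \<mu> + 1 = 0"
    by (rule index_labelling[OF k]) blast
  obtain u0 C x where u0: "u0 > 0" and C: "\<And>u \<mu>. u \<noteq> 0 \<Longrightarrow> norm u < u0 \<Longrightarrow> \<mu> < N \<Longrightarrow> norm (x u \<mu>) \<le> C"
    and eqs: "\<And>u. u \<noteq> 0 \<Longrightarrow> norm u < u0 \<Longrightarrow> glc_eqs {..<N} (\<lambda>\<mu>. p (lab \<mu>) + u * x u \<mu>) (1 / u)"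
    and cont: "\<And>u \<mu>. u \<noteq> 0 \<Longrightarrow> norm u < u0 \<Longrightarrow> \<mu> < N \<Longrightarrow> isCont (\<lambda>u. x u \<mu>) u"
    by (rule rescaled_branch[where \<xi> = \<xi> and lab = lab, OF \<xi>(1) \<xi>(2) \<xi>(3)]) (assumption | rule that)+
  define b where "b u \<mu> = p (lab \<mu>) + u * x u \<mu>" for u \<mu>
  have ev: "\<forall>\<^sub>F u in at (0::complex). u \<noteq> 0 \<and> norm u < u0"
    unfolding eventually_at using u0 by (auto intro!: exI[of _ u0])
  have eq: "\<forall>\<^sub>F u in at 0. glc_eqs ?I (b u) (1 / u)" using ev by eventually_elim (use eqs in \<open>simp add: b_def[abs_def]\<close>)
  have lim: "((\<lambda>u. b u \<mu>) \<longlongrightarrow> p (lab \<mu>)) (at 0)" if "\<mu> \<in> ?I" for \<mu>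
  proof -
    have "((\<lambda>u. u * x u \<mu>) \<longlongrightarrow> 0) (at 0)"
    proof (rule Lim_null_comparison)
      show "\<forall>\<^sub>F u in at 0. norm (u * x u \<mu>) \<le> norm u * C"
        using ev by eventually_elim (use C that in \<open>auto simp: norm_mult intro!: mult_left_mono\<close>)
      show "((\<lambda>u. norm u * C) \<longlongrightarrow> 0) (at (0::complex))" by (auto intro!: tendsto_eq_intros)
    qed
    then show ?thesis unfolding b_def using tendsto_add[OF tendsto_const[of "p (lab \<mu>)"]] by fastforce
  qed
  have hinf: "filterlim (\<lambda>u. 1 / u) at_infinity (at (0::complex))"
    unfolding inverse_eq_divide[symmetric] by (rule filterlim_inverse_at_infinity)
  have bot: "at (0::complex) \<noteq> bot" by simp
  note lims = finite_lessThan normalized_labelled lim eq bot hinf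
  have B1: "((\<lambda>u. Bf ?I (b u) (1 / u) / (1 / u)\<^sup>2) \<longlongrightarrow> 1) (at 0)"
    by (rule Bf_over_h2[OF lims])
  define Bu where "Bu u = u\<^sup>2 * Bf ?I (b u) (1 / u)" for u
  have B1: "(Bu \<longlongrightarrow> 1) (at 0)" using B1 by (simp add: Bu_def[abs_def] power_one_over mult.commute)
  have A1: "((\<lambda>u. u * Af ?I (b u) (1 / u) $ i) \<longlongrightarrow> direction k $ i) (at 0)" for i
    using Af_over_h[OF lims, of i] unfolding card_cluster_labelled lab direction_nth by (simp add: mult.commute)
  \<comment> \<open>Normalization giving s^2 B = 1. Since \<open>Bu\<close> tends to 1, the
    principal root is close to 1 and s is asymptotic to u.\<close>
  define s where "s u = u / csqrt (Bu u)" for u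
  have r1: "((\<lambda>u. csqrt (Bu u)) \<longlongrightarrow> 1) (at 0)"
    using isCont_tendsto_compose[OF continuous_at_csqrt B1] by simp
  have su: "((\<lambda>u. s u / u) \<longlongrightarrow> 1) (at 0)"
  proof (rule Lim_transform_eventually)
    show "((\<lambda>u. 1 / csqrt (Bu u)) \<longlongrightarrow> 1) (at 0)" using tendsto_divide[OF tendsto_const r1, of 1] by simp
    show "\<forall>\<^sub>F u in at 0. 1 / csqrt (Bu u) = s u / u" using ev by eventually_elim (auto simp: s_def)
  qed
  have sA: "((\<lambda>u. s u * Af ?I (b u) (1 / u) $ i) \<longlongrightarrow> direction k $ i) (at 0)" for i
  proof (rule Lim_transform_eventually)
    show "((\<lambda>u. (s u / u) * (u * Af ?I (b u) (1 / u) $ i)) \<longlongrightarrow> direction k $ i) (at 0)"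
      using tendsto_mult[OF su A1] by simp
    show "\<forall>\<^sub>F u in at 0. (s u / u) * (u * Af ?I (b u) (1 / u) $ i) = s u * Af ?I (b u) (1 / u) $ i"
      using ev by eventually_elim auto
  qed
  show thesis
  proof
    show "card {\<mu>\<in>?I. lab \<mu> = i} = k i" for i by (rule lab)
    fix \<delta> :: real assume \<delta>: "\<delta> > 0"
    have "\<forall>\<^sub>F u in at 0. \<forall>\<mu>\<in>?I. dist (b u \<mu>) (p (lab \<mu>)) < \<delta>"
      by (intro eventually_ball_finite ballI tendstoD lim finite_lessThan \<delta>)
    moreover have "\<forall>\<^sub>F u in at 0. \<forall>i\<in>UNIV. dist (s u * Af ?I (b u) (1 / u) $ i) (direction k $ i) < \<delta>"
      by (intro eventually_ball_finite ballI tendstoD sA finite \<delta>)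
    moreover have "\<forall>\<^sub>F u in at 0. dist (s u / u) 1 < 1 / 2" by (rule tendstoD[OF su]) simp
    moreover have "\<forall>\<^sub>F u in at 0. dist (Bu u) 1 < 1" by (rule tendstoD[OF B1]) simp
    moreover have "\<forall>\<^sub>F u in at (0::complex). norm u < \<delta>" using \<delta> unfolding eventually_at by auto
    ultimately have "\<forall>\<^sub>F u in at 0. (\<forall>\<mu>\<in>?I. dist (b u \<mu>) (p (lab \<mu>)) < \<delta>) \<and>
      (\<forall>i\<in>UNIV. dist (s u * Af ?I (b u) (1 / u) $ i) (direction k $ i) < \<delta>) \<and> dist (s u / u) 1 < 1 / 2 \<and>
      dist (Bu u) 1 < 1 \<and> norm u < \<delta> \<and> u \<noteq> 0 \<and> norm u < u0"
      using ev by eventually_elim blast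
    then obtain d where d: "d > 0" and
      du: "\<And>u. u \<noteq> 0 \<Longrightarrow> norm u < d \<Longrightarrow> (\<forall>\<mu>\<in>?I. dist (b u \<mu>) (p (lab \<mu>)) < \<delta>) \<and>
      (\<forall>i\<in>UNIV. dist (s u * Af ?I (b u) (1 / u) $ i) (direction k $ i) < \<delta>) \<and> dist (s u / u) 1 < 1 / 2 \<and>
      dist (Bu u) 1 < 1 \<and> norm u < \<delta> \<and> u \<noteq> 0 \<and> norm u < u0"
      unfolding eventually_at by (auto simp: dist_norm)
    \<comment> \<open>Keeps \<open>Bu\<close> off the cut of the principal square root, so that s is
      continuous.\<close>
    have Re: "Re (Bu u) > 0" if "u \<noteq> 0" "norm u < d" for u
      using du[OF that] abs_Re_le_cmod[of "Bu u - 1"] by (auto simp: dist_norm)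
    have near: "norm (u - s u) \<le> norm u / 2" if "norm u < d" for u
    proof (cases "u = 0")
      case False
      have "u - s u = - (u * (s u / u - 1))" using False by (simp add: algebra_simps)
      then have "norm (u - s u) = norm u * norm (s u / u - 1)" by (simp only: norm_minus_cancel norm_mult)
      also have "\<dots> \<le> norm u * (1 / 2)" using du[OF False that] by (intro mult_left_mono) (auto simp: dist_norm)
      finally show ?thesis by simp
    qed (simp add: s_def)
    have sc: "isCont s u" if u: "norm u < d" for u
    proof (cases "u = 0")
      case False
      have "isCont (\<lambda>u. Bf ?I (b u) (1 / u)) u"
      proof (rule isCont_Bf)
        show "generic ?I (b u)" using eqs[of u] du[OF False u] by (simp add: glc_eqs_def b_def[abs_def])
        show "isCont (\<lambda>u. b u \<mu>) u" if "\<mu> \<in> ?I" for \<mu>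
          unfolding b_def using cont[of u \<mu>] du[OF False u] that by (intro continuous_intros) auto
        show "isCont (\<lambda>u. 1 / u) u" using False by (intro continuous_intros)
      qed
      then have "isCont Bu u" unfolding Bu_def by (intro continuous_intros)
      moreover have "Bu u \<notin> \<real>\<^sub>\<le>\<^sub>0" using Re[OF False u] by (auto simp: complex_nonpos_Reals_iff)
      ultimately have "isCont (\<lambda>u. csqrt (Bu u)) u" by (intro isCont_o2[OF _ continuous_at_csqrt])
      moreover have "csqrt (Bu u) \<noteq> 0" using Re[OF False u] by auto
      ultimately show ?thesis unfolding s_def by (intro continuous_intros)
    next
      case True
      have "((\<lambda>u. u * (s u / u)) \<longlongrightarrow> 0 * 1) (at 0)" by (intro tendsto_mult su tendsto_ident_at)
      moreover have "\<forall>\<^sub>F u in at 0. u * (s u / u) = s u" using ev by eventually_elim simp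
      ultimately have "(s \<longlongrightarrow> 0 * 1) (at 0)" by (rule Lim_transform_eventually)
      then show ?thesis using True by (simp add: isCont_def s_def)
    qed
    define r where "r = d / 2"
    have r: "r > 0" "r < d" using d by (auto simp: r_def)
    show "\<exists>s0>0. \<forall>s. s \<noteq> 0 \<and> norm s < s0 \<longrightarrow> (\<exists>b h. glc_eqs {..<N} b h \<and>
       (\<forall>\<mu><N. dist (b \<mu>) (p (lab \<mu>)) < \<delta>) \<and> norm h > 1 / \<delta> \<and> s\<^sup>2 * Bf {..<N} b h = 1 \<and>
       (\<forall>i. dist (s * Af {..<N} b h $ i) (direction k $ i) < \<delta>))"
    proof (intro exI[of _ "r / 2"] conjI allI impI)
      show "r / 2 > 0" using r by simp
      fix t :: complex assume t: "t \<noteq> 0 \<and> norm t < r / 2"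
      \<comment> \<open>Solving s u = t means finding a fixed point of z -> t + (z - s z). Both
        \<open>norm t\<close> and \<open>norm (z - s z)\<close> are at most r / 2, so this map
        preserves the closed disc.\<close>
      have "\<exists>u\<in>cball 0 r. s u = t"
      proof (rule brouwer_surjective_cball[where S = "{t}"])
        show "continuous_on (cball 0 r) s"
          using sc r by (intro continuous_at_imp_continuous_on ballI) auto
        fix y z assume "y \<in> {t}" "z \<in> cball (0::complex) r"
        then have "norm (y + (z - s z)) \<le> norm t + norm z / 2" "norm z \<le> r"
          using near[of z] r norm_triangle_ineq[of y "z - s z"] by auto
        then show "y + (z - s z) \<in> cball 0 r" using t by auto
      qed (use r in auto)
      then obtain u where u: "norm u \<le> r" "s u = t" by auto
      then have u: "u \<noteq> 0" "norm u < d" "s u = t" using t r by (auto simp: s_def)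
      note D = du[OF u(1,2)]
      have "t\<^sup>2 * Bf ?I (b u) (1 / u) = 1"
      proof -
        have "t\<^sup>2 * Bf ?I (b u) (1 / u) = Bu u / (csqrt (Bu u))\<^sup>2"
          unfolding u(3)[symmetric] s_def Bu_def by (simp add: power_divide)
        also have "\<dots> = 1" using Re[OF u(1,2)] by (auto simp: power2_csqrt)
        finally show ?thesis .
      qed
      moreover have "glc_eqs ?I (b u) (1 / u)" using eqs[of u] D by (simp add: b_def[abs_def])
      moreover have "norm (1 / u) > 1 / \<delta>" using D \<delta> u(1) by (simp add: norm_divide frac_less2)
      ultimately show "\<exists>b h. glc_eqs {..<N} b h \<and>
       (\<forall>\<mu><N. dist (b \<mu>) (p (lab \<mu>)) < \<delta>) \<and> norm h > 1 / \<delta> \<and> t\<^sup>2 * Bf {..<N} b h = 1 \<and>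
       (\<forall>i. dist (t * Af {..<N} b h $ i) (direction k $ i) < \<delta>)"
        using D unfolding u(3) by (intro exI[of _ "b u"] exI[of _ "1 / u"]) auto
    qed
  qed
qed

end

section \<open>Neighbourhoods in the quotient\<close>

lemma topspace_quotient_topology: "topspace (quotient_topology X f) = f ` topspace X"
  using quotient_map_quotient_topology[of X f] by (simp add: quotient_map_def)

lemma image_mset_restrict: "image_mset (restrict b I) (mset_set I) = image_mset b (mset_set I)"
proof (cases "finite I")
  case True
  then show ?thesis by (intro image_mset_cong) simp
qed simp

lemma topspace_Sym: "topspace (Sym_topology M) = range (\<lambda>a. image_mset a (mset_set {..<M}))"
proof -
  have "(\<lambda>a. image_mset a (mset_set {..<M})) ` (PiE {..<M} (\<lambda>_. UNIV)) = range (\<lambda>a. image_mset a (mset_set {..<M}))"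
  proof (intro equalityI subsetI)
    fix y assume "y \<in> range (\<lambda>a. image_mset a (mset_set {..<M}))"
    then obtain a where "y = image_mset a (mset_set {..<M})" by blast
    then have "y = image_mset (restrict a {..<M}) (mset_set {..<M})" by (simp only: image_mset_restrict)
    then show "y \<in> (\<lambda>a. image_mset a (mset_set {..<M})) ` (PiE {..<M} (\<lambda>_. UNIV))"
      by (intro image_eqI[where x = "restrict a {..<M}"]) (simp_all add: PiE_def)
  qed blast
  then show ?thesis by (simp add: Sym_topology_def topspace_quotient_topology)
qed

lemma topspace_P1: "topspace P1_topology = UNIV"
  by (simp add: P1_topology_def UNIV_option_conv)

text \<open>The preimage in the product space is the union of the boxes with permuted
  centres.\<close>

lemma openin_Sym_box:
  fixes a :: "nat \<Rightarrow> complex"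
  shows "openin (Sym_topology M) {image_mset b (mset_set {..<M}) |b. \<forall>\<mu><M. dist (b \<mu>) (a \<mu>) < \<delta>}" (is "openin _ ?U")
proof -
  let ?X = "product_topology (\<lambda>_. euclidean :: complex topology) {..<M}"
  let ?q = "\<lambda>a. image_mset a (mset_set {..<M}) :: complex multiset"
  have "{x \<in> topspace ?X. ?q x \<in> ?U} = (\<Union>\<pi>\<in>{\<pi>. \<pi> permutes {..<M}}. PiE {..<M} (\<lambda>\<mu>. ball (a (\<pi> \<mu>)) \<delta>))" (is "?L = ?R")
  proof (intro set_eqI iffI)
    fix x assume x: "x \<in> ?L"
    then obtain b where b: "?q x = ?q b" "\<forall>\<mu><M. dist (b \<mu>) (a \<mu>) < \<delta>" by blast
    obtain \<pi> where \<pi>: "\<pi> permutes {..<M}" "\<forall>\<mu>\<in>{..<M}. x \<mu> = b (\<pi> \<mu>)"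
      using image_mset_eq_implies_permutes[OF finite_lessThan b(1)] by blast
    have "x \<mu> \<in> ball (a (\<pi> \<mu>)) \<delta>" if "\<mu> < M" for \<mu>
    proof -
      have "\<pi> \<mu> < M" using permutes_in_image[OF \<pi>(1), of \<mu>] that by simp
      then show ?thesis using \<pi>(2) b(2) that by (simp add: dist_commute)
    qed
    then show "x \<in> ?R" using x \<pi>(1) by (auto simp: PiE_def)
  next
    fix x assume "x \<in> ?R"
    then obtain \<pi> where \<pi>: "\<pi> permutes {..<M}" and x: "x \<in> PiE {..<M} (\<lambda>\<mu>. ball (a (\<pi> \<mu>)) \<delta>)" by blast
    define b where "b = x \<circ> inv \<pi>"
    have \<pi>': "inv \<pi> permutes {..<M}" by (rule permutes_inv[OF \<pi>])
    have "image_mset (inv \<pi>) (mset_set {..<M}) = mset_set {..<M}" by (rule permutes_image_mset[OF \<pi>'])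
    then have "?q x = ?q b" unfolding b_def by (metis multiset.map_comp)
    moreover have "dist (b \<mu>) (a \<mu>) < \<delta>" if "\<mu> < M" for \<mu>
    proof -
      have "inv \<pi> \<mu> < M" using permutes_in_image[OF \<pi>', of \<mu>] that by simp
      then have "x (inv \<pi> \<mu>) \<in> ball (a (\<pi> (inv \<pi> \<mu>))) \<delta>" using PiE_mem[OF x] by blast
      then show ?thesis using permutes_inverses(1)[OF \<pi>] by (simp add: b_def dist_commute)
    qed
    ultimately show "x \<in> ?L" using x by (auto simp: PiE_def)
  qed
  moreover have "openin ?X ?R"
    by (intro openin_Union ballI) (auto simp: openin_PiE_gen intro!: openin_Union)
  moreover have "?U \<subseteq> ?q ` topspace ?X"
  proof
    fix y assume "y \<in> ?U"
    then obtain b where "y = ?q b" by (elim CollectE exE conjE)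
    then show "y \<in> ?q ` topspace ?X" by (intro image_eqI[of _ _ "restrict b {..<M}"]) (simp_all add: image_mset_restrict PiE_def)
  qed
  ultimately show ?thesis unfolding Sym_topology_def openin_quotient_topology by simp
qed

definition near_infinity :: "real \<Rightarrow> complex option \<Rightarrow> bool" where
  "near_infinity \<delta> H = (case H of None \<Rightarrow> True | Some h \<Rightarrow> norm h > 1 / \<delta>)"

lemma near_infinity_simps [simp]: "near_infinity \<delta> None" "near_infinity \<delta> (Some h) \<longleftrightarrow> norm h > 1 / \<delta>"
  by (simp_all add: near_infinity_def)

text \<open>The translation by c is included because lattice shifts of the nodes translate h; the
  complement of the image is a closed disc about c, which is compact.\<close>

lemma openin_P1_near_infinity: "openin P1_topology (map_option (\<lambda>h. h + c) ` Collect (near_infinity \<delta>))"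
proof -
  have "map_option (\<lambda>h. h + c) ` Collect (near_infinity \<delta>) = insert None (Some ` (UNIV - cball c (1 / \<delta>)))"
  proof (intro set_eqI iffI)
    fix H assume "H \<in> insert None (Some ` (UNIV - cball c (1 / \<delta>)))"
    then have "H = None \<or> (\<exists>h. H = Some h \<and> norm (h - c) > 1 / \<delta>)" by (auto simp: dist_norm norm_minus_commute)
    then have "H = map_option (\<lambda>h. h + c) (map_option (\<lambda>h. h - c) H)" "near_infinity \<delta> (map_option (\<lambda>h. h - c) H)" by auto
    then show "H \<in> map_option (\<lambda>h. h + c) ` Collect (near_infinity \<delta>)" by blast
  next
    fix H assume "H \<in> map_option (\<lambda>h. h + c) ` Collect (near_infinity \<delta>)"
    then obtain H' where "H = map_option (\<lambda>h. h + c) H'" "near_infinity \<delta> H'" by blast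
    then show "H \<in> insert None (Some ` (UNIV - cball c (1 / \<delta>)))"
      by (cases H') (auto simp: dist_norm)
  qed
  then show ?thesis
    unfolding P1_topology_def openin_Alexandroff_compactification by (intro disjI2 exI[of _ "cball c (1 / \<delta>)"]) auto
qed

lemma openin_P1_ball: "openin P1_topology (map_option (\<lambda>h. h + c) ` Some ` ball h0 \<delta>)"
proof -
  have "map_option (\<lambda>h. h + c) ` Some ` ball h0 \<delta> = Some ` ((+) c ` ball h0 \<delta>)"
    unfolding image_image by (intro image_cong) (auto simp: add.commute)
  then show ?thesis unfolding P1_topology_def by (simp add: open_translation)
qed

lemma LIMSEQ_of_dist_less:
  assumes "\<And>m. dist (f m) l < inverse (real (Suc m))"
  shows "f \<longlonglongrightarrow> l"
proof (rule metric_LIMSEQ_I)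
  fix e :: real assume "e > 0"
  then obtain k where k: "inverse (real (Suc k)) < e" using reals_Archimedean by blast
  have "dist (f m) l < e" if "m \<ge> k" for m
  proof -
    have "inverse (real (Suc m)) \<le> inverse (real (Suc k))" using that by (intro le_imp_inverse_le) auto
    then show ?thesis using assms[of m] k by linarith
  qed
  then show "\<exists>k. \<forall>m\<ge>k. dist (f m) l < e" by blast
qed

context glc
begin

text \<open>The preimage under the quotient map is the union, over all families of lattice shifts,
  of shifted boxes times translated sets; this is why openness of every translate of
  \<open>O1\<close> is assumed.\<close>

lemma openin_P_box:
  assumes O: "\<And>c. openin P1_topology (map_option (\<lambda>h. h + c) ` O1)"
  shows "openin (P_topology \<tau> N) {pt b H |b H. (\<forall>\<mu><N. dist (b \<mu>) (a \<mu>) < \<delta>) \<and> H \<in> O1}" (is "openin _ ?U")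
proof -
  let ?q = "\<lambda>a. image_mset a (mset_set {..<N}) :: complex multiset"
  let ?X = "prod_topology (Sym_topology N) P1_topology"
  define D where "D m = {?q b |b. \<forall>\<mu><N. dist (b \<mu>) (a \<mu> + lat (m \<mu>)) < \<delta>} \<times> map_option (\<lambda>h. h + (\<Sum>\<mu>\<in>{..<N}. eta (m \<mu>))) ` O1" for m
  have oD: "openin ?X (D m)" for m unfolding D_def openin_prod_Times_iff
    by (intro disjI2 conjI openin_Sym_box O)
  have "x \<in> topspace ?X \<and> glc_class \<tau> x \<in> ?U \<longleftrightarrow> (\<exists>m. x \<in> D m)" for x
  proof
    assume "x \<in> topspace ?X \<and> glc_class \<tau> x \<in> ?U"
    then obtain b H where b: "glc_class \<tau> x = pt b H" "\<forall>\<mu><N. dist (b \<mu>) (a \<mu>) < \<delta>" "H \<in> O1" by blast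
    have "x \<in> pt b H" using b(1) glc_class_self[of x] by simp
    then obtain m where "x = (?q (\<lambda>\<mu>. b \<mu> + lat (m \<mu>)), map_option (\<lambda>h. h + (\<Sum>\<mu>\<in>{..<N}. eta (m \<mu>))) H)"
      unfolding pt_def glc_class_mem_iff[OF finite_lessThan] by blast
    then have "x \<in> D m" unfolding D_def using b(2,3)
      by (simp only:) (intro SigmaI imageI; force simp: dist_norm)
    then show "\<exists>m. x \<in> D m" by blast
  next
    assume "\<exists>m. x \<in> D m"
    then obtain m where xm: "x \<in> D m" by blast
    then obtain b H where x: "x = (?q b, map_option (\<lambda>h. h + (\<Sum>\<mu>\<in>{..<N}. eta (m \<mu>))) H)"
      and b: "\<forall>\<mu><N. dist (b \<mu>) (a \<mu> + lat (m \<mu>)) < \<delta>" and H: "H \<in> O1"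
      unfolding D_def by auto
    define b' where "b' \<mu> = b \<mu> - lat (m \<mu>)" for \<mu>
    have "x = (?q (\<lambda>\<mu>. b' \<mu> + lat (m \<mu>)), map_option (\<lambda>h. h + (\<Sum>\<mu>\<in>{..<N}. eta (m \<mu>))) H)"
      by (simp add: x b'_def)
    then have "x \<in> pt b' H" unfolding pt_def glc_class_mem_iff[OF finite_lessThan] by blast
    then have "pt b' H = glc_class \<tau> x" unfolding pt_def using glc_class_eq_iff by blast
    then have c: "glc_class \<tau> x = pt b' H" by simp
    have d: "dist (b' \<mu>) (a \<mu>) < \<delta>" if "\<mu> < N" for \<mu>
      using b that by (simp add: b'_def dist_norm algebra_simps)
    have "glc_class \<tau> x \<in> ?U"
      unfolding mem_Collect_eq by (intro exI[of _ b'] exI[of _ H] conjI allI impI c d H)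
    moreover have "x \<in> topspace ?X" using openin_subset[OF oD] xm by (rule subsetD)
    ultimately show "x \<in> topspace ?X \<and> glc_class \<tau> x \<in> ?U" by simp
  qed
  then have e: "{x \<in> topspace ?X. glc_class \<tau> x \<in> ?U} = (\<Union>m. D m)"
    by (intro set_eqI) (simp only: mem_Collect_eq UN_iff bex_UNIV)
  have "?U \<subseteq> glc_class \<tau> ` topspace ?X"
    by (auto simp: pt_def topspace_Sym topspace_P1)
  moreover have "openin ?X (\<Union>m. D m)" using oD by blast
  ultimately show ?thesis unfolding P_topology_def openin_quotient_topology e by blast
qed

lemma openin_P_near_infinity:
  "openin (P_topology \<tau> N) {pt b H |b H. (\<forall>\<mu><N. dist (b \<mu>) (a \<mu>) < \<delta>) \<and> near_infinity \<delta> H}"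
  using openin_P_box[of "Collect (near_infinity \<delta>)", OF openin_P1_near_infinity] by simp

lemma openin_P_finite:
  "openin (P_topology \<tau> N) {pt b (Some h) |b h. (\<forall>\<mu><N. dist (b \<mu>) (a \<mu>) < \<delta>) \<and> dist h h0 < \<delta>}"
proof -
  have "{pt b (Some h) |b h. (\<forall>\<mu><N. dist (b \<mu>) (a \<mu>) < \<delta>) \<and> dist h h0 < \<delta>} =
     {pt b H |b H. (\<forall>\<mu><N. dist (b \<mu>) (a \<mu>) < \<delta>) \<and> H \<in> Some ` ball h0 \<delta>}"
  proof (intro set_eqI iffI)
    fix y assume "y \<in> {pt b (Some h) |b h. (\<forall>\<mu><N. dist (b \<mu>) (a \<mu>) < \<delta>) \<and> dist h h0 < \<delta>}"
    then obtain b h where "y = pt b (Some h)" "\<forall>\<mu><N. dist (b \<mu>) (a \<mu>) < \<delta>" "dist h h0 < \<delta>" by (elim CollectE exE conjE)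
    then show "y \<in> {pt b H |b H. (\<forall>\<mu><N. dist (b \<mu>) (a \<mu>) < \<delta>) \<and> H \<in> Some ` ball h0 \<delta>}"
      by (intro CollectI exI[of _ b] exI[of _ "Some h"] conjI) (simp_all add: dist_commute)
  next
    fix y assume "y \<in> {pt b H |b H. (\<forall>\<mu><N. dist (b \<mu>) (a \<mu>) < \<delta>) \<and> H \<in> Some ` ball h0 \<delta>}"
    then obtain b H where y: "y = pt b H" "\<forall>\<mu><N. dist (b \<mu>) (a \<mu>) < \<delta>" "H \<in> Some ` ball h0 \<delta>" by (elim CollectE exE conjE)
    obtain h where "H = Some h" "h \<in> ball h0 \<delta>" using y(3) by (elim imageE)
    then show "y \<in> {pt b (Some h) |b h. (\<forall>\<mu><N. dist (b \<mu>) (a \<mu>) < \<delta>) \<and> dist h h0 < \<delta>}"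
      using y(1,2) by (intro CollectI exI[of _ b] exI[of _ h] conjI) (simp_all add: dist_commute)
  qed
  then show ?thesis using openin_P_box[of "Some ` ball h0 \<delta>", OF openin_P1_ball] by simp
qed

text \<open>Converse of the openness of boxes: a neighbourhood of a point with h = infinity contains
  a box. A neighbourhood of infinity omits only a compact, hence bounded, set, which fixes how small
  delta must be.\<close>

lemma P_neighbourhood_infinity:
  assumes V: "openin (P_topology \<tau> N) V" and a: "pt a None \<in> V"
  obtains \<delta> where "\<delta> > 0" "\<And>b H. \<forall>\<mu><N. dist (b \<mu>) (a \<mu>) < \<delta> \<Longrightarrow> near_infinity \<delta> H \<Longrightarrow> pt b H \<in> V"
proof -
  let ?q = "\<lambda>a. image_mset a (mset_set {..<N}) :: complex multiset"
  let ?Y = "product_topology (\<lambda>_. euclidean :: complex topology) {..<N}"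
  let ?X = "prod_topology (Sym_topology N) P1_topology"
  have o1: "openin ?X {x \<in> topspace ?X. glc_class \<tau> x \<in> V}"
    using V by (simp add: P_topology_def openin_quotient_topology)
  have m1: "(?q a, None) \<in> {x \<in> topspace ?X. glc_class \<tau> x \<in> V}" using a by (simp add: topspace_Sym topspace_P1 pt_def)
  obtain S T where S: "openin (Sym_topology N) S" "?q a \<in> S" and T: "openin P1_topology T" "None \<in> T"
    and ST: "S \<times> T \<subseteq> {x \<in> topspace ?X. glc_class \<tau> x \<in> V}"
    using o1[unfolded openin_prod_topology_alt, rule_format, OF m1] by (elim exE conjE)
  have "openin ?Y {x \<in> topspace ?Y. ?q x \<in> S}"
    using S by (simp add: Sym_topology_def openin_quotient_topology)
  moreover have "restrict a {..<N} \<in> {x \<in> topspace ?Y. ?q x \<in> S}" using S(2) by (simp add: image_mset_restrict)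
  ultimately have "\<exists>U. finite {i \<in> {..<N}. U i \<noteq> topspace (euclidean :: complex topology)} \<and> (\<forall>i\<in>{..<N}. openin euclidean (U i)) \<and>
      restrict a {..<N} \<in> PiE {..<N} U \<and> PiE {..<N} U \<subseteq> {x \<in> topspace ?Y. ?q x \<in> S}"
    unfolding openin_product_topology_alt by (rule bspec)
  then obtain U where Ua: "\<forall>i\<in>{..<N}. openin euclidean (U i)" and U: "restrict a {..<N} \<in> PiE {..<N} U" "PiE {..<N} U \<subseteq> {x \<in> topspace ?Y. ?q x \<in> S}"
    by (elim exE conjE)
  have Uo: "open (U \<mu>)" if "\<mu> < N" for \<mu>
  proof -
    have "openin euclidean (U \<mu>)" by (rule bspec[OF Ua]) (simp add: that)
    then show ?thesis by (subst open_openin)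
  qed
  have "\<forall>\<mu>\<in>{..<N}. \<forall>\<^sub>F \<delta> in at_right 0. ball (a \<mu>) \<delta> \<subseteq> U \<mu>"
  proof
    fix \<mu> assume \<mu>: "\<mu> \<in> {..<N}"
    have "a \<mu> \<in> U \<mu>" using PiE_mem[OF U(1) \<mu>] \<mu> by simp
    then obtain e where e: "e > 0" "ball (a \<mu>) e \<subseteq> U \<mu>" using Uo[of \<mu>] \<mu> open_contains_ball by blast
    show "\<forall>\<^sub>F \<delta> in at_right 0. ball (a \<mu>) \<delta> \<subseteq> U \<mu>"
      unfolding eventually_at_right_field by (intro exI[of _ e]) (use e in auto)
  qed
  then have ev: "\<forall>\<^sub>F \<delta> in at_right 0. \<forall>\<mu>\<in>{..<N}. ball (a \<mu>) \<delta> \<subseteq> U \<mu>" by (intro eventually_ball_finite) auto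
  obtain C where C: "compact C" "T = insert None (Some ` (- C))"
    using T unfolding P1_topology_def openin_Alexandroff_compactification by (auto simp: Compl_eq_Diff_UNIV)
  obtain R where R: "R > 0" "C \<subseteq> ball 0 R" using compact_imp_bounded[OF C(1)] bounded_subset_ballD by blast
  have "\<forall>\<^sub>F \<delta> in at_right 0. \<delta> < 1 / R"
    unfolding eventually_at_right_field using R by (intro exI[of _ "1 / R"]) auto
  moreover have "\<forall>\<^sub>F \<delta> in at_right (0::real). \<delta> > 0" by (rule eventually_at_right_less)
  ultimately have "\<forall>\<^sub>F \<delta> in at_right 0. \<delta> > 0 \<and> \<delta> < 1 / R \<and> (\<forall>\<mu>\<in>{..<N}. ball (a \<mu>) \<delta> \<subseteq> U \<mu>)"
    using ev by eventually_elim blast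
  from eventually_happens'[OF trivial_limit_at_right_real this]
  obtain \<delta> where \<delta>: "\<delta> > 0" "\<delta> < 1 / R" "\<And>\<mu>. \<mu> < N \<Longrightarrow> ball (a \<mu>) \<delta> \<subseteq> U \<mu>" by auto
  show thesis
  proof (rule that[OF \<delta>(1)])
    fix b H assume b: "\<forall>\<mu><N. dist (b \<mu>) (a \<mu>) < \<delta>" and H: "near_infinity \<delta> H"
    have "b \<mu> \<in> U \<mu>" if "\<mu> < N" for \<mu> using \<delta>(3)[OF that] b that by (auto simp: dist_commute)
    then have "restrict b {..<N} \<in> PiE {..<N} U" by auto
    with U(2) have "restrict b {..<N} \<in> {x \<in> topspace ?Y. ?q x \<in> S}" by (rule subsetD)
    then have "?q b \<in> S" by (simp add: image_mset_restrict)
    moreover have "H \<in> T"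
    proof (cases H)
      case (Some h)
      have "1 / \<delta> > R" using \<delta> R by (simp add: field_simps)
      then have "h \<notin> ball 0 R" using H Some by simp
      then show ?thesis using R(2) Some by (auto simp: C(2))
    qed (simp add: T)
    ultimately show "pt b H \<in> V" unfolding pt_def using ST by blast
  qed
qed

lemma topspace_P: "topspace (P_topology \<tau> N) = {pt b H |b H. True}"
  unfolding P_topology_def topspace_quotient_topology by (auto simp: pt_def topspace_Sym topspace_P1)

lemma glc_eqs_reindex:
  assumes "glc_eqs {..<N} a h" "image_mset b (mset_set {..<N}) = image_mset a (mset_set {..<N})"
  shows "glc_eqs {..<N} b h"
proof -
  obtain \<pi> where \<pi>: "\<pi> permutes {..<N}" and b: "\<And>\<mu>. \<mu> \<in> {..<N} \<Longrightarrow> b \<mu> = a (\<pi> \<mu>)"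
    using image_mset_eq_implies_permutes[OF finite_lessThan assms(2)] by metis
  have \<pi>N: "\<pi> \<mu> \<in> {..<N}" if "\<mu> \<in> {..<N}" for \<mu> using permutes_in_image[OF \<pi>] that by blast
  have inj: "\<pi> \<mu> = \<pi> \<nu> \<longleftrightarrow> \<mu> = \<nu>" for \<mu> \<nu> using permutes_inj[OF \<pi>] by (auto simp: inj_on_def)
  have "res {..<N} b h \<mu> = res {..<N} a h (\<pi> \<mu>)" if \<mu>: "\<mu> \<in> {..<N}" for \<mu>
  proof -
    have bij: "bij_betw \<pi> ({..<N} - {\<mu>}) ({..<N} - {\<pi> \<mu>})"
      using bij_betw_DiffI[OF permutes_imp_bij[OF \<pi>], of "{\<mu>}" "{\<pi> \<mu>}"] \<mu> \<pi>N by auto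
    have "(\<Sum>\<nu>\<in>{..<N} - {\<mu>}. \<zeta> (b \<mu> - b \<nu>)) = (\<Sum>\<nu>\<in>{..<N} - {\<mu>}. \<zeta> (a (\<pi> \<mu>) - a (\<pi> \<nu>)))"
      using b \<mu> by (intro sum.cong) auto
    also have "\<dots> = (\<Sum>\<nu>\<in>{..<N} - {\<pi> \<mu>}. \<zeta> (a (\<pi> \<mu>) - a \<nu>))"
      by (rule sum.reindex_bij_betw[OF bij])
    finally show ?thesis using b[OF \<mu>] by (simp add: res_def)
  qed
  then show ?thesis using assms(1) \<pi>N b inj unfolding glc_eqs_def generic_def by simp
qed

text \<open>Membership can be tested on any representative: two of them differ by lattice shifts and
  a permutation, and the equations are invariant under both.\<close>

lemma pt_in_GLC: "pt a (Some h) \<in> GLC \<tau> n p \<longleftrightarrow> glc_eqs {..<N} a h"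
proof
  assume "pt a (Some h) \<in> GLC \<tau> n p"
  then obtain a' h' where e: "pt a (Some h) = pt a' (Some h')" "glc_eqs {..<N} a' h'" unfolding GLC_eq by blast
  then have "(image_mset a (mset_set {..<N}), Some h) \<in> pt a' (Some h')" unfolding pt_def using glc_class_self by metis
  then obtain m where m: "image_mset a (mset_set {..<N}) = image_mset (\<lambda>\<mu>. a' \<mu> + lat (m \<mu>)) (mset_set {..<N})"
    "h = h' + (\<Sum>\<mu>\<in>{..<N}. eta (m \<mu>))" unfolding pt_def glc_class_mem_iff[OF finite_lessThan] by auto
  show "glc_eqs {..<N} a h"
    unfolding m(2) by (rule glc_eqs_reindex[OF glc_eqs_shift[OF e(2)] m(1)])
qed (auto simp: GLC_eq)

lemma pt_None_notin_GLC: "pt a None \<notin> GLC \<tau> n p"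
proof
  assume "pt a None \<in> GLC \<tau> n p"
  then obtain a' h' where e: "pt a None = pt a' (Some h')" unfolding GLC_eq by blast
  then have "(image_mset a (mset_set {..<N}), None) \<in> pt a' (Some h')" unfolding pt_def using glc_class_self by metis
  then show False unfolding pt_def glc_class_mem_iff[OF finite_lessThan] by auto
qed

text \<open>Boxes of radius 1/(m + 1) around the chosen representative provide representatives of
  curve points whose coordinates converge in the plane itself and not merely modulo the
  lattice.\<close>

lemma closure_sequence_infinity:
  assumes "pt a None \<in> GLC_closure \<tau> n p"
  obtains b h where "\<And>m::nat. glc_eqs {..<N} (b m) (h m)" "\<And>\<mu>. \<mu> < N \<Longrightarrow> (\<lambda>m. b m \<mu>) \<longlonglongrightarrow> a \<mu>"
    "filterlim h at_infinity sequentially"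
proof -
  have "\<exists>b h. glc_eqs {..<N} b h \<and> (\<forall>\<mu><N. dist (b \<mu>) (a \<mu>) < inverse (real (Suc m))) \<and> norm h > real m" for m
  proof -
    let ?V = "{pt b H |b H. (\<forall>\<mu><N. dist (b \<mu>) (a \<mu>) < inverse (real (Suc m))) \<and> near_infinity (inverse (real (Suc m))) H}"
    have aV: "pt a None \<in> ?V" by (auto intro!: exI[of _ a] exI[of _ None])
    have cl: "\<forall>T. pt a None \<in> T \<and> openin (P_topology \<tau> N) T \<longrightarrow> (\<exists>y. y \<in> GLC \<tau> n p \<and> y \<in> T)"
      using assms unfolding GLC_closure_def in_closure_of by (rule conjunct2)
    have "\<exists>y. y \<in> GLC \<tau> n p \<and> y \<in> ?V" by (rule mp[OF spec[OF cl]]) (intro conjI aV openin_P_near_infinity)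
    then obtain y where y: "y \<in> GLC \<tau> n p" "y \<in> ?V" by (elim exE conjE)
    then obtain b H where b: "y = pt b H" "\<forall>\<mu><N. dist (b \<mu>) (a \<mu>) < inverse (real (Suc m))" "near_infinity (inverse (real (Suc m))) H"
      by (elim CollectE exE conjE)
    then obtain h where h: "H = Some h" using y(1) pt_None_notin_GLC by (cases H) auto
    have "norm h > real m" using b(3) by (simp add: h divide_inverse)
    then show ?thesis using y(1) b(1,2) by (intro exI[of _ b] exI[of _ h] conjI) (simp_all add: h pt_in_GLC)
  qed
  then obtain b h where bh: "\<And>m. glc_eqs {..<N} (b m) (h m)" "\<And>m \<mu>. \<mu> < N \<Longrightarrow> dist (b m \<mu>) (a \<mu>) < inverse (real (Suc m))" "\<And>m. norm (h m) > real m"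
    by metis
  show thesis
  proof (rule that[OF bh(1)])
    show "(\<lambda>m. b m \<mu>) \<longlonglongrightarrow> a \<mu>" if "\<mu> < N" for \<mu>
      by (rule LIMSEQ_of_dist_less) (rule bh(2)[OF that])
    show "filterlim h at_infinity sequentially"
      using filterlim_real_sequentially bh(3)
      by (intro filterlim_at_infinity_conv_norm_at_top[THEN iffD2] filterlim_at_top_mono[OF filterlim_real_sequentially]) (auto intro!: always_eventually less_imp_le)
  qed
qed

lemma closure_sequence_finite:
  assumes "pt a (Some h0) \<in> GLC_closure \<tau> n p"
  obtains b h where "\<And>m::nat. glc_eqs {..<N} (b m) (h m)" "\<And>\<mu>. \<mu> < N \<Longrightarrow> (\<lambda>m. b m \<mu>) \<longlonglongrightarrow> a \<mu>" "h \<longlonglongrightarrow> h0"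
proof -
  have "\<exists>b h. glc_eqs {..<N} b h \<and> (\<forall>\<mu><N. dist (b \<mu>) (a \<mu>) < inverse (real (Suc m))) \<and> dist h h0 < inverse (real (Suc m))" for m
  proof -
    let ?V = "{pt b (Some h) |b h. (\<forall>\<mu><N. dist (b \<mu>) (a \<mu>) < inverse (real (Suc m))) \<and> dist h h0 < inverse (real (Suc m))}"
    have aV: "pt a (Some h0) \<in> ?V" by (auto intro!: exI[of _ a] exI[of _ h0])
    have cl: "\<forall>T. pt a (Some h0) \<in> T \<and> openin (P_topology \<tau> N) T \<longrightarrow> (\<exists>y. y \<in> GLC \<tau> n p \<and> y \<in> T)"
      using assms unfolding GLC_closure_def in_closure_of by (rule conjunct2)
    have "\<exists>y. y \<in> GLC \<tau> n p \<and> y \<in> ?V" by (rule mp[OF spec[OF cl]]) (intro conjI aV openin_P_finite)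
    then obtain y where y: "y \<in> GLC \<tau> n p" "y \<in> ?V" by (elim exE conjE)
    then obtain b h where b: "y = pt b (Some h)" "\<forall>\<mu><N. dist (b \<mu>) (a \<mu>) < inverse (real (Suc m))" "dist h h0 < inverse (real (Suc m))"
      by (elim CollectE exE conjE)
    then show ?thesis using y(1) by (intro exI[of _ b] exI[of _ h] conjI) (simp_all add: pt_in_GLC)
  qed
  then obtain b h where bh: "\<And>m. glc_eqs {..<N} (b m) (h m)" "\<And>m \<mu>. \<mu> < N \<Longrightarrow> dist (b m \<mu>) (a \<mu>) < inverse (real (Suc m))" "\<And>m. dist (h m) h0 < inverse (real (Suc m))"
    by metis
  show thesis
    by (rule that[OF bh(1)]) (rule LIMSEQ_of_dist_less; use bh(2,3) in blast)+
qed

end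

section \<open>The weighted projective space\<close>

definition wscale :: "complex \<Rightarrow> 'r::finite hcoords \<Rightarrow> 'r hcoords" where
  "wscale c = (\<lambda>(A0, A, B). (c * A0, c *s A, c\<^sup>2 * B))"

lemma wscale_simp [simp]: "wscale c (A0, A, B) = (c * A0, c *s A, c\<^sup>2 * B)" by (simp add: wscale_def)

lemma wscale_wscale: "wscale c (wscale d x) = wscale (c * d) x"
  by (cases x) (simp add: vector_smult_assoc power_mult_distrib mult.assoc)

lemma wscale_1 [simp]: "wscale 1 x = x" by (cases x) (simp add: vec_eq_iff)

lemma mem_wproj: "y \<in> wproj x \<longleftrightarrow> (\<exists>c. c \<noteq> 0 \<and> y = wscale c x)"
  by (cases x) (auto simp: wproj_def)

lemma wproj_eq_iff: "wproj x = wproj y \<longleftrightarrow> (\<exists>c. c \<noteq> 0 \<and> y = wscale c x)"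
proof
  assume "wproj x = wproj y"
  moreover have "y \<in> wproj y" unfolding mem_wproj by (intro exI[of _ 1]) simp
  ultimately show "\<exists>c. c \<noteq> 0 \<and> y = wscale c x" unfolding mem_wproj[symmetric] by simp
next
  assume "\<exists>c. c \<noteq> 0 \<and> y = wscale c x"
  then obtain c where c: "c \<noteq> 0" "y = wscale c x" by blast
  show "wproj x = wproj y"
  proof (intro set_eqI iffI)
    fix z assume "z \<in> wproj x"
    then obtain d where "d \<noteq> 0" "z = wscale d x" unfolding mem_wproj by blast
    then have "d / c \<noteq> 0" "z = wscale (d / c) y" using c by (simp_all add: wscale_wscale)
    then show "z \<in> wproj y" unfolding mem_wproj by blast
  next
    fix z assume "z \<in> wproj y"
    then obtain d where "d \<noteq> 0" "z = wscale d y" unfolding mem_wproj by blast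
    then have "d * c \<noteq> 0" "z = wscale (d * c) x" using c by (simp_all add: wscale_wscale)
    then show "z \<in> wproj x" unfolding mem_wproj by blast
  qed
qed

lemma wproj_wscale: "c \<noteq> 0 \<Longrightarrow> wproj (wscale c x) = wproj x"
  using wproj_eq_iff[of x "wscale c x"] by blast

lemma tendsto_smult_vec:
  fixes A :: "'x \<Rightarrow> complex ^ 'r::finite"
  assumes "(c \<longlongrightarrow> c0) F" "(A \<longlongrightarrow> A0) F"
  shows "((\<lambda>x. c x *s A x) \<longlongrightarrow> c0 *s A0) F"
  unfolding vector_scalar_mult_def using assms by (intro tendsto_vec_lambda tendsto_mult tendsto_vec_nth)

lemma tendsto_wscale:
  fixes f :: "'x \<Rightarrow> 'r::finite hcoords"
  assumes "(c \<longlongrightarrow> c0) F" "(f \<longlongrightarrow> x) F"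
  shows "((\<lambda>y. wscale (c y) (f y)) \<longlongrightarrow> wscale c0 x) F"
proof -
  have e: "wscale c x = (c * fst x, c *s fst (snd x), c\<^sup>2 * snd (snd x))" for c and x :: "'r hcoords"
    by (cases x) simp
  show ?thesis unfolding e using assms by (intro tendsto_Pair tendsto_mult tendsto_power tendsto_smult_vec tendsto_fst tendsto_snd)
qed

lemma continuous_wscale: "continuous_on UNIV (wscale c :: 'r::finite hcoords \<Rightarrow> _)"
  unfolding continuous_on_def by (intro ballI tendsto_wscale tendsto_const tendsto_ident_at)

lemma wscale_eq_0: "c \<noteq> 0 \<Longrightarrow> wscale c x = 0 \<longleftrightarrow> x = 0"
  by (cases x) (auto simp: zero_prod_def vec_eq_iff)

lemma topspace_wproj: "topspace (wproj_topology :: 'r::finite hcoords set topology) = wproj ` (- {0})"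
  using topspace_quotient_topology[of "top_of_set (- {0})" wproj] by (simp add: wproj_topology_def)

lemma openin_wproj_iff:
  "openin (wproj_topology :: 'r::finite hcoords set topology) W \<longleftrightarrow> W \<subseteq> wproj ` (- {0}) \<and> open {x. x \<noteq> 0 \<and> wproj x \<in> W}"
proof -
  have e: "{x \<in> topspace (top_of_set (- {0 :: 'r hcoords})). wproj x \<in> W} = {x. x \<noteq> 0 \<and> wproj x \<in> W}" by auto
  have s: "{x. x \<noteq> 0 \<and> wproj x \<in> W} \<subseteq> - {0}" by auto
  show ?thesis
    unfolding wproj_topology_def openin_quotient_topology e
    using openin_open_eq[of "- {0 :: 'r hcoords}"] s by (simp add: open_Compl)
qed

text \<open>The quotient map of a group action by homeomorphisms is open: the saturation of U is the
  union of its preimages under all \<open>wscale c\<close>.\<close>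

lemma openin_wproj_image:
  fixes U :: "'r::finite hcoords set"
  assumes "open U" "0 \<notin> U"
  shows "openin wproj_topology (wproj ` U)"
proof -
  have "{x. x \<noteq> 0 \<and> wproj x \<in> wproj ` U} = (\<Union>c\<in>- {0}. wscale c -` U)"
  proof (intro set_eqI iffI)
    fix x assume "x \<in> {x. x \<noteq> 0 \<and> wproj x \<in> wproj ` U}"
    then obtain u where u: "u \<in> U" "wproj x = wproj u" by (elim CollectE conjE imageE)
    then obtain c where "c \<noteq> 0" "u = wscale c x" unfolding wproj_eq_iff by blast
    then show "x \<in> (\<Union>c\<in>- {0}. wscale c -` U)" using u by auto
  next
    fix x assume "x \<in> (\<Union>c\<in>- {0}. wscale c -` U)"
    then obtain c where c: "c \<noteq> 0" "wscale c x \<in> U" by auto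
    then have "x \<noteq> 0" using assms(2) wscale_eq_0[OF c(1)] by metis
    moreover have "wproj x \<in> wproj ` U" using c wproj_wscale[OF c(1), of x] by (metis imageI)
    ultimately show "x \<in> {x. x \<noteq> 0 \<and> wproj x \<in> wproj ` U}" by simp
  qed
  moreover have "open (\<Union>c\<in>- {0}. wscale c -` U)"
    using assms(1) continuous_wscale by (intro open_UN ballI open_vimage)
  moreover have "wproj ` U \<subseteq> wproj ` (- {0})" using assms(2) by (intro image_mono) auto
  ultimately show ?thesis unfolding openin_wproj_iff by simp
qed

text \<open>For inseparable points there are x_m -> x and scalars c_m with c_m x_m -> y, and the
  scaling must be carried to the limit. A nonzero coordinate of weight 1 at x makes c_m converge;
  otherwise only c_m^2 is controlled.\<close>

lemma Hausdorff_wproj: "Hausdorff_space (wproj_topology :: 'r::finite hcoords set topology)"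
  unfolding Hausdorff_space_def
proof (intro allI impI, rule ccontr)
  fix q q' :: "'r hcoords set"
  assume h: "q \<in> topspace wproj_topology \<and> q' \<in> topspace wproj_topology \<and> q \<noteq> q'"
    and no: "\<not> (\<exists>U V. openin wproj_topology U \<and> openin wproj_topology V \<and> q \<in> U \<and> q' \<in> V \<and> disjnt U V)"
  obtain x where x: "q = wproj x" "x \<noteq> 0" using h unfolding topspace_wproj by auto
  obtain y where y: "q' = wproj y" "y \<noteq> 0" using h unfolding topspace_wproj by auto
  have "\<forall>m. \<exists>t :: complex \<times> 'r hcoords. fst t \<noteq> 0 \<and> dist (snd t) x < inverse (real (Suc m)) \<and> dist (wscale (fst t) (snd t)) y < inverse (real (Suc m))"
  proof
    fix m
    let ?U = "ball x (inverse (real (Suc m))) - {0}" and ?V = "ball y (inverse (real (Suc m))) - {0}"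
    have "openin wproj_topology (wproj ` ?U)" "openin wproj_topology (wproj ` ?V)"
      by (intro openin_wproj_image open_Diff open_ball closed_singleton; simp)+
    moreover have "q \<in> wproj ` ?U" "q' \<in> wproj ` ?V" using x y by auto
    ultimately have "\<not> disjnt (wproj ` ?U) (wproj ` ?V)" using no by blast
    then obtain z where z: "z \<in> wproj ` ?U" "z \<in> wproj ` ?V" unfolding disjnt_iff by blast
    obtain x' where x': "z = wproj x'" "x' \<in> ?U" using z(1) by (elim imageE)
    obtain y' where y': "z = wproj y'" "y' \<in> ?V" using z(2) by (elim imageE)
    obtain c where "c \<noteq> 0" "y' = wscale c x'" using x'(1) y'(1) wproj_eq_iff by metis
    then show "\<exists>t :: complex \<times> 'r hcoords. fst t \<noteq> 0 \<and> dist (snd t) x < inverse (real (Suc m)) \<and> dist (wscale (fst t) (snd t)) y < inverse (real (Suc m))"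
      using x'(2) y'(2) by (intro exI[of _ "(c, x')"]) (simp add: dist_commute)
  qed
  from choice[OF this] obtain f :: "nat \<Rightarrow> complex \<times> 'r hcoords" where f: "\<forall>m. fst (f m) \<noteq> 0 \<and> dist (snd (f m)) x < inverse (real (Suc m)) \<and> dist (wscale (fst (f m)) (snd (f m))) y < inverse (real (Suc m))"
    by (elim exE)
  define c where "c m = fst (f m)" for m
  define X where "X m = snd (f m)" for m
  define Y where "Y m = wscale (c m) (X m)" for m
  have c0: "c m \<noteq> 0" and YX: "Y m = wscale (c m) (X m)" for m using f by (simp_all add: c_def Y_def)
  have X: "X \<longlonglongrightarrow> x" by (rule LIMSEQ_of_dist_less) (use f in \<open>simp add: X_def\<close>)
  have Y: "Y \<longlonglongrightarrow> y" by (rule LIMSEQ_of_dist_less) (use f in \<open>simp add: Y_def X_def c_def\<close>)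
  have "\<exists>d. d \<noteq> 0 \<and> y = wscale d x"
  \<comment> \<open>The case distinction asks for a continuous function of weight 1 that is nonzero
    at x, which covers A0 and all A_i at once.\<close>
  proof (cases "\<exists>g :: 'r hcoords \<Rightarrow> complex. g x \<noteq> 0 \<and> continuous_on UNIV g \<and> (\<forall>c z. g (wscale c z) = c * g z)")
    case True
    then obtain g :: "'r hcoords \<Rightarrow> complex" where g: "g x \<noteq> 0" "continuous_on UNIV g" and "\<forall>c z. g (wscale c z) = c * g z" by (elim exE conjE)
    then have g3: "g (wscale c z) = c * g z" for c z by (elim allE)
    have gc: "isCont g z" for z using g(2) continuous_on_eq_continuous_at[OF open_UNIV] by blast
    have gX: "(\<lambda>m. g (X m)) \<longlonglongrightarrow> g x" and gY: "(\<lambda>m. g (Y m)) \<longlonglongrightarrow> g y"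
      by (intro isCont_tendsto_compose[OF gc] X Y)+
    have ev: "\<forall>\<^sub>F m in sequentially. g (X m) \<noteq> 0" by (rule tendsto_imp_eventually_ne[OF gX g(1)])
    have "c \<longlonglongrightarrow> g y / g x"
    proof (rule Lim_transform_eventually)
      show "(\<lambda>m. g (Y m) / g (X m)) \<longlonglongrightarrow> g y / g x" by (rule tendsto_divide[OF gY gX g(1)])
      show "\<forall>\<^sub>F m in sequentially. g (Y m) / g (X m) = c m" using ev by eventually_elim (simp add: YX g3)
    qed
    from tendsto_wscale[OF this X] have "Y \<longlonglongrightarrow> wscale (g y / g x) x" by (simp only: YX[symmetric])
    then have e: "y = wscale (g y / g x) x" using Y LIMSEQ_unique by blast
    moreover have "g y / g x \<noteq> 0"
    proof
      assume "g y / g x = 0"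
      then have "y = wscale 0 x" using e by metis
      then show False using y(2) by (cases x) (simp add: zero_prod_def)
    qed
    ultimately show ?thesis by blast
  next
    case False
    obtain x0 xa xb where xx: "x = (x0, xa, xb)" by (cases x)
    obtain y0 ya yb where yy: "y = (y0, ya, yb)" by (cases y)
    have x0: "x0 = 0"
    proof (rule ccontr)
      assume "x0 \<noteq> 0"
      then have f: "fst x \<noteq> 0 \<and> continuous_on UNIV fst \<and> (\<forall>c z. fst (wscale c z :: 'r hcoords) = c * fst z)"
        by (auto simp: xx wscale_def intro!: continuous_intros)
      show False by (rule notE[OF False], rule exI[of _ fst], rule f)
    qed
    have xa: "xa $ i = 0" for i
    proof (rule ccontr)
      assume "xa $ i \<noteq> 0"
      then have f: "fst (snd x) $ i \<noteq> 0 \<and> continuous_on UNIV (\<lambda>z :: 'r hcoords. fst (snd z) $ i) \<and> (\<forall>c z. fst (snd (wscale c z :: 'r hcoords)) $ i = c * fst (snd z) $ i)"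
        by (auto simp: xx wscale_def intro!: continuous_intros)
      show False by (rule notE[OF False], rule exI[of _ "\<lambda>z. fst (snd z) $ i"], rule f)
    qed
    have xb: "xb \<noteq> 0" using x(2) x0 xa by (auto simp: xx zero_prod_def vec_eq_iff)
    have XB: "(\<lambda>m. snd (snd (X m))) \<longlonglongrightarrow> xb" using tendsto_snd[OF tendsto_snd[OF X]] by (simp add: xx)
    have YB: "(\<lambda>m. snd (snd (Y m))) \<longlonglongrightarrow> yb" using tendsto_snd[OF tendsto_snd[OF Y]] by (simp add: yy)
    have c2: "(\<lambda>m. (c m)\<^sup>2) \<longlonglongrightarrow> yb / xb"
    proof (rule Lim_transform_eventually)
      show "(\<lambda>m. snd (snd (Y m)) / snd (snd (X m))) \<longlonglongrightarrow> yb / xb" by (rule tendsto_divide[OF YB XB xb])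
      have "\<forall>\<^sub>F m in sequentially. snd (snd (X m)) \<noteq> 0" by (rule tendsto_imp_eventually_ne[OF XB xb])
      then show "\<forall>\<^sub>F m in sequentially. snd (snd (Y m)) / snd (snd (X m)) = (c m)\<^sup>2"
        by eventually_elim (simp add: YX wscale_def case_prod_unfold)
    qed
    \<comment> \<open>Squaring replaces c_m by the convergent c_m^2, so every coordinate of weight 1
      of y vanishes like that of x. Both points then have only a B coordinate, and any square root
      of the ratio relates them.\<close>
    have zero: "w = 0" if "(\<lambda>m. f (X m)) \<longlonglongrightarrow> 0" "(\<lambda>m. f (Y m)) \<longlonglongrightarrow> w" "\<And>c z. f (wscale c z) = c * f z" for w and f :: "'r hcoords \<Rightarrow> complex"
    proof -
      have "(\<lambda>m. (c m)\<^sup>2 * (f (X m))\<^sup>2) \<longlonglongrightarrow> yb / xb * 0\<^sup>2" by (intro tendsto_mult tendsto_power c2 that)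
      then have a: "(\<lambda>m. (f (Y m))\<^sup>2) \<longlonglongrightarrow> yb / xb * 0\<^sup>2" by (simp only: YX that(3) power_mult_distrib)
      have "(\<lambda>m. (f (Y m))\<^sup>2) \<longlonglongrightarrow> w\<^sup>2" by (intro tendsto_power that)
      from LIMSEQ_unique[OF this a] have "w\<^sup>2 = yb / xb * 0\<^sup>2" .
      then show ?thesis by simp
    qed
    have y0: "y0 = 0"
      by (rule zero[of fst]) (use tendsto_fst[OF X] tendsto_fst[OF Y] in \<open>auto simp: xx yy x0 wscale_def\<close>)
    have ya: "ya $ i = 0" for i
      by (rule zero[of "\<lambda>z. fst (snd z) $ i"])
         (use tendsto_vec_nth[OF tendsto_fst[OF tendsto_snd[OF X]], of i] tendsto_vec_nth[OF tendsto_fst[OF tendsto_snd[OF Y]], of i] in \<open>auto simp: xx yy xa wscale_def\<close>)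
    have yb: "yb \<noteq> 0" using y(2) y0 ya by (auto simp: yy zero_prod_def vec_eq_iff)
    have "csqrt (yb / xb) \<noteq> 0" using yb xb by simp
    moreover have "y = wscale (csqrt (yb / xb)) x"
      using xb by (simp add: xx yy x0 y0 xa ya vec_eq_iff power2_csqrt)
    ultimately show ?thesis by blast
  qed
  then show False using h x y wproj_eq_iff by metis
qed

text \<open>The scalars preserving B = 1 are those with c^2 = 1. This orbifold sign is what
  identifies k with 2n - k.\<close>

lemma wproj_infinity_eq_iff:
  fixes A A' :: "complex ^ 'r::finite"
  shows "wproj (0, A, 1) = wproj (0, A', 1) \<longleftrightarrow> A' = A \<or> A' = - A"
proof
  assume "wproj (0, A, 1) = wproj (0, A', 1)"
  then obtain c :: complex where "c \<noteq> 0" "A' = c *s A" "c\<^sup>2 = 1" unfolding wproj_eq_iff by auto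
  then have "c = 1 \<or> c = -1" by (simp add: power2_eq_1_iff)
  then show "A' = A \<or> A' = - A" using \<open>A' = c *s A\<close> by (auto simp: vec_eq_iff)
next
  assume "A' = A \<or> A' = - A"
  then have "(0, A', 1) = wscale 1 (0, A, 1) \<or> (0, A', 1) = wscale (- 1) (0, A, 1)" by (auto simp: vec_eq_iff)
  moreover have "(1 :: complex) \<noteq> 0" "(- 1 :: complex) \<noteq> 0" by simp_all
  ultimately show "wproj (0, A, 1) = wproj (0, A', 1)" unfolding wproj_eq_iff by blast
qed

section \<open>Branches\<close>

lemma germ_self: "S \<in> germ q S" if "openin wproj_topology W" "q \<in> W" for W :: "'r::finite hcoords set set"
  using that unfolding germ_def by blast

lemma germ_eqI:
  fixes W :: "'r::finite hcoords set set"
  assumes W: "openin wproj_topology W" "q \<in> W" and eq: "S \<inter> W = T \<inter> W"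
  shows "germ q S = germ q T"
proof -
  have "germ q S \<subseteq> germ q T" if eq: "S \<inter> W = T \<inter> W" for S T
  proof
    fix R assume "R \<in> germ q S"
    then obtain W' where W': "openin wproj_topology W'" "q \<in> W'" "S \<inter> W' = R \<inter> W'" unfolding germ_def by blast
    have "openin wproj_topology (W \<inter> W')" "q \<in> W \<inter> W'" "T \<inter> (W \<inter> W') = R \<inter> (W \<inter> W')"
      using W W' eq by (auto intro: openin_Int)
    then show "R \<in> germ q T" unfolding germ_def by blast
  qed
  then show ?thesis using eq by (metis subset_antisym)
qed

lemma germ_eqD:
  fixes S :: "'r::finite hcoords set set"
  assumes "germ q S = germ q T" "q \<in> topspace wproj_topology"
  obtains W where "openin wproj_topology W" "q \<in> W" "S \<inter> W = T \<inter> W"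
proof -
  have "T \<in> germ q S" unfolding assms(1) by (rule germ_self[OF openin_topspace assms(2)])
  then show thesis unfolding germ_def using that by blast
qed

text \<open>An irreducible germ is its own unique maximal irreducible part: mutual inclusion of
  germs is equality.\<close>

lemma branches_at_irreducible:
  fixes X :: "'r::finite hcoords set set"
  assumes X: "irreducible_germ q X" and q: "q \<in> topspace wproj_topology"
  shows "branches_at X q = {germ q X}"
proof -
  have le: "germ_le q X X" unfolding germ_le_def using q by (intro exI[of _ "topspace wproj_topology"]) auto
  have anti: "germ q T = germ q X" if TX: "germ_le q T X" "germ_le q X T" for T
  proof -
    obtain W W' where W: "openin wproj_topology W" "q \<in> W" "T \<inter> W \<subseteq> X" and W': "openin wproj_topology W'" "q \<in> W'" "X \<inter> W' \<subseteq> T"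
      using TX unfolding germ_le_def by blast
    show ?thesis by (rule germ_eqI[of "W \<inter> W'"]) (use W W' in \<open>auto intro: openin_Int\<close>)
  qed
  show ?thesis
  proof (intro set_eqI iffI)
    fix \<beta> assume "\<beta> \<in> branches_at X q"
    then obtain S where S: "\<beta> = germ q S" "irreducible_germ q S" "germ_le q S X"
      "\<forall>T. irreducible_germ q T \<and> germ_le q T X \<and> germ_le q S T \<longrightarrow> germ q T = germ q S" unfolding branches_at_def by blast
    then have "germ q X = germ q S" using X le by blast
    then show "\<beta> \<in> {germ q X}" using S(1) by simp
  next
    fix \<beta> assume "\<beta> \<in> {germ q X}"
    then show "\<beta> \<in> branches_at X q" unfolding branches_at_def using X le anti by blast
  qed
qed

section \<open>Complex differentiability on the coordinate space\<close>

definition cdifferentiable :: "('r::finite hcoords \<Rightarrow> complex) \<Rightarrow> 'r hcoords \<Rightarrow> bool" where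
  "cdifferentiable f x \<longleftrightarrow> (\<exists>D. (f has_derivative D) (at x) \<and> (\<forall>c v. D (cscale c v) = c * D v))"

lemma holomorphic_several_iff: "holomorphic_several f U \<longleftrightarrow> (\<forall>x\<in>U. cdifferentiable f x)"
  by (simp add: holomorphic_several_def cdifferentiable_def)

lemma cdifferentiable_fst: "cdifferentiable fst x"
  unfolding cdifferentiable_def
  by (intro exI[of _ fst] conjI allI) (auto intro!: derivative_eq_intros simp: cscale_def case_prod_unfold)

lemma cdifferentiable_nth: "cdifferentiable (\<lambda>x. fst (snd x) $ i) x"
  unfolding cdifferentiable_def
  by (intro exI[of _ "\<lambda>x. fst (snd x) $ i"] conjI allI bounded_linear_imp_has_derivative
      bounded_linear_compose[OF bounded_linear_vec_nth] bounded_linear_compose[OF bounded_linear_fst bounded_linear_snd])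
     (simp add: cscale_def case_prod_unfold)

lemma cdifferentiable_snd: "cdifferentiable (\<lambda>x. snd (snd x)) x"
  unfolding cdifferentiable_def
  by (intro exI[of _ "\<lambda>x. snd (snd x)"] conjI allI bounded_linear_imp_has_derivative
      bounded_linear_compose[OF bounded_linear_snd bounded_linear_snd])
     (simp add: cscale_def case_prod_unfold)

lemma cdifferentiable_diff: "cdifferentiable f x \<Longrightarrow> cdifferentiable g x \<Longrightarrow> cdifferentiable (\<lambda>x. f x - g x) x"
  unfolding cdifferentiable_def
proof (elim exE conjE)
  fix D E assume "(f has_derivative D) (at x)" "\<forall>c v. D (cscale c v) = c * D v" "(g has_derivative E) (at x)" "\<forall>c v. E (cscale c v) = c * E v"
  then show "\<exists>D. ((\<lambda>x. f x - g x) has_derivative D) (at x) \<and> (\<forall>c v. D (cscale c v) = c * D v)"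
    by (intro exI[of _ "\<lambda>v. D v - E v"] conjI has_derivative_diff) (simp_all add: right_diff_distrib)
qed

lemma cdifferentiable_mult: "cdifferentiable f x \<Longrightarrow> cdifferentiable g x \<Longrightarrow> cdifferentiable (\<lambda>x. f x * g x) x"
  unfolding cdifferentiable_def
proof (elim exE conjE)
  fix D E assume "(f has_derivative D) (at x)" "\<forall>c v. D (cscale c v) = c * D v" "(g has_derivative E) (at x)" "\<forall>c v. E (cscale c v) = c * E v"
  then show "\<exists>D. ((\<lambda>x. f x * g x) has_derivative D) (at x) \<and> (\<forall>c v. D (cscale c v) = c * D v)"
    by (intro exI[of _ "\<lambda>v. f x * E v + D v * g x"] conjI has_derivative_mult) (simp_all add: algebra_simps)
qed

lemma cdifferentiable_compose:
  assumes "g field_differentiable at (f x)" "cdifferentiable f x"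
  shows "cdifferentiable (\<lambda>x. g (f x)) x"
proof -
  obtain d where d: "(g has_field_derivative d) (at (f x))" using assms(1) unfolding field_differentiable_def by blast
  obtain D where D: "(f has_derivative D) (at x)" "\<forall>c v. D (cscale c v) = c * D v" using assms(2) unfolding cdifferentiable_def by blast
  have "((\<lambda>x. g (f x)) has_derivative (\<lambda>v. d * D v)) (at x)"
    using has_derivative_compose[OF D(1), of g "(*) d"] d by (simp add: has_field_derivative_def)
  then show ?thesis unfolding cdifferentiable_def using D(2) by (intro exI[of _ "\<lambda>v. d * D v"]) simp
qed

text \<open>Restriction to a holomorphic curve reduces analytic equations in several variables to
  functions of s alone, to which isolation of zeros applies.\<close>

lemma cdifferentiable_along_curve:
  fixes \<beta> :: "complex \<Rightarrow> complex ^ 'r::finite"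
  assumes f: "cdifferentiable f (s, \<beta> s, 1)" and b: "\<And>i. (\<lambda>s. \<beta> s $ i) field_differentiable (at s)"
  shows "(\<lambda>s. f (s, \<beta> s, 1)) field_differentiable (at s)"
proof -
  obtain D where D: "(f has_derivative D) (at (s, \<beta> s, 1))" "\<And>c v. D (cscale c v) = c * D v" using f unfolding cdifferentiable_def by blast
  obtain d where d: "\<And>i. ((\<lambda>s. \<beta> s $ i) has_field_derivative d i) (at s)" using b unfolding field_differentiable_def by metis
  have "((\<lambda>s. \<chi> i. \<beta> s $ i) has_derivative (\<lambda>h. \<chi> i. d i * h)) (at s)"
    using d by (intro has_derivative_vec_lambda) (simp add: has_field_derivative_def)
  then have "((\<lambda>s. (s, \<beta> s, 1)) has_derivative (\<lambda>h. (h, \<chi> i. d i * h, 0))) (at s)"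
    by (intro has_derivative_Pair has_derivative_ident has_derivative_const) simp
  from has_derivative_compose[OF this D(1)]
  have "((\<lambda>s. f (s, \<beta> s, 1)) has_derivative (\<lambda>h. D (h, \<chi> i. d i * h, 0))) (at s)" .
  moreover have "D (h, \<chi> i. d i * h, 0) = D (1, \<chi> i. d i, 0) * h" for h
  proof -
    have "(h, \<chi> i. d i * h, 0) = cscale h (1, \<chi> i. d i, 0)" by (simp add: cscale_def vec_eq_iff mult.commute)
    then show ?thesis using D(2) by simp
  qed
  ultimately show ?thesis unfolding field_differentiable_def has_field_derivative_def by (intro exI[of _ "D (1, \<chi> i. d i, 0)"]) simp
qed

section \<open>Multisets of labels and quotients by fibres\<close>

lemma image_mset_sum_set: "image_mset f (\<Sum>i\<in>S. M i) = (\<Sum>i\<in>S. image_mset f (M i))"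
  by (induction S rule: infinite_finite_induct) auto

lemma count_sum_replicate:
  fixes c :: "'r::finite \<Rightarrow> 'b"
  assumes "\<And>i j. c i = c j \<Longrightarrow> i = j"
  shows "count (\<Sum>i\<in>UNIV. replicate_mset (k i) (c i)) (c j) = k j"
proof -
  have "count (\<Sum>i\<in>UNIV. replicate_mset (k i) (c i)) (c j) = (\<Sum>i\<in>UNIV. if i = j then k i else 0)"
    unfolding count_sum using assms by (intro sum.cong) auto
  then show ?thesis by simp
qed

lemma image_mset_labelled:
  fixes lab :: "'k \<Rightarrow> 'r::finite"
  assumes "finite I"
  shows "image_mset (\<lambda>\<mu>. p (lab \<mu>)) (mset_set I) = (\<Sum>i\<in>UNIV. replicate_mset (card {\<mu>\<in>I. lab \<mu> = i}) (p i))"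
  using assms
proof (induction I rule: finite_induct)
  case (insert x I)
  have "card {\<mu> \<in> insert x I. lab \<mu> = i} = card {\<mu>\<in>I. lab \<mu> = i} + (if i = lab x then 1 else 0)" for i
  proof -
    have "{\<mu> \<in> insert x I. lab \<mu> = i} = (if i = lab x then insert x {\<mu>\<in>I. lab \<mu> = i} else {\<mu>\<in>I. lab \<mu> = i})" by auto
    then show ?thesis using insert(1,2) by simp
  qed
  then have "replicate_mset (card {\<mu> \<in> insert x I. lab \<mu> = i}) (p i) = replicate_mset (card {\<mu>\<in>I. lab \<mu> = i}) (p i) + (if i = lab x then {#p i#} else {#})" for i
    by simp
  then have "(\<Sum>i\<in>UNIV. replicate_mset (card {\<mu> \<in> insert x I. lab \<mu> = i}) (p i)) = (\<Sum>i\<in>UNIV. replicate_mset (card {\<mu>\<in>I. lab \<mu> = i}) (p i)) + {#p (lab x)#}"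
    by (simp add: sum.distrib)
  then show ?case using insert by simp
qed simp

text \<open>Equivalence classes are the fibres of g, so the representative picked by choice does not
  affect the value of g.\<close>

lemma quotient_by_fibres:
  assumes E: "E = {(x, y). x \<in> T \<and> y \<in> T \<and> g x = g y}"
  shows "bij_betw (\<lambda>C. g (SOME x. x \<in> C)) (T // E) (g ` T)"
    and "x \<in> T \<Longrightarrow> g (SOME y. y \<in> E `` {x}) = g x"
proof -
  have some: "(SOME y. y \<in> E `` {x}) \<in> E `` {x}" if "x \<in> T" for x
  proof (rule someI[of _ x])
    have "(x, x) \<in> E" unfolding E using that by simp
    then show "x \<in> E `` {x}" by (simp only: Image_singleton_iff)
  qed
  show *: "g (SOME y. y \<in> E `` {x}) = g x" if "x \<in> T" for x
  proof -
    have EE: "g x = g y" if "(x, y) \<in> E" for x y using that E by blast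
    have "(x, SOME y. y \<in> E `` {x}) \<in> E" using some[OF that] by (simp only: Image_singleton_iff)
    from EE[OF this] show ?thesis by (rule sym)
  qed
  show "bij_betw (\<lambda>C. g (SOME x. x \<in> C)) (T // E) (g ` T)"
    unfolding bij_betw_def
  proof
    show "inj_on (\<lambda>C. g (SOME x. x \<in> C)) (T // E)"
    proof (rule inj_onI)
      fix C D assume CD: "C \<in> T // E" "D \<in> T // E" and e: "g (SOME x. x \<in> C) = g (SOME x. x \<in> D)"
      obtain x where C: "C = E `` {x}" "x \<in> T" using CD(1) by (rule quotientE)
      obtain y where D: "D = E `` {y}" "y \<in> T" using CD(2) by (rule quotientE)
      have "g x = g y" using e unfolding C(1) D(1) *[OF C(2)] *[OF D(2)] .
      then have "(x, z) \<in> E \<longleftrightarrow> (y, z) \<in> E" for z unfolding E using C(2) D(2) by simp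
      then show "C = D" unfolding C(1) D(1) set_eq_iff Image_singleton_iff by blast
    qed
    show "(\<lambda>C. g (SOME x. x \<in> C)) ` (T // E) = g ` T"
    proof (intro equalityI subsetI)
      fix z assume "z \<in> (\<lambda>C. g (SOME x. x \<in> C)) ` (T // E)"
      then obtain C where C: "z = g (SOME x. x \<in> C)" "C \<in> T // E" by (elim imageE)
      obtain x where x: "C = E `` {x}" "x \<in> T" using C(2) by (rule quotientE)
      have "z = g x" unfolding C(1) x(1) by (rule *[OF x(2)])
      then show "z \<in> g ` T" using x(2) by (rule image_eqI)
    next
      fix z assume "z \<in> g ` T"
      then obtain x where x: "z = g x" "x \<in> T" by (elim imageE)
      have "z = g (SOME y. y \<in> E `` {x})" unfolding x(1) by (rule *[OF x(2), symmetric])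
      then show "z \<in> (\<lambda>C. g (SOME x. x \<in> C)) ` (T // E)" using quotientI[OF x(2)] by (rule image_eqI)
    qed
  qed
qed

section \<open>The chart B = 1\<close>

definition wsc :: "'r::finite hcoords \<Rightarrow> complex" where "wsc x = 1 / csqrt (snd (snd x))"

text \<open>An open set of coordinate vectors over the neighbourhood of points (s, A, 1) with s and
  A in balls. Restricting to Re B > 0 makes the normalizing factor \<open>wsc\<close>, the principal
  B^(-1/2), holomorphic; no such point is lost, since (s, A, 1) itself belongs to the set.\<close>

definition wbox :: "real \<Rightarrow> complex ^ 'r \<Rightarrow> real \<Rightarrow> 'r::finite hcoords set" where
  "wbox \<epsilon> \<alpha> \<rho> = {x. Re (snd (snd x)) > 0 \<and> norm (wsc x * fst x) < \<epsilon> \<and> dist \<alpha> (wsc x *s fst (snd x)) < \<rho>}"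

lemma wscale_wsc: "Re (snd (snd x)) > 0 \<Longrightarrow> wscale (wsc x) x = (wsc x * fst x, wsc x *s fst (snd x), 1)"
  by (cases x) (auto simp: wsc_def power_divide power2_csqrt)

lemma wsc_nonzero: "Re (snd (snd x)) > 0 \<Longrightarrow> wsc x \<noteq> 0" by (auto simp: wsc_def)

lemma isCont_wsc: "Re (snd (snd x)) > 0 \<Longrightarrow> isCont wsc x"
  unfolding wsc_def[abs_def]
  by (intro continuous_intros isCont_o2[OF _ continuous_at_csqrt]) (auto simp: complex_nonpos_Reals_iff)

lemma open_wbox: "open (wbox \<epsilon> \<alpha> \<rho> :: 'r::finite hcoords set)"
proof -
  let ?S = "{x :: 'r hcoords. Re (snd (snd x)) > 0}"
  have S: "open ?S" by (intro open_Collect_less continuous_intros)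
  have "continuous_on ?S (\<lambda>x. (wsc x * fst x, wsc x *s fst (snd x)))"
  proof (intro continuous_at_imp_continuous_on ballI)
    fix x :: "'r hcoords" assume "x \<in> ?S"
    then have "(wsc \<longlongrightarrow> wsc x) (at x)" using isCont_wsc[of x] by (simp add: isCont_def)
    then show "isCont (\<lambda>x. (wsc x * fst x, wsc x *s fst (snd x))) x"
      unfolding isCont_def by (intro tendsto_Pair tendsto_mult tendsto_smult_vec tendsto_fst tendsto_snd tendsto_ident_at)
  qed
  from continuous_open_preimage[OF this S open_Times[OF open_ball[of 0 \<epsilon>] open_ball[of \<alpha> \<rho>]]]
  have "open (?S \<inter> (\<lambda>x. (wsc x * fst x, wsc x *s fst (snd x))) -` (ball 0 \<epsilon> \<times> ball \<alpha> \<rho>))" .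
  moreover have "wbox \<epsilon> \<alpha> \<rho> = ?S \<inter> (\<lambda>x. (wsc x * fst x, wsc x *s fst (snd x))) -` (ball 0 \<epsilon> \<times> ball \<alpha> \<rho>)"
    by (intro set_eqI) (simp add: wbox_def)
  ultimately show ?thesis by simp
qed

lemma wbox_nonzero: "0 \<notin> wbox \<epsilon> \<alpha> \<rho>" by (simp add: wbox_def)

lemma mem_wproj_wbox:
  "v \<in> wproj ` wbox \<epsilon> \<alpha> \<rho> \<longleftrightarrow> (\<exists>s A. norm s < \<epsilon> \<and> A \<in> ball \<alpha> \<rho> \<and> v = wproj (s, A, 1))"
proof
  assume "v \<in> wproj ` wbox \<epsilon> \<alpha> \<rho>"
  then obtain x where x: "v = wproj x" "x \<in> wbox \<epsilon> \<alpha> \<rho>" by (elim imageE)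
  then have r: "Re (snd (snd x)) > 0" "norm (wsc x * fst x) < \<epsilon>" "wsc x *s fst (snd x) \<in> ball \<alpha> \<rho>" by (simp_all add: wbox_def)
  have "v = wproj (wsc x * fst x, wsc x *s fst (snd x), 1)"
    using wproj_wscale[OF wsc_nonzero[OF r(1)], of x] by (simp only: x(1) wscale_wsc[OF r(1)])
  then show "\<exists>s A. norm s < \<epsilon> \<and> A \<in> ball \<alpha> \<rho> \<and> v = wproj (s, A, 1)" using r by blast
next
  assume "\<exists>s A. norm s < \<epsilon> \<and> A \<in> ball \<alpha> \<rho> \<and> v = wproj (s, A, 1)"
  then obtain s A where "norm s < \<epsilon>" "A \<in> ball \<alpha> \<rho>" "v = wproj (s, A, 1)" by blast
  then show "v \<in> wproj ` wbox \<epsilon> \<alpha> \<rho>"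
    by (intro image_eqI[where x = "(s, A, 1)"]) (simp_all add: wbox_def wsc_def)
qed

lemma openin_wbox: "openin wproj_topology (wproj ` wbox \<epsilon> \<alpha> \<rho>)"
  by (intro openin_wproj_image open_wbox wbox_nonzero)

lemma cdifferentiable_const: "cdifferentiable (\<lambda>_. c) x"
  unfolding cdifferentiable_def by (intro exI[of _ "\<lambda>_. 0"]) auto

section \<open>The cone of the variety and its points at infinity\<close>

context glc
begin

abbreviation Vbar :: "'r hcoords set set" where "Vbar \<equiv> log_free_closure \<tau> n p"

definition cone :: "'r hcoords set" where
  "cone = {x. x \<noteq> 0 \<and> (\<forall>i. Fh i x = 0) \<and> (\<Sum>i\<in>UNIV. fst (snd x) $ i) = 0}"

lemma cone_wscale:
  assumes c: "c \<noteq> 0" and x: "x \<in> cone" shows "wscale c x \<in> cone"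
proof -
  obtain A0 A B where xx: "x = (A0, A, B)" by (cases x)
  have "wscale c x \<noteq> 0" using x wscale_eq_0[OF c, of x] by (simp add: cone_def)
  moreover have "(\<Sum>i\<in>UNIV. (c *s A) $ i) = c * (\<Sum>i\<in>UNIV. A $ i)" by (simp add: sum_distrib_left)
  ultimately show ?thesis using x by (simp add: cone_def xx Fh_scale)
qed

lemma wproj_mem_cone: "wproj x \<in> wproj ` cone \<longleftrightarrow> x \<in> cone"
proof
  assume "wproj x \<in> wproj ` cone"
  then obtain y where y: "wproj y = wproj x" "y \<in> cone" by (metis imageE)
  then obtain c where "c \<noteq> 0" "x = wscale c y" unfolding wproj_eq_iff by blast
  then show "x \<in> cone" using cone_wscale y(2) by simp
qed simp

lemma closedin_cone: "closedin wproj_topology (wproj ` cone)"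
proof -
  have ne: "cone \<subseteq> - {0}" by (auto simp: cone_def)
  have cl: "closed ({x. \<forall>i. Fh i x = 0} \<inter> {x :: 'r hcoords. (\<Sum>i\<in>UNIV. fst (snd x) $ i) = 0})"
    by (intro closed_Int closed_Collect_all closed_Collect_eq C1_several_continuous[OF C1_Fh] continuous_intros)
  have "{x. x \<noteq> 0 \<and> wproj x \<in> wproj ` (- {0}) - wproj ` cone} = - {0} \<inter> - ({x. \<forall>i. Fh i x = 0} \<inter> {x. (\<Sum>i\<in>UNIV. fst (snd x) $ i) = 0})"
    (is "?L = ?R")
  proof (rule set_eqI)
    fix x :: "'r hcoords"
    have "x \<in> ?L \<longleftrightarrow> x \<noteq> 0 \<and> x \<notin> cone" unfolding mem_Collect_eq Diff_iff wproj_mem_cone by (metis ComplI imageI singletonD)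
    also have "\<dots> \<longleftrightarrow> x \<in> ?R" unfolding cone_def by blast
    finally show "x \<in> ?L \<longleftrightarrow> x \<in> ?R" .
  qed
  moreover have "open (- {0} \<inter> - ({x. \<forall>i. Fh i x = 0} \<inter> {x :: 'r hcoords. (\<Sum>i\<in>UNIV. fst (snd x) $ i) = 0}))"
    using cl by (intro open_Int open_Compl) auto
  ultimately have "openin wproj_topology (wproj ` (- {0}) - wproj ` cone)" unfolding openin_wproj_iff by simp
  moreover have "wproj ` cone \<subseteq> wproj ` (- {0})" by (rule image_mono[OF ne])
  ultimately show ?thesis unfolding closedin_def topspace_wproj by simp
qed

lemma variety_in_cone: "(A, B) \<in> log_free_variety \<tau> n p \<Longrightarrow> (1, A, B) \<in> cone"
  by (simp add: cone_def log_free_variety_def Fh_1 zero_prod_def)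

text \<open>The weighted homogeneous equations cut out a closed set that contains the affine
  variety, hence its closure.\<close>

lemma Vbar_cone: assumes "wproj x \<in> Vbar" shows "x \<in> cone"
proof -
  have "(\<lambda>(A, B). wproj (1, A, B)) ` log_free_variety \<tau> n p \<subseteq> wproj ` cone"
    using variety_in_cone by auto
  from closure_of_minimal[OF this closedin_cone] show ?thesis
    using assms unfolding log_free_closure_def wproj_mem_cone[symmetric] by (rule subsetD)
qed

lemma variety_in_Vbar: assumes AB: "(A, B) \<in> log_free_variety \<tau> n p" shows "wproj (1, A, B) \<in> Vbar"
proof -
  let ?f = "\<lambda>(A, B). wproj (1, A, B) :: 'r hcoords set"
  have ne: "(1 :: complex, A, B) \<in> - {0}" for A :: "complex ^ 'r" and B :: complex by (simp add: zero_prod_def)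
  have "?f ` log_free_variety \<tau> n p \<subseteq> topspace wproj_topology"
  proof (rule image_subsetI)
    fix x :: "(complex ^ 'r) \<times> complex"
    show "?f x \<in> topspace wproj_topology" unfolding topspace_wproj by (cases x) (simp only: prod.case imageI[OF ne])
  qed
  then have "?f ` log_free_variety \<tau> n p \<subseteq> Vbar" unfolding log_free_closure_def by (rule closure_of_subset)
  moreover have "wproj (1, A, B) \<in> ?f ` log_free_variety \<tau> n p"
    by (rule image_eqI[OF _ AB]) simp
  ultimately show ?thesis by (rule subsetD)
qed

lemma glc_map_proj_pt:
  assumes "glc_eqs {..<N} b h"
  shows "glc_map_proj \<tau> n p (pt b (Some h)) = wproj (1, Af {..<N} b h, Bf {..<N} b h)"
  by (simp add: glc_map_proj_def glc_map_pt[OF assms])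

lemma glc_map_proj_scale:
  assumes "glc_eqs {..<N} b h" "s \<noteq> 0"
  shows "glc_map_proj \<tau> n p (pt b (Some h)) = wproj (s, s *s Af {..<N} b h, s\<^sup>2 * Bf {..<N} b h)"
  unfolding glc_map_proj_pt[OF assms(1)]
  using wproj_wscale[OF assms(2), of "(1, Af {..<N} b h, Bf {..<N} b h)"] by simp

lemma glc_map_proj_in_Vbar: "glc_eqs {..<N} b h \<Longrightarrow> glc_map_proj \<tau> n p (pt b (Some h)) \<in> Vbar"
  unfolding glc_map_proj_pt by (intro variety_in_Vbar mem_log_free_variety)

definition qpt :: "('r \<Rightarrow> nat) \<Rightarrow> 'r hcoords set" where "qpt k = wproj (0, direction k, 1)"

lemma qpt_topspace: "qpt k \<in> topspace wproj_topology"
  unfolding qpt_def topspace_wproj by (rule imageI) (simp add: zero_prod_def)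

text \<open>B = 0 would force all A_i = 0. After scaling to B = 1 each A_i is a root of
  \<open>Fpoly\<close>, that is 2 k_i - 2 n_i, and the equation sum A_i = 0 becomes sum k_i =
  N.\<close>

lemma infinity_point:
  assumes "q \<in> Vbar" "q \<in> infinity_divisor"
  obtains k where "k \<in> boundary_indices n" "q = qpt k"
proof -
  obtain A B where q: "q = wproj (0, A, B)" "(A, B) \<noteq> 0" using assms(2) unfolding infinity_divisor_def by blast
  have c: "(0, A, B) \<in> cone" using Vbar_cone assms(1) unfolding q(1) by blast
  then have F: "poly (Fpoly (ell n i) B) (A $ i) = 0" for i by (simp add: cone_def Fh_infinity)
  have B: "B \<noteq> 0"
  proof
    assume "B = 0"
    then have "A $ i = 0" for i using F[of i] Fpoly_0_root by simp
    then show False using q(2) \<open>B = 0\<close> by (simp add: vec_eq_iff zero_prod_def)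
  qed
  define r where "r = 1 / csqrt B"
  have r: "r \<noteq> 0" "r\<^sup>2 * B = 1" using B by (simp_all add: r_def power_divide power2_csqrt)
  have q': "q = wproj (0, r *s A, 1)" using wproj_wscale[OF r(1), of "(0, A, B)"] by (simp add: q(1) r(2))
  have c': "(0, r *s A, 1) \<in> cone" using cone_wscale[OF r(1) c] by (simp add: r(2))
  then have "poly (Fpoly (ell n i) 1) ((r *s A) $ i) = 0" for i by (simp add: cone_def Fh_infinity)
  then have "(r *s A) $ i \<in> (\<lambda>k. 2 * of_nat k - of_nat (ell n i)) ` {..ell n i}" for i
    unfolding Fpoly_roots(1)[OF ell_pos[of i], symmetric] by simp
  then have "\<exists>j. j \<le> ell n i \<and> (r *s A) $ i = 2 * of_nat j - of_nat (ell n i)" for i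
    unfolding image_iff Bex_def atMost_iff .
  then have "\<forall>i. \<exists>j. j \<le> ell n i \<and> (r *s A) $ i = 2 * of_nat j - of_nat (ell n i)" by (rule allI)
  from choice[OF this] obtain k where k0: "\<forall>i. k i \<le> ell n i \<and> (r *s A) $ i = 2 * of_nat (k i) - of_nat (ell n i)" by (elim exE)
  have k: "k i \<le> ell n i" "(r *s A) $ i = 2 * of_nat (k i) - of_nat (ell n i)" for i using k0 by blast+
  have d: "r *s A = direction k" unfolding vec_eq_iff k(2) by (simp add: direction_def)
  have "(\<Sum>i\<in>UNIV. 2 * of_nat (k i) - 2 * cn i) = 0" using c' by (simp add: cone_def d direction_nth)
  then have "(of_nat (\<Sum>i\<in>UNIV. k i) :: complex) = of_nat N"
    by (simp add: of_nat_N sum_subtractf sum_distrib_left[symmetric])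
  then have "(\<Sum>i\<in>UNIV. k i) = N" unfolding of_nat_eq_iff .
  then have "k \<in> boundary_indices n" using k(1) by (simp add: boundary_indices_def)
  then show thesis by (rule that) (simp add: q' d qpt_def)
qed

lemma boundary_pt_eq:
  assumes "\<And>i. card {\<mu>\<in>{..<N}. lab \<mu> = i} = k i"
  shows "boundary_pt \<tau> p k = pt (\<lambda>\<mu>. p (lab \<mu>)) None"
  unfolding boundary_pt_def pt_def image_mset_labelled[OF finite_lessThan] assms by simp

text \<open>Turns the sequential limits into a uniform statement about boxes: failure for every
  radius would give a sequence of curve points approaching the boundary point against the known
  asymptotics.\<close>

lemma near_infinity_asymptotics:
  assumes lab: "\<And>i. card {\<mu>\<in>{..<N}. lab \<mu> = i} = k i" and O: "open S" "(0, direction k, 1) \<in> S"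
  obtains \<delta> where "\<delta> > 0" "\<And>b h. glc_eqs {..<N} b h \<Longrightarrow> \<forall>\<mu><N. dist (b \<mu>) (p (lab \<mu>)) < \<delta> \<Longrightarrow> norm h > 1 / \<delta> \<Longrightarrow>
     (1 / h, (1 / h) *s Af {..<N} b h, (1 / h)\<^sup>2 * Bf {..<N} b h) \<in> S"
proof (rule ccontr)
  let ?I = "{..<N}"
  assume no: "\<not> thesis"
  have "\<exists>t. glc_eqs ?I (fst t) (snd t) \<and> (\<forall>\<mu><N. dist (fst t \<mu>) (p (lab \<mu>)) < inverse (real (Suc m))) \<and> norm (snd t) > real (Suc m) \<and>
    (1 / snd t, (1 / snd t) *s Af ?I (fst t) (snd t), (1 / snd t)\<^sup>2 * Bf ?I (fst t) (snd t)) \<notin> S" for m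
  proof (rule ccontr)
    assume c: "\<not> ?thesis"
    show False
    proof (rule no[THEN notE], rule that)
      show "inverse (real (Suc m)) > 0" by simp
      fix b h assume e: "glc_eqs ?I b h" "\<forall>\<mu><N. dist (b \<mu>) (p (lab \<mu>)) < inverse (real (Suc m))" and "norm h > 1 / inverse (real (Suc m))"
      then have n: "norm h > real (Suc m)" by (simp add: divide_inverse)
      show "(1 / h, (1 / h) *s Af ?I b h, (1 / h)\<^sup>2 * Bf ?I b h) \<in> S"
      proof (rule ccontr)
        assume ns: "(1 / h, (1 / h) *s Af ?I b h, (1 / h)\<^sup>2 * Bf ?I b h) \<notin> S"
        show False
          by (rule notE[OF c], rule exI[of _ "(b, h)"], unfold fst_conv snd_conv, intro conjI e n ns)
      qed
    qed
  qed
  then have "\<forall>m. \<exists>t. glc_eqs ?I (fst t) (snd t) \<and> (\<forall>\<mu><N. dist (fst t \<mu>) (p (lab \<mu>)) < inverse (real (Suc m))) \<and> norm (snd t) > real (Suc m) \<and>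
    (1 / snd t, (1 / snd t) *s Af ?I (fst t) (snd t), (1 / snd t)\<^sup>2 * Bf ?I (fst t) (snd t)) \<notin> S" by (rule allI)
  from choice[OF this] obtain t where t0: "\<forall>m. glc_eqs ?I (fst (t m)) (snd (t m)) \<and> (\<forall>\<mu><N. dist (fst (t m) \<mu>) (p (lab \<mu>)) < inverse (real (Suc m))) \<and> norm (snd (t m)) > real (Suc m) \<and>
    (1 / snd (t m), (1 / snd (t m)) *s Af ?I (fst (t m)) (snd (t m)), (1 / snd (t m))\<^sup>2 * Bf ?I (fst (t m)) (snd (t m))) \<notin> S" by (elim exE)
  have t: "glc_eqs ?I (fst (t m)) (snd (t m))" "\<mu> < N \<Longrightarrow> dist (fst (t m) \<mu>) (p (lab \<mu>)) < inverse (real (Suc m))"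
    "norm (snd (t m)) > real (Suc m)"
    "(1 / snd (t m), (1 / snd (t m)) *s Af ?I (fst (t m)) (snd (t m)), (1 / snd (t m))\<^sup>2 * Bf ?I (fst (t m)) (snd (t m))) \<notin> S" for m \<mu>
    using t0[rule_format, of m] by simp_all
  have hinf: "filterlim (\<lambda>m. snd (t m)) at_infinity sequentially"
    unfolding filterlim_at_infinity_conv_norm_at_top
  proof (rule filterlim_at_top_mono[OF filterlim_real_sequentially], rule always_eventually, rule allI)
    fix m show "real m \<le> norm (snd (t m))" using t(3)[of m] by simp
  qed
  have lim: "(\<lambda>m. fst (t m) \<mu>) \<longlonglongrightarrow> p (lab \<mu>)" if "\<mu> \<in> ?I" for \<mu>
    by (rule LIMSEQ_of_dist_less) (use t(2) that in simp)
  have ev: "\<forall>\<^sub>F m in sequentially. glc_eqs ?I (fst (t m)) (snd (t m))" using t(1) by simp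
  note lims = finite_lessThan normalized_labelled lim ev sequentially_bot hinf
  have A: "(\<lambda>m. Af ?I (fst (t m)) (snd (t m)) $ i / snd (t m)) \<longlonglongrightarrow> direction k $ i" for i
    using Af_over_h[OF lims, of i] unfolding card_cluster_labelled lab direction_nth .
  have "(\<lambda>m. (1 / snd (t m)) *s Af ?I (fst (t m)) (snd (t m))) = (\<lambda>m. \<chi> i. Af ?I (fst (t m)) (snd (t m)) $ i / snd (t m))"
    by (simp add: vec_eq_iff fun_eq_iff)
  moreover have "(\<lambda>m. \<chi> i. Af ?I (fst (t m)) (snd (t m)) $ i / snd (t m)) \<longlonglongrightarrow> (\<chi> i. direction k $ i)"
    by (intro tendsto_vec_lambda A)
  ultimately have A': "(\<lambda>m. (1 / snd (t m)) *s Af ?I (fst (t m)) (snd (t m))) \<longlonglongrightarrow> direction k" by simp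
  have B: "(\<lambda>m. (1 / snd (t m))\<^sup>2 * Bf ?I (fst (t m)) (snd (t m))) \<longlonglongrightarrow> 1"
    using Bf_over_h2[OF lims] by (simp add: power_divide)
  have "(\<lambda>m. 1 / snd (t m)) \<longlonglongrightarrow> 0" using tendsto_divide_0[OF tendsto_const hinf] .
  from topological_tendstoD[OF tendsto_Pair[OF this tendsto_Pair[OF A' B]] O]
  have "\<forall>\<^sub>F m in sequentially. False" by eventually_elim (use t(4) in blast)
  then show False by simp
qed

lemma glc_limit_boundary:
  assumes k: "k \<in> boundary_indices n"
  shows "glc_limit \<tau> n p (boundary_pt \<tau> p k) (qpt k)"
  unfolding glc_limit_def limitin_def
proof (intro conjI allI impI)
  show "qpt k \<in> topspace wproj_topology" by (rule qpt_topspace)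
  fix W :: "'r hcoords set set" assume W: "openin wproj_topology W \<and> qpt k \<in> W"
  obtain lab :: "nat \<Rightarrow> 'r" where lab: "\<And>i. card {\<mu>\<in>{..<N}. lab \<mu> = i} = k i" by (rule index_labelling[OF k]) (assumption | rule that)+
  have oW: "open {x. x \<noteq> 0 \<and> wproj x \<in> W}" using W unfolding openin_wproj_iff by simp
  have "(0, direction k, 1) \<in> {x. x \<noteq> 0 \<and> wproj x \<in> W}" using W unfolding qpt_def by (simp add: zero_prod_def)
  then obtain \<delta> where \<delta>: "\<delta> > 0" "\<And>b h. glc_eqs {..<N} b h \<Longrightarrow> \<forall>\<mu><N. dist (b \<mu>) (p (lab \<mu>)) < \<delta> \<Longrightarrow> norm h > 1 / \<delta> \<Longrightarrow>
     (1 / h, (1 / h) *s Af {..<N} b h, (1 / h)\<^sup>2 * Bf {..<N} b h) \<in> {x. x \<noteq> 0 \<and> wproj x \<in> W}"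
    by (rule near_infinity_asymptotics[OF lab oW]) (assumption | rule that)+
  let ?V = "{pt b H |b H. (\<forall>\<mu><N. dist (b \<mu>) (p (lab \<mu>)) < \<delta>) \<and> near_infinity \<delta> H}"
  have "boundary_pt \<tau> p k \<in> ?V" unfolding boundary_pt_eq[OF lab]
    by (intro CollectI exI[of _ "\<lambda>\<mu>. p (lab \<mu>)"] exI[of _ None]) (simp add: \<delta>(1))
  moreover have "glc_map_proj \<tau> n p y \<in> W" if y: "y \<in> ?V" "y \<in> GLC \<tau> n p" for y
  proof -
    obtain b H where b: "y = pt b H" "\<forall>\<mu><N. dist (b \<mu>) (p (lab \<mu>)) < \<delta>" "near_infinity \<delta> H"
      using y(1) by (elim CollectE exE conjE)
    obtain h where h: "H = Some h" using y(2) pt_None_notin_GLC b(1) by (cases H) auto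
    have e: "glc_eqs {..<N} b h" using y(2) unfolding b(1) h pt_in_GLC .
    have n: "norm h > 1 / \<delta>" using b(3) h by simp
    moreover have "1 / \<delta> > 0" using \<delta>(1) by simp
    ultimately have "norm h > 0" by linarith
    then have "1 / h \<noteq> 0" by auto
    from glc_map_proj_scale[OF e this] show ?thesis using \<delta>(2)[OF e b(2) n] unfolding b(1) h by simp
  qed
  ultimately show "\<forall>\<^sub>F y in atin_within (P_topology \<tau> N) (boundary_pt \<tau> p k) (GLC \<tau> n p). glc_map_proj \<tau> n p y \<in> W"
    unfolding eventually_atin_within using openin_P_near_infinity[of "\<lambda>\<mu>. p (lab \<mu>)" \<delta>] by (intro disjI2 exI[of _ ?V]) blast
qed

lemma boundary_in_closure:
  assumes k: "k \<in> boundary_indices n"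
  shows "boundary_pt \<tau> p k \<in> GLC_closure \<tau> n p"
  unfolding GLC_closure_def in_closure_of
proof (intro conjI allI impI)
  obtain lab where lab: "\<And>i. card {\<mu>\<in>{..<N}. lab \<mu> = i} = k i"
    and lift: "\<And>\<delta>. \<delta> > 0 \<Longrightarrow> \<exists>s0>0. \<forall>s. s \<noteq> 0 \<and> norm s < s0 \<longrightarrow> (\<exists>b h. glc_eqs {..<N} b h \<and>
       (\<forall>\<mu><N. dist (b \<mu>) (p (lab \<mu>)) < \<delta>) \<and> norm h > 1 / \<delta> \<and> s\<^sup>2 * Bf {..<N} b h = 1 \<and>
       (\<forall>i. dist (s * Af {..<N} b h $ i) (direction k $ i) < \<delta>))"
    by (rule branch_surjective[OF k]) (assumption | rule that)+
  show "boundary_pt \<tau> p k \<in> topspace (P_topology \<tau> N)" unfolding boundary_pt_eq[OF lab] topspace_P by blast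
  fix V assume V: "boundary_pt \<tau> p k \<in> V \<and> openin (P_topology \<tau> N) V"
  then obtain \<delta> where \<delta>: "\<delta> > 0" "\<And>b H. \<forall>\<mu><N. dist (b \<mu>) (p (lab \<mu>)) < \<delta> \<Longrightarrow> near_infinity \<delta> H \<Longrightarrow> pt b H \<in> V"
    by (elim conjE) (rule P_neighbourhood_infinity[of V "\<lambda>\<mu>. p (lab \<mu>)"], assumption, unfold boundary_pt_eq[OF lab], (assumption | rule that)+)
  obtain s0 where s0: "s0 > 0" "\<forall>s. s \<noteq> 0 \<and> norm s < s0 \<longrightarrow> (\<exists>b h. glc_eqs {..<N} b h \<and>
       (\<forall>\<mu><N. dist (b \<mu>) (p (lab \<mu>)) < \<delta>) \<and> norm h > 1 / \<delta> \<and> s\<^sup>2 * Bf {..<N} b h = 1 \<and>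
       (\<forall>i. dist (s * Af {..<N} b h $ i) (direction k $ i) < \<delta>))" using lift[OF \<delta>(1)] by (elim exE conjE)
  have "complex_of_real (s0 / 2) \<noteq> 0 \<and> norm (complex_of_real (s0 / 2)) < s0" using s0(1) by (simp add: norm_divide)
  with s0(2) obtain b h where bh: "glc_eqs {..<N} b h" "\<forall>\<mu><N. dist (b \<mu>) (p (lab \<mu>)) < \<delta>" "norm h > 1 / \<delta>" by blast
  have "pt b (Some h) \<in> V" by (rule \<delta>(2)[OF bh(2)]) (simp add: bh(3))
  then show "\<exists>y. y \<in> GLC \<tau> n p \<and> y \<in> V" using bh(1) pt_in_GLC by blast
qed

lemma boundary_notin_GLC: "k \<in> boundary_indices n \<Longrightarrow> boundary_pt \<tau> p k \<notin> GLC \<tau> n p"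
proof -
  assume "k \<in> boundary_indices n"
  then obtain lab :: "nat \<Rightarrow> 'r" where "\<And>i. card {\<mu>\<in>{..<N}. lab \<mu> = i} = k i" by (rule index_labelling) (assumption | rule that)+
  then show ?thesis using boundary_pt_eq pt_None_notin_GLC by metis
qed

text \<open>The limit is unique because the target is Hausdorff and the boundary point is an
  accumulation point of the curve, being in its closure but not on it.\<close>

lemma glc_map_ext_boundary:
  assumes k: "k \<in> boundary_indices n"
  shows "glc_map_ext \<tau> n p (boundary_pt \<tau> p k) = qpt k"
proof -
  have nt: "\<not> trivial_limit (atin_within (P_topology \<tau> N) (boundary_pt \<tau> p k) (GLC \<tau> n p))"
    unfolding derived_set_of_trivial_limit[symmetric] in_derived_set_of
    using boundary_in_closure[OF k] boundary_notin_GLC[OF k] unfolding GLC_closure_def in_closure_of by metis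
  have "(THE q. glc_limit \<tau> n p (boundary_pt \<tau> p k) q) = qpt k"
  proof (rule the_equality)
    show "glc_limit \<tau> n p (boundary_pt \<tau> p k) (qpt k)" by (rule glc_limit_boundary[OF k])
    fix q assume "glc_limit \<tau> n p (boundary_pt \<tau> p k) q"
    then show "q = qpt k" using limitin_Hausdorff_unique[OF _ _ nt Hausdorff_wproj] glc_limit_boundary[OF k]
      unfolding glc_limit_def by blast
  qed
  then show ?thesis using boundary_notin_GLC[OF k] by (simp add: glc_map_ext_def)
qed

text \<open>For finite h the clusters at p_i have at most k_i <= 2 n_i nodes, so no node reaches p_i
  in a limit of the curve and the limit lies on the curve. For infinite h all nodes must sit at
  singular points, which leaves only the boundary point itself.\<close>

lemma boundary_neighbourhood:
  assumes lab: "\<And>i. card {\<mu>\<in>{..<N}. lab \<mu> = i} = k i" and k: "k \<in> boundary_indices n"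
  obtains \<delta> where "\<delta> > 0" "\<And>b H. \<forall>\<mu><N. dist (b \<mu>) (p (lab \<mu>)) < \<delta> \<Longrightarrow> pt b H \<in> GLC_closure \<tau> n p \<Longrightarrow>
     pt b H \<in> GLC \<tau> n p \<or> pt b H = boundary_pt \<tau> p k"
proof -
  let ?I = "{..<N}"
  have "\<forall>\<^sub>F \<delta> in at_right 0. \<forall>z. dist z (p i - p j) < 2 * \<delta> \<longrightarrow> z \<in> \<Lambda> \<longrightarrow> z = p i - p j" for i j
  proof -
    have "open (- (\<Lambda> - {p i - p j}))" by (intro open_Compl closed_lattice_subset) auto
    then obtain e where e: "e > 0" "ball (p i - p j) e \<subseteq> - (\<Lambda> - {p i - p j})" by (metis open_contains_ball ComplI Diff_iff singletonI)
    have "z = p i - p j" if "\<delta> < e / 2" "dist z (p i - p j) < 2 * \<delta>" "z \<in> \<Lambda>" for \<delta> z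
    proof -
      have "z \<in> ball (p i - p j) e" using that by (simp add: dist_commute)
      then show ?thesis using e(2) that(3) by auto
    qed
    then show ?thesis unfolding eventually_at_right_field using e(1) by (intro exI[of _ "e / 2"]) auto
  qed
  then have "\<forall>\<^sub>F \<delta> in at_right 0. \<forall>i\<in>UNIV. \<forall>j\<in>UNIV. \<forall>z. dist z (p i - p j) < 2 * \<delta> \<longrightarrow> z \<in> \<Lambda> \<longrightarrow> z = p i - p j"
    by (intro eventually_ball_finite ballI) auto
  moreover have "\<forall>\<^sub>F \<delta> in at_right (0::real). \<delta> > 0" by (rule eventually_at_right_less)
  ultimately have "\<forall>\<^sub>F \<delta> in at_right 0. \<delta> > 0 \<and> (\<forall>i\<in>UNIV. \<forall>j\<in>UNIV. \<forall>z. dist z (p i - p j) < 2 * \<delta> \<longrightarrow> z \<in> \<Lambda> \<longrightarrow> z = p i - p j)"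
    by eventually_elim blast
  from eventually_happens'[OF trivial_limit_at_right_real this]
  \<comment> \<open>The radius 2 delta covers a difference of two nodes, each displaced by less than
    delta. Near p_i - p_j there is then no other lattice point, so the representatives are already
    normalized.\<close>
  obtain \<delta> where \<delta>: "\<delta> > 0" and sep: "\<And>i j z. dist z (p i - p j) < 2 * \<delta> \<Longrightarrow> z \<in> \<Lambda> \<Longrightarrow> z = p i - p j" by blast
  show thesis
  proof (rule that[OF \<delta>])
    fix b H assume b: "\<forall>\<mu><N. dist (b \<mu>) (p (lab \<mu>)) < \<delta>" and cl: "pt b H \<in> GLC_closure \<tau> n p"
    have bp: "lab \<mu> = i \<and> b \<mu> = p i" if "\<mu> \<in> ?I" "b \<mu> - p i \<in> \<Lambda>" for \<mu> i
    proof -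
      have "dist (b \<mu> - p i) (p (lab \<mu>) - p i) < 2 * \<delta>" using b \<delta> that(1) by (auto simp: dist_norm)
      then have e: "b \<mu> - p i = p (lab \<mu>) - p i" using that(2) by (rule sep)
      then have "p (lab \<mu>) - p i \<in> \<Lambda>" using that(2) by simp
      then have "lab \<mu> = i" using p_distinct by blast
      then show ?thesis using e by simp
    qed
    have bb: "b \<mu> = b \<nu>" if "\<mu> \<in> ?I" "\<nu> \<in> ?I" "b \<mu> - b \<nu> \<in> \<Lambda>" for \<mu> \<nu>
    proof -
      have "norm ((b \<mu> - p (lab \<mu>)) - (b \<nu> - p (lab \<nu>))) \<le> norm (b \<mu> - p (lab \<mu>)) + norm (b \<nu> - p (lab \<nu>))" by (rule norm_triangle_ineq4)
      moreover have "norm (b \<mu> - p (lab \<mu>)) < \<delta>" "norm (b \<nu> - p (lab \<nu>)) < \<delta>" using b that by (simp_all add: dist_norm)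
      ultimately have "dist (b \<mu> - b \<nu>) (p (lab \<mu>) - p (lab \<nu>)) < 2 * \<delta>" by (simp add: dist_norm algebra_simps)
      then have e: "b \<mu> - b \<nu> = p (lab \<mu>) - p (lab \<nu>)" using that(3) by (rule sep)
      then have "p (lab \<mu>) - p (lab \<nu>) \<in> \<Lambda>" using that(3) by simp
      then have "lab \<mu> = lab \<nu>" using p_distinct by blast
      then show ?thesis using e by simp
    qed
    have nrm: "normalized ?I b" unfolding normalized_def using bb bp by blast
    show "pt b H \<in> GLC \<tau> n p \<or> pt b H = boundary_pt \<tau> p k"
    proof (cases H)
      case (Some h0)
      obtain b' h' where s: "\<And>m::nat. glc_eqs ?I (b' m) (h' m)" "\<And>\<mu>. \<mu> < N \<Longrightarrow> (\<lambda>m. b' m \<mu>) \<longlonglongrightarrow> b \<mu>" "h' \<longlonglongrightarrow> h0"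
        by (rule closure_sequence_finite[OF cl[unfolded Some]]) (assumption | rule that)+
      have lim: "(\<lambda>m. b' m \<mu>) \<longlonglongrightarrow> b \<mu>" if "\<mu> \<in> ?I" for \<mu> using s(2) that by simp
      have ev: "\<forall>\<^sub>F m in sequentially. glc_eqs ?I (b' m) (h' m)" using s(1) by simp
      have le: "card (cluster ?I b (p i)) \<le> ell n i" for i
      proof -
        have "cluster ?I b (p i) \<subseteq> {\<mu>\<in>?I. lab \<mu> = i}" unfolding cluster_def using bp by auto
        then have "card (cluster ?I b (p i)) \<le> k i" using card_mono[of "{\<mu>\<in>?I. lab \<mu> = i}"] lab[of i] by simp
        also have "k i \<le> ell n i" using k by (simp add: boundary_indices_def)
        finally show ?thesis .
      qed
      have "glc_eqs ?I b h0" by (rule finite_limit_glc_eqs[OF finite_lessThan nrm lim ev sequentially_bot s(3) le])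
      then show ?thesis by (simp add: Some pt_in_GLC)
    next
      case None
      obtain b' h' where s: "\<And>m::nat. glc_eqs ?I (b' m) (h' m)" "\<And>\<mu>. \<mu> < N \<Longrightarrow> (\<lambda>m. b' m \<mu>) \<longlonglongrightarrow> b \<mu>" "filterlim h' at_infinity sequentially"
        by (rule closure_sequence_infinity[OF cl[unfolded None]]) (assumption | rule that)+
      have lim: "(\<lambda>m. b' m \<mu>) \<longlonglongrightarrow> b \<mu>" if "\<mu> \<in> ?I" for \<mu> using s(2) that by simp
      have ev: "\<forall>\<^sub>F m in sequentially. glc_eqs ?I (b' m) (h' m)" using s(1) by simp
      have "b \<mu> = p (lab \<mu>)" if mu: "\<mu> \<in> ?I" for \<mu>
      proof -
        obtain i where i: "b \<mu> = p i" using infinite_limit_in_p[OF finite_lessThan nrm lim ev sequentially_bot s(3) mu] by blast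
        then have "b \<mu> - p i \<in> \<Lambda>" by simp
        from bp[OF mu this] show ?thesis using i by blast
      qed
      then have "image_mset b (mset_set ?I) = image_mset (\<lambda>\<mu>. p (lab \<mu>)) (mset_set ?I)" by (intro image_mset_cong) auto
      then show ?thesis unfolding None boundary_pt_eq[OF lab] by (simp add: pt_def)
    qed
  qed
qed

text \<open>Any point of the closure at h = infinity has a normalized representative, and the limit
  analysis along a sequence of curve points identifies it. The other inclusion rests on the
  constructed branches.\<close>

lemma type_I_eq: "type_I \<tau> n p = boundary_pt \<tau> p ` boundary_indices n"
proof (intro equalityI subsetI)
  fix x assume "x \<in> boundary_pt \<tau> p ` boundary_indices n"
  then obtain k where "x = boundary_pt \<tau> p k" "k \<in> boundary_indices n" by blast
  then show "x \<in> type_I \<tau> n p"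
    using boundary_in_closure boundary_notin_GLC unfolding type_I_def by (auto simp: boundary_pt_def)
next
  let ?I = "{..<N}"
  fix x assume x: "x \<in> type_I \<tau> n p"
  then obtain M where M: "x = glc_class \<tau> (M, None)" and cl: "x \<in> GLC_closure \<tau> n p" unfolding type_I_def by blast
  have "x \<in> topspace (P_topology \<tau> N)" using cl unfolding GLC_closure_def in_closure_of by blast
  then obtain b H where "x = pt b H" unfolding topspace_P by blast
  then have "(M, None) \<in> pt b H" using M glc_class_self by metis
  then obtain a where "M = image_mset a (mset_set ?I)" unfolding pt_def glc_class_mem_iff[OF finite_lessThan] by blast
  then have xa: "x = pt a None" by (simp add: M pt_def)
  \<comment> \<open>A system of representatives of the torus that uses p_i for its own class;
    elsewhere the choice depends only on the class, so congruent nodes receive equal values.\<close>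
  define rep where "rep z = (if \<exists>i. z - p i \<in> \<Lambda> then p (THE i. z - p i \<in> \<Lambda>) else (SOME w. w - z \<in> \<Lambda>))" for z
  have the: "(THE i. z - p i \<in> \<Lambda>) = i" if "z - p i \<in> \<Lambda>" for z i
  proof (rule the_equality)
    show "z - p i \<in> \<Lambda>" by (rule that)
    fix j assume "z - p j \<in> \<Lambda>"
    then have "(z - p j) - (z - p i) \<in> \<Lambda>" using that by (rule lattice_diff)
    then have "p i - p j \<in> \<Lambda>" by simp
    then show "j = i" using p_distinct[of i j] by metis
  qed
  have rep: "rep z - z \<in> \<Lambda>" for z
  proof (cases "\<exists>i. z - p i \<in> \<Lambda>")
    case True
    then obtain i where i: "z - p i \<in> \<Lambda>" by blast
    then show ?thesis using lattice_diff_commute[of z "p i"] by (simp add: rep_def the[OF i]) blast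
  next
    case False
    have "z - z \<in> \<Lambda>" by simp
    from someI[of "\<lambda>w. w - z \<in> \<Lambda>", OF this] False show ?thesis by (simp add: rep_def)
  qed
  have rep_p: "rep z = p i" if "z - p i \<in> \<Lambda>" for z i
    using that the[OF that] by (auto simp: rep_def)
  have rep_eq: "rep z = rep w" if zw: "z - w \<in> \<Lambda>" for z w
  proof -
    have "u - z \<in> \<Lambda> \<longleftrightarrow> u - w \<in> \<Lambda>" for u
      using lattice_add[OF _ zw, of "u - z"] lattice_diff[OF _ zw, of "u - w"] by auto
    moreover have "z - u \<in> \<Lambda> \<longleftrightarrow> w - u \<in> \<Lambda>" for u
      using calculation lattice_diff_commute by metis
    ultimately show ?thesis by (simp add: rep_def)
  qed
  define a' where "a' \<mu> = rep (a \<mu>)" for \<mu>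
  have a': "a' \<mu> - a \<mu> \<in> \<Lambda>" for \<mu> unfolding a'_def by (rule rep)
  have nrm: "normalized ?I a'"
    unfolding normalized_def
  proof (intro conjI ballI allI impI)
    fix \<mu> \<nu> assume "a' \<mu> - a' \<nu> \<in> \<Lambda>"
    then have "(a' \<mu> - a' \<nu>) - ((a' \<mu> - a \<mu>) - (a' \<nu> - a \<nu>)) \<in> \<Lambda>" by (rule lattice_diff[OF _ lattice_diff[OF a' a']])
    then have "a \<mu> - a \<nu> \<in> \<Lambda>" by (simp add: algebra_simps)
    then show "a' \<mu> = a' \<nu>" unfolding a'_def by (rule rep_eq)
  next
    fix \<mu> i assume "a' \<mu> - p i \<in> \<Lambda>"
    then have "(a' \<mu> - p i) - (a' \<mu> - a \<mu>) \<in> \<Lambda>" by (rule lattice_diff[OF _ a'])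
    then show "a' \<mu> = p i" unfolding a'_def by (intro rep_p) simp
  qed
  have "\<exists>m. a' \<mu> = a \<mu> + lat m" for \<mu>
  proof -
    obtain m where "a' \<mu> - a \<mu> = lat m" using a'[of \<mu>] unfolding lattice_eq_range by blast
    then show ?thesis by (intro exI[of _ m]) (simp add: algebra_simps)
  qed
  then obtain m where m: "\<And>\<mu>. a' \<mu> = a \<mu> + lat (m \<mu>)" by metis
  have ma: "a' = (\<lambda>\<mu>. a \<mu> + lat (m \<mu>))" by (rule ext) (rule m)
  have "(image_mset a' (mset_set ?I), None) \<in> pt a None"
    unfolding pt_def glc_class_mem_iff[OF finite_lessThan] ma by (intro exI[of _ m]) simp
  then have xa': "x = pt a' None" unfolding xa pt_def using glc_class_eq_iff by blast
  obtain b h where s: "\<And>m::nat. glc_eqs ?I (b m) (h m)" "\<And>\<mu>. \<mu> < N \<Longrightarrow> (\<lambda>m. b m \<mu>) \<longlonglongrightarrow> a' \<mu>" "filterlim h at_infinity sequentially"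
    by (rule closure_sequence_infinity[OF cl[unfolded xa']]) (assumption | rule that)+
  have lim: "(\<lambda>m. b m \<mu>) \<longlonglongrightarrow> a' \<mu>" if "\<mu> \<in> ?I" for \<mu> using s(2) that by simp
  have ev: "\<forall>\<^sub>F m in sequentially. glc_eqs ?I (b m) (h m)" using s(1) by simp
  note lims = finite_lessThan nrm lim ev sequentially_bot s(3)
  have "\<forall>\<mu>. \<exists>i. \<mu> \<in> ?I \<longrightarrow> a' \<mu> = p i" using infinite_limit_in_p[OF lims] by blast
  then obtain lab where lab: "\<And>\<mu>. \<mu> \<in> ?I \<Longrightarrow> a' \<mu> = p (lab \<mu>)" by metis
  have "cluster ?I a' (p i) = cluster ?I (\<lambda>\<mu>. p (lab \<mu>)) (p i)" for i using lab by (auto simp: cluster_def)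
  then have k: "(\<lambda>i. card {\<mu>\<in>?I. lab \<mu> = i}) \<in> boundary_indices n"
    using limit_index(1)[OF lims] by (simp only: card_cluster_labelled)
  have "image_mset a' (mset_set ?I) = image_mset (\<lambda>\<mu>. p (lab \<mu>)) (mset_set ?I)" using lab by (intro image_mset_cong) auto
  then have "x = boundary_pt \<tau> p (\<lambda>i. card {\<mu>\<in>?I. lab \<mu> = i})"
    by (simp add: xa' boundary_pt_eq pt_def)
  then show "x \<in> boundary_pt \<tau> p ` boundary_indices n" using k by blast
qed

end

section \<open>The branch of the variety covered by the branch of the curve\<close>

lemma dist_vec_le_sum:
  fixes x y :: "'a::metric_space ^ 'b::finite"
  shows "dist x y \<le> (\<Sum>i\<in>UNIV. dist (x $ i) (y $ i))"
  unfolding dist_vec_def by (intro L2_set_le_sum) simp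

context glc
begin

text \<open>The local graph and the branch of the curve are matched: images of curve points satisfy
  the obstructions and lie in the uniqueness region, so they are on the graph; conversely, every
  graph point with small s is such an image, hence belongs to the closure of the variety.\<close>

lemma branch_parametrization:
  assumes k: "k \<in> boundary_indices n"
  obtains lab :: "nat \<Rightarrow> 'r" and \<epsilon> \<rho> :: real and \<beta> :: "complex \<Rightarrow> complex ^ 'r" where "\<And>i. card {\<mu>\<in>{..<N}. lab \<mu> = i} = k i" "\<epsilon> > 0" "\<rho> > 0" "\<beta> 0 = direction k"
    "\<And>i. (\<lambda>s. \<beta> s $ i) holomorphic_on ball 0 \<epsilon>" "\<And>s. norm s < \<epsilon> \<Longrightarrow> \<beta> s \<in> ball (direction k) \<rho>"
    "\<And>s A. norm s < \<epsilon> \<Longrightarrow> A \<in> ball (direction k) \<rho> \<Longrightarrow> wproj (s, A, 1) \<in> Vbar \<longleftrightarrow> A = \<beta> s"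
    "\<And>\<delta>. \<delta> > 0 \<Longrightarrow> \<exists>s0>0. \<forall>s. s \<noteq> 0 \<longrightarrow> norm s < s0 \<longrightarrow> (\<exists>b h. glc_eqs {..<N} b h \<and> (\<forall>\<mu><N. dist (b \<mu>) (p (lab \<mu>)) < \<delta>) \<and>
       norm h > 1 / \<delta> \<and> glc_map_proj \<tau> n p (pt b (Some h)) = wproj (s, \<beta> s, 1))"
proof -
  let ?I = "{..<N}" and ?\<alpha> = "direction k"
  have dir: "\<exists>k\<le>ell n i. ?\<alpha> $ i = 2 * of_nat k - of_nat (ell n i)" for i
    using k by (intro exI[of _ "k i"]) (simp add: direction_def boundary_indices_def)
  obtain e \<rho> :: real and \<beta> :: "complex \<Rightarrow> complex ^ 'r" where e: "e > 0" and \<rho>: "\<rho> > 0" and \<beta>0: "\<beta> 0 = ?\<alpha>" and hol: "\<And>i. (\<lambda>s. \<beta> s $ i) holomorphic_on ball 0 e"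
    and F0: "\<And>s i. s \<in> ball 0 e \<Longrightarrow> Fh i (s, \<beta> s, 1) = 0" and \<beta>b: "\<And>s. s \<in> ball 0 e \<Longrightarrow> \<beta> s \<in> ball ?\<alpha> \<rho>"
    and uniq: "\<And>s A. s \<in> ball 0 e \<Longrightarrow> A \<in> ball ?\<alpha> \<rho> \<Longrightarrow> (\<And>i. Fh i (s, A, 1) = 0) \<Longrightarrow> A = \<beta> s"
  proof (rule Fh_local_graph[OF dir])
    fix e \<rho> :: real and \<beta> :: "complex \<Rightarrow> complex ^ 'r"
    assume "e > 0" "\<rho> > 0" "\<beta> 0 = ?\<alpha>" "\<And>i. (\<lambda>s. \<beta> s $ i) holomorphic_on ball 0 e"
      "\<And>s i. s \<in> ball 0 e \<Longrightarrow> Fh i (s, \<beta> s, 1) = 0" "\<And>s. s \<in> ball 0 e \<Longrightarrow> \<beta> s \<in> ball ?\<alpha> \<rho>"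
      "\<And>s A. s \<in> ball 0 e \<Longrightarrow> A \<in> ball ?\<alpha> \<rho> \<Longrightarrow> (\<And>i. Fh i (s, A, 1) = 0) \<Longrightarrow> A = \<beta> s"
    then show ?thesis by (rule that[of e \<rho> \<beta>])
  qed
  obtain lab :: "nat \<Rightarrow> 'r" where lab: "\<And>i. card {\<mu>\<in>?I. lab \<mu> = i} = k i"
    and lift: "\<And>\<delta>. \<delta> > 0 \<Longrightarrow> \<exists>s0>0. \<forall>s. s \<noteq> 0 \<and> norm s < s0 \<longrightarrow> (\<exists>b h. glc_eqs ?I b h \<and>
       (\<forall>\<mu><N. dist (b \<mu>) (p (lab \<mu>)) < \<delta>) \<and> norm h > 1 / \<delta> \<and> s\<^sup>2 * Bf ?I b h = 1 \<and>
       (\<forall>i. dist (s * Af ?I b h $ i) (?\<alpha> $ i) < \<delta>))"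
    by (rule branch_surjective[OF k]) (assumption | rule that)+
  have in_Vbar: "A = \<beta> s" if "wproj (s, A, 1) \<in> Vbar" "norm s < e" "A \<in> ball ?\<alpha> \<rho>" for s A
  proof (rule uniq)
    show "Fh i (s, A, 1) = 0" for i using Vbar_cone[OF that(1)] by (simp add: cone_def)
  qed (use that in simp_all)
  have lift': "\<exists>s0>0. \<forall>s. s \<noteq> 0 \<longrightarrow> norm s < s0 \<longrightarrow> (\<exists>b h. glc_eqs ?I b h \<and> (\<forall>\<mu><N. dist (b \<mu>) (p (lab \<mu>)) < \<delta>) \<and>
       norm h > 1 / \<delta> \<and> glc_map_proj \<tau> n p (pt b (Some h)) = wproj (s, \<beta> s, 1))" if \<delta>: "\<delta> > 0" for \<delta>
  proof -
    define C where "C = real CARD('r)"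
    have C: "C > 0" by (simp add: C_def)
    \<comment> \<open>Closeness of all coordinates within d gives distance at most CARD('r) times d,
      and the factor 2 makes this less than rho.\<close>
    define d where "d = min \<delta> (\<rho> / (2 * C))"
    have d: "d > 0" "d \<le> \<delta>" "d \<le> \<rho> / (2 * C)" using \<delta> \<rho> C by (simp_all add: d_def)
    obtain s0 where s0: "s0 > 0" "\<forall>s. s \<noteq> 0 \<and> norm s < s0 \<longrightarrow> (\<exists>b h. glc_eqs ?I b h \<and>
       (\<forall>\<mu><N. dist (b \<mu>) (p (lab \<mu>)) < d) \<and> norm h > 1 / d \<and> s\<^sup>2 * Bf ?I b h = 1 \<and>
       (\<forall>i. dist (s * Af ?I b h $ i) (?\<alpha> $ i) < d))" using lift[OF d(1)] by (elim exE conjE)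
    show ?thesis
    proof (intro exI[of _ "min s0 e"] conjI allI impI)
      show "min s0 e > 0" using s0(1) e by simp
      fix s :: complex assume s: "s \<noteq> 0" "norm s < min s0 e"
      then have "s \<noteq> 0 \<and> norm s < s0" by simp
      from s0(2)[rule_format, OF this] obtain b h where bh: "glc_eqs ?I b h" "\<forall>\<mu><N. dist (b \<mu>) (p (lab \<mu>)) < d" "norm h > 1 / d"
        "s\<^sup>2 * Bf ?I b h = 1" "\<forall>i. dist (s * Af ?I b h $ i) (?\<alpha> $ i) < d" by (elim exE conjE)
      have m: "glc_map_proj \<tau> n p (pt b (Some h)) = wproj (s, s *s Af ?I b h, 1)"
        using glc_map_proj_scale[OF bh(1) s(1)] bh(4) by simp
      have "dist (s *s Af ?I b h) ?\<alpha> \<le> (\<Sum>i\<in>UNIV. dist ((s *s Af ?I b h) $ i) (?\<alpha> $ i))" by (rule dist_vec_le_sum)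
      also have "\<dots> \<le> (\<Sum>i\<in>(UNIV :: 'r set). d)" using bh(5) by (intro sum_mono) (simp add: less_imp_le)
      also have "\<dots> = C * d" by (simp add: C_def)
      also have "\<dots> \<le> C * (\<rho> / (2 * C))" using d(3) C by (intro mult_left_mono) auto
      also have "\<dots> < \<rho>" using C \<rho> by simp
      finally have "s *s Af ?I b h \<in> ball ?\<alpha> \<rho>" by (simp add: dist_commute)
      then have "s *s Af ?I b h = \<beta> s" using in_Vbar glc_map_proj_in_Vbar[OF bh(1)] s(2) unfolding m by simp
      moreover have "1 / d \<ge> 1 / \<delta>" using d(1,2) by (simp add: frac_le)
      then have "norm h > 1 / \<delta>" using bh(3) by linarith
      moreover have "\<forall>\<mu><N. dist (b \<mu>) (p (lab \<mu>)) < \<delta>"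
      proof (intro allI impI)
        fix \<mu> assume "\<mu> < N"
        then have "dist (b \<mu>) (p (lab \<mu>)) < d" using bh(2) by simp
        then show "dist (b \<mu>) (p (lab \<mu>)) < \<delta>" using d(2) by simp
      qed
      ultimately show "\<exists>b h. glc_eqs ?I b h \<and> (\<forall>\<mu><N. dist (b \<mu>) (p (lab \<mu>)) < \<delta>) \<and>
       norm h > 1 / \<delta> \<and> glc_map_proj \<tau> n p (pt b (Some h)) = wproj (s, \<beta> s, 1)"
        using bh(1) m by (intro exI[of _ b] exI[of _ h] conjI) simp_all
    qed
  qed
  \<comment> \<open>The value s = 0 is not attained by curve points, so the centre of the branch
    enters as their limit.\<close>
  have q: "qpt k \<in> Vbar"
    unfolding log_free_closure_def in_closure_of
  proof (intro conjI allI impI)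
    show "qpt k \<in> topspace wproj_topology" by (rule qpt_topspace)
    fix W assume W: "qpt k \<in> W \<and> openin wproj_topology W"
    have oW: "open {x. x \<noteq> 0 \<and> wproj x \<in> W}" using W unfolding openin_wproj_iff by simp
    have "(0, ?\<alpha>, 1) \<in> {x. x \<noteq> 0 \<and> wproj x \<in> W}" using W unfolding qpt_def by (simp add: zero_prod_def)
    then obtain \<delta> where \<delta>: "\<delta> > 0" "\<And>b h. glc_eqs ?I b h \<Longrightarrow> \<forall>\<mu><N. dist (b \<mu>) (p (lab \<mu>)) < \<delta> \<Longrightarrow> norm h > 1 / \<delta> \<Longrightarrow>
       (1 / h, (1 / h) *s Af ?I b h, (1 / h)\<^sup>2 * Bf ?I b h) \<in> {x. x \<noteq> 0 \<and> wproj x \<in> W}"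
      by (rule near_infinity_asymptotics[OF lab oW]) (assumption | rule that)+
    obtain s0 where s0: "s0 > 0" "\<forall>s. s \<noteq> 0 \<longrightarrow> norm s < s0 \<longrightarrow> (\<exists>b h. glc_eqs ?I b h \<and> (\<forall>\<mu><N. dist (b \<mu>) (p (lab \<mu>)) < \<delta>) \<and>
       norm h > 1 / \<delta> \<and> glc_map_proj \<tau> n p (pt b (Some h)) = wproj (s, \<beta> s, 1))" using lift'[OF \<delta>(1)] by (elim exE conjE)
    have "complex_of_real (s0 / 2) \<noteq> 0" "norm (complex_of_real (s0 / 2)) < s0" using s0(1) by (simp_all add: norm_divide)
    from s0(2)[rule_format, OF this] obtain b h where bh: "glc_eqs ?I b h" "\<forall>\<mu><N. dist (b \<mu>) (p (lab \<mu>)) < \<delta>" "norm h > 1 / \<delta>" by (elim exE conjE)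
    have "1 / \<delta> > 0" using \<delta>(1) by simp
    then have "norm h > 0" using bh(3) by linarith
    then have hne: "1 / h \<noteq> 0" by auto
    have "wproj (1, Af ?I b h, Bf ?I b h) = wproj (1 / h, (1 / h) *s Af ?I b h, (1 / h)\<^sup>2 * Bf ?I b h)"
      using glc_map_proj_scale[OF bh(1) hne] unfolding glc_map_proj_pt[OF bh(1)] .
    moreover have "wproj (1 / h, (1 / h) *s Af ?I b h, (1 / h)\<^sup>2 * Bf ?I b h) \<in> W" using \<delta>(2)[OF bh] by blast
    ultimately have "wproj (1, Af ?I b h, Bf ?I b h) \<in> W" by (simp only:)
    then show "\<exists>y. y \<in> (\<lambda>(A, B). wproj (1, A, B)) ` log_free_variety \<tau> n p \<and> y \<in> W"
      using mem_log_free_variety[OF bh(1)] by (intro exI[of _ "wproj (1, Af ?I b h, Bf ?I b h)"]) (auto simp: image_iff)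
  qed
  obtain s1 where s1: "s1 > 0" "\<forall>s. s \<noteq> 0 \<longrightarrow> norm s < s1 \<longrightarrow> (\<exists>b h. glc_eqs ?I b h \<and> (\<forall>\<mu><N. dist (b \<mu>) (p (lab \<mu>)) < 1) \<and>
       norm h > 1 / 1 \<and> glc_map_proj \<tau> n p (pt b (Some h)) = wproj (s, \<beta> s, 1))" using lift'[OF zero_less_one] by (elim exE conjE)
  have \<gamma>: "wproj (s, \<beta> s, 1) \<in> Vbar" if "norm s < s1" for s
  proof (cases "s = 0")
    case True
    then show ?thesis using q by (simp add: qpt_def \<beta>0)
  next
    case False
    from s1(2)[rule_format, OF this that] obtain b h where "glc_eqs ?I b h" "glc_map_proj \<tau> n p (pt b (Some h)) = wproj (s, \<beta> s, 1)" by (elim exE conjE)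
    then show ?thesis using glc_map_proj_in_Vbar[of b h] by simp
  qed
  show thesis
  proof (rule that[of lab "min e s1" \<rho> \<beta>])
    show "card {\<mu>\<in>?I. lab \<mu> = i} = k i" for i by (rule lab)
    show "min e s1 > 0" "\<rho> > 0" "\<beta> 0 = ?\<alpha>" using e s1(1) \<rho> \<beta>0 by simp_all
    show "(\<lambda>s. \<beta> s $ i) holomorphic_on ball 0 (min e s1)" for i by (rule holomorphic_on_subset[OF hol]) auto
    show "\<beta> s \<in> ball ?\<alpha> \<rho>" if "norm s < min e s1" for s using \<beta>b[of s] that by simp
    show "wproj (s, A, 1) \<in> Vbar \<longleftrightarrow> A = \<beta> s" if "norm s < min e s1" "A \<in> ball ?\<alpha> \<rho>" for s A
      using in_Vbar[of s A] \<gamma>[of s] that by auto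
  qed (rule lift')
qed

text \<open>Restricting the equations of an analytic germ to the parametrized curve gives
  holomorphic functions of s. Either all vanish near 0, or some one has no zero in a punctured disc;
  so each of two germs covering the branch contains all of it or meets it at most at the
  centre.\<close>

lemma branch_irreducible:
  assumes k: "k \<in> boundary_indices n"
  shows "irreducible_germ (qpt k) Vbar"
proof -
  let ?\<alpha> = "direction k"
  obtain lab :: "nat \<Rightarrow> 'r" and \<epsilon> \<rho> :: real and \<beta> :: "complex \<Rightarrow> complex ^ 'r" where \<epsilon>: "\<epsilon> > 0" and \<rho>: "\<rho> > 0" and \<beta>0: "\<beta> 0 = ?\<alpha>"
    and hol: "\<And>i. (\<lambda>s. \<beta> s $ i) holomorphic_on ball 0 \<epsilon>" and \<beta>b: "\<And>s. norm s < \<epsilon> \<Longrightarrow> \<beta> s \<in> ball ?\<alpha> \<rho>"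
    and graph: "\<And>s A. norm s < \<epsilon> \<Longrightarrow> A \<in> ball ?\<alpha> \<rho> \<Longrightarrow> wproj (s, A, 1) \<in> Vbar \<longleftrightarrow> A = \<beta> s"
    by (rule branch_parametrization[OF k]) (assumption | rule that)+
  have fd: "(\<lambda>s. \<beta> s $ i) field_differentiable (at s)" if "norm s < \<epsilon>" for s i
    using holomorphic_on_imp_differentiable_at[OF hol open_ball] that by simp
  have qW: "qpt k \<in> wproj ` wbox r ?\<alpha> \<rho>" if "r > 0" for r
    unfolding mem_wproj_wbox qpt_def using that \<rho> by (intro exI[of _ 0] exI[of _ ?\<alpha>]) simp
  have qV: "qpt k \<in> Vbar" unfolding qpt_def using graph[of 0 ?\<alpha>] \<epsilon> \<rho> \<beta>0 by simp
  have curve: "\<exists>r>0. r \<le> \<epsilon> \<and> (\<forall>s. norm s < r \<longrightarrow> (s, \<beta> s, 1) \<in> S)" if S: "open S" "(0, ?\<alpha>, 1) \<in> S" for S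
  proof -
    have "((\<lambda>s. \<beta> s $ i) \<longlongrightarrow> \<beta> 0 $ i) (at 0)" for i
      using field_differentiable_imp_continuous_at[OF fd[of 0 i]] \<epsilon> by (simp add: isCont_def)
    then have "((\<lambda>s. \<chi> i. \<beta> s $ i) \<longlongrightarrow> (\<chi> i. \<beta> 0 $ i)) (at 0)" by (intro tendsto_vec_lambda)
    then have "(\<beta> \<longlongrightarrow> ?\<alpha>) (at 0)" by (simp add: \<beta>0)
    then have "((\<lambda>s. (s, \<beta> s, 1)) \<longlongrightarrow> (0, ?\<alpha>, 1)) (at 0)" by (intro tendsto_Pair tendsto_ident_at tendsto_const)
    from topological_tendstoD[OF this S] obtain r where r: "r > 0" "\<And>s. s \<noteq> 0 \<Longrightarrow> dist s 0 < r \<Longrightarrow> (s, \<beta> s, 1) \<in> S"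
      unfolding eventually_at by auto
    have "(s, \<beta> s, 1) \<in> S" if "norm s < min r \<epsilon>" for s
      using r(2)[of s] that S(2) \<beta>0 by (cases "s = 0") simp_all
    then show ?thesis using r(1) \<epsilon> by (intro exI[of _ "min r \<epsilon>"]) simp
  qed
  have analytic: "analytic_germ (qpt k) Vbar"
    unfolding analytic_germ_def
  proof (intro exI[of _ "wproj ` wbox \<epsilon> ?\<alpha> \<rho>"] conjI allI impI)
    show "openin wproj_topology (wproj ` wbox \<epsilon> ?\<alpha> \<rho>)" by (rule openin_wbox)
    show "qpt k \<in> wproj ` wbox \<epsilon> ?\<alpha> \<rho>" by (rule qW[OF \<epsilon>])
    fix x :: "'r hcoords" assume "wproj x \<in> wproj ` wbox \<epsilon> ?\<alpha> \<rho>"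
    then obtain z where z: "z \<in> wbox \<epsilon> ?\<alpha> \<rho>" "wproj x = wproj z" by (elim imageE)
    then obtain d where d: "d \<noteq> 0" "z = wscale d x" using wproj_eq_iff by metis
    \<comment> \<open>Analyticity is tested at every point of the cone, whereas the graph equation
      is holomorphic only for Re B > 0; the fixed scalar d transports a neighbourhood of x into that
      region.\<close>
    define U where "U = wscale d -` wbox \<epsilon> ?\<alpha> \<rho>"
    define f where "f i y = wsc (wscale d y) * fst (snd (wscale d y)) $ i - \<beta> (wsc (wscale d y) * fst (wscale d y)) $ i" for i and y :: "'r hcoords"
    have "open U" unfolding U_def by (rule open_vimage[OF open_wbox continuous_wscale])
    moreover have "x \<in> U" using z(1) d(2) by (simp add: U_def)
    moreover have "holomorphic_several (f i) U" for i
      unfolding holomorphic_several_iff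
    proof
      fix y :: "'r hcoords" assume "y \<in> U"
      then have yU: "Re (snd (snd (wscale d y))) > 0" "norm (wsc (wscale d y) * fst (wscale d y)) < \<epsilon>" by (simp_all add: U_def wbox_def)
      have e1: "fst (wscale d y) = d * fst y" and e2: "fst (snd (wscale d y)) $ i = d * fst (snd y) $ i" and e3: "snd (snd (wscale d y)) = d\<^sup>2 * snd (snd y)"
        for i and y :: "'r hcoords" by (simp_all add: wscale_def case_prod_unfold)
      have R: "d\<^sup>2 * snd (snd y) \<notin> \<real>\<^sub>\<le>\<^sub>0" using yU(1) by (auto simp: e3 complex_nonpos_Reals_iff)
      have c1: "cdifferentiable (\<lambda>y. wsc (wscale d y)) y"
        unfolding wsc_def e3
      proof (rule cdifferentiable_compose[where g = "\<lambda>w. 1 / csqrt w" and f = "\<lambda>y. d\<^sup>2 * snd (snd y)"])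
        show "(\<lambda>w. 1 / csqrt w) field_differentiable at (d\<^sup>2 * snd (snd y))"
          using R field_differentiable_at_csqrt[OF R] by (intro field_differentiable_divide field_differentiable_const) auto
        show "cdifferentiable (\<lambda>y. d\<^sup>2 * snd (snd y)) y" by (intro cdifferentiable_mult cdifferentiable_const cdifferentiable_snd)
      qed
      have c2: "cdifferentiable (\<lambda>y. wsc (wscale d y) * fst (snd (wscale d y)) $ i) y"
        unfolding e2 by (intro cdifferentiable_mult[OF c1] cdifferentiable_mult cdifferentiable_const cdifferentiable_nth)
      have c3: "cdifferentiable (\<lambda>y. wsc (wscale d y) * fst (wscale d y)) y"
        unfolding e1 by (intro cdifferentiable_mult[OF c1] cdifferentiable_mult cdifferentiable_const cdifferentiable_fst)
      show "cdifferentiable (f i) y"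
        unfolding f_def[abs_def]
        by (rule cdifferentiable_diff[OF c2])
           (rule cdifferentiable_compose[where g = "\<lambda>s. \<beta> s $ i" and f = "\<lambda>y. wsc (wscale d y) * fst (wscale d y)", OF fd[OF yU(2)] c3])
    qed
    moreover have "wproj y \<in> Vbar \<longleftrightarrow> (\<forall>i. f i y = 0)" if "y \<in> U" for y
    proof -
      let ?z = "wscale d y"
      have r: "Re (snd (snd ?z)) > 0" "norm (wsc ?z * fst ?z) < \<epsilon>" "wsc ?z *s fst (snd ?z) \<in> ball ?\<alpha> \<rho>"
        using that by (simp_all add: U_def wbox_def)
      have "wproj y = wproj (wsc ?z * fst ?z, wsc ?z *s fst (snd ?z), 1)"
        using wproj_wscale[OF d(1), of y] wproj_wscale[OF wsc_nonzero[OF r(1)], of ?z] by (simp only: wscale_wsc[OF r(1)])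
      then have "wproj y \<in> Vbar \<longleftrightarrow> wsc ?z *s fst (snd ?z) = \<beta> (wsc ?z * fst ?z)" using graph[OF r(2,3)] by simp
      then show ?thesis by (simp add: f_def vec_eq_iff)
    qed
    then have "{y \<in> U. wproj y \<in> Vbar} = {y \<in> U. \<forall>g\<in>range f. g y = 0}" by auto
    ultimately show "\<exists>U F. open U \<and> x \<in> U \<and> finite F \<and> (\<forall>f\<in>F. holomorphic_several f U) \<and> {y \<in> U. wproj y \<in> Vbar} = {y \<in> U. \<forall>f\<in>F. f y = 0}"
      by (intro exI[of _ U] exI[of _ "range f"] conjI) auto
  qed
  have dichotomy: "\<exists>r>0. r \<le> \<epsilon> \<and> ((\<forall>s. norm s < r \<longrightarrow> wproj (s, \<beta> s, 1) \<in> S) \<or> (\<forall>s. s \<noteq> 0 \<longrightarrow> norm s < r \<longrightarrow> wproj (s, \<beta> s, 1) \<notin> S))"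
    if S: "analytic_germ (qpt k) S" for S
  proof -
    obtain W where W: "qpt k \<in> W" "\<forall>x. wproj x \<in> W \<longrightarrow> (\<exists>U F. open U \<and> x \<in> U \<and> finite F \<and> (\<forall>f\<in>F. holomorphic_several f U) \<and>
              {y \<in> U. wproj y \<in> S} = {y \<in> U. \<forall>f\<in>F. f y = 0})" using S unfolding analytic_germ_def by blast
    obtain U F where U: "open U" "(0, ?\<alpha>, 1) \<in> U" "\<forall>f\<in>F. holomorphic_several f U" and US: "{y \<in> U. wproj y \<in> S} = {y \<in> U. \<forall>f\<in>F. f y = 0}"
      using W(2)[rule_format, OF W(1)[unfolded qpt_def]] by (elim exE conjE)
    obtain r1 where r1: "r1 > 0" "r1 \<le> \<epsilon>" "\<And>s. norm s < r1 \<Longrightarrow> (s, \<beta> s, 1) \<in> U" using curve[OF U(1,2)] by blast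
    have iff: "wproj (s, \<beta> s, 1) \<in> S \<longleftrightarrow> (\<forall>f\<in>F. f (s, \<beta> s, 1) = 0)" if "norm s < r1" for s
      using US r1(3)[OF that] by blast
    show ?thesis
    proof (cases "\<forall>f\<in>F. \<forall>s. norm s < r1 \<longrightarrow> f (s, \<beta> s, 1) = 0")
      case True
      then show ?thesis using r1 iff by (intro exI[of _ r1]) blast
    next
      case False
      then obtain f s1 where f: "f \<in> F" "norm s1 < r1" "f (s1, \<beta> s1, 1) \<noteq> 0" by blast
      define g where "g s = f (s, \<beta> s, 1)" for s
      have gd: "g field_differentiable (at s)" if "norm s < r1" for s
        unfolding g_def
      proof (rule cdifferentiable_along_curve)
        show "cdifferentiable f (s, \<beta> s, 1)" using U(3) f(1) r1(3)[OF that] unfolding holomorphic_several_iff by blast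
        show "(\<lambda>s. \<beta> s $ i) field_differentiable (at s)" for i using fd that r1(2) by simp
      qed
      then have gh: "g holomorphic_on ball 0 r1" unfolding holomorphic_on_def by (simp add: field_differentiable_at_within)
      have "\<exists>r>0. \<forall>s. s \<noteq> 0 \<longrightarrow> norm s < r \<longrightarrow> g s \<noteq> 0"
      proof (cases "g 0 = 0")
        case True
        obtain r where "r > 0" "\<And>z. z \<in> ball 0 r - {0} \<Longrightarrow> g z \<noteq> 0"
          by (rule isolated_zeros[OF gh open_ball connected_ball, of 0 s1]) (use True r1(1) f in \<open>auto simp: g_def\<close>)
        then show ?thesis by (intro exI[of _ r]) simp
      next
        case False
        have "(g \<longlongrightarrow> g 0) (at 0)" using field_differentiable_imp_continuous_at[OF gd[of 0]] r1(1) by (simp add: isCont_def)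
        then have "\<forall>\<^sub>F s in at 0. g s \<noteq> 0" using False by (rule tendsto_imp_eventually_ne)
        then show ?thesis unfolding eventually_at by (simp add: imp_conjL)
      qed
      then obtain r where r: "r > 0" "\<And>s. s \<noteq> 0 \<Longrightarrow> norm s < r \<Longrightarrow> g s \<noteq> 0" by blast
      have "wproj (s, \<beta> s, 1) \<notin> S" if "s \<noteq> 0" "norm s < min r r1" for s
        using r(2)[OF that(1)] that(2) iff[of s] f(1) by (auto simp: g_def)
      then show ?thesis using r(1) r1(1,2) by (intro exI[of _ "min r r1"]) auto
    qed
  qed
  \<comment> \<open>In a small chart box the closure of the variety is just the arc with norm s < r,
    so a set that contains the arc and locally lies in the closure has the same germ.\<close>
  have whole: "germ (qpt k) Vbar = germ (qpt k) S"
    if r: "r > 0" "r \<le> \<epsilon>" "\<And>s. norm s < r \<Longrightarrow> wproj (s, \<beta> s, 1) \<in> S" and W: "openin wproj_topology W" "qpt k \<in> W" "S \<inter> W \<subseteq> Vbar" for r S W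
  proof (rule germ_eqI[of "wproj ` wbox r ?\<alpha> \<rho> \<inter> W"])
    show "openin wproj_topology (wproj ` wbox r ?\<alpha> \<rho> \<inter> W)" by (intro openin_Int openin_wbox W)
    show "qpt k \<in> wproj ` wbox r ?\<alpha> \<rho> \<inter> W" using qW[OF r(1)] W(2) by simp
    have "v \<in> S" if vv: "v \<in> Vbar" "v \<in> wproj ` wbox r ?\<alpha> \<rho>" for v
    proof -
      obtain s A where s: "norm s < r" "A \<in> ball ?\<alpha> \<rho>" "v = wproj (s, A, 1)" using vv(2) unfolding mem_wproj_wbox by blast
      then have "A = \<beta> s" using graph[of s A] vv(1) r(2) by simp
      then show ?thesis using r(3)[OF s(1)] s(3) by simp
    qed
    then show "Vbar \<inter> (wproj ` wbox r ?\<alpha> \<rho> \<inter> W) = S \<inter> (wproj ` wbox r ?\<alpha> \<rho> \<inter> W)" using W(3) by blast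
  qed
  show ?thesis
    unfolding irreducible_germ_def
  proof (intro conjI allI impI analytic qV)
    fix S1 S2 assume h: "analytic_germ (qpt k) S1 \<and> analytic_germ (qpt k) S2 \<and> germ (qpt k) Vbar = germ (qpt k) (S1 \<union> S2)"
    then have g: "germ (qpt k) Vbar = germ (qpt k) (S1 \<union> S2)" by blast
    obtain W where W: "openin wproj_topology W" "qpt k \<in> W" "Vbar \<inter> W = (S1 \<union> S2) \<inter> W"
      by (rule germ_eqD[OF g qpt_topspace]) (assumption | rule that)+
    obtain r1 where r1: "r1 > 0" "r1 \<le> \<epsilon>" and d1: "(\<forall>s. norm s < r1 \<longrightarrow> wproj (s, \<beta> s, 1) \<in> S1) \<or> (\<forall>s. s \<noteq> 0 \<longrightarrow> norm s < r1 \<longrightarrow> wproj (s, \<beta> s, 1) \<notin> S1)"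
      using dichotomy h by blast
    obtain r2 where r2: "r2 > 0" "r2 \<le> \<epsilon>" and d2: "(\<forall>s. norm s < r2 \<longrightarrow> wproj (s, \<beta> s, 1) \<in> S2) \<or> (\<forall>s. s \<noteq> 0 \<longrightarrow> norm s < r2 \<longrightarrow> wproj (s, \<beta> s, 1) \<notin> S2)"
      using dichotomy h by blast
    have S1W: "S1 \<inter> W \<subseteq> Vbar" and S2W: "S2 \<inter> W \<subseteq> Vbar" using W(3) by blast+
    show "germ (qpt k) Vbar = germ (qpt k) S1 \<or> germ (qpt k) Vbar = germ (qpt k) S2"
    proof (rule ccontr)
      assume no: "\<not> ?thesis"
      have n1: "wproj (s, \<beta> s, 1) \<notin> S1" if "s \<noteq> 0" "norm s < r1" for s
        using d1 no whole[OF r1 _ W(1,2) S1W] that by blast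
      have n2: "wproj (s, \<beta> s, 1) \<notin> S2" if "s \<noteq> 0" "norm s < r2" for s
        using d2 no whole[OF r2 _ W(1,2) S2W] that by blast
      have oW: "open {x. x \<noteq> 0 \<and> wproj x \<in> W}" using W(1) unfolding openin_wproj_iff by simp
      have "(0, ?\<alpha>, 1) \<in> {x. x \<noteq> 0 \<and> wproj x \<in> W}" using W(2) unfolding qpt_def by (simp add: zero_prod_def)
      from curve[OF oW this] obtain r3 where r3: "r3 > 0" "r3 \<le> \<epsilon>" "\<And>s. norm s < r3 \<Longrightarrow> wproj (s, \<beta> s, 1) \<in> W" by blast
      \<comment> \<open>A nonzero parameter inside all three discs: its point is on the branch,
        hence in one of the two sets, contrary to both avoiding the punctured arc.\<close>
      define s where "s = complex_of_real (min r1 (min r2 r3) / 2)"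
      have ns: "norm s = min r1 (min r2 r3) / 2" unfolding s_def norm_of_real using r1 r2 r3 by simp
      have s: "s \<noteq> 0" "norm s < r1" "norm s < r2" "norm s < r3" using ns r1(1) r2(1) r3(1) by (auto simp: min_def split: if_splits)
      have "wproj (s, \<beta> s, 1) \<in> Vbar" using graph[of s "\<beta> s"] \<beta>b[of s] s r1(2) by simp
      then have "wproj (s, \<beta> s, 1) \<in> S1 \<union> S2" using W(3) r3(3)[OF s(4)] by blast
      then show False using n1[OF s(1,2)] n2[OF s(1,3)] by blast
    qed
  qed
qed

text \<open>The neighbourhood \<open>U0\<close> contains only curve points and the boundary point,
  so its image stays in the closure of the variety. Conversely, every neighbourhood contains a box,
  and the lifts of all small s into that box fill the branch.\<close>

lemma boundary_maps_onto_branch: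
  assumes k: "k \<in> boundary_indices n"
  shows "maps_nbhds_onto \<tau> n p (boundary_pt \<tau> p k) (qpt k, germ (qpt k) Vbar)"
proof -
  let ?\<alpha> = "direction k" and ?I = "{..<N}" and ?x = "boundary_pt \<tau> p k"
  let ?P = "P_topology \<tau> N" and ?C = "GLC_closure \<tau> n p"
  obtain lab :: "nat \<Rightarrow> 'r" and \<epsilon> \<rho> :: real and \<beta> :: "complex \<Rightarrow> complex ^ 'r" where lab: "\<And>i. card {\<mu>\<in>?I. lab \<mu> = i} = k i" and \<epsilon>: "\<epsilon> > 0" and \<rho>: "\<rho> > 0" and \<beta>0: "\<beta> 0 = ?\<alpha>"
    and hol: "\<And>i. (\<lambda>s. \<beta> s $ i) holomorphic_on ball 0 \<epsilon>" and \<beta>b: "\<And>s. norm s < \<epsilon> \<Longrightarrow> \<beta> s \<in> ball ?\<alpha> \<rho>"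
    and graph: "\<And>s A. norm s < \<epsilon> \<Longrightarrow> A \<in> ball ?\<alpha> \<rho> \<Longrightarrow> wproj (s, A, 1) \<in> Vbar \<longleftrightarrow> A = \<beta> s"
    and lift: "\<And>\<delta>. \<delta> > 0 \<Longrightarrow> \<exists>s0>0. \<forall>s. s \<noteq> 0 \<longrightarrow> norm s < s0 \<longrightarrow> (\<exists>b h. glc_eqs ?I b h \<and> (\<forall>\<mu><N. dist (b \<mu>) (p (lab \<mu>)) < \<delta>) \<and>
       norm h > 1 / \<delta> \<and> glc_map_proj \<tau> n p (pt b (Some h)) = wproj (s, \<beta> s, 1))"
    by (rule branch_parametrization[OF k]) (assumption | rule that)+
  have qV: "qpt k \<in> Vbar" unfolding qpt_def using graph[of 0 ?\<alpha>] \<epsilon> \<rho> \<beta>0 by simp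
  have sub: "GLC \<tau> n p \<subseteq> ?C"
  proof -
    have "GLC \<tau> n p \<subseteq> topspace ?P" unfolding GLC_eq topspace_P by blast
    then show ?thesis unfolding GLC_closure_def by (rule closure_of_subset)
  qed
  obtain d where d: "d > 0" and nb: "\<And>b H. \<forall>\<mu><N. dist (b \<mu>) (p (lab \<mu>)) < d \<Longrightarrow> pt b H \<in> ?C \<Longrightarrow> pt b H \<in> GLC \<tau> n p \<or> pt b H = ?x"
    by (rule boundary_neighbourhood[OF lab k]) (assumption | rule that)+
  define U0 where "U0 = {pt b H |b H. (\<forall>\<mu><N. dist (b \<mu>) (p (lab \<mu>)) < d) \<and> near_infinity d H} \<inter> ?C"
  have xeq: "?x = pt (\<lambda>\<mu>. p (lab \<mu>)) None" by (rule boundary_pt_eq[OF lab])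
  have oU0: "openin (subtopology ?P ?C) U0" unfolding U0_def openin_subtopology
    by (rule exI, rule conjI, rule openin_P_near_infinity[of "\<lambda>\<mu>. p (lab \<mu>)" d], rule refl)
  have xU0: "?x \<in> U0"
  proof -
    have "?x \<in> {pt b H |b H. (\<forall>\<mu><N. dist (b \<mu>) (p (lab \<mu>)) < d) \<and> near_infinity d H}"
      unfolding xeq by (intro CollectI exI[of _ "\<lambda>\<mu>. p (lab \<mu>)"] exI[of _ None]) (simp add: d)
    then show ?thesis unfolding U0_def by (rule IntI[OF _ boundary_in_closure[OF k]])
  qed
  have gU: "germ (qpt k) (glc_map_ext \<tau> n p ` U) = germ (qpt k) Vbar"
    if U: "openin (subtopology ?P ?C) U" "?x \<in> U" "U \<subseteq> U0" for U
  proof -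
    obtain V where V: "openin ?P V" "U = V \<inter> ?C" using U(1) unfolding openin_subtopology by blast
    have "pt (\<lambda>\<mu>. p (lab \<mu>)) None \<in> V" using U(2) V(2) xeq by simp
    then obtain \<delta> where \<delta>: "\<delta> > 0" "\<And>b H. \<forall>\<mu><N. dist (b \<mu>) (p (lab \<mu>)) < \<delta> \<Longrightarrow> near_infinity \<delta> H \<Longrightarrow> pt b H \<in> V"
      by (rule P_neighbourhood_infinity[OF V(1)]) (assumption | rule that)+
    obtain s0 where s0: "s0 > 0" "\<forall>s. s \<noteq> 0 \<longrightarrow> norm s < s0 \<longrightarrow> (\<exists>b h. glc_eqs ?I b h \<and> (\<forall>\<mu><N. dist (b \<mu>) (p (lab \<mu>)) < \<delta>) \<and>
       norm h > 1 / \<delta> \<and> glc_map_proj \<tau> n p (pt b (Some h)) = wproj (s, \<beta> s, 1))" using lift[OF \<delta>(1)] by (elim exE conjE)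
    define r where "r = min s0 \<epsilon>"
    have r: "r > 0" "r \<le> \<epsilon>" "r \<le> s0" using s0(1) \<epsilon> by (simp_all add: r_def)
    have img: "glc_map_ext \<tau> n p ` U \<subseteq> Vbar"
    proof
      fix v assume "v \<in> glc_map_ext \<tau> n p ` U"
      then obtain y where y: "y \<in> U" "v = glc_map_ext \<tau> n p y" by blast
      have "y \<in> {pt b H |b H. (\<forall>\<mu><N. dist (b \<mu>) (p (lab \<mu>)) < d) \<and> near_infinity d H}"
        using subsetD[OF U(3) y(1)] unfolding U0_def by (rule IntD1)
      then obtain b H where b: "y = pt b H" "\<forall>\<mu><N. dist (b \<mu>) (p (lab \<mu>)) < d" by (elim CollectE exE conjE)
      have "pt b H \<in> ?C" using y(1) unfolding V(2) b(1) by (rule IntD2)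
      from nb[OF b(2) this] have "y \<in> GLC \<tau> n p \<or> y = ?x" unfolding b(1) .
      then show "v \<in> Vbar"
      proof
        assume yG: "y \<in> GLC \<tau> n p"
        then obtain a h where "y = pt a (Some h)" "glc_eqs ?I a h" unfolding GLC_eq by (elim CollectE exE conjE)
        then show ?thesis using yG glc_map_proj_in_Vbar by (simp add: y(2) glc_map_ext_def)
      next
        assume "y = ?x"
        then show ?thesis using qV by (simp add: y(2) glc_map_ext_boundary[OF k])
      qed
    qed
    \<comment> \<open>The point with s = 0 is the image of the boundary point itself, every other
      one of a lifted curve point.\<close>
    have surj: "v \<in> glc_map_ext \<tau> n p ` U" if vv: "v \<in> Vbar" "v \<in> wproj ` wbox r ?\<alpha> \<rho>" for v
    proof -
      obtain s A where s: "norm s < r" "A \<in> ball ?\<alpha> \<rho>" "v = wproj (s, A, 1)" using vv(2) unfolding mem_wproj_wbox by blast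
      then have v: "v = wproj (s, \<beta> s, 1)" using graph[of s A] vv(1) r(2) by simp
      show ?thesis
      proof (cases "s = 0")
        case True
        then have "v = glc_map_ext \<tau> n p ?x" by (simp add: v \<beta>0 glc_map_ext_boundary[OF k] qpt_def)
        then show ?thesis using U(2) by (rule image_eqI)
      next
        case False
        have "norm s < s0" using s(1) r(3) by simp
        from s0(2)[rule_format, OF False this] obtain b h where bh: "glc_eqs ?I b h" "\<forall>\<mu><N. dist (b \<mu>) (p (lab \<mu>)) < \<delta>" "norm h > 1 / \<delta>"
          "glc_map_proj \<tau> n p (pt b (Some h)) = wproj (s, \<beta> s, 1)" by (elim exE conjE)
        have G: "pt b (Some h) \<in> GLC \<tau> n p" using bh(1) by (simp add: pt_in_GLC)
        have "pt b (Some h) \<in> V" by (rule \<delta>(2)[OF bh(2)]) (simp add: bh(3))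
        then have "pt b (Some h) \<in> U" unfolding V(2) by (rule IntI[OF _ subsetD[OF sub G]])
        moreover have "v = glc_map_ext \<tau> n p (pt b (Some h))" using G by (simp add: v glc_map_ext_def bh(4))
        ultimately show ?thesis by (rule rev_image_eqI)
      qed
    qed
    show ?thesis
    proof (rule germ_eqI[of "wproj ` wbox r ?\<alpha> \<rho>"])
      show "openin wproj_topology (wproj ` wbox r ?\<alpha> \<rho>)" by (rule openin_wbox)
      show "qpt k \<in> wproj ` wbox r ?\<alpha> \<rho>"
        unfolding mem_wproj_wbox qpt_def using r(1) \<rho> by (intro exI[of _ 0] exI[of _ ?\<alpha>]) simp
      show "glc_map_ext \<tau> n p ` U \<inter> wproj ` wbox r ?\<alpha> \<rho> = Vbar \<inter> wproj ` wbox r ?\<alpha> \<rho>" using img surj by blast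
    qed
  qed
  show ?thesis
    unfolding maps_nbhds_onto_def Let_def fst_conv snd_conv
    by (intro conjI glc_limit_boundary[OF k] exI[of _ U0] oU0 xU0 allI impI) (rule gU; elim conjE; assumption)
qed

section \<open>Divisors and the equivalence of boundary points\<close>

lemma torus_class_eq_iff: "torus_class \<tau> z = torus_class \<tau> w \<longleftrightarrow> z - w \<in> \<Lambda>"
proof
  assume "torus_class \<tau> z = torus_class \<tau> w"
  moreover have "z \<in> torus_class \<tau> z" by (simp add: torus_class_def)
  ultimately show "z - w \<in> \<Lambda>" by (simp add: torus_class_def)
next
  assume zw: "z - w \<in> \<Lambda>"
  have "u - z \<in> \<Lambda> \<longleftrightarrow> u - w \<in> \<Lambda>" for u
    using lattice_add[OF _ zw, of "u - z"] lattice_diff[OF _ zw, of "u - w"] by auto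
  then show "torus_class \<tau> z = torus_class \<tau> w" by (simp add: torus_class_def)
qed

text \<open>Lattice shifts leave torus classes unchanged. The divisor is thus an invariant of the
  class, and its multiplicities recover k.\<close>

lemma torus_divisor_glc_class:
  assumes "glc_class \<tau> (a, H) = glc_class \<tau> (b, H')"
  shows "image_mset (torus_class \<tau>) a = image_mset (torus_class \<tau>) b"
proof -
  obtain x where b: "b = image_mset x (mset_set {..<size b})" using ex_index_mset by blast
  have "(a, H) \<in> glc_class \<tau> (image_mset x (mset_set {..<size b}), H')" using assms glc_class_self[of "(a, H)"] b by simp
  then obtain m where m: "a = image_mset (\<lambda>\<mu>. x \<mu> + lat (m \<mu>)) (mset_set {..<size b})" unfolding glc_class_mem_iff[OF finite_lessThan] by blast
  have "torus_class \<tau> (x \<mu> + lat (m \<mu>)) = torus_class \<tau> (x \<mu>)" for \<mu> by (simp add: torus_class_eq_iff)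
  then have "image_mset (torus_class \<tau>) a = image_mset (\<lambda>\<mu>. torus_class \<tau> (x \<mu>)) (mset_set {..<size b})"
    unfolding m by (simp add: multiset.map_comp comp_def)
  also have "\<dots> = image_mset (torus_class \<tau>) (image_mset x (mset_set {..<size b}))" by (simp add: multiset.map_comp comp_def)
  finally show ?thesis using b by simp
qed

abbreviation pdiv :: "('r \<Rightarrow> nat) \<Rightarrow> complex set multiset" where
  "pdiv k \<equiv> \<Sum>i\<in>UNIV. replicate_mset (k i) (torus_class \<tau> (p i))"

lemma pdiv_inject: "pdiv k = pdiv k' \<Longrightarrow> k = k'"
proof
  fix j assume e: "pdiv k = pdiv k'"
  have "torus_class \<tau> (p i) = torus_class \<tau> (p j) \<Longrightarrow> i = j" for i j using p_distinct torus_class_eq_iff by blast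
  from count_sum_replicate[where c = "\<lambda>i. torus_class \<tau> (p i)", OF this]
  show "k j = k' j" using arg_cong[OF e, of "\<lambda>M. count M (torus_class \<tau> (p j))"] by simp
qed

lemma pdiv_add: "pdiv k + pdiv k' = pdiv (\<lambda>i. k i + k' i)"
proof -
  have "replicate_mset (a + b) x = replicate_mset a x + replicate_mset b x" for a b and x :: "complex set"
    by (induction a) simp_all
  then show ?thesis by (simp add: sum.distrib)
qed

lemma torus_divisor_boundary: "image_mset (torus_class \<tau>) (\<Sum>i\<in>UNIV. replicate_mset (k i) (p i)) = pdiv k"
  by (simp add: image_mset_sum_set)

lemma boundary_pt_inject: "boundary_pt \<tau> p k = boundary_pt \<tau> p k' \<Longrightarrow> k = k'"
  unfolding boundary_pt_def by (drule torus_divisor_glc_class) (simp add: torus_divisor_boundary pdiv_inject)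

text \<open>Replacing k by 2n - k changes the sign of \<open>direction\<close>, the only ambiguity
  of a point with B = 1 at infinity.\<close>

lemma qpt_eq_iff:
  assumes "k \<in> boundary_indices n" "k' \<in> boundary_indices n"
  shows "qpt k = qpt k' \<longleftrightarrow> k' = k \<or> (\<forall>i. k i + k' i = ell n i)"
proof -
  have "direction k' = direction k \<longleftrightarrow> k' = k" by (auto simp: direction_def vec_eq_iff)
  moreover have "direction k' = - direction k \<longleftrightarrow> (\<forall>i. k i + k' i = ell n i)"
  proof -
    have "direction k' $ i = - direction k $ i \<longleftrightarrow> k i + k' i = ell n i" for i
    proof -
      have "direction k' $ i = - direction k $ i \<longleftrightarrow> 2 * (of_nat (k i + k' i) :: complex) = 2 * of_nat (ell n i)"
        by (simp add: direction_def algebra_simps)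
      then show ?thesis by (simp del: of_nat_add)
    qed
    then show ?thesis by (simp add: vec_eq_iff)
  qed
  ultimately show ?thesis unfolding qpt_def wproj_infinity_eq_iff by simp
qed

text \<open>Both relations amount to k = k' or k + k' = 2n: on the curve through multiplicities of
  the divisors, at infinity through the sign.\<close>

lemma type_I_equiv_iff:
  assumes k: "k \<in> boundary_indices n" and k': "k' \<in> boundary_indices n"
  shows "(boundary_pt \<tau> p k, boundary_pt \<tau> p k') \<in> type_I_equiv \<tau> n p \<longleftrightarrow> qpt k = qpt k'"
proof -
  let ?M = "\<lambda>k. \<Sum>i\<in>UNIV. replicate_mset (k i) (p i)"
  have T: "boundary_pt \<tau> p k \<in> type_I \<tau> n p" "boundary_pt \<tau> p k' \<in> type_I \<tau> n p" using k k' by (simp_all add: type_I_eq)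
  have "(\<exists>a b. boundary_pt \<tau> p k = glc_class \<tau> (a, None) \<and> boundary_pt \<tau> p k' = glc_class \<tau> (b, None) \<and>
      image_mset (torus_class \<tau>) (a + b) = pdiv (ell n)) \<longleftrightarrow> (\<forall>i. k i + k' i = ell n i)" (is "?L \<longleftrightarrow> ?R")
  proof
    assume ?L
    then obtain a b where ab: "boundary_pt \<tau> p k = glc_class \<tau> (a, None)" "boundary_pt \<tau> p k' = glc_class \<tau> (b, None)"
      "image_mset (torus_class \<tau>) (a + b) = pdiv (ell n)" by (elim exE conjE)
    have "image_mset (torus_class \<tau>) a = pdiv k"
      using torus_divisor_glc_class[OF ab(1)[unfolded boundary_pt_def]] by (simp add: torus_divisor_boundary)
    moreover have "image_mset (torus_class \<tau>) b = pdiv k'"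
      using torus_divisor_glc_class[OF ab(2)[unfolded boundary_pt_def]] by (simp add: torus_divisor_boundary)
    ultimately have "pdiv (\<lambda>i. k i + k' i) = pdiv (ell n)" using ab(3) by (simp add: pdiv_add)
    from pdiv_inject[OF this] show ?R by (simp add: fun_eq_iff)
  next
    assume ?R
    then have "pdiv k + pdiv k' = pdiv (ell n)" by (simp add: pdiv_add)
    then show ?L by (intro exI[of _ "?M k"] exI[of _ "?M k'"]) (simp add: boundary_pt_def torus_divisor_boundary)
  qed
  then have "(boundary_pt \<tau> p k, boundary_pt \<tau> p k') \<in> type_I_equiv \<tau> n p \<longleftrightarrow> boundary_pt \<tau> p k = boundary_pt \<tau> p k' \<or> (\<forall>i. k i + k' i = ell n i)"
    unfolding type_I_equiv_def using T by simp
  also have "\<dots> \<longleftrightarrow> qpt k = qpt k'" unfolding qpt_eq_iff[OF k k'] using boundary_pt_inject by blast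
  finally show ?thesis .
qed

lemma branches_at_qpt: "k \<in> boundary_indices n \<Longrightarrow> branches_at Vbar (qpt k) = {germ (qpt k) Vbar}"
  by (rule branches_at_irreducible[OF branch_irreducible qpt_topspace])

text \<open>At each point at infinity the germ of the whole closure is irreducible, so it is the
  only branch there and points and branches correspond.\<close>

lemma branches_at_infinity_eq: "branches_at_infinity \<tau> n p = (\<lambda>k. (qpt k, germ (qpt k) Vbar)) ` boundary_indices n"
proof (intro equalityI subsetI)
  fix b assume "b \<in> branches_at_infinity \<tau> n p"
  then obtain q B where b: "b = (q, B)" "q \<in> Vbar" "q \<in> infinity_divisor" "B \<in> branches_at Vbar q" unfolding branches_at_infinity_def by blast
  obtain k where "k \<in> boundary_indices n" "q = qpt k" by (rule infinity_point[OF b(2,3)]) (assumption | rule that)+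
  then show "b \<in> (\<lambda>k. (qpt k, germ (qpt k) Vbar)) ` boundary_indices n" using b(1,4) branches_at_qpt by auto
next
  fix b assume "b \<in> (\<lambda>k. (qpt k, germ (qpt k) Vbar)) ` boundary_indices n"
  then obtain k where k: "k \<in> boundary_indices n" and b: "b = (qpt k, germ (qpt k) Vbar)" by blast
  have "qpt k \<in> Vbar" using branch_irreducible[OF k] unfolding irreducible_germ_def by blast
  moreover have "qpt k \<in> infinity_divisor" unfolding infinity_divisor_def qpt_def
    by (intro CollectI exI[of _ "direction k"] exI[of _ 1]) (simp add: zero_prod_def)
  ultimately show "b \<in> branches_at_infinity \<tau> n p" unfolding branches_at_infinity_def b using branches_at_qpt[OF k] by simp
qed

lemma branch_over_qpt:
  assumes k: "k \<in> boundary_indices n"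
  shows "{b \<in> branches_at_infinity \<tau> n p. fst b = qpt k} = {(qpt k, germ (qpt k) Vbar)}"
  unfolding branches_at_infinity_eq using k by auto

text \<open>The bijection is induced by sending x to its extended image together with the germ
  there. Its fibres are the equivalence classes, because this value depends only on
  \<open>qpt\<close>.\<close>

lemma type_I_branch_correspondence:
  "\<exists>\<Phi>. bij_betw \<Phi> (type_I \<tau> n p // type_I_equiv \<tau> n p) (branches_at_infinity \<tau> n p) \<and>
     (\<forall>x\<in>type_I \<tau> n p. maps_nbhds_onto \<tau> n p x (\<Phi> (type_I_equiv \<tau> n p `` {x})))"
proof -
  let ?T = "type_I \<tau> n p" and ?E = "type_I_equiv \<tau> n p"
  define g where "g x = (glc_map_ext \<tau> n p x, germ (glc_map_ext \<tau> n p x) Vbar)" for x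
  have g: "g (boundary_pt \<tau> p k) = (qpt k, germ (qpt k) Vbar)" if "k \<in> boundary_indices n" for k
    by (simp add: g_def glc_map_ext_boundary[OF that])
  have E: "?E = {(x, y). x \<in> ?T \<and> y \<in> ?T \<and> g x = g y}"
  proof (rule set_eqI)
    fix z :: "pre_point set \<times> pre_point set"
    obtain x y where z: "z = (x, y)" by (cases z)
    have "(x, y) \<in> ?E \<longleftrightarrow> g x = g y" if xy: "x \<in> ?T" "y \<in> ?T"
    proof -
      obtain k where k: "x = boundary_pt \<tau> p k" "k \<in> boundary_indices n" using xy(1) unfolding type_I_eq by blast
      obtain k' where k': "y = boundary_pt \<tau> p k'" "k' \<in> boundary_indices n" using xy(2) unfolding type_I_eq by blast
      have "g x = g y \<longleftrightarrow> qpt k = qpt k'" unfolding k(1) k'(1) g[OF k(2)] g[OF k'(2)] by auto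
      then show ?thesis using type_I_equiv_iff[OF k(2) k'(2)] unfolding k(1) k'(1) by simp
    qed
    moreover have "(x, y) \<in> ?E \<Longrightarrow> x \<in> ?T \<and> y \<in> ?T" unfolding type_I_equiv_def by blast
    ultimately show "z \<in> ?E \<longleftrightarrow> z \<in> {(x, y). x \<in> ?T \<and> y \<in> ?T \<and> g x = g y}" unfolding z by blast
  qed
  have "g ` ?T = branches_at_infinity \<tau> n p"
    unfolding type_I_eq branches_at_infinity_eq image_image using g by (intro image_cong) auto
  moreover have "maps_nbhds_onto \<tau> n p x (g (SOME y. y \<in> ?E `` {x}))" if xT: "x \<in> ?T" for x
  proof -
    obtain k where k: "x = boundary_pt \<tau> p k" "k \<in> boundary_indices n" using xT unfolding type_I_eq by blast
    show ?thesis unfolding quotient_by_fibres(2)[OF E xT] unfolding k(1) g[OF k(2)] by (rule boundary_maps_onto_branch[OF k(2)])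
  qed
  ultimately show ?thesis using quotient_by_fibres(1)[OF E]
    by (intro exI[of _ "\<lambda>C. g (SOME x. x \<in> C)"]) simp
qed

end

theorem theorem5p2:
  fixes \<tau> :: complex and n :: "'r::finite \<Rightarrow> real" and p :: "'r \<Rightarrow> complex"
  assumes "Im \<tau> > 0"
    and "\<forall>i. n i > 0 \<and> 2 * n i \<in> \<nat>"
    and "(\<Sum>i\<in>UNIV. n i) \<in> \<nat>"
    and "\<forall>i j. i \<noteq> j \<longrightarrow> p i - p j \<notin> lattice \<tau>"
  shows
    "(\<exists>\<Phi>. bij_betw \<Phi> (type_I \<tau> n p // type_I_equiv \<tau> n p) (branches_at_infinity \<tau> n p) \<and>
        (\<forall>x\<in>type_I \<tau> n p. maps_nbhds_onto \<tau> n p x (\<Phi> (type_I_equiv \<tau> n p `` {x}))))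
     \<and> (\<forall>k\<in>boundary_indices n.
          boundary_pt \<tau> p k \<noteq> boundary_pt \<tau> p (\<lambda>i. ell n i - k i) \<longrightarrow>
          (\<exists>\<beta>. {b \<in> branches_at_infinity \<tau> n p.
                   fst b = wproj (0, \<chi> i. 2 * (of_real (n i) - of_nat (k i)), 1)} = {\<beta>} \<and>
               maps_nbhds_onto \<tau> n p (boundary_pt \<tau> p k) \<beta>))
     \<and> (\<forall>k\<in>boundary_indices n.
          boundary_pt \<tau> p k = boundary_pt \<tau> p (\<lambda>i. ell n i - k i) \<longrightarrow>
          (\<exists>\<beta>. {b \<in> branches_at_infinity \<tau> n p. fst b = wproj (0, 0, 1)} = {\<beta>} \<and>
               maps_nbhds_onto \<tau> n p (boundary_pt \<tau> p k) \<beta>))"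
proof -
  interpret glc \<tau> n p using assms by unfold_locales auto
  \<comment> \<open>The stated vector is minus \<open>direction\<close>; scaling by -1 fixes B = 1,
    so the weighted projective point is the same.\<close>
  have q1: "wproj (0, \<chi> i. 2 * (of_real (n i) - of_nat (k i)), 1) = qpt k" for k
  proof -
    have "direction k = - (\<chi> i. 2 * (of_real (n i) - of_nat (k i)))" by (simp add: vec_eq_iff direction_nth algebra_simps)
    then show ?thesis unfolding qpt_def wproj_infinity_eq_iff by blast
  qed
  \<comment> \<open>Equal boundary points have equal multiplicities, so 2 k = 2n and the direction
    is zero. The truncated subtraction is harmless, since k_i is at most
    \<open>ell n i\<close>.\<close>
  have q0: "wproj (0, 0, 1) = qpt k" if k: "k \<in> boundary_indices n" "boundary_pt \<tau> p k = boundary_pt \<tau> p (\<lambda>i. ell n i - k i)" for k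
  proof -
    have e: "k = (\<lambda>i. ell n i - k i)" by (rule boundary_pt_inject[OF k(2)])
    have "ell n i = 2 * k i" for i
    proof -
      have "k i = ell n i - k i" using e by metis
      moreover have "k i \<le> ell n i" using k(1) by (simp add: boundary_indices_def)
      ultimately show ?thesis by simp
    qed
    then have "direction k = 0" by (simp add: vec_eq_iff direction_def)
    then show ?thesis by (simp add: qpt_def)
  qed
  show ?thesis
  proof (intro conjI ballI impI type_I_branch_correspondence)
    fix k assume k: "k \<in> boundary_indices n"
    show "\<exists>\<beta>. {b \<in> branches_at_infinity \<tau> n p. fst b = wproj (0, \<chi> i. 2 * (of_real (n i) - of_nat (k i)), 1)} = {\<beta>} \<and>
               maps_nbhds_onto \<tau> n p (boundary_pt \<tau> p k) \<beta>"
      unfolding q1 branch_over_qpt[OF k]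
      by (rule exI[of _ "(qpt k, germ (qpt k) Vbar)"]) (intro conjI refl boundary_maps_onto_branch[OF k])
  next
    fix k assume k: "k \<in> boundary_indices n" and sym: "boundary_pt \<tau> p k = boundary_pt \<tau> p (\<lambda>i. ell n i - k i)"
    show "\<exists>\<beta>. {b \<in> branches_at_infinity \<tau> n p. fst b = wproj (0, 0, 1)} = {\<beta>} \<and>
               maps_nbhds_onto \<tau> n p (boundary_pt \<tau> p k) \<beta>"
      unfolding q0[OF k sym] branch_over_qpt[OF k]
      by (rule exI[of _ "(qpt k, germ (qpt k) Vbar)"]) (intro conjI refl boundary_maps_onto_branch[OF k])
  qed
qed

end
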